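(* Assume that either (S1) or (S2) of the context holds. Then the zero-th order solution $\Theta^{[0]}=(X^{[0]},Y^{[0]},Z^{[0]},\psi^{[0]})$, i.e. the solution $(X^\epsilon,Y^\epsilon,Z^\epsilon,\psi^\epsilon)$ of (F)-(B) evaluated at $\epsilon=0$, is given for $s\in[0,T]$ by $$X_s^{[0]}=x+\int_0^s b(r,X_r^{[0]},0)\,dr,\qquad Y_s^{[0]}=\xi(X_T^{[0]})+\int_s^T f(r,X_r^{[0]},Y_r^{[0]},0,0)\,dr,\qquad Z^{[0]}=\psi^{[0]}(\cdot)\equiv 0,$$ which is continuous, deterministic and bounded.
   Context: $T>0$ is a fixed horizon and $\mathbb R_0=\mathbb R\setminus\{0\}$. On a filtered probability space $(\Omega,\mathcal F,\mathbb F,\mathbb P)$ satisfying the usual conditions, carrying a one-dimensional Brownian motion $W$ and a random measure $\mu$ on $[0,T]\times\mathbb R_0$, and with the predictable representation property for $(W,\tilde\mu)$, where $\tilde\mu$ is the compensated random measure specified in (S1), (S2) below, consider for $x\in\mathbb R$, $\epsilon\in[0,1]$, $s\in[0,T]$ (all processes one-dimensional): (F) $X_s^\epsilon=x+\int_0^s b(r,X_r^\epsilon,\epsilon)dr+\int_0^s\epsilon\,\sigma(r,X_r^\epsilon)dW_r+\int_0^s\int_{\mathbb R_0}\epsilon\,\gamma(r,X_{r-}^\epsilon,z)\,\tilde\mu(dr,dz)$, (B) $Y_s^\epsilon=\xi(X_T^\epsilon)+\int_s^T f\big(r,X_r^\epsilon,Y_r^\epsilon,Z_r^\epsilon,\int_{\mathbb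 R_0}\rho(z)\psi_r^\epsilon(z)\nu(dz)\big)dr-\int_s^T Z_r^\epsilon dW_r-\int_s^T\int_{\mathbb R_0}\psi_r^\epsilon(z)\,\tilde\mu(dr,dz)$. Here $\nu$ is a $\sigma$-finite measure on $\mathbb R_0$ with $\int_{\mathbb R_0}|z|^2\nu(dz)<\infty$. Fix $n_{\max}\in\mathbb N$ and put $n^{ae}=n_{\max}+2$. Given functions $\eta,\rho$ on $\mathbb R_0$, consider the following conditions, for some constants $K,q>0$. (AX) $b(t,x,\epsilon),\sigma(t,x),\gamma(t,x,z)$ are continuous in all arguments and $n^{ae}$-times differentiable in $(x,\epsilon)$ (resp. in $x$) with continuous derivatives; $|\partial_\epsilon^j b(t,0,\epsilon)|+|\sigma(t,0)|\le K$ and $|\gamma(t,0,z)|/\eta(z)\le K$ for $0\le j\le n^{ae}$; $|\partial_x^n\partial_\epsilon^j b(t,x,\epsilon)|+|\partial_x^n\sigma(t,x)|\le K$ and $|\partial_x^n\gamma(t,x,z)|/\eta(z)\le K$ for $1\le n\le n^{ae}$, $0\le j\le n^{ae}$; all uniformly in $t\in[0,T]$, $x\in\mathbb R$, $z\in\mathbb R_0$, $\epsilon\in[0,1]$. (AY) $\xi$ is $n^{ae}$-times differentiable with continuous derivatives and $|\partial_x^n\xi(x)|\le K(1+|x|^q)$ for $0\le n\le n^{ae}$; $|\rho(z)|\le K\eta(z)$; $f(t,x,y,z,u)$ is continuous in all arguments and $n^{ae}$-times differentiable in $(x,y,z,u)$ with continuous derivatives, the derivatives in $x$ only satisfy $|\partial_x^n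 f(t,x,y,z,u)|\le K(1+|x|^q)$ for $1\le n\le n^{ae}$, and all other partial derivatives (up to order $n^{ae}$) are bounded by $K$, uniformly in $(t,x,y,z,u)$; $|f(t,x,0,0,0)|\le K(1+|x|^q)$ uniformly in $t$. The two alternative sets of standing assumptions are: (S1) (Poissonian case) $\mu$ is a Poisson random measure independent of $W$ with compensator $\nu(dz)dt$, $\tilde\mu(dt,dz)=\mu(dt,dz)-\nu(dz)dt$, and (AX), (AY) hold with $\eta(z)=1\wedge|z|$. (S2) (State-dependent intensity case) $\nu(\mathbb R_0)=1$; the compensated random measure in (F)-(B) is $\tilde\mu(dr,dz)=\mu(dr,dz)-\lambda(r,X_r^\epsilon)\nu(dz)dr$ (so $\mu$ is in general not Poissonian and depends implicitly on $\epsilon$ through its intensity); (AX), (AY) hold with $\eta$ and $\rho$ both replaced by the constant $1$ (also in (B)); and $\lambda:[0,T]\times\mathbb R\to\mathbb R$ and $\gamma$ satisfy, for some constants $K,c_1,c_2>0$: (i) $\lambda(t,x)$ is continuous in $(t,x)$ and $n^{ae}$-times differentiable in $x$ with continuous derivatives, $|\partial_x^n\lambda(t,x)|\le K$ for $1\le n\le n^{ae}$, uniformly in $(t,x)$; (ii) $0<c_1\le\lambda(t,x)\le c_2$ uniformly in $(t,x)$; (iii) the jump coefficient $\epsilon\gamma(t,x,z)$ of (F) has all $\epsilon$-derivatives of order $1$ to $n^{ae}$ bounded by $K$ uniformly in $(t,x,z,\epsilon)$, i.e. $|\gamma(t,x,z)|\le K$. *)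

theory Defs
  imports "HOL-Probability.Probability"
begin

definition usual_filtration :: "'w measure \<Rightarrow> (real \<Rightarrow> 'w measure) \<Rightarrow> real \<Rightarrow> bool" where
  "usual_filtration M F T \<longleftrightarrow>
     (\<forall>t\<in>{0..T}. subalgebra M (F t)) \<and>
     (\<forall>s\<in>{0..T}. \<forall>t\<in>{s..T}. sets (F s) \<subseteq> sets (F t)) \<and>
     (\<forall>t\<in>{0..<T}. sets (F t) = (\<Inter>u\<in>{t<..T}. sets (F u))) \<and>
     complete_measure M \<and> null_sets M \<subseteq> sets (F 0)"

definition adapted :: "(real \<Rightarrow> 'w measure) \<Rightarrow> real \<Rightarrow> (real \<Rightarrow> 'w \<Rightarrow> real) \<Rightarrow> bool" where
  "adapted F T X \<longleftrightarrow> (\<forall>t\<in>{0..T}. X t \<in> borel_measurable (F t))"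

definition cadlag_on :: "real \<Rightarrow> (real \<Rightarrow> real) \<Rightarrow> bool" where
  "cadlag_on T g \<longleftrightarrow>
     (\<forall>t\<in>{0..<T}. (g \<longlongrightarrow> g t) (at_right t)) \<and>
     (\<forall>t\<in>{0<..T}. \<exists>l. (g \<longlongrightarrow> l) (at_left t))"

definition cadlag_adapted ::
  "'w measure \<Rightarrow> (real \<Rightarrow> 'w measure) \<Rightarrow> real \<Rightarrow> (real \<Rightarrow> 'w \<Rightarrow> real) \<Rightarrow> bool" where
  "cadlag_adapted M F T X \<longleftrightarrow> adapted F T X \<and> (\<forall>\<omega>\<in>space M. cadlag_on T (\<lambda>t. X t \<omega>))"

text \<open>The process \<open>X\<^bsub>r-\<^esub>\<close>, with the convention \<open>X\<^bsub>0-\<^esub> = X\<^bsub>0\<^esub>\<close>.\<close>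

definition left_limit :: "(real \<Rightarrow> 'w \<Rightarrow> real) \<Rightarrow> real \<Rightarrow> 'w \<Rightarrow> real" where
  "left_limit X r \<omega> = (if r \<le> 0 then X 0 \<omega> else Lim (at_left r) (\<lambda>u. X u \<omega>))"

definition time_leb :: "real \<Rightarrow> real measure" where
  "time_leb T = restrict_space lborel {0..T}"

definition R0 :: "real measure" where
  "R0 = restrict_space borel (- {0})"

definition predictable_algebra ::
  "'w measure \<Rightarrow> (real \<Rightarrow> 'w measure) \<Rightarrow> real \<Rightarrow> (real \<times> 'w) measure" where
  "predictable_algebra M F T = sigma ({0..T} \<times> space M)
     ({{0} \<times> A | A. A \<in> sets (F 0)} \<union>
      {{s<..t} \<times> A | s t A. 0 \<le> s \<and> s \<le> t \<and> t \<le> T \<and> A \<in> sets (F s)})"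

definition S2_space ::
  "'w measure \<Rightarrow> (real \<Rightarrow> 'w measure) \<Rightarrow> real \<Rightarrow> (real \<Rightarrow> 'w \<Rightarrow> real) \<Rightarrow> bool" where
  "S2_space M F T X \<longleftrightarrow> cadlag_adapted M F T X \<and>
     (\<integral>\<^sup>+\<omega>. (SUP s\<in>{0..T}. ennreal ((X s \<omega>)\<^sup>2)) \<partial>M) < \<infinity>"

definition H2_space ::
  "'w measure \<Rightarrow> (real \<Rightarrow> 'w measure) \<Rightarrow> real \<Rightarrow> (real \<Rightarrow> 'w \<Rightarrow> real) \<Rightarrow> bool" where
  "H2_space M F T Z \<longleftrightarrow>
     (\<lambda>(r, \<omega>). Z r \<omega>) \<in> borel_measurable (predictable_algebra M F T) \<and>
     (\<integral>\<^sup>+(r, \<omega>). ennreal ((Z r \<omega>)\<^sup>2) \<partial>(time_leb T \<Otimes>\<^sub>M M)) < \<infinity>"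

definition J2_space ::
  "'w measure \<Rightarrow> (real \<Rightarrow> 'w measure) \<Rightarrow> real \<Rightarrow> real measure \<Rightarrow>
   (real \<Rightarrow> 'w \<Rightarrow> real \<Rightarrow> real) \<Rightarrow> bool" where
  "J2_space M F T \<nu> \<psi> \<longleftrightarrow>
     (\<lambda>((r, \<omega>), z). \<psi> r \<omega> z) \<in> borel_measurable (predictable_algebra M F T \<Otimes>\<^sub>M R0) \<and>
     (\<integral>\<^sup>+((r, \<omega>), z). ennreal ((\<psi> r \<omega> z)\<^sup>2) \<partial>((time_leb T \<Otimes>\<^sub>M M) \<Otimes>\<^sub>M \<nu>)) < \<infinity>"

definition brownian_motion ::
  "'w measure \<Rightarrow> (real \<Rightarrow> 'w measure) \<Rightarrow> real \<Rightarrow> (real \<Rightarrow> 'w \<Rightarrow> real) \<Rightarrow> bool" where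
  "brownian_motion M F T W \<longleftrightarrow>
     adapted F T W \<and>
     (AE \<omega> in M. W 0 \<omega> = 0 \<and> continuous_on {0..T} (\<lambda>t. W t \<omega>)) \<and>
     (\<forall>s t. 0 \<le> s \<and> s < t \<and> t \<le> T \<longrightarrow>
        distributed M lborel (\<lambda>\<omega>. W t \<omega> - W s \<omega>) (normal_density 0 (sqrt (t - s))) \<and>
        prob_space.indep_set M (sets (F s))
          (sets (vimage_algebra (space M) (\<lambda>\<omega>. W t \<omega> - W s \<omega>) borel)))"

definition mark_space :: "real \<Rightarrow> (real \<times> real) measure" where
  "mark_space T = restrict_space borel {0..T} \<Otimes>\<^sub>M R0"

definition random_measure ::
  "'w measure \<Rightarrow> (real \<Rightarrow> 'w measure) \<Rightarrow> real \<Rightarrow> ('w \<Rightarrow> (real \<times> real) measure) \<Rightarrow> bool" where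
  "random_measure M F T \<mu> \<longleftrightarrow>
     (\<forall>\<omega>\<in>space M. sets (\<mu> \<omega>) = sets (mark_space T)) \<and>
     (\<forall>t\<in>{0..T}. \<forall>A\<in>sets (mark_space T). A \<subseteq> {0..t} \<times> UNIV \<longrightarrow>
        (\<lambda>\<omega>. emeasure (\<mu> \<omega>) A) \<in> borel_measurable (F t))"

definition integer_valued ::
  "'w measure \<Rightarrow> real \<Rightarrow> ('w \<Rightarrow> (real \<times> real) measure) \<Rightarrow> bool" where
  "integer_valued M T \<mu> \<longleftrightarrow>
     (AE \<omega> in M.
        (\<forall>A\<in>sets (mark_space T). emeasure (\<mu> \<omega>) A = \<infinity> \<or> emeasure (\<mu> \<omega>) A \<in> range of_nat) \<and>
        (\<forall>t\<in>{0..T}. emeasure (\<mu> \<omega>) ({t} \<times> (- {0})) \<le> 1))"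

definition random_measure_algebra ::
  "'w measure \<Rightarrow> real \<Rightarrow> ('w \<Rightarrow> (real \<times> real) measure) \<Rightarrow> (real \<times> real) set \<Rightarrow> 'w set set" where
  "random_measure_algebra M T \<mu> S = sigma_sets (space M)
     {{\<omega>\<in>space M. emeasure (\<mu> \<omega>) A \<in> B} | A B. A \<in> sets (mark_space T) \<and> A \<subseteq> S \<and> B \<in> sets borel}"

definition process_algebra ::
  "'w measure \<Rightarrow> real \<Rightarrow> (real \<Rightarrow> 'w \<Rightarrow> real) \<Rightarrow> 'w set set" where
  "process_algebra M T W = sigma_sets (space M)
     {{\<omega>\<in>space M. W t \<omega> \<in> B} | t B. t \<in> {0..T} \<and> B \<in> sets borel}"

definition poisson_random_measure ::
  "'w measure \<Rightarrow> (real \<Rightarrow> 'w measure) \<Rightarrow> real \<Rightarrow> real measure \<Rightarrow>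
   ('w \<Rightarrow> (real \<times> real) measure) \<Rightarrow> bool" where
  "poisson_random_measure M F T \<nu> \<mu> \<longleftrightarrow>
     random_measure M F T \<mu> \<and>
     (\<forall>A\<in>sets (mark_space T). emeasure (time_leb T \<Otimes>\<^sub>M \<nu>) A < \<infinity> \<longrightarrow>
        (\<forall>k::nat. measure M {\<omega>\<in>space M. emeasure (\<mu> \<omega>) A = of_nat k} =
           measure (time_leb T \<Otimes>\<^sub>M \<nu>) A ^ k / fact k * exp (- measure (time_leb T \<Otimes>\<^sub>M \<nu>) A))) \<and>
     (\<forall>\<A>. finite \<A> \<and> \<A> \<subseteq> sets (mark_space T) \<and> disjoint \<A> \<longrightarrow>
        prob_space.indep_vars M (\<lambda>_. borel) (\<lambda>A \<omega>. emeasure (\<mu> \<omega>) A) \<A>) \<and>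
     (\<forall>s\<in>{0..T}. prob_space.indep_set M (sets (F s))
        (random_measure_algebra M T \<mu> ({s<..T} \<times> UNIV)))"

text \<open>\<open>\<Lambda>\<^sub>r(\<omega>) \<nu>(dz) dr\<close> is the compensator (dual predictable projection) of \<open>\<mu>\<close>.\<close>

definition has_compensator ::
  "'w measure \<Rightarrow> (real \<Rightarrow> 'w measure) \<Rightarrow> real \<Rightarrow> real measure \<Rightarrow>
   ('w \<Rightarrow> (real \<times> real) measure) \<Rightarrow> (real \<Rightarrow> 'w \<Rightarrow> real) \<Rightarrow> bool" where
  "has_compensator M F T \<nu> \<mu> \<Lambda> \<longleftrightarrow>
     (\<forall>H :: (real \<times> 'w) \<times> real \<Rightarrow> ennreal.
        H \<in> borel_measurable (predictable_algebra M F T \<Otimes>\<^sub>M R0) \<longrightarrow>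
        (\<integral>\<^sup>+\<omega>. (\<integral>\<^sup>+(r, z). H ((r, \<omega>), z) \<partial>\<mu> \<omega>) \<partial>M) =
        (\<integral>\<^sup>+\<omega>. (\<integral>\<^sup>+(r, z). H ((r, \<omega>), z) * ennreal (\<Lambda> r \<omega>) \<partial>(time_leb T \<Otimes>\<^sub>M \<nu>)) \<partial>M))"

text \<open>
  A list of triples \<open>(a, b, h)\<close> encodes the simple predictable process
  \<open>\<Sum> h 1\<^bsub>(a,b]\<^esub>\<close>, and a list of quadruples \<open>(a, b, A, h)\<close> the simple predictable
  function \<open>\<Sum> h 1\<^bsub>(a,b]\<^esub> 1\<^bsub>A\<^esub>\<close>. The intervals need not be disjoint.
  Stochastic integrals of square-integrable integrands are the \<open>L\<^sup>2\<close>-limits of the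
  elementary integrals, taken in their cadlag adapted version; they are introduced
  as relations, in the manner of \<open>has_integral\<close>.
\<close>

type_synonym 'w simple_process = "(real \<times> real \<times> ('w \<Rightarrow> real)) list"
type_synonym 'w simple_field = "(real \<times> real \<times> real set \<times> ('w \<Rightarrow> real)) list"

definition simple_process ::
  "'w measure \<Rightarrow> (real \<Rightarrow> 'w measure) \<Rightarrow> real \<Rightarrow> 'w simple_process \<Rightarrow> bool" where
  "simple_process M F T H \<longleftrightarrow>
     (\<forall>(a, b, h)\<in>set H. 0 \<le> a \<and> a \<le> b \<and> b \<le> T \<and>
        h \<in> borel_measurable (F a) \<and> bounded (h ` space M))"

definition simple_process_eval :: "'w simple_process \<Rightarrow> real \<Rightarrow> 'w \<Rightarrow> real" where
  "simple_process_eval H r \<omega> = (\<Sum>(a, b, h)\<leftarrow>H. h \<omega> * indicator {a<..b} r)"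

definition simple_ito_integral ::
  "(real \<Rightarrow> 'w \<Rightarrow> real) \<Rightarrow> 'w simple_process \<Rightarrow> real \<Rightarrow> 'w \<Rightarrow> real" where
  "simple_ito_integral W H s \<omega> = (\<Sum>(a, b, h)\<leftarrow>H. h \<omega> * (W (min b s) \<omega> - W (min a s) \<omega>))"

definition has_ito_integral ::
  "'w measure \<Rightarrow> (real \<Rightarrow> 'w measure) \<Rightarrow> real \<Rightarrow> (real \<Rightarrow> 'w \<Rightarrow> real) \<Rightarrow>
   (real \<Rightarrow> 'w \<Rightarrow> real) \<Rightarrow> (real \<Rightarrow> 'w \<Rightarrow> real) \<Rightarrow> bool" where
  "has_ito_integral M F T W Z I \<longleftrightarrow>
     (\<lambda>(r, \<omega>). Z r \<omega>) \<in> borel_measurable (time_leb T \<Otimes>\<^sub>M M) \<and>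
     cadlag_adapted M F T I \<and>
     (\<exists>H. (\<forall>n. simple_process M F T (H n)) \<and>
        (\<lambda>n. \<integral>\<^sup>+(r, \<omega>). ennreal ((simple_process_eval (H n) r \<omega> - Z r \<omega>)\<^sup>2)
               \<partial>(time_leb T \<Otimes>\<^sub>M M)) \<longlonglongrightarrow> 0 \<and>
        (\<forall>s\<in>{0..T}.
           (\<lambda>n. \<integral>\<^sup>+\<omega>. ennreal ((simple_ito_integral W (H n) s \<omega> - I s \<omega>)\<^sup>2) \<partial>M) \<longlonglongrightarrow> 0))"

definition simple_field ::
  "'w measure \<Rightarrow> (real \<Rightarrow> 'w measure) \<Rightarrow> real \<Rightarrow> real measure \<Rightarrow> 'w simple_field \<Rightarrow> bool" where
  "simple_field M F T \<nu> H \<longleftrightarrow>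
     (\<forall>(a, b, A, h)\<in>set H. 0 \<le> a \<and> a \<le> b \<and> b \<le> T \<and>
        A \<in> sets \<nu> \<and> emeasure \<nu> A < \<infinity> \<and>
        h \<in> borel_measurable (F a) \<and> bounded (h ` space M))"

definition simple_field_eval :: "'w simple_field \<Rightarrow> real \<Rightarrow> 'w \<Rightarrow> real \<Rightarrow> real" where
  "simple_field_eval H r \<omega> z = (\<Sum>(a, b, A, h)\<leftarrow>H. h \<omega> * indicator {a<..b} r * indicator A z)"

text \<open>\<open>\<mu>(dr, dz) - \<Lambda>\<^sub>r \<nu>(dz) dr\<close> evaluated on \<open>(a, b] \<times> A\<close>, for \<open>\<nu>(A)\<close> finite.\<close>

definition compensated ::
  "real measure \<Rightarrow> ('w \<Rightarrow> (real \<times> real) measure) \<Rightarrow> (real \<Rightarrow> 'w \<Rightarrow> real) \<Rightarrow>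
   real \<Rightarrow> real \<Rightarrow> real set \<Rightarrow> 'w \<Rightarrow> real" where
  "compensated \<nu> \<mu> \<Lambda> a b A \<omega> =
     measure (\<mu> \<omega>) ({a<..b} \<times> A) - (LBINT r:{a<..b}. \<Lambda> r \<omega>) * measure \<nu> A"

definition simple_jump_integral ::
  "real measure \<Rightarrow> ('w \<Rightarrow> (real \<times> real) measure) \<Rightarrow> (real \<Rightarrow> 'w \<Rightarrow> real) \<Rightarrow>
   'w simple_field \<Rightarrow> real \<Rightarrow> 'w \<Rightarrow> real" where
  "simple_jump_integral \<nu> \<mu> \<Lambda> H s \<omega> =
     (\<Sum>(a, b, A, h)\<leftarrow>H. h \<omega> * compensated \<nu> \<mu> \<Lambda> (min a s) (min b s) A \<omega>)"

definition has_jump_integral ::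
  "'w measure \<Rightarrow> (real \<Rightarrow> 'w measure) \<Rightarrow> real \<Rightarrow> real measure \<Rightarrow>
   ('w \<Rightarrow> (real \<times> real) measure) \<Rightarrow> (real \<Rightarrow> 'w \<Rightarrow> real) \<Rightarrow>
   (real \<Rightarrow> 'w \<Rightarrow> real \<Rightarrow> real) \<Rightarrow> (real \<Rightarrow> 'w \<Rightarrow> real) \<Rightarrow> bool" where
  "has_jump_integral M F T \<nu> \<mu> \<Lambda> \<psi> I \<longleftrightarrow>
     (\<lambda>((r, \<omega>), z). \<psi> r \<omega> z) \<in> borel_measurable ((time_leb T \<Otimes>\<^sub>M M) \<Otimes>\<^sub>M \<nu>) \<and>
     cadlag_adapted M F T I \<and>
     (\<exists>H. (\<forall>n. simple_field M F T \<nu> (H n)) \<and>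
        (\<lambda>n. \<integral>\<^sup>+((r, \<omega>), z). ennreal ((simple_field_eval (H n) r \<omega> z - \<psi> r \<omega> z)\<^sup>2)
               \<partial>((time_leb T \<Otimes>\<^sub>M M) \<Otimes>\<^sub>M \<nu>)) \<longlonglongrightarrow> 0 \<and>
        (\<forall>s\<in>{0..T}.
           (\<lambda>n. \<integral>\<^sup>+\<omega>. ennreal ((simple_jump_integral \<nu> \<mu> \<Lambda> (H n) s \<omega> - I s \<omega>)\<^sup>2) \<partial>M) \<longlonglongrightarrow> 0))"

definition square_integrable_martingale ::
  "'w measure \<Rightarrow> (real \<Rightarrow> 'w measure) \<Rightarrow> real \<Rightarrow> (real \<Rightarrow> 'w \<Rightarrow> real) \<Rightarrow> bool" where
  "square_integrable_martingale M F T N \<longleftrightarrow>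
     adapted F T N \<and>
     (\<forall>t\<in>{0..T}. integrable M (\<lambda>\<omega>. (N t \<omega>)\<^sup>2)) \<and>
     (\<forall>s\<in>{0..T}. \<forall>t\<in>{s..T}. AE \<omega> in M. real_cond_exp M (F s) (N t) \<omega> = N s \<omega>)"

definition predictable_representation ::
  "'w measure \<Rightarrow> (real \<Rightarrow> 'w measure) \<Rightarrow> real \<Rightarrow> (real \<Rightarrow> 'w \<Rightarrow> real) \<Rightarrow> real measure \<Rightarrow>
   ('w \<Rightarrow> (real \<times> real) measure) \<Rightarrow> (real \<Rightarrow> 'w \<Rightarrow> real) \<Rightarrow> bool" where
  "predictable_representation M F T W \<nu> \<mu> \<Lambda> \<longleftrightarrow>
     (\<forall>N. square_integrable_martingale M F T N \<longrightarrow>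
        (\<exists>Z \<psi> I J. H2_space M F T Z \<and> J2_space M F T \<nu> \<psi> \<and>
           has_ito_integral M F T W Z I \<and> has_jump_integral M F T \<nu> \<mu> \<Lambda> \<psi> J \<and>
           (\<forall>t\<in>{0..T}. AE \<omega> in M. N t \<omega> = N 0 \<omega> + I t \<omega> + J t \<omega>)))"

text \<open>
  \<open>\<Lambda>\<close> is the intensity in \<open>\<mu>(dr, dz) - \<Lambda>\<^sub>r \<nu>(dz) dr\<close>, the measure driving both equations.
\<close>

definition forward_sde ::
  "'w measure \<Rightarrow> (real \<Rightarrow> 'w measure) \<Rightarrow> real \<Rightarrow> (real \<Rightarrow> 'w \<Rightarrow> real) \<Rightarrow> real measure \<Rightarrow>
   ('w \<Rightarrow> (real \<times> real) measure) \<Rightarrow> (real \<Rightarrow> 'w \<Rightarrow> real) \<Rightarrow>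
   (real \<Rightarrow> real \<Rightarrow> real \<Rightarrow> real) \<Rightarrow> (real \<Rightarrow> real \<Rightarrow> real) \<Rightarrow> (real \<Rightarrow> real \<Rightarrow> real \<Rightarrow> real) \<Rightarrow>
   real \<Rightarrow> real \<Rightarrow> (real \<Rightarrow> 'w \<Rightarrow> real) \<Rightarrow> bool" where
  "forward_sde M F T W \<nu> \<mu> \<Lambda> b \<sigma> \<gamma> x \<epsilon> X \<longleftrightarrow>
     S2_space M F T X \<and>
     (\<exists>I J. has_ito_integral M F T W (\<lambda>r \<omega>. \<epsilon> * \<sigma> r (X r \<omega>)) I \<and>
        has_jump_integral M F T \<nu> \<mu> \<Lambda> (\<lambda>r \<omega> z. \<epsilon> * \<gamma> r (left_limit X r \<omega>) z) J \<and>
        (AE \<omega> in M. \<forall>s\<in>{0..T}.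
           X s \<omega> = x + (LBINT r:{0..s}. b r (X r \<omega>) \<epsilon>) + I s \<omega> + J s \<omega>))"

definition backward_sde ::
  "'w measure \<Rightarrow> (real \<Rightarrow> 'w measure) \<Rightarrow> real \<Rightarrow> (real \<Rightarrow> 'w \<Rightarrow> real) \<Rightarrow> real measure \<Rightarrow>
   ('w \<Rightarrow> (real \<times> real) measure) \<Rightarrow> (real \<Rightarrow> 'w \<Rightarrow> real) \<Rightarrow>
   (real \<Rightarrow> real) \<Rightarrow> (real \<Rightarrow> real \<Rightarrow> real \<Rightarrow> real \<Rightarrow> real \<Rightarrow> real) \<Rightarrow> (real \<Rightarrow> real) \<Rightarrow>
   (real \<Rightarrow> 'w \<Rightarrow> real) \<Rightarrow> (real \<Rightarrow> 'w \<Rightarrow> real) \<Rightarrow> (real \<Rightarrow> 'w \<Rightarrow> real) \<Rightarrow>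
   (real \<Rightarrow> 'w \<Rightarrow> real \<Rightarrow> real) \<Rightarrow> bool" where
  "backward_sde M F T W \<nu> \<mu> \<Lambda> \<xi> f \<rho> X Y Z \<psi> \<longleftrightarrow>
     S2_space M F T Y \<and> H2_space M F T Z \<and> J2_space M F T \<nu> \<psi> \<and>
     (\<exists>I J. has_ito_integral M F T W Z I \<and>
        has_jump_integral M F T \<nu> \<mu> \<Lambda> \<psi> J \<and>
        (AE \<omega> in M. \<forall>s\<in>{0..T}.
           Y s \<omega> = \<xi> (X T \<omega>)
             + (LBINT r:{s..T}. f r (X r \<omega>) (Y r \<omega>) (Z r \<omega>) (LINT z|\<nu>. \<rho> z * \<psi> r \<omega> z))
             - (I T \<omega> - I s \<omega>) - (J T \<omega> - J s \<omega>)))"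

definition fbsde_solution ::
  "'w measure \<Rightarrow> (real \<Rightarrow> 'w measure) \<Rightarrow> real \<Rightarrow> (real \<Rightarrow> 'w \<Rightarrow> real) \<Rightarrow> real measure \<Rightarrow>
   ('w \<Rightarrow> (real \<times> real) measure) \<Rightarrow> (real \<Rightarrow> 'w \<Rightarrow> real) \<Rightarrow>
   (real \<Rightarrow> real \<Rightarrow> real \<Rightarrow> real) \<Rightarrow> (real \<Rightarrow> real \<Rightarrow> real) \<Rightarrow> (real \<Rightarrow> real \<Rightarrow> real \<Rightarrow> real) \<Rightarrow>
   (real \<Rightarrow> real) \<Rightarrow> (real \<Rightarrow> real \<Rightarrow> real \<Rightarrow> real \<Rightarrow> real \<Rightarrow> real) \<Rightarrow> (real \<Rightarrow> real) \<Rightarrow>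
   real \<Rightarrow> real \<Rightarrow>
   (real \<Rightarrow> 'w \<Rightarrow> real) \<Rightarrow> (real \<Rightarrow> 'w \<Rightarrow> real) \<Rightarrow> (real \<Rightarrow> 'w \<Rightarrow> real) \<Rightarrow>
   (real \<Rightarrow> 'w \<Rightarrow> real \<Rightarrow> real) \<Rightarrow> bool" where
  "fbsde_solution M F T W \<nu> \<mu> \<Lambda> b \<sigma> \<gamma> \<xi> f \<rho> x \<epsilon> X Y Z \<psi> \<longleftrightarrow>
     forward_sde M F T W \<nu> \<mu> \<Lambda> b \<sigma> \<gamma> x \<epsilon> X \<and>
     backward_sde M F T W \<nu> \<mu> \<Lambda> \<xi> f \<rho> X Y Z \<psi>"

text \<open>
  Iterated partial derivatives of \<open>g\<close> on \<open>S\<close> are indexed by words of direction vectors,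
  the most recent derivative first: \<open>D [e\<^sub>1, ..., e\<^sub>k]\<close> is
  \<open>\<partial>\<^bsub>e\<^sub>1\<^esub> ... \<partial>\<^bsub>e\<^sub>k\<^esub> g\<close>. The derivatives are one-sided at boundary points of \<open>S\<close>.
\<close>

definition has_partials ::
  "'a::real_normed_vector set \<Rightarrow> ('a \<Rightarrow> real) \<Rightarrow> 'a list set \<Rightarrow> ('a list \<Rightarrow> 'a \<Rightarrow> real) \<Rightarrow> bool" where
  "has_partials S g L D \<longleftrightarrow>
     (\<forall>p\<in>S. D [] p = g p) \<and>
     (\<forall>e es. e # es \<in> L \<longrightarrow>
        (\<forall>p\<in>S. ((\<lambda>h. D es (p + h *\<^sub>R e)) has_real_derivative D (e # es) p)
                  (at 0 within {h. p + h *\<^sub>R e \<in> S})))"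

definition words :: "'a set \<Rightarrow> nat \<Rightarrow> 'a list set" where
  "words B n = {es. set es \<subseteq> B \<and> length es \<le> n}"

text \<open>\<open>D\<close> collects the derivatives of order at most \<open>n\<close> of a function that is \<open>n\<close> times
  continuously differentiable on \<open>S\<close> in the directions \<open>B\<close>.\<close>

definition has_continuous_partials ::
  "nat \<Rightarrow> 'a::real_normed_vector set \<Rightarrow> 'a set \<Rightarrow> ('a \<Rightarrow> real) \<Rightarrow> ('a list \<Rightarrow> 'a \<Rightarrow> real) \<Rightarrow> bool" where
  "has_continuous_partials n S B g D \<longleftrightarrow>
     has_partials S g (words B n) D \<and> (\<forall>es\<in>words B n. continuous_on S (D es))"

text \<open>
  For \<open>b\<close>, besides the derivatives in \<open>(x, \<epsilon>)\<close> of total order at most \<open>n\<close>, the bounds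
  concern the derivatives \<open>\<partial>\<^sub>x\<^sup>i \<partial>\<^sub>\<epsilon>\<^sup>j b\<close> for all \<open>i, j \<le> n\<close>, whose existence is thus
  assumed as well.
\<close>

definition AX ::
  "real \<Rightarrow> nat \<Rightarrow> (real \<Rightarrow> real) \<Rightarrow> (real \<Rightarrow> real \<Rightarrow> real \<Rightarrow> real) \<Rightarrow> (real \<Rightarrow> real \<Rightarrow> real) \<Rightarrow>
   (real \<Rightarrow> real \<Rightarrow> real \<Rightarrow> real) \<Rightarrow> real \<Rightarrow> bool" where
  "AX T n \<eta> b \<sigma> \<gamma> K \<longleftrightarrow>
     (\<exists>Db D\<sigma> D\<gamma>.
        has_continuous_partials n ({0..T} \<times> UNIV \<times> {0..1}) {(0, 1, 0), (0, 0, 1)}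
          (\<lambda>(t, x, \<epsilon>). b t x \<epsilon>) Db \<and>
        has_partials ({0..T} \<times> UNIV \<times> {0..1}) (\<lambda>(t, x, \<epsilon>). b t x \<epsilon>)
          {replicate i (0, 1, 0) @ replicate j (0, 0, 1) | i j. i \<le> n \<and> j \<le> n} Db \<and>
        has_continuous_partials n ({0..T} \<times> UNIV) {(0, 1)} (\<lambda>(t, x). \<sigma> t x) D\<sigma> \<and>
        has_continuous_partials n ({0..T} \<times> UNIV \<times> (- {0})) {(0, 1, 0)}
          (\<lambda>(t, x, z). \<gamma> t x z) D\<gamma> \<and>
        (\<forall>t\<in>{0..T}. \<forall>\<epsilon>\<in>{0..1}. \<forall>j\<le>n.
           \<bar>Db (replicate j (0, 0, 1)) (t, 0, \<epsilon>)\<bar> + \<bar>\<sigma> t 0\<bar> \<le> K) \<and>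
        (\<forall>t\<in>{0..T}. \<forall>z\<in>- {0}. \<bar>\<gamma> t 0 z\<bar> / \<eta> z \<le> K) \<and>
        (\<forall>t\<in>{0..T}. \<forall>x. \<forall>\<epsilon>\<in>{0..1}. \<forall>i\<in>{1..n}. \<forall>j\<le>n.
           \<bar>Db (replicate i (0, 1, 0) @ replicate j (0, 0, 1)) (t, x, \<epsilon>)\<bar>
             + \<bar>D\<sigma> (replicate i (0, 1)) (t, x)\<bar> \<le> K) \<and>
        (\<forall>t\<in>{0..T}. \<forall>x. \<forall>z\<in>- {0}. \<forall>i\<in>{1..n}.
           \<bar>D\<gamma> (replicate i (0, 1, 0)) (t, x, z)\<bar> / \<eta> z \<le> K))"

definition AY ::
  "real \<Rightarrow> nat \<Rightarrow> (real \<Rightarrow> real) \<Rightarrow> (real \<Rightarrow> real) \<Rightarrow> (real \<Rightarrow> real) \<Rightarrow>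
   (real \<Rightarrow> real \<Rightarrow> real \<Rightarrow> real \<Rightarrow> real \<Rightarrow> real) \<Rightarrow> real \<Rightarrow> real \<Rightarrow> bool" where
  "AY T n \<eta> \<rho> \<xi> f K q \<longleftrightarrow>
     (\<exists>D\<xi>. has_continuous_partials n UNIV {1} \<xi> D\<xi> \<and>
        (\<forall>i\<le>n. \<forall>x. \<bar>D\<xi> (replicate i 1) x\<bar> \<le> K * (1 + \<bar>x\<bar> powr q))) \<and>
     \<rho> \<in> borel_measurable R0 \<and> (\<forall>z\<in>- {0}. \<bar>\<rho> z\<bar> \<le> K * \<eta> z) \<and>
     (let dx = (0, 1, 0, 0, 0); dy = (0, 0, 1, 0, 0); dz = (0, 0, 0, 1, 0); du = (0, 0, 0, 0, 1) in
      \<exists>Df. has_continuous_partials n ({0..T} \<times> UNIV) {dx, dy, dz, du}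
            (\<lambda>(t, x, y, z, u). f t x y z u) Df \<and>
        (\<forall>t\<in>{0..T}. \<forall>x y z u.
           (\<forall>i\<in>{1..n}. \<bar>Df (replicate i dx) (t, x, y, z, u)\<bar> \<le> K * (1 + \<bar>x\<bar> powr q)) \<and>
           (\<forall>es\<in>words {dx, dy, dz, du} n. \<not> set es \<subseteq> {dx} \<longrightarrow> \<bar>Df es (t, x, y, z, u)\<bar> \<le> K))) \<and>
     (\<forall>t\<in>{0..T}. \<forall>x. \<bar>f t x 0 0 0\<bar> \<le> K * (1 + \<bar>x\<bar> powr q))"

definition poissonian_case ::
  "'w measure \<Rightarrow> (real \<Rightarrow> 'w measure) \<Rightarrow> real \<Rightarrow> (real \<Rightarrow> 'w \<Rightarrow> real) \<Rightarrow> real measure \<Rightarrow>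
   ('w \<Rightarrow> (real \<times> real) measure) \<Rightarrow> nat \<Rightarrow>
   (real \<Rightarrow> real \<Rightarrow> real \<Rightarrow> real) \<Rightarrow> (real \<Rightarrow> real \<Rightarrow> real) \<Rightarrow> (real \<Rightarrow> real \<Rightarrow> real \<Rightarrow> real) \<Rightarrow>
   (real \<Rightarrow> real) \<Rightarrow> (real \<Rightarrow> real \<Rightarrow> real \<Rightarrow> real \<Rightarrow> real \<Rightarrow> real) \<Rightarrow> (real \<Rightarrow> real) \<Rightarrow> bool" where
  "poissonian_case M F T W \<nu> \<mu> n b \<sigma> \<gamma> \<xi> f \<rho> \<longleftrightarrow>
     poisson_random_measure M F T \<nu> \<mu> \<and>
     prob_space.indep_set M (process_algebra M T W) (random_measure_algebra M T \<mu> UNIV) \<and>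
     predictable_representation M F T W \<nu> \<mu> (\<lambda>r \<omega>. 1) \<and>
     (\<exists>K q. K > 0 \<and> q > 0 \<and>
        AX T n (\<lambda>z. min 1 \<bar>z\<bar>) b \<sigma> \<gamma> K \<and> AY T n (\<lambda>z. min 1 \<bar>z\<bar>) \<rho> \<xi> f K q)"

definition state_dependent_case ::
  "'w measure \<Rightarrow> (real \<Rightarrow> 'w measure) \<Rightarrow> real \<Rightarrow> (real \<Rightarrow> 'w \<Rightarrow> real) \<Rightarrow> real measure \<Rightarrow>
   ('w \<Rightarrow> (real \<times> real) measure) \<Rightarrow> nat \<Rightarrow>
   (real \<Rightarrow> real \<Rightarrow> real \<Rightarrow> real) \<Rightarrow> (real \<Rightarrow> real \<Rightarrow> real) \<Rightarrow> (real \<Rightarrow> real \<Rightarrow> real \<Rightarrow> real) \<Rightarrow>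
   (real \<Rightarrow> real) \<Rightarrow> (real \<Rightarrow> real \<Rightarrow> real \<Rightarrow> real \<Rightarrow> real \<Rightarrow> real) \<Rightarrow>
   (real \<Rightarrow> real \<Rightarrow> real) \<Rightarrow> (real \<Rightarrow> 'w \<Rightarrow> real) \<Rightarrow> bool" where
  "state_dependent_case M F T W \<nu> \<mu> n b \<sigma> \<gamma> \<xi> f lam X \<longleftrightarrow>
     emeasure \<nu> (- {0}) = 1 \<and>
     random_measure M F T \<mu> \<and> integer_valued M T \<mu> \<and>
     has_compensator M F T \<nu> \<mu> (\<lambda>r \<omega>. lam r (X r \<omega>)) \<and>
     predictable_representation M F T W \<nu> \<mu> (\<lambda>r \<omega>. lam r (X r \<omega>)) \<and>
     (\<exists>K q. K > 0 \<and> q > 0 \<and>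
        AX T n (\<lambda>_. 1) b \<sigma> \<gamma> K \<and> AY T n (\<lambda>_. 1) (\<lambda>_. 1) \<xi> f K q) \<and>
     (\<exists>K c1 c2 Dlam. K > 0 \<and> c1 > 0 \<and> c2 > 0 \<and>
        has_continuous_partials n ({0..T} \<times> UNIV) {(0, 1)} (\<lambda>(t, x). lam t x) Dlam \<and>
        (\<forall>t\<in>{0..T}. \<forall>x. \<forall>i\<in>{1..n}. \<bar>Dlam (replicate i (0, 1)) (t, x)\<bar> \<le> K) \<and>
        (\<forall>t\<in>{0..T}. \<forall>x. c1 \<le> lam t x \<and> lam t x \<le> c2) \<and>
        (\<forall>t\<in>{0..T}. \<forall>x. \<forall>z\<in>- {0}. \<bar>\<gamma> t x z\<bar> \<le> K))"

end

theory Submission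
  imports Defs
begin

text \<open>
  At \<open>\<epsilon> = 0\<close> both integrands of the forward equation vanish, hence so do the stochastic integrals, and
  \<open>X\<close> solves a Lipschitz ODE pathwise. In the state-dependent case the intensity \<open>\<lambda>(r, X\<^sub>r)\<close> is therefore
  deterministic, so that in both cases \<open>W\<close> and the compensated jump counts are orthogonal martingales with
  deterministic brackets, and the stochastic integrals satisfy an isometry.

  Let \<open>y0\<close> solve the terminal value problem for the claimed \<open>Y\<close>. The difference \<open>Y - y0\<close> and the stochastic
  integrals over \<open>(s, T]\<close> are orthogonal and add up to the time integral of the difference of the drivers.
  By the isometry and the Lipschitz condition the square norms of \<open>(Y - y0, Z, \<psi>)\<close> over \<open>(s, T]\<close> are bounded
  by \<open>C (T - s)\<close> times themselves, so they vanish for short intervals, and by iteration on \<open>[0, T]\<close>.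
  No Ito formula is needed.
\<close>

subsection \<open>Cadlag functions and scalar integral equations\<close>

text \<open>The obstacle is a circularity. The isometry requires deterministic brackets, hence a
  deterministic intensity, hence a forward equation that is already solved; but solving it requires
  the jump integral of the zero integrand to vanish while the intensity is still random. At that
  stage the compensator supplies only an L^1 bound, which is just enough for a vanishing integrand.
  Orthogonality of \<open>W\<close> and the jump counts, conditionally on the past, is derived
  rather than assumed: increments of \<open>W\<close> have small fourth powers on fine partitions,
  whereas compensated counts have finite variation. Likewise a compensator prescribes first moments
  only; the second moments of the counts are recovered from their integer values and from the
  absence of simultaneous jumps. Limits are taken with squared triangle inequalities and with |y|
  \<le> \<epsilon> + y^2/\<epsilon> in place of the norm inequalities with roots, since the square
  norms are extended reals. The isometry therefore survives only up to constant factors, which is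
  all that a contraction on short intervals needs.\<close>

lemma cadlag_on_bounded:
  fixes g :: "real \<Rightarrow> real"
  assumes "cadlag_on T g"
  shows "bounded (g ` {0..T})"
proof -
  \<comment> \<open>The one-sided limits bound \<open>g\<close> on either side of \<open>t\<close>,
    and the value \<open>g t\<close> is added by hand. Compactness then leaves finitely many such
    neighbourhoods.\<close>
  have loc: "\<exists>U. open U \<and> t \<in> U \<and> bounded (g ` (U \<inter> {0..T}))" if t: "t \<in> {0..T}" for t
  proof -
    have R: "\<exists>b>t. bounded (g ` ({t<..<b} \<inter> {0..T}))"
    proof (cases "t < T")
      case True
      then have "(g \<longlongrightarrow> g t) (at_right t)" using assms t by (auto simp: cadlag_on_def)
      then have "eventually (\<lambda>u. dist (g u) (g t) < 1) (at_right t)"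
        by (rule tendstoD) simp
      then obtain b where b: "b > t" "\<And>u. t < u \<Longrightarrow> u < b \<Longrightarrow> dist (g u) (g t) < 1"
        unfolding eventually_at_right_field by auto
      have "bounded (g ` ({t<..<b} \<inter> {0..T}))"
        unfolding bounded_def using b(2) by (intro exI[of _ "g t"] exI[of _ 1]) (auto simp: dist_commute less_imp_le)
      with b show ?thesis by blast
    next
      case False
      then have "{t<..<t+1} \<inter> {0..T} = {}" using t by auto
      then show ?thesis by (intro exI[of _ "t+1"]) auto
    qed
    have L: "\<exists>a<t. bounded (g ` ({a<..<t} \<inter> {0..T}))"
    proof (cases "0 < t")
      case True
      then obtain l where "(g \<longlongrightarrow> l) (at_left t)" using assms t unfolding cadlag_on_def by force
      then have "eventually (\<lambda>u. dist (g u) l < 1) (at_left t)"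
        by (rule tendstoD) simp
      then obtain a where a: "a < t" "\<And>u. a < u \<Longrightarrow> u < t \<Longrightarrow> dist (g u) l < 1"
        unfolding eventually_at_left_field by auto
      have "bounded (g ` ({a<..<t} \<inter> {0..T}))"
        unfolding bounded_def using a(2) by (intro exI[of _ l] exI[of _ 1]) (auto simp: dist_commute less_imp_le)
      with a show ?thesis by blast
    next
      case False
      then have "{t-1<..<t} \<inter> {0..T} = {}" using t by auto
      then show ?thesis by (intro exI[of _ "t-1"]) auto
    qed
    from R L obtain a b where ab: "a < t" "t < b"
      "bounded (g ` ({t<..<b} \<inter> {0..T}))" "bounded (g ` ({a<..<t} \<inter> {0..T}))" by auto
    have "bounded (insert (g t) (g ` ({t<..<b} \<inter> {0..T}) \<union> g ` ({a<..<t} \<inter> {0..T})))"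
      using ab by auto
    moreover have "g ` ({a<..<b} \<inter> {0..T}) \<subseteq> insert (g t) (g ` ({t<..<b} \<inter> {0..T}) \<union> g ` ({a<..<t} \<inter> {0..T}))"
    proof
      fix y assume "y \<in> g ` ({a<..<b} \<inter> {0..T})"
      then obtain u where "y = g u" "u \<in> {a<..<b} \<inter> {0..T}" by blast
      then show "y \<in> insert (g t) (g ` ({t<..<b} \<inter> {0..T}) \<union> g ` ({a<..<t} \<inter> {0..T}))"
        by (cases u t rule: linorder_cases) auto
    qed
    ultimately have "bounded (g ` ({a<..<b} \<inter> {0..T}))" by (rule bounded_subset)
    then show ?thesis using ab by (intro exI[of _ "{a<..<b}"]) auto
  qed
  obtain U where U: "\<And>t. t \<in> {0..T} \<Longrightarrow> open (U t) \<and> t \<in> U t \<and> bounded (g ` (U t \<inter> {0..T}))"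
    using loc by metis
  have "compact {0..T}" by simp
  then obtain D where D: "D \<subseteq> {0..T}" "finite D" "{0..T} \<subseteq> (\<Union>t\<in>D. U t)"
    by (rule compactE_image[of _ "{0..T}" U]) (use U in auto)
  have "bounded (\<Union>t\<in>D. g ` (U t \<inter> {0..T}))"
    using D U by (intro bounded_UN) blast+
  moreover have "g ` {0..T} \<subseteq> (\<Union>t\<in>D. g ` (U t \<inter> {0..T}))" using D by blast
  ultimately show ?thesis by (rule bounded_subset)
qed

section \<open>Measurability and uniqueness for cadlag paths\<close>

lemma space_time_leb [simp]: "space (time_leb T) = {0..T}"
  by (simp add: time_leb_def space_restrict_space)

lemma sets_time_leb [measurable_cong]: "sets (time_leb T) = sets (restrict_space borel {0..T})"
  unfolding time_leb_def by (rule sets_restrict_space_cong) simp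

lemma measurable_time_id [measurable]: "(\<lambda>r. r) \<in> borel_measurable (time_leb T)"
  unfolding time_leb_def by (intro measurable_restrict_space1) simp

text \<open>Right-continuity: the value at \<open>r\<close> is the limit of the values at the next
  point to the right on the grid of mesh \<open>1 / Suc n\<close>. For fixed \<open>n\<close> only
  countably many sampling times occur, so each approximation is jointly measurable.\<close>

lemma cadlag_measurable_pair:
  assumes X: "\<And>t. t \<in> {0..T} \<Longrightarrow> X t \<in> borel_measurable M"
    and cad: "\<And>\<omega>. \<omega> \<in> space M \<Longrightarrow> cadlag_on T (\<lambda>t. X t \<omega>)"
  shows "(\<lambda>(r, \<omega>). X r \<omega>) \<in> borel_measurable (time_leb T \<Otimes>\<^sub>M M)"
proof (cases "0 \<le> T")
  case True
  \<comment> \<open>The right end point of the \<open>k\<close>-th grid cell, clipped to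
    \<open>[0, T]\<close>. The \<open>+ 1\<close> keeps the sampling time strictly above
    \<open>r\<close> when \<open>r < T\<close>, so that only the right limit is involved; at
    \<open>r = T\<close> the clipping returns \<open>T\<close> itself.\<close>
  define d where "d n k = max 0 (min T ((real_of_int k + 1) / real (Suc n)))" for n :: nat and k :: int
  have dT: "d n k \<in> {0..T}" for n k using True by (auto simp: d_def)
  have meas: "(\<lambda>(r, \<omega>). X (d n \<lfloor>real (Suc n) * r\<rfloor>) \<omega>) \<in> borel_measurable (time_leb T \<Otimes>\<^sub>M M)" for n
  proof -
    have "(\<lambda>p. (\<lambda>k p. X (d n k) (snd p)) (\<lfloor>real (Suc n) * fst p\<rfloor>) p) \<in> borel_measurable (time_leb T \<Otimes>\<^sub>M M)"
    proof (rule measurable_compose_countable)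
      fix k show "(\<lambda>p. X (d n k) (snd p)) \<in> borel_measurable (time_leb T \<Otimes>\<^sub>M M)"
        using X[OF dT] by measurable
      show "(\<lambda>p. \<lfloor>real (Suc n) * fst p\<rfloor>) \<in> time_leb T \<Otimes>\<^sub>M M \<rightarrow>\<^sub>M count_space UNIV"
        by measurable
    qed
    then show ?thesis by (simp add: case_prod_beta')
  qed
  show ?thesis
  proof (rule borel_measurable_LIMSEQ_metric[OF meas])
    fix p assume p: "p \<in> space (time_leb T \<Otimes>\<^sub>M M)"
    obtain r \<omega> where [simp]: "p = (r, \<omega>)" by force
    from p have r: "r \<in> {0..T}" and \<omega>: "\<omega> \<in> space M" by (auto simp: space_pair_measure)
    have "(\<lambda>n. X (d n \<lfloor>real (Suc n) * r\<rfloor>) \<omega>) \<longlonglongrightarrow> X r \<omega>"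
    proof (cases "r < T")
      case False
      then have [simp]: "r = T" using r by auto
      have "d n \<lfloor>real (Suc n) * T\<rfloor> = T" for n
      proof -
        have "T \<le> (real_of_int \<lfloor>real (Suc n) * T\<rfloor> + 1) / real (Suc n)"
        proof -
          have "real (Suc n) * T \<le> real_of_int \<lfloor>real (Suc n) * T\<rfloor> + 1" by linarith
          then show ?thesis
            by (simp add: pos_le_divide_eq mult.commute del: of_nat_Suc)
        qed
        then show ?thesis using True unfolding d_def by linarith
      qed
      then show ?thesis by simp
    next
      case lt: True
      have lim: "((\<lambda>t. X t \<omega>) \<longlongrightarrow> X r \<omega>) (at_right r)"
        using cad[OF \<omega>] r lt by (auto simp: cadlag_on_def)
      have up: "d n \<lfloor>real (Suc n) * r\<rfloor> \<le> r + 1 / real (Suc n)" for n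
      proof -
        have "(real_of_int \<lfloor>real (Suc n) * r\<rfloor> + 1) / real (Suc n) \<le> (real (Suc n) * r + 1) / real (Suc n)"
          by (intro divide_right_mono) auto
        also have "\<dots> = r + 1 / real (Suc n)" by (simp add: field_simps)
        finally show ?thesis using r by (auto simp: d_def)
      qed
      have lo: "d n \<lfloor>real (Suc n) * r\<rfloor> > r" for n
      proof -
        have "real (Suc n) * r < real_of_int \<lfloor>real (Suc n) * r\<rfloor> + 1" by linarith
        then have "r < (real_of_int \<lfloor>real (Suc n) * r\<rfloor> + 1) / real (Suc n)"
          by (simp add: pos_less_divide_eq mult.commute del: of_nat_Suc)
        then show ?thesis using lt by (simp add: d_def)
      qed
      have "(\<lambda>n. d n \<lfloor>real (Suc n) * r\<rfloor>) \<longlonglongrightarrow> r"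
      proof (rule tendsto_sandwich[of "\<lambda>_. r" _ _ "\<lambda>n. r + 1 / real (Suc n)"])
        show "(\<lambda>n. r + 1 / real (Suc n)) \<longlonglongrightarrow> r"
          using tendsto_add[OF tendsto_const LIMSEQ_inverse_real_of_nat, of r] by (simp add: inverse_eq_divide)
      qed (use up less_imp_le[OF lo] in \<open>auto simp del: of_nat_Suc\<close>)
      then have "filterlim (\<lambda>n. d n \<lfloor>real (Suc n) * r\<rfloor>) (at_right r) sequentially"
        using lo less_imp_neq[OF lo, THEN not_sym] by (simp add: filterlim_at del: of_nat_Suc)
      from filterlim_compose[OF lim this] show ?thesis .
    qed
    then show "(\<lambda>n. (\<lambda>(r, \<omega>). X (d n \<lfloor>real (Suc n) * r\<rfloor>) \<omega>) p) \<longlonglongrightarrow> (\<lambda>(r, \<omega>). X r \<omega>) p"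
      by simp
  qed
next
  case False
  then have "space (time_leb T \<Otimes>\<^sub>M M) = {}" by (auto simp: space_pair_measure)
  then show ?thesis by (simp add: measurable_empty_iff measurable_def)
qed

text \<open>A single path is a process over a one-point space.\<close>

lemma cadlag_on_measurable:
  fixes g :: "real \<Rightarrow> real"
  assumes "cadlag_on T g"
  shows "g \<in> borel_measurable (restrict_space borel {0..T})"
proof -
  have "(\<lambda>(r, \<omega>). g r) \<in> borel_measurable (time_leb T \<Otimes>\<^sub>M count_space {()})"
    by (rule cadlag_measurable_pair) (use assms in auto)
  then have "(\<lambda>r. (\<lambda>(r, \<omega>). g r) (r, ())) \<in> borel_measurable (time_leb T)"
    by measurable
  then show ?thesis by (simp add: measurable_cong_sets[OF sets_time_leb refl])
qed

lemma cadlag_on_continuous: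
  assumes "continuous_on {0..T} g"
  shows "cadlag_on T g"
  unfolding cadlag_on_def
proof (intro conjI ballI)
  fix t assume t: "t \<in> {0..<T}"
  have "(g \<longlongrightarrow> g t) (at t within {0..T})" using assms t by (auto simp: continuous_on_def)
  then have "(g \<longlongrightarrow> g t) (at t within {t<..T})"
    by (rule tendsto_within_subset) (use t in auto)
  moreover have "at t within {t<..T} = at_right t"
    by (rule at_within_nhd[of _ "{..<T}"]) (use t in auto)
  ultimately show "(g \<longlongrightarrow> g t) (at_right t)" by simp
next
  fix t assume t: "t \<in> {0<..T}"
  have "(g \<longlongrightarrow> g t) (at t within {0..T})" using assms t by (auto simp: continuous_on_def)
  then have "(g \<longlongrightarrow> g t) (at t within {0..<t})"
    by (rule tendsto_within_subset) (use t in auto)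
  moreover have "at t within {0..<t} = at_left t"
    by (rule at_within_nhd[of _ "{0<..}"]) (use t in auto)
  ultimately show "\<exists>l. (g \<longlongrightarrow> l) (at_left t)" by auto
qed

text \<open>Right limits along the rationals determine \<open>g\<close> on \<open>[0, T)\<close>.
  The end point \<open>T\<close> is listed separately because nothing lies to its right.\<close>

lemma cadlag_on_zero:
  fixes g :: "real \<Rightarrow> real"
  assumes "cadlag_on T g" "\<And>t. t \<in> {0..T} \<Longrightarrow> t \<in> \<rat> \<or> t = T \<Longrightarrow> g t = 0" "t \<in> {0..T}"
  shows "g t = 0"
proof (cases "t = T")
  case False
  then have t: "t \<in> {0..<T}" using assms by auto
  have lim: "(g \<longlongrightarrow> g t) (at_right t)" using assms t by (auto simp: cadlag_on_def)
  show ?thesis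
  proof (rule ccontr)
    assume "g t \<noteq> 0"
    then have "eventually (\<lambda>u. dist (g u) (g t) < \<bar>g t\<bar>) (at_right t)"
      by (intro tendstoD[OF lim]) simp
    then obtain b where b: "b > t" "\<And>u. t < u \<Longrightarrow> u < b \<Longrightarrow> dist (g u) (g t) < \<bar>g t\<bar>"
      unfolding eventually_at_right_field by auto
    obtain q where q: "q \<in> \<rat>" "t < q" "q < min b T"
      using Rats_dense_in_real[of t "min b T"] b t by auto
    then have "g q = 0" using assms(2)[of q] t by auto
    with b(2)[of q] q show False by (auto simp: dist_real_def)
  qed
qed (use assms in auto)

lemma cadlag_on_add:
  "cadlag_on T f \<Longrightarrow> cadlag_on T g \<Longrightarrow> cadlag_on T (\<lambda>t. f t + g t :: real)"
  unfolding cadlag_on_def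
proof (elim conjE, intro conjI ballI)
  fix t assume "\<forall>t\<in>{0<..T}. \<exists>l. (f \<longlongrightarrow> l) (at_left t)" "\<forall>t\<in>{0<..T}. \<exists>l. (g \<longlongrightarrow> l) (at_left t)" "t \<in> {0<..T}"
  then obtain l m where "(f \<longlongrightarrow> l) (at_left t)" "(g \<longlongrightarrow> m) (at_left t)" by meson
  then show "\<exists>l. ((\<lambda>t. f t + g t) \<longlongrightarrow> l) (at_left t)" by (auto intro!: exI[of _ "l + m"] tendsto_add)
qed (intro tendsto_add; simp)

lemma cadlag_on_uminus:
  "cadlag_on T f \<Longrightarrow> cadlag_on T (\<lambda>t. - f t :: real)"
  unfolding cadlag_on_def
proof (elim conjE, intro conjI ballI)
  fix t assume "\<forall>t\<in>{0<..T}. \<exists>l. (f \<longlongrightarrow> l) (at_left t)" "t \<in> {0<..T}"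
  then obtain l where "(f \<longlongrightarrow> l) (at_left t)" by meson
  then show "\<exists>l. ((\<lambda>t. - f t) \<longlongrightarrow> l) (at_left t)" by (auto intro!: exI[of _ "- l"] tendsto_minus)
qed (intro tendsto_minus; simp)

lemma cadlag_on_diff:
  "cadlag_on T f \<Longrightarrow> cadlag_on T g \<Longrightarrow> cadlag_on T (\<lambda>t. f t - g t :: real)"
  using cadlag_on_add[OF _ cadlag_on_uminus, of T f g] by simp

section \<open>Gronwall and Picard arguments for scalar integral equations\<close>

lemma gronwall_zero:
  fixes d :: "real \<Rightarrow> real"
  assumes cont: "continuous_on {0..T} d" and L: "L > 0"
    and nn: "\<And>s. s \<in> {0..T} \<Longrightarrow> 0 \<le> d s"
    and le: "\<And>s. s \<in> {0..T} \<Longrightarrow> d s \<le> L * (LBINT r:{0..s}. d r)"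
    and s: "s \<in> {0..T}"
  shows "d s = 0"
proof -
  have "\<exists>x\<in>{0..T}. \<forall>y\<in>{0..T}. exp (- 2 * L * y) * d y \<le> exp (- 2 * L * x) * d x"
    by (rule continuous_attains_sup) (use s in \<open>auto intro!: continuous_intros cont\<close>)
  then obtain u where u: "u \<in> {0..T}" "\<And>y. y \<in> {0..T} \<Longrightarrow> exp (- 2 * L * y) * d y \<le> exp (- 2 * L * u) * d u"
    by blast
  \<comment> \<open>\<open>m\<close> is the maximum of \<open>d\<close> in an exponential weight,
    attained at \<open>u\<close>. Inserting \<open>d r \<le> m * exp (2 * L * r)\<close> into the
    hypothesis at \<open>u\<close>, the integration produces the factor \<open>1 / (2 * L)\<close>,
    hence \<open>m \<le> m / 2\<close>; the 2 in the exponent is there to produce this half.\<close>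
  define m where "m = exp (- 2 * L * u) * d u"
  have dm: "d y \<le> m * exp (2 * L * y)" if "y \<in> {0..T}" for y
    using u(2)[OF that] by (simp add: m_def exp_minus field_simps)
  have m0: "0 \<le> m" using nn u by (simp add: m_def)
  have i1: "set_integrable lborel {0..u} d"
    by (rule borel_integrable_atLeastAtMost') (rule continuous_on_subset[OF cont], use u in auto)
  have i2: "set_integrable lborel {0..u} (\<lambda>r. m * exp (2 * L * r))"
    by (rule borel_integrable_atLeastAtMost') (intro continuous_intros)
  have "d u \<le> L * (LBINT r:{0..u}. d r)" using le u by auto
  also have "\<dots> \<le> L * (LBINT r:{0..u}. m * exp (2 * L * r))"
    by (intro mult_left_mono set_integral_mono i1 i2 dm) (use u L in auto)
  also have "(LBINT r:{0..u}. m * exp (2 * L * r)) = m / (2 * L) * exp (2 * L * u) - m / (2 * L) * exp (2 * L * 0)"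
  proof -
    have "((\<lambda>r. m * exp (2 * L * r)) has_integral m / (2 * L) * exp (2 * L * u) - m / (2 * L) * exp (2 * L * 0)) {0..u}"
      by (rule fundamental_theorem_of_calculus)
         (use u L in \<open>auto intro!: derivative_eq_intros simp flip: has_real_derivative_iff_has_vector_derivative\<close>)
    moreover have "((\<lambda>r. m * exp (2 * L * r)) has_integral (LBINT r:{0..u}. m * exp (2 * L * r))) {0..u}"
      unfolding set_borel_integral_eq_integral(2)[OF i2]
      by (rule integrable_integral[OF set_borel_integral_eq_integral(1)[OF i2]])
    ultimately show ?thesis by (rule has_integral_unique[symmetric])
  qed
  also have "L * \<dots> \<le> m / 2 * exp (2 * L * u)"
    using L m0 by (simp add: field_simps)
  finally have "m \<le> m / 2"
    by (simp add: m_def exp_minus field_simps)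
  then have "m = 0" using m0 by simp
  then show ?thesis using dm[OF s] nn[OF s] by simp
qed

lemma continuous_on_set_integral:
  fixes g :: "real \<Rightarrow> real"
  assumes "set_integrable lborel {0..T} g"
  shows "continuous_on {0..T} (\<lambda>s. LBINT r:{0..s}. g r)" "continuous_on {0..T} (\<lambda>s. LBINT r:{s..T}. g r)"
proof -
  have sub: "set_integrable lborel A g" if "A \<subseteq> {0..T}" "A \<in> sets borel" for A
    using assms that by (auto intro: set_integrable_subset)
  have int: "g integrable_on {0..T}" using set_borel_integral_eq_integral[OF assms] by simp
  have e: "(LBINT r:A. g r) = integral A g" if "A \<subseteq> {0..T}" "A \<in> sets borel" for A
    using set_borel_integral_eq_integral[OF sub[OF that]] by simp
  show "continuous_on {0..T} (\<lambda>s. LBINT r:{0..s}. g r)"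
    by (subst continuous_on_cong[OF refl e]) (auto intro!: indefinite_integral_continuous_1 int)
  show "continuous_on {0..T} (\<lambda>s. LBINT r:{s..T}. g r)"
    by (subst continuous_on_cong[OF refl e]) (auto intro!: indefinite_integral_continuous_1' int)
qed

lemma terminal_ode_exists:
  fixes G :: "real \<Rightarrow> real \<Rightarrow> real"
  assumes T: "0 \<le> T" and L: "L > 0"
    and cont: "continuous_on ({0..T} \<times> UNIV) (\<lambda>(t, y). G t y)"
    and lip: "\<And>t y y'. t \<in> {0..T} \<Longrightarrow> \<bar>G t y - G t y'\<bar> \<le> L * \<bar>y - y'\<bar>"
  obtains y0 where "continuous_on {0..T} y0" "\<And>s. s \<in> {0..T} \<Longrightarrow> y0 s = \<xi> + (LBINT r:{s..T}. G r (y0 r))"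
proof -
  \<comment> \<open>\<open>c\<close> clamps time to \<open>[0, T]\<close>. The fixed point theorem
    is applied in the space of bounded continuous functions on the whole line, and clamping makes
    the Picard map act there: its values are determined by those on the compact interval.\<close>
  define c where "c s = max 0 (min T s)" for s
  have c: "c s \<in> {0..T}" for s using T by (auto simp: c_def)
  have cc: "continuous_on UNIV c" unfolding c_def by (intro continuous_intros)
  have cid: "c s = s" if "s \<in> {0..T}" for s using that by (auto simp: c_def)
  txt \<open>With this exponential weight the Picard map is a contraction on all of \<open>[0, T]\<close>.\<close>
  define w where "w s = exp (- 2 * L * (T - s))" for s
  have w0: "w s > 0" for s by (simp add: w_def)
  have wc: "continuous_on A w" for A unfolding w_def by (intro continuous_intros)
  \<comment> \<open>The unknown is \<open>u = w * y\<close>, so the sum metric on \<open>u\<close>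
    is the weighted one on \<open>y\<close>. Recovering \<open>y = u / w\<close> costs the factor
    \<open>exp (2 * L * (T - r))\<close>, whose integral over \<open>[s, T]\<close> is at most
    \<open>1 / (2 * L)\<close> times its value at \<open>s\<close>; the outer weight cancels that
    value and leaves the contraction constant 1/2.\<close>
  define \<Phi> where "\<Phi> u s = w (c s) * (\<xi> + (LBINT r:{c s..T}. G r (u r / w r)))" for u s
  have Gc: "continuous_on {0..T} (\<lambda>r. G r (u r))" if "continuous_on {0..T} u" for u
    using continuous_on_compose2[OF cont continuous_on_Pair[OF continuous_on_id that]] by auto
  have uc: "continuous_on {0..T} (\<lambda>r. u r / w r)" if "continuous_on UNIV u" for u
    by (intro continuous_intros continuous_on_subset[OF that] wc) (auto simp: w0 less_imp_neq[THEN not_sym])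
  have si: "set_integrable lborel {s..T} (\<lambda>r. G r (u r / w r))" if "continuous_on UNIV u" "s \<in> {0..T}" for u s
    by (rule borel_integrable_atLeastAtMost') (rule continuous_on_subset[OF Gc[OF uc[OF that(1)]]], use that in auto)
  have \<Phi>c: "continuous_on UNIV (\<Phi> u)" if "continuous_on UNIV u" for u
  proof -
    have "continuous_on {0..T} (\<lambda>s. w s * (\<xi> + (LBINT r:{s..T}. G r (u r / w r))))"
      by (intro continuous_intros continuous_on_set_integral si wc that) (use T in auto)
    from continuous_on_compose2[OF this cc] show ?thesis
      unfolding \<Phi>_def using c by blast
  qed
  have \<Phi>b: "\<Phi> u \<in> bcontfun" if "continuous_on UNIV u" for u
  proof -
    have "bounded (\<Phi> u ` {0..T})"
      by (intro compact_imp_bounded compact_continuous_image continuous_on_subset[OF \<Phi>c[OF that]]) auto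
    moreover have "range (\<Phi> u) \<subseteq> \<Phi> u ` {0..T}"
    proof
      fix x assume "x \<in> range (\<Phi> u)"
      then obtain s where "x = \<Phi> u s" by auto
      moreover have "\<Phi> u s = \<Phi> u (c s)" by (simp add: \<Phi>_def cid[OF c])
      ultimately show "x \<in> \<Phi> u ` {0..T}" using c by blast
    qed
    ultimately show ?thesis using \<Phi>c[OF that] by (auto simp: bcontfun_def intro: bounded_subset)
  qed
  define P where "P v = Bcontfun (\<Phi> (apply_bcontfun v))" for v
  have Pa: "apply_bcontfun (P v) = \<Phi> (apply_bcontfun v)" for v
    unfolding P_def by (rule Bcontfun_inverse) (rule \<Phi>b, simp)
  have contr: "dist (P u) (P v) \<le> (1/2) * dist u v" for u v :: "real \<Rightarrow>\<^sub>C real"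
  proof (rule dist_bound)
    fix s0 define s where "s = c s0"
    have s: "s \<in> {0..T}" using c by (simp add: s_def)
    define D where "D = dist u v"
    have D: "\<bar>apply_bcontfun u r - apply_bcontfun v r\<bar> \<le> D" for r
      using dist_bounded[of u r v] by (simp add: D_def dist_real_def)
    have iu: "set_integrable lborel {s..T} (\<lambda>r. G r (u r / w r))"
         "set_integrable lborel {s..T} (\<lambda>r. G r (v r / w r))"
      using s by (auto intro!: si)
    have ie: "set_integrable lborel {s..T} (\<lambda>r. L * D * exp (2 * L * (T - r)))"
      by (rule borel_integrable_atLeastAtMost') (intro continuous_intros)
    have "\<bar>(LBINT r:{s..T}. G r (u r / w r)) - (LBINT r:{s..T}. G r (v r / w r))\<bar>
        = \<bar>LBINT r:{s..T}. G r (u r / w r) - G r (v r / w r)\<bar>"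
      using set_integral_diff(2)[OF iu] by simp
    also have "\<dots> \<le> (LBINT r:{s..T}. \<bar>G r (u r / w r) - G r (v r / w r)\<bar>)"
      using set_integral_norm_bound[OF set_integral_diff(1)[OF iu]] by simp
    also have "\<dots> \<le> (LBINT r:{s..T}. L * D * exp (2 * L * (T - r)))"
    proof (rule set_integral_mono[OF _ ie])
      show "set_integrable lborel {s..T} (\<lambda>r. \<bar>G r (u r / w r) - G r (v r / w r)\<bar>)"
        using set_integrable_norm[OF set_integral_diff(1)[OF iu]] by simp
      fix r assume r: "r \<in> {s..T}"
      have "\<bar>G r (u r / w r) - G r (v r / w r)\<bar> \<le> L * \<bar>u r / w r - v r / w r\<bar>"
        using r s by (intro lip) auto
      also have "\<bar>u r / w r - v r / w r\<bar> = \<bar>u r - v r\<bar> * exp (2 * L * (T - r))"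
      proof -
        have "inverse (w r) = exp (2 * L * (T - r))"
          unfolding w_def by (simp flip: exp_minus)
        then show ?thesis using w0[of r]
          by (simp add: divide_inverse abs_mult flip: left_diff_distrib)
      qed
      also have "L * \<dots> \<le> L * (D * exp (2 * L * (T - r)))"
        using L by (intro mult_left_mono mult_right_mono D) auto
      finally show "\<bar>G r (u r / w r) - G r (v r / w r)\<bar> \<le> L * D * exp (2 * L * (T - r))" by simp
    qed
    also have "(LBINT r:{s..T}. L * D * exp (2 * L * (T - r))) = - D / 2 * exp (2 * L * (T - T)) - - D / 2 * exp (2 * L * (T - s))"
    proof -
      have "((\<lambda>r. L * D * exp (2 * L * (T - r))) has_integral - D / 2 * exp (2 * L * (T - T)) - - D / 2 * exp (2 * L * (T - s))) {s..T}"
        by (rule fundamental_theorem_of_calculus)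
           (use s L in \<open>auto intro!: derivative_eq_intros simp flip: has_real_derivative_iff_has_vector_derivative\<close>)
      moreover have "((\<lambda>r. L * D * exp (2 * L * (T - r))) has_integral (LBINT r:{s..T}. L * D * exp (2 * L * (T - r)))) {s..T}"
        unfolding set_borel_integral_eq_integral(2)[OF ie]
        by (rule integrable_integral[OF set_borel_integral_eq_integral(1)[OF ie]])
      ultimately show ?thesis by (rule has_integral_unique[symmetric])
    qed
    also have "\<dots> \<le> D / 2 * exp (2 * L * (T - s))"
      using D[of 0] by simp
    finally have *: "\<bar>(LBINT r:{s..T}. G r (u r / w r)) - (LBINT r:{s..T}. G r (v r / w r))\<bar> \<le> D / 2 * exp (2 * L * (T - s))" .
    have "dist (P u s0) (P v s0) = w s * \<bar>(LBINT r:{s..T}. G r (u r / w r)) - (LBINT r:{s..T}. G r (v r / w r))\<bar>"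
      unfolding Pa \<Phi>_def dist_real_def s_def[symmetric]
      using w0[of s] by (simp flip: right_diff_distrib add: abs_mult)
    also have "\<dots> \<le> w s * (D / 2 * exp (2 * L * (T - s)))"
      using * w0[of s] by (intro mult_left_mono) auto
    also have "\<dots> = D / 2 * (exp (- (2 * L * (T - s))) * exp (2 * L * (T - s)))"
      by (simp add: w_def)
    also have "\<dots> = D / 2" unfolding mult_exp_exp by simp
    finally show "dist (apply_bcontfun (P u) s0) (apply_bcontfun (P v) s0) \<le> (1/2) * dist u v"
      by (simp add: D_def)
  qed
  have "\<exists>!x. P x = x"
    by (rule banach_fix_type[of "1/2"]) (use contr in auto)
  then obtain v where v: "P v = v" by blast
  show ?thesis
  proof
    show "continuous_on {0..T} (\<lambda>r. apply_bcontfun v r / w r)" by (rule uc) simp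
    fix s assume s: "s \<in> {0..T}"
    have "apply_bcontfun v s = \<Phi> (apply_bcontfun v) s" using Pa[of v] v by simp
    then show "apply_bcontfun v s / w s = \<xi> + (LBINT r:{s..T}. G r (apply_bcontfun v r / w r))"
      using w0[of s] by (simp add: \<Phi>_def cid[OF s] field_simps)
  qed
qed

text \<open>The whole line through \<open>p\<close> stays in \<open>S\<close>, so the derivative
  within \<open>S\<close> is an ordinary two-sided one and the mean value inequality applies along
  the line.\<close>

lemma lipschitz_direction:
  fixes g :: "'a::real_normed_vector \<Rightarrow> real"
  assumes S: "\<And>h. p + h *\<^sub>R e \<in> S"
    and D: "\<And>p. p \<in> S \<Longrightarrow> ((\<lambda>h. g (p + h *\<^sub>R e)) has_real_derivative D p) (at 0 within {h. p + h *\<^sub>R e \<in> S})"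
    and K: "\<And>p. p \<in> S \<Longrightarrow> \<bar>D p\<bar> \<le> K"
  shows "\<bar>g (p + h *\<^sub>R e) - g p\<bar> \<le> K * \<bar>h\<bar>"
proof -
  have der: "((\<lambda>h. g (p + h *\<^sub>R e)) has_real_derivative D (p + h *\<^sub>R e)) (at h)" for h
  proof -
    have "{k. (p + h *\<^sub>R e) + k *\<^sub>R e \<in> S} = UNIV"
      using S by (simp add: add.assoc flip: scaleR_add_left)
    then have "((\<lambda>k. g ((p + h *\<^sub>R e) + k *\<^sub>R e)) has_real_derivative D (p + h *\<^sub>R e)) (at 0)"
      using D[OF S, of h] by simp
    then have "((\<lambda>k. (\<lambda>h. g (p + h *\<^sub>R e)) (h + k)) has_real_derivative D (p + h *\<^sub>R e)) (at 0)"
      by (simp add: add.assoc scaleR_add_left)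
    then show ?thesis using DERIV_at_within_shift[of "\<lambda>h. g (p + h *\<^sub>R e)" "D (p + h *\<^sub>R e)" h 0 UNIV]
      by (simp add: add.commute)
  qed
  have "norm ((\<lambda>h. g (p + h *\<^sub>R e)) h - (\<lambda>h. g (p + h *\<^sub>R e)) 0) \<le> K * norm (h - 0)"
    by (rule field_differentiable_bound[of UNIV _ "\<lambda>h. D (p + h *\<^sub>R e)"])
       (use der K S in auto)
  then show ?thesis by simp
qed

subsection \<open>Square-integrable martingales with deterministic brackets\<close>

lemma bounded_imageD:
  fixes h :: "'a \<Rightarrow> real"
  assumes "bounded (h ` S)"
  obtains C where "0 \<le> C" "\<And>x. x \<in> S \<Longrightarrow> \<bar>h x\<bar> \<le> C"
proof -
  obtain C where "\<And>x. x \<in> S \<Longrightarrow> \<bar>h x\<bar> \<le> C" using assms by (auto simp: bounded_iff)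
  then show ?thesis using that[of "max C 0"] by fastforce
qed

lemma integrable_mult_L2:
  fixes f g :: "'a \<Rightarrow> real"
  assumes [measurable]: "f \<in> borel_measurable M" "g \<in> borel_measurable M"
    and "integrable M (\<lambda>x. (f x)\<^sup>2)" "integrable M (\<lambda>x. (g x)\<^sup>2)"
  shows "integrable M (\<lambda>x. f x * g x)"
proof (rule Bochner_Integration.integrable_bound[OF Bochner_Integration.integrable_add[OF assms(3,4)]])
  have "\<bar>f x * g x\<bar> \<le> (f x)\<^sup>2 + (g x)\<^sup>2" for x
  proof -
    have "2 * \<bar>f x * g x\<bar> \<le> (f x)\<^sup>2 + (g x)\<^sup>2"
      using sum_squares_bound[of "\<bar>f x\<bar>" "\<bar>g x\<bar>"] by (simp add: abs_mult mult.assoc)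
    then show ?thesis using abs_ge_zero[of "f x * g x"] by linarith
  qed
  then show "AE x in M. norm (f x * g x) \<le> norm ((f x)\<^sup>2 + (g x)\<^sup>2)" by simp
qed simp

lemma integrable_bounded_mult:
  fixes h f :: "'a \<Rightarrow> real"
  assumes [measurable]: "h \<in> borel_measurable M" and "bounded (h ` space M)" and f: "integrable M f"
  shows "integrable M (\<lambda>x. h x * f x)"
proof -
  obtain C where C: "0 \<le> C" "\<And>x. x \<in> space M \<Longrightarrow> \<bar>h x\<bar> \<le> C" by (rule bounded_imageD[OF assms(2)]) blast
  have [measurable]: "f \<in> borel_measurable M" using f by simp
  show ?thesis
    by (rule Bochner_Integration.integrable_bound[OF integrable_mult_right[OF f, of C]])
       (use C in \<open>auto intro!: AE_I2 mult_right_mono simp: abs_mult\<close>)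
qed

lemma bounded_image_mult:
  fixes h k :: "'a \<Rightarrow> real"
  assumes "bounded (h ` S)" "bounded (k ` S)"
  shows "bounded ((\<lambda>x. h x * k x) ` S)"
proof -
  obtain C where C: "0 \<le> C" "\<And>x. x \<in> S \<Longrightarrow> \<bar>h x\<bar> \<le> C" by (rule bounded_imageD[OF assms(1)]) blast
  obtain D where D: "0 \<le> D" "\<And>x. x \<in> S \<Longrightarrow> \<bar>k x\<bar> \<le> D" by (rule bounded_imageD[OF assms(2)]) blast
  show ?thesis unfolding bounded_iff
    by (intro exI[of _ "C * D"]) (use C D in \<open>auto simp: abs_mult intro!: mult_mono\<close>)
qed

lemma integrable_square_bounded_mult:
  fixes h f :: "'a \<Rightarrow> real"
  assumes [measurable]: "h \<in> borel_measurable M" and "bounded (h ` space M)" and f: "integrable M (\<lambda>x. (f x)\<^sup>2)"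
  shows "integrable M (\<lambda>x. (h x * f x)\<^sup>2)"
proof -
  have "integrable M (\<lambda>x. (h x * h x) * (f x)\<^sup>2)"
    by (rule integrable_bounded_mult[OF _ bounded_image_mult[OF assms(2,2)] f]) simp
  then show ?thesis unfolding power_mult_distrib power2_eq_square[of "h _"] .
qed

lemma integrable_square_add:
  fixes f g :: "'a \<Rightarrow> real"
  assumes "f \<in> borel_measurable M" "g \<in> borel_measurable M"
    and "integrable M (\<lambda>x. (f x)\<^sup>2)" "integrable M (\<lambda>x. (g x)\<^sup>2)"
  shows "integrable M (\<lambda>x. (f x + g x)\<^sup>2)"
proof -
  have "integrable M (\<lambda>x. (f x)\<^sup>2 + (g x)\<^sup>2 + 2 * (f x * g x))"
    by (intro Bochner_Integration.integrable_add integrable_mult_right integrable_mult_L2 assms)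
  then show ?thesis unfolding power2_sum mult.assoc .
qed

lemma integrable_square_diff:
  fixes f g :: "'a \<Rightarrow> real"
  assumes "f \<in> borel_measurable M" "g \<in> borel_measurable M"
    and "integrable M (\<lambda>x. (f x)\<^sup>2)" "integrable M (\<lambda>x. (g x)\<^sup>2)"
  shows "integrable M (\<lambda>x. (f x - g x)\<^sup>2)"
proof -
  have "integrable M (\<lambda>x. (f x + - g x)\<^sup>2)"
    by (rule integrable_square_add) (use assms in simp_all)
  then show ?thesis by simp
qed

lemma integrable_square_sum:
  fixes f :: "'i \<Rightarrow> 'a \<Rightarrow> real"
  assumes "\<And>i. i \<in> I \<Longrightarrow> f i \<in> borel_measurable M" "\<And>i. i \<in> I \<Longrightarrow> integrable M (\<lambda>x. (f i x)\<^sup>2)"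
  shows "integrable M (\<lambda>x. (\<Sum>i\<in>I. f i x)\<^sup>2)"
  using assms
proof (induction I rule: infinite_finite_induct)
  case (insert i I)
  then show ?case
    using integrable_square_add[of "f i" M "\<lambda>x. \<Sum>i\<in>I. f i x"] by (auto intro!: borel_measurable_sum)
qed auto

lemma (in finite_measure) integrable_of_square:
  fixes f :: "'a \<Rightarrow> real"
  assumes "f \<in> borel_measurable M" "integrable M (\<lambda>x. (f x)\<^sup>2)"
  shows "integrable M f"
  using integrable_mult_L2[of f M "\<lambda>_. 1"] assms by simp

lemma (in finite_measure) integrable_of_bounded:
  fixes k :: "'a \<Rightarrow> real"
  assumes "k \<in> borel_measurable M" "bounded (k ` space M)"
  shows "integrable M k"
  using integrable_bounded_mult[OF assms, of "\<lambda>_. 1"] by simp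

section \<open>Increments of martingales tested against the past\<close>

locale filtered_prob_space = prob_space M for M :: "'w measure" +
  fixes F :: "real \<Rightarrow> 'w measure" and T :: real
  assumes F_sub: "t \<in> {0..T} \<Longrightarrow> subalgebra M (F t)"
    and F_mono: "0 \<le> s \<Longrightarrow> s \<le> t \<Longrightarrow> t \<le> T \<Longrightarrow> sets (F s) \<subseteq> sets (F t)"
begin

lemma space_F: "t \<in> {0..T} \<Longrightarrow> space (F t) = space M"
  using F_sub by (simp add: subalgebra_def)

lemma measurable_F: "t \<in> {0..T} \<Longrightarrow> f \<in> measurable (F t) N \<Longrightarrow> f \<in> measurable M N"
  using F_sub measurable_from_subalg by blast

lemma measurable_F_mono:
  assumes "0 \<le> s" "s \<le> t" "t \<le> T" "f \<in> measurable (F s) N"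
  shows "f \<in> measurable (F t) N"
proof -
  have "subalgebra (F t) (F s)"
    using assms F_mono[of s t] space_F[of s] space_F[of t] by (auto simp: subalgebra_def)
  then show ?thesis using assms(4) measurable_from_subalg by blast
qed

end

text \<open>Truncating \<open>k\<close> at level \<open>n\<close> gives bounded test variables, and
  the product of the two square-integrable factors is an integrable majorant. The extension is what
  allows increments of one martingale, or the solution itself, to act as the test variable.\<close>

lemma (in filtered_prob_space) orthogonal_extend:
  assumes a: "a \<in> {0..T}" and [measurable]: "D \<in> borel_measurable M"
    and D2: "integrable M (\<lambda>\<omega>. (D \<omega>)\<^sup>2)"
    and orth: "\<And>k. k \<in> borel_measurable (F a) \<Longrightarrow> bounded (k ` space M) \<Longrightarrow> (\<integral>\<omega>. k \<omega> * D \<omega> \<partial>M) = (0::real)"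
    and k: "k \<in> borel_measurable (F a)" "integrable M (\<lambda>\<omega>. (k \<omega>)\<^sup>2)"
  shows "(\<integral>\<omega>. k \<omega> * D \<omega> \<partial>M) = 0"
proof -
  define t where "t n \<omega> = max (- real n) (min (real n) (k \<omega>))" for n \<omega>
  have [measurable]: "k \<in> borel_measurable M" using measurable_F[OF a k(1)] .
  have "(\<lambda>n. \<integral>\<omega>. t n \<omega> * D \<omega> \<partial>M) \<longlonglongrightarrow> (\<integral>\<omega>. k \<omega> * D \<omega> \<partial>M)"
  proof (rule integral_dominated_convergence)
    show "integrable M (\<lambda>\<omega>. \<bar>k \<omega> * D \<omega>\<bar>)"
      using integrable_mult_L2[OF _ _ k(2) D2] by simp
    show "AE \<omega> in M. (\<lambda>n. t n \<omega> * D \<omega>) \<longlonglongrightarrow> k \<omega> * D \<omega>"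
    proof (intro AE_I2 tendsto_mult tendsto_const)
      fix \<omega>
      have "eventually (\<lambda>n. t n \<omega> = k \<omega>) sequentially"
      proof -
        obtain m where "\<bar>k \<omega>\<bar> \<le> real m" using real_arch_simple by blast
        then show ?thesis unfolding eventually_sequentially t_def by (intro exI[of _ m]) auto
      qed
      then show "(\<lambda>n. t n \<omega>) \<longlonglongrightarrow> k \<omega>" by (rule tendsto_eventually)
    qed
    show "AE \<omega> in M. norm (t n \<omega> * D \<omega>) \<le> \<bar>k \<omega> * D \<omega>\<bar>" for n
      by (intro AE_I2) (auto simp: abs_mult t_def intro!: mult_right_mono)
  qed (simp_all add: t_def)
  moreover have "(\<integral>\<omega>. t n \<omega> * D \<omega> \<partial>M) = 0" for n
  proof (rule orth)
    show "t n \<in> borel_measurable (F a)" unfolding t_def using k(1) by measurable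
    show "bounded (t n ` space M)" unfolding bounded_iff t_def by (intro exI[of _ "real n"]) auto
  qed
  ultimately show ?thesis by (simp add: LIMSEQ_const_iff)
qed

text \<open>The martingale property is stated by testing increments against bounded
  \<open>F a\<close>-measurable variables. This is the form that independence and the compensator
  deliver, and the form that products of elementary integrals consume; no conditional expectation
  has to be formed.\<close>

locale martingales = filtered_prob_space M F T for M :: "'w measure" and F T +
  fixes J :: "'i set" and N :: "'i \<Rightarrow> real \<Rightarrow> 'w \<Rightarrow> real"
  assumes N_adapted: "i \<in> J \<Longrightarrow> t \<in> {0..T} \<Longrightarrow> N i t \<in> borel_measurable (F t)"
    and N_square: "i \<in> J \<Longrightarrow> t \<in> {0..T} \<Longrightarrow> integrable M (\<lambda>\<omega>. (N i t \<omega>)\<^sup>2)"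
    and N_martingale: "i \<in> J \<Longrightarrow> 0 \<le> a \<Longrightarrow> a \<le> b \<Longrightarrow> b \<le> T \<Longrightarrow> k \<in> borel_measurable (F a) \<Longrightarrow>
       bounded (k ` space M) \<Longrightarrow> (\<integral>\<omega>. k \<omega> * (N i b \<omega> - N i a \<omega>) \<partial>M) = 0"
begin

lemma N_measurable: "i \<in> J \<Longrightarrow> t \<in> {0..T} \<Longrightarrow> N i t \<in> borel_measurable M"
  using measurable_F N_adapted by blast

lemma N_diff_square:
  "i \<in> J \<Longrightarrow> s \<in> {0..T} \<Longrightarrow> t \<in> {0..T} \<Longrightarrow> integrable M (\<lambda>\<omega>. (N i t \<omega> - N i s \<omega>)\<^sup>2)"
  by (intro integrable_square_diff N_measurable N_square)

lemma N_orthogonal: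
  assumes "i \<in> J" "0 \<le> a" "a \<le> b" "b \<le> T" "k \<in> borel_measurable (F a)" "integrable M (\<lambda>\<omega>. (k \<omega>)\<^sup>2)"
  shows "(\<integral>\<omega>. k \<omega> * (N i b \<omega> - N i a \<omega>) \<partial>M) = 0"
proof (rule orthogonal_extend[OF _ _ _ _ assms(5,6)])
  show "(\<lambda>\<omega>. N i b \<omega> - N i a \<omega>) \<in> borel_measurable M"
    using N_measurable[of i a] N_measurable[of i b] assms by auto
qed (use assms N_diff_square N_martingale in auto)

text \<open>The increment over the earlier of two consecutive intervals is a square-integrable factor
  for the later one.\<close>

lemma N_orthogonal_consecutive:
  assumes i: "i \<in> J" and j: "j \<in> J" and t: "0 \<le> a" "a \<le> c" "c \<le> d" "d \<le> e" "e \<le> T"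
    and k: "k \<in> borel_measurable (F d)" "bounded (k ` space M)"
  shows "(\<integral>\<omega>. k \<omega> * ((N i c \<omega> - N i a \<omega>) * (N j e \<omega> - N j d \<omega>)) \<partial>M) = 0"
proof -
  have m: "N i a \<in> borel_measurable (F d)" "N i c \<in> borel_measurable (F d)"
    using t by (auto intro!: measurable_F_mono[OF _ _ _ N_adapted[OF i]])
  have "(\<integral>\<omega>. (k \<omega> * (N i c \<omega> - N i a \<omega>)) * (N j e \<omega> - N j d \<omega>) \<partial>M) = 0"
  proof (rule N_orthogonal[OF j])
    show "(\<lambda>\<omega>. k \<omega> * (N i c \<omega> - N i a \<omega>)) \<in> borel_measurable (F d)"
      using m k(1) by measurable
    show "integrable M (\<lambda>\<omega>. (k \<omega> * (N i c \<omega> - N i a \<omega>))\<^sup>2)"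
      by (rule integrable_square_bounded_mult[OF measurable_F[OF _ k(1)] k(2) N_diff_square[OF i]])
         (use t in auto)
  qed (use t in auto)
  then show ?thesis by (simp add: mult.assoc)
qed

lemma N_mult_integrable:
  assumes "i \<in> J" "j \<in> J" "a \<in> {0..T}" "b \<in> {0..T}" "c \<in> {0..T}" "d \<in> {0..T}"
    and k: "k \<in> borel_measurable M" "bounded (k ` space M)"
  shows "integrable M (\<lambda>\<omega>. k \<omega> * ((N i b \<omega> - N i a \<omega>) * (N j d \<omega> - N j c \<omega>)))"
  by (intro integrable_bounded_mult k integrable_mult_L2 N_diff_square borel_measurable_diff N_measurable assms)

end

text \<open>\<open>Q i j\<close> is the bracket of the martingales \<open>N i\<close> and \<open>N j\<close>, assumed to be deterministic.\<close>

locale bracket_martingales = martingales M F T J N for M :: "'w measure" and F T J and N :: "'i \<Rightarrow> real \<Rightarrow> 'w \<Rightarrow> real" +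
  fixes Q :: "'i \<Rightarrow> 'i \<Rightarrow> real \<Rightarrow> real"
  assumes Q_sym: "i \<in> J \<Longrightarrow> j \<in> J \<Longrightarrow> Q i j t = Q j i t"
    and N_bracket: "i \<in> J \<Longrightarrow> j \<in> J \<Longrightarrow> 0 \<le> a \<Longrightarrow> a \<le> b \<Longrightarrow> b \<le> T \<Longrightarrow> k \<in> borel_measurable (F a) \<Longrightarrow>
       bounded (k ` space M) \<Longrightarrow>
       (\<integral>\<omega>. k \<omega> * ((N i b \<omega> - N i a \<omega>) * (N j b \<omega> - N j a \<omega>)) \<partial>M) = (\<integral>\<omega>. k \<omega> \<partial>M) * (Q i j b - Q i j a)"
begin

text \<open>Cut the longer interval at \<open>b\<close>: its remainder is orthogonal to everything
  known at time \<open>b\<close>, including the shorter increment.\<close>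

lemma bracket_same_start:
  assumes i: "i \<in> J" and j: "j \<in> J" and t: "0 \<le> a" "a \<le> b" "b \<le> c" "c \<le> T"
    and k: "k \<in> borel_measurable (F a)" "bounded (k ` space M)"
  shows "(\<integral>\<omega>. k \<omega> * ((N i b \<omega> - N i a \<omega>) * (N j c \<omega> - N j a \<omega>)) \<partial>M) = (\<integral>\<omega>. k \<omega> \<partial>M) * (Q i j b - Q i j a)"
proof -
  have kM: "k \<in> borel_measurable M" by (rule measurable_F[OF _ k(1)]) (use t in auto)
  have kb: "k \<in> borel_measurable (F b)" by (rule measurable_F_mono[OF _ _ _ k(1)]) (use t in auto)
  have "(\<integral>\<omega>. k \<omega> * ((N i b \<omega> - N i a \<omega>) * (N j c \<omega> - N j a \<omega>)) \<partial>M)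
      = (\<integral>\<omega>. k \<omega> * ((N i b \<omega> - N i a \<omega>) * (N j b \<omega> - N j a \<omega>)) + k \<omega> * ((N i b \<omega> - N i a \<omega>) * (N j c \<omega> - N j b \<omega>)) \<partial>M)"
    by (simp add: algebra_simps)
  also have "\<dots> = (\<integral>\<omega>. k \<omega> * ((N i b \<omega> - N i a \<omega>) * (N j b \<omega> - N j a \<omega>)) \<partial>M)
      + (\<integral>\<omega>. k \<omega> * ((N i b \<omega> - N i a \<omega>) * (N j c \<omega> - N j b \<omega>)) \<partial>M)"
    by (intro Bochner_Integration.integral_add N_mult_integrable kM k i j) (use t in auto)
  also have "(\<integral>\<omega>. k \<omega> * ((N i b \<omega> - N i a \<omega>) * (N j c \<omega> - N j b \<omega>)) \<partial>M) = 0"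
    by (rule N_orthogonal_consecutive) (use i j t kb k in auto)
  finally show ?thesis using N_bracket[OF i j _ _ _ k] t by simp
qed

text \<open>The part of the earlier interval before \<open>a'\<close> is known at \<open>a'\<close>,
  hence orthogonal to the second increment; what remains starts at a common time.
  \<open>max a' (min b b')\<close> is the right end of the overlap, and collapses to
  \<open>a'\<close> for disjoint intervals, so that the bracket term is then 0.\<close>

lemma bracket_general_le:
  assumes i: "i \<in> J" and j: "j \<in> J" and t: "0 \<le> a" "a \<le> b" "b \<le> T" "a \<le> a'" "a' \<le> b'" "b' \<le> T"
    and k: "k \<in> borel_measurable (F a')" "bounded (k ` space M)"
  shows "(\<integral>\<omega>. k \<omega> * ((N i b \<omega> - N i a \<omega>) * (N j b' \<omega> - N j a' \<omega>)) \<partial>M)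
     = (\<integral>\<omega>. k \<omega> \<partial>M) * (Q i j (max a' (min b b')) - Q i j a')"
proof (cases "b \<le> a'")
  case True
  have "(\<integral>\<omega>. k \<omega> * ((N i b \<omega> - N i a \<omega>) * (N j b' \<omega> - N j a' \<omega>)) \<partial>M) = 0"
    by (rule N_orthogonal_consecutive) (use i j t True k in auto)
  moreover have "max a' (min b b') = a'" using True t by auto
  ultimately show ?thesis by simp
next
  case False
  have kM: "k \<in> borel_measurable M" by (rule measurable_F[OF _ k(1)]) (use t in auto)
  have "(\<integral>\<omega>. k \<omega> * ((N i b \<omega> - N i a \<omega>) * (N j b' \<omega> - N j a' \<omega>)) \<partial>M)
      = (\<integral>\<omega>. k \<omega> * ((N i a' \<omega> - N i a \<omega>) * (N j b' \<omega> - N j a' \<omega>)) + k \<omega> * ((N i b \<omega> - N i a' \<omega>) * (N j b' \<omega> - N j a' \<omega>)) \<partial>M)"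
    by (simp add: algebra_simps)
  also have "\<dots> = (\<integral>\<omega>. k \<omega> * ((N i a' \<omega> - N i a \<omega>) * (N j b' \<omega> - N j a' \<omega>)) \<partial>M)
      + (\<integral>\<omega>. k \<omega> * ((N i b \<omega> - N i a' \<omega>) * (N j b' \<omega> - N j a' \<omega>)) \<partial>M)"
    by (intro Bochner_Integration.integral_add N_mult_integrable kM k i j) (use t False in auto)
  also have "(\<integral>\<omega>. k \<omega> * ((N i a' \<omega> - N i a \<omega>) * (N j b' \<omega> - N j a' \<omega>)) \<partial>M) = 0"
    by (rule N_orthogonal_consecutive) (use i j t k in auto)
  also have "(\<integral>\<omega>. k \<omega> * ((N i b \<omega> - N i a' \<omega>) * (N j b' \<omega> - N j a' \<omega>)) \<partial>M)
     = (\<integral>\<omega>. k \<omega> \<partial>M) * (Q i j (min b b') - Q i j a')"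
  proof (cases "b \<le> b'")
    case True
    then show ?thesis using bracket_same_start[OF i j _ _ _ _ k, of b b'] t False by auto
  next
    case False
    then show ?thesis using bracket_same_start[OF j i _ _ _ _ k, of b' b] t Q_sym[OF i j]
      by (auto simp: mult.commute[of "N j _ _ - _"])
  qed
  finally show ?thesis using False t by (simp add: max_def min_def)
qed

lemma bracket_general:
  assumes i: "i \<in> J" and j: "j \<in> J" and t: "0 \<le> a" "a \<le> b" "b \<le> T" "0 \<le> a'" "a' \<le> b'" "b' \<le> T"
    and h: "h \<in> borel_measurable (F a)" "bounded (h ` space M)"
    and h': "h' \<in> borel_measurable (F a')" "bounded (h' ` space M)"
  shows "(\<integral>\<omega>. (h \<omega> * (N i b \<omega> - N i a \<omega>)) * (h' \<omega> * (N j b' \<omega> - N j a' \<omega>)) \<partial>M)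
     = (\<integral>\<omega>. h \<omega> * h' \<omega> \<partial>M) * (Q i j (max (max a a') (min b b')) - Q i j (max a a'))"
proof -
  have e: "(h \<omega> * (N i b \<omega> - N i a \<omega>)) * (h' \<omega> * (N j b' \<omega> - N j a' \<omega>)) =
     (h \<omega> * h' \<omega>) * ((N i b \<omega> - N i a \<omega>) * (N j b' \<omega> - N j a' \<omega>))" for \<omega> by simp
  \<comment> \<open>Both weights are known at the later of the two starting times, so their product
    can serve as one test variable there.\<close>
  have m: "(\<lambda>\<omega>. h \<omega> * h' \<omega>) \<in> borel_measurable (F (max a a'))"
    by (intro borel_measurable_times measurable_F_mono[OF _ _ _ h(1)] measurable_F_mono[OF _ _ _ h'(1)])
       (use t in auto)
  note bd = bounded_image_mult[OF h(2) h'(2)]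
  show ?thesis
  proof (cases "a \<le> a'")
    case True
    then have [simp]: "max a a' = a'" by simp
    show ?thesis unfolding e
      using bracket_general_le[OF i j _ _ _ _ _ _ m[simplified] bd] t True by simp
  next
    case False
    then have [simp]: "max a a' = a" by simp
    have c: "min b' b = min b b'" by (rule min.commute)
    show ?thesis unfolding e
      using bracket_general_le[OF j i _ _ _ _ _ _ m[simplified] bd, of a' b' b] t False Q_sym[OF i j]
      by (simp add: c mult.commute[of "N j _ _ - _"])
  qed
qed

text \<open>Taking \<open>max _ s\<close> of both end points restricts an interval to its part after
  \<open>s\<close>, and empties it if it ends earlier; \<open>D\<close> is thus the increment over
  \<open>(s, T]\<close> of an elementary integral. The double sum is left as it stands: intervals
  may overlap, and the square norms of simple integrands evaluate to the same double sum, so neither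
  side has to be brought to a disjoint form.\<close>

lemma elementary_isometry:
  assumes P: "finite P" and s: "s \<in> {0..T}"
    and a: "\<And>p. p \<in> P \<Longrightarrow> 0 \<le> a p \<and> a p \<le> b p \<and> b p \<le> T" and \<iota>: "\<And>p. p \<in> P \<Longrightarrow> \<iota> p \<in> J"
    and h: "\<And>p. p \<in> P \<Longrightarrow> h p \<in> borel_measurable (F (a p))" "\<And>p. p \<in> P \<Longrightarrow> bounded (h p ` space M)"
  defines "D \<equiv> \<lambda>\<omega>. \<Sum>p\<in>P. h p \<omega> * (N (\<iota> p) (max (b p) s) \<omega> - N (\<iota> p) (max (a p) s) \<omega>)"
  shows "D \<in> borel_measurable M"
    and "integrable M (\<lambda>\<omega>. (D \<omega>)\<^sup>2)"
    and "(\<integral>\<omega>. (D \<omega>)\<^sup>2 \<partial>M) = (\<Sum>p\<in>P. \<Sum>q\<in>P. (\<integral>\<omega>. h p \<omega> * h q \<omega> \<partial>M) *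
       (Q (\<iota> p) (\<iota> q) (max (max (max (a p) (a q)) s) (min (b p) (b q))) - Q (\<iota> p) (\<iota> q) (max (max (a p) (a q)) s)))"
    and "\<And>k :: _ \<Rightarrow> real. k \<in> borel_measurable (F s) \<Longrightarrow> integrable M (\<lambda>\<omega>. (k \<omega>)\<^sup>2) \<Longrightarrow> (\<integral>\<omega>. k \<omega> * D \<omega> \<partial>M) = 0"
proof -
  let ?d = "\<lambda>p \<omega>. h p \<omega> * (N (\<iota> p) (max (b p) s) \<omega> - N (\<iota> p) (max (a p) s) \<omega>)"
  have hF: "h p \<in> borel_measurable (F (max (a p) s))" if "p \<in> P" for p
    by (rule measurable_F_mono[OF _ _ _ h(1)[OF that]]) (use that a[OF that] s in auto)
  have hM: "h p \<in> borel_measurable M" if "p \<in> P" for p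
    by (rule measurable_F[OF _ h(1)[OF that]]) (use that a[OF that] in auto)
  have dM: "?d p \<in> borel_measurable M" if "p \<in> P" for p
    by (intro borel_measurable_times borel_measurable_diff hM N_measurable \<iota> that) (use a[OF that] s in auto)
  have d2: "integrable M (\<lambda>\<omega>. (?d p \<omega>)\<^sup>2)" if "p \<in> P" for p
    by (intro integrable_square_bounded_mult hM h N_diff_square \<iota> that) (use a[OF that] s in auto)
  show DM: "D \<in> borel_measurable M" unfolding D_def by (intro borel_measurable_sum dM)
  show "integrable M (\<lambda>\<omega>. (D \<omega>)\<^sup>2)" unfolding D_def by (intro integrable_square_sum dM d2)
  have "(\<integral>\<omega>. (D \<omega>)\<^sup>2 \<partial>M) = (\<integral>\<omega>. (\<Sum>p\<in>P. \<Sum>q\<in>P. ?d p \<omega> * ?d q \<omega>) \<partial>M)"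
    unfolding D_def power2_eq_square by (simp add: sum_product)
  also have "\<dots> = (\<Sum>p\<in>P. \<Sum>q\<in>P. \<integral>\<omega>. ?d p \<omega> * ?d q \<omega> \<partial>M)"
    by (subst Bochner_Integration.integral_sum)
       (auto intro!: Bochner_Integration.integrable_sum integrable_mult_L2 dM d2 sum.cong Bochner_Integration.integral_sum)
  also have "\<dots> = (\<Sum>p\<in>P. \<Sum>q\<in>P. (\<integral>\<omega>. h p \<omega> * h q \<omega> \<partial>M) *
       (Q (\<iota> p) (\<iota> q) (max (max (max (a p) (a q)) s) (min (b p) (b q))) - Q (\<iota> p) (\<iota> q) (max (max (a p) (a q)) s)))"
  proof (intro sum.cong refl)
    fix p q assume p: "p \<in> P" and q: "q \<in> P"
    have e1: "max (max (a p) s) (max (a q) s) = max (max (a p) (a q)) s" by (simp add: max_def)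
    have e2: "max (max (max (a p) (a q)) s) (min (max (b p) s) (max (b q) s)) = max (max (max (a p) (a q)) s) (min (b p) (b q))"
      by (simp add: max_def min_def)
    show "(\<integral>\<omega>. ?d p \<omega> * ?d q \<omega> \<partial>M) = (\<integral>\<omega>. h p \<omega> * h q \<omega> \<partial>M) *
       (Q (\<iota> p) (\<iota> q) (max (max (max (a p) (a q)) s) (min (b p) (b q))) - Q (\<iota> p) (\<iota> q) (max (max (a p) (a q)) s))"
      using bracket_general[OF \<iota>[OF p] \<iota>[OF q] _ _ _ _ _ _ hF[OF p] h(2)[OF p] hF[OF q] h(2)[OF q], of "max (b p) s" "max (b q) s"]
        a[OF p] a[OF q] s unfolding e1 e2 by auto
  qed
  finally show "(\<integral>\<omega>. (D \<omega>)\<^sup>2 \<partial>M) = (\<Sum>p\<in>P. \<Sum>q\<in>P. (\<integral>\<omega>. h p \<omega> * h q \<omega> \<partial>M) *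
       (Q (\<iota> p) (\<iota> q) (max (max (max (a p) (a q)) s) (min (b p) (b q))) - Q (\<iota> p) (\<iota> q) (max (max (a p) (a q)) s)))" .
  fix k :: "_ \<Rightarrow> real" assume k: "k \<in> borel_measurable (F s)" "integrable M (\<lambda>\<omega>. (k \<omega>)\<^sup>2)"
  have kM: "k \<in> borel_measurable M" by (rule measurable_F[OF s k(1)])
  have "(\<integral>\<omega>. k \<omega> * D \<omega> \<partial>M) = (\<Sum>p\<in>P. \<integral>\<omega>. k \<omega> * ?d p \<omega> \<partial>M)"
    unfolding D_def sum_distrib_left
    by (intro Bochner_Integration.integral_sum integrable_mult_L2 kM k dM d2)
  also have "\<dots> = 0"
  proof (intro sum.neutral ballI)
    fix p assume p: "p \<in> P"
    have "(\<integral>\<omega>. (h p \<omega> * k \<omega>) * (N (\<iota> p) (max (b p) s) \<omega> - N (\<iota> p) (max (a p) s) \<omega>) \<partial>M) = 0"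
    proof (rule N_orthogonal[OF \<iota>[OF p]])
      show "(\<lambda>\<omega>. h p \<omega> * k \<omega>) \<in> borel_measurable (F (max (a p) s))"
        by (intro borel_measurable_times hF p measurable_F_mono[OF _ _ _ k(1)]) (use a[OF p] s in auto)
      show "integrable M (\<lambda>\<omega>. (h p \<omega> * k \<omega>)\<^sup>2)"
        by (intro integrable_square_bounded_mult hM h k p)
    qed (use a[OF p] s in auto)
    then show "(\<integral>\<omega>. k \<omega> * ?d p \<omega> \<partial>M) = 0" by (simp add: mult_ac)
  qed
  finally show "(\<integral>\<omega>. k \<omega> * D \<omega> \<partial>M) = 0" .
qed

end

subsection \<open>Brownian motion and jump counts\<close>

text \<open>\<open>G\<close> stands for the events generated by a Brownian increment or by the
  points of the jump measure after time \<open>s\<close>. The preimages of Borel sets under one real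
  variable already form a sigma-algebra, which turns independence of event families into
  independence of variables.\<close>

lemma (in filtered_prob_space) indep_F_integral:
  fixes k R :: "_ \<Rightarrow> real"
  assumes s: "s \<in> {0..T}" and ind: "indep_set (sets (F s)) G"
    and R: "R \<in> borel_measurable M" "\<And>B. B \<in> sets borel \<Longrightarrow> R -` B \<inter> space M \<in> G" "integrable M R"
    and k: "k \<in> borel_measurable (F s)" "integrable M k"
  shows "(\<integral>\<omega>. k \<omega> * R \<omega> \<partial>M) = (\<integral>\<omega>. k \<omega> \<partial>M) * (\<integral>\<omega>. R \<omega> \<partial>M)"
proof (rule indep_var_lebesgue_integral)
  have gen: "sigma_sets (space M) {f -` B \<inter> space M | B. B \<in> sets borel} = {f -` B \<inter> space M | B. B \<in> sets borel}"
    for f :: "_ \<Rightarrow> real"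
    using sets_vimage_algebra2[of f "space M" borel] by (simp add: sets_vimage_algebra)
  have i: "indep_set {k -` B \<inter> space M | B. B \<in> sets borel} {R -` B \<inter> space M | B. B \<in> sets borel}"
    unfolding indep_set_def
  proof (rule indep_sets_mono_sets[OF ind[unfolded indep_set_def]])
    fix i :: bool
    have "k -` B \<inter> space M \<in> sets (F s)" if "B \<in> sets borel" for B
      using measurable_sets[OF k(1) that] space_F[OF s] by simp
    then show "case_bool {k -` B \<inter> space M | B. B \<in> sets borel} {R -` B \<inter> space M | B. B \<in> sets borel} i
        \<subseteq> case_bool (sets (F s)) G i"
      using R(2) by (cases i) auto
  qed
  show "indep_var borel k borel R"
    unfolding indep_var_eq gen by (intro conjI i R(1) measurable_F[OF s k(1)])
qed (rule k(2) R(3))+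

locale brownian = filtered_prob_space M F T for M :: "'w measure" and F T +
  fixes W
  assumes W: "brownian_motion M F T W" and T_nonneg: "0 \<le> T"
begin

lemma W_adapted: "t \<in> {0..T} \<Longrightarrow> W t \<in> borel_measurable (F t)"
  using W by (simp add: brownian_motion_def adapted_def)

lemma W_measurable: "t \<in> {0..T} \<Longrightarrow> W t \<in> borel_measurable M"
  using W_adapted measurable_F by blast

text \<open>Beyond the martingale property and the bracket, the fourth moment is recorded because it
  is quadratic in the length of the interval: its sum over a partition tends to 0 with the mesh,
  which drives the orthogonality of \<open>W\<close> and the jump counts.\<close>

lemma W_moments:
  assumes "0 \<le> s" "s < t" "t \<le> T"
  shows "integrable M (\<lambda>\<omega>. W t \<omega> - W s \<omega>)" "(\<integral>\<omega>. W t \<omega> - W s \<omega> \<partial>M) = 0"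
    "integrable M (\<lambda>\<omega>. (W t \<omega> - W s \<omega>)\<^sup>2)" "(\<integral>\<omega>. (W t \<omega> - W s \<omega>)\<^sup>2 \<partial>M) = t - s"
    "integrable M (\<lambda>\<omega>. (W t \<omega> - W s \<omega>) ^ 4)" "(\<integral>\<omega>. (W t \<omega> - W s \<omega>) ^ 4 \<partial>M) = 3 * (t - s)\<^sup>2"
proof -
  define \<sigma> where "\<sigma> = sqrt (t - s)"
  have \<sigma>: "0 < \<sigma>" "\<sigma>\<^sup>2 = t - s" using assms by (auto simp: \<sigma>_def)
  have d: "distributed M lborel (\<lambda>\<omega>. W t \<omega> - W s \<omega>) (normal_density 0 \<sigma>)"
    using W assms by (auto simp: brownian_motion_def \<sigma>_def)
  note i = distributed_integrable[OF d] and e = distributed_integral[OF d]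
  have *: "integrable M (\<lambda>\<omega>. (W t \<omega> - W s \<omega>) ^ k)" for k
    using i[of "\<lambda>x. x ^ k"] integrable_normal_moment[OF \<sigma>(1), of 0 k] by simp
  show "integrable M (\<lambda>\<omega>. W t \<omega> - W s \<omega>)" using *[of 1] by simp
  show "integrable M (\<lambda>\<omega>. (W t \<omega> - W s \<omega>)\<^sup>2)" "integrable M (\<lambda>\<omega>. (W t \<omega> - W s \<omega>) ^ 4)" by (rule *)+
  show "(\<integral>\<omega>. W t \<omega> - W s \<omega> \<partial>M) = 0"
    using e[of "\<lambda>x. x"] integral_normal_moment_odd[OF \<sigma>(1), of 0 0] by simp
  show "(\<integral>\<omega>. (W t \<omega> - W s \<omega>)\<^sup>2 \<partial>M) = t - s"
    using e[of "\<lambda>x. x\<^sup>2"] integral_normal_moment_even[OF \<sigma>(1), of 0 1] \<sigma> by (simp add: fact_numeral)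
  show "(\<integral>\<omega>. (W t \<omega> - W s \<omega>) ^ 4 \<partial>M) = 3 * (t - s)\<^sup>2"
    using e[of "\<lambda>x. x ^ 4"] integral_normal_moment_even[OF \<sigma>(1), of 0 2] \<sigma>
    by (simp add: fact_numeral power_divide)
qed

lemma W_indep:
  assumes t: "0 \<le> s" "s < t" "t \<le> T" and k: "k \<in> borel_measurable (F s)" "integrable M k"
    and g: "g \<in> borel_measurable borel" "integrable M (\<lambda>\<omega>. g (W t \<omega> - W s \<omega>) :: real)"
  shows "(\<integral>\<omega>. k \<omega> * g (W t \<omega> - W s \<omega>) \<partial>M) = (\<integral>\<omega>. k \<omega> \<partial>M) * (\<integral>\<omega>. g (W t \<omega> - W s \<omega>) \<partial>M)"
proof (rule indep_F_integral[OF _ _ _ _ g(2) k])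
  show "indep_set (sets (F s)) (sets (vimage_algebra (space M) (\<lambda>\<omega>. W t \<omega> - W s \<omega>) borel))"
    using W t by (auto simp: brownian_motion_def)
  fix B :: "real set" assume "B \<in> sets borel"
  then have "g -` B \<in> sets borel" using measurable_sets[OF g(1)] by force
  then have "(\<lambda>\<omega>. W t \<omega> - W s \<omega>) -` (g -` B) \<inter> space M \<in> sets (vimage_algebra (space M) (\<lambda>\<omega>. W t \<omega> - W s \<omega>) borel)"
    by (rule in_vimage_algebra)
  moreover have "(\<lambda>\<omega>. g (W t \<omega> - W s \<omega>)) -` B = (\<lambda>\<omega>. W t \<omega> - W s \<omega>) -` (g -` B)" by auto
  ultimately show "(\<lambda>\<omega>. g (W t \<omega> - W s \<omega>)) -` B \<inter> space M \<in> sets (vimage_algebra (space M) (\<lambda>\<omega>. W t \<omega> - W s \<omega>) borel)"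
    by (simp only:)
qed (use t g in auto)

lemma W_martingale:
  assumes t: "0 \<le> a" "a \<le> b" "b \<le> T" and k: "k \<in> borel_measurable (F a)" "bounded (k ` space M)"
  shows "(\<integral>\<omega>. k \<omega> * (W b \<omega> - W a \<omega>) \<partial>M) = 0"
proof (cases "a = b")
  case False
  have "integrable M k" by (rule integrable_of_bounded[OF measurable_F[OF _ k(1)] k(2)]) (use t in auto)
  with False show ?thesis using W_indep[of a b k "\<lambda>x. x"] t k W_moments[of a b] by simp
qed simp

lemma W_bracket:
  assumes t: "0 \<le> a" "a \<le> b" "b \<le> T" and k: "k \<in> borel_measurable (F a)" "bounded (k ` space M)"
  shows "(\<integral>\<omega>. k \<omega> * ((W b \<omega> - W a \<omega>) * (W b \<omega> - W a \<omega>)) \<partial>M) = (\<integral>\<omega>. k \<omega> \<partial>M) * (b - a)"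
proof (cases "a = b")
  case False
  have "integrable M k" by (rule integrable_of_bounded[OF measurable_F[OF _ k(1)] k(2)]) (use t in auto)
  with False show ?thesis
    using W_indep[of a b k "\<lambda>x. x\<^sup>2"] t k W_moments[of a b] by (simp add: power2_eq_square)
qed simp

lemma W_square:
  assumes "t \<in> {0..T}"
  shows "integrable M (\<lambda>\<omega>. (W t \<omega>)\<^sup>2)"
proof -
  have z: "AE \<omega> in M. W 0 \<omega> = 0" using W by (simp add: brownian_motion_def)
  have m: "W t \<in> borel_measurable M" using W_measurable assms by simp
  show ?thesis
  proof (cases "t = 0")
    case True
    have "integrable M (\<lambda>\<omega>. (W t \<omega>)\<^sup>2) = integrable M (\<lambda>\<omega>. 0 :: real)"
      using z m by (intro integrable_cong_AE) (auto simp: True)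
    then show ?thesis by simp
  next
    case False
    have "integrable M (\<lambda>\<omega>. (W t \<omega>)\<^sup>2) = integrable M (\<lambda>\<omega>. (W t \<omega> - W 0 \<omega>)\<^sup>2)"
      using z m W_measurable[of 0] assms by (intro integrable_cong_AE) auto
    then show ?thesis using W_moments(3)[of 0 t] False assms by simp
  qed
qed

end

section \<open>Compensated jump counts and their brackets\<close>

lemma interval_times_mark_space:
  assumes "0 \<le> a" "b \<le> T" "A \<in> sets R0"
  shows "{a<..b} \<times> A \<in> sets (mark_space T)"
  unfolding mark_space_def
proof (rule pair_measureI)
  have "{a<..b} = {a<..b} \<inter> {0..T}" using assms by auto
  then show "{a<..b} \<in> sets (restrict_space borel {0..T})"
    unfolding sets_restrict_space by (metis greaterThanAtMost_borel image_eqI inf_commute)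
qed (rule assms)

lemma measure_interval_times_add:
  assumes S: "sets \<mu>\<^sub>\<omega> = sets (mark_space T)" and A: "A \<in> sets R0" and t: "0 \<le> a" "a \<le> b" "b \<le> c" "c \<le> T"
    and fin: "emeasure \<mu>\<^sub>\<omega> ({0<..T} \<times> A) < \<infinity>"
  shows "measure \<mu>\<^sub>\<omega> ({a<..c} \<times> A) = measure \<mu>\<^sub>\<omega> ({a<..b} \<times> A) + measure \<mu>\<^sub>\<omega> ({b<..c} \<times> A)"
proof -
  have S: "{u<..v} \<times> A \<in> sets \<mu>\<^sub>\<omega>" if "0 \<le> u" "v \<le> T" for u v
    using interval_times_mark_space[of u v T A] that A S by auto
  \<comment> \<open>Finiteness matters because \<open>measure\<close> sends an infinite value to 0
    and is additive only on sets of finite measure. This is why the identities between counts below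
    hold almost surely and not everywhere.\<close>
  have f: "emeasure \<mu>\<^sub>\<omega> ({u<..v} \<times> A) \<noteq> \<infinity>" if "0 \<le> u" "v \<le> T" for u v
    using emeasure_mono[OF _ S[of 0 T], of "{u<..v} \<times> A"] that fin t by (fastforce simp: top_unique)
  have "{a<..c} \<times> A = {a<..b} \<times> A \<union> {b<..c} \<times> A" "({a<..b} \<times> A) \<inter> ({b<..c} \<times> A) = {}" using t by auto
  then show ?thesis using measure_Union[OF f f S S, of a b b c] t by auto
qed

text \<open>The first two conditional moments of the number of points in \<open>(a, b] \<times> A\<close> are those of a Poisson
  variable, with deterministic mean.\<close>

locale jump_moments = filtered_prob_space M F T for M :: "'w measure" and F T +
  fixes \<nu> :: "real measure" and \<mu> :: "'w \<Rightarrow> (real \<times> real) measure" and \<Lambda> :: "real \<Rightarrow> real"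
  assumes \<nu>_sets: "sets \<nu> = sets R0"
    and \<mu>: "random_measure M F T \<mu>"
    and \<Lambda>_int: "set_integrable lborel {0..T} \<Lambda>" and \<Lambda>_nonneg: "\<And>r. r \<in> {0..T} \<Longrightarrow> 0 \<le> \<Lambda> r"
    and \<mu>_finite: "\<And>A. A \<in> sets \<nu> \<Longrightarrow> emeasure \<nu> A < \<infinity> \<Longrightarrow> AE \<omega> in M. emeasure (\<mu> \<omega>) ({0<..T} \<times> A) < \<infinity>"
    and count_square: "\<And>A a b. A \<in> sets \<nu> \<Longrightarrow> emeasure \<nu> A < \<infinity> \<Longrightarrow> 0 \<le> a \<Longrightarrow> a \<le> b \<Longrightarrow> b \<le> T \<Longrightarrow>
       integrable M (\<lambda>\<omega>. (measure (\<mu> \<omega>) ({a<..b} \<times> A))\<^sup>2)"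
    and count_moment1: "\<And>A a b k. A \<in> sets \<nu> \<Longrightarrow> emeasure \<nu> A < \<infinity> \<Longrightarrow> 0 \<le> a \<Longrightarrow> a \<le> b \<Longrightarrow> b \<le> T \<Longrightarrow>
       k \<in> borel_measurable (F a) \<Longrightarrow> bounded (k ` space M) \<Longrightarrow>
       (\<integral>\<omega>. k \<omega> * measure (\<mu> \<omega>) ({a<..b} \<times> A) \<partial>M) = (\<integral>\<omega>. k \<omega> \<partial>M) * ((LBINT r:{a<..b}. \<Lambda> r) * measure \<nu> A)"
    and count_moment2: "\<And>A a b k. A \<in> sets \<nu> \<Longrightarrow> emeasure \<nu> A < \<infinity> \<Longrightarrow> 0 \<le> a \<Longrightarrow> a \<le> b \<Longrightarrow> b \<le> T \<Longrightarrow>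
       k \<in> borel_measurable (F a) \<Longrightarrow> bounded (k ` space M) \<Longrightarrow>
       (\<integral>\<omega>. k \<omega> * (measure (\<mu> \<omega>) ({a<..b} \<times> A))\<^sup>2 \<partial>M) =
       (\<integral>\<omega>. k \<omega> \<partial>M) * ((LBINT r:{a<..b}. \<Lambda> r) * measure \<nu> A + ((LBINT r:{a<..b}. \<Lambda> r) * measure \<nu> A)\<^sup>2)"
begin

abbreviation count where "count a b A \<omega> \<equiv> measure (\<mu> \<omega>) ({a<..b} \<times> A)"

definition \<Lambda>\<^sub>I where "\<Lambda>\<^sub>I t = (LBINT r:{0<..t}. \<Lambda> r)"

definition N where "N A t \<omega> = count 0 t A \<omega> - \<Lambda>\<^sub>I t * measure \<nu> A"

lemma \<Lambda>_int_sub: "0 \<le> a \<Longrightarrow> b \<le> T \<Longrightarrow> set_integrable lborel {a<..b} \<Lambda>"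
  by (rule set_integrable_subset[OF \<Lambda>_int]) auto

lemma \<Lambda>\<^sub>I_diff:
  assumes "0 \<le> a" "a \<le> b" "b \<le> T"
  shows "(LBINT r:{a<..b}. \<Lambda> r) = \<Lambda>\<^sub>I b - \<Lambda>\<^sub>I a"
proof -
  have "{0<..b} = {0<..a} \<union> {a<..b}" using assms by auto
  then have "\<Lambda>\<^sub>I b = \<Lambda>\<^sub>I a + (LBINT r:{a<..b}. \<Lambda> r)"
    unfolding \<Lambda>\<^sub>I_def using assms by (simp add: set_integral_Un \<Lambda>_int_sub)
  then show ?thesis by simp
qed

lemma \<Lambda>_integral_nonneg: "0 \<le> a \<Longrightarrow> b \<le> T \<Longrightarrow> 0 \<le> (LBINT r:{a<..b}. \<Lambda> r)"
  unfolding set_lebesgue_integral_def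
  by (rule Bochner_Integration.integral_nonneg) (use \<Lambda>_nonneg in \<open>auto simp: indicator_def\<close>)

lemma count_measurable_F:
  assumes A: "A \<in> sets \<nu>" and t: "0 \<le> a" "b \<le> c" "c \<in> {0..T}"
  shows "count a b A \<in> borel_measurable (F c)"
proof -
  have "{a<..b} \<times> A \<in> sets (mark_space T)" using A t by (intro interval_times_mark_space) (auto simp: \<nu>_sets)
  moreover have "{a<..b} \<times> A \<subseteq> {0..c} \<times> UNIV" using t by auto
  ultimately have "(\<lambda>\<omega>. emeasure (\<mu> \<omega>) ({a<..b} \<times> A)) \<in> borel_measurable (F c)"
    using \<mu> t unfolding random_measure_def by blast
  then show ?thesis unfolding measure_def by measurable
qed

lemma count_add_finite:
  assumes A: "A \<in> sets \<nu>" and t: "0 \<le> a" "a \<le> b" "b \<le> c" "c \<le> T" and \<omega>: "\<omega> \<in> space M"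
    and fin: "emeasure (\<mu> \<omega>) ({0<..T} \<times> A) < \<infinity>"
  shows "count a c A \<omega> = count a b A \<omega> + count b c A \<omega>"
  using A \<mu> \<omega> by (intro measure_interval_times_add[OF _ _ t fin]) (auto simp: \<nu>_sets random_measure_def)

lemma count_disjoint_finite:
  assumes A: "A \<in> sets \<nu>" "B \<in> sets \<nu>" "A \<inter> B = {}" and t: "0 \<le> a" "a \<le> b" "b \<le> T" and \<omega>: "\<omega> \<in> space M"
    and fin: "emeasure (\<mu> \<omega>) ({0<..T} \<times> A) < \<infinity>" "emeasure (\<mu> \<omega>) ({0<..T} \<times> B) < \<infinity>"
  shows "count a b (A \<union> B) \<omega> = count a b A \<omega> + count a b B \<omega>"
proof -
  have S: "{u<..v} \<times> C \<in> sets (\<mu> \<omega>)" if "0 \<le> u" "v \<le> T" "C \<in> sets \<nu>" for u v C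
    using interval_times_mark_space[of u v T C] that \<mu> \<omega> by (auto simp: \<nu>_sets random_measure_def)
  have f: "emeasure (\<mu> \<omega>) ({a<..b} \<times> C) \<noteq> \<infinity>" if "C \<in> sets \<nu>" "emeasure (\<mu> \<omega>) ({0<..T} \<times> C) < \<infinity>" for C
    using emeasure_mono[OF _ S[of 0 T C], of "{a<..b} \<times> C"] that t by (fastforce simp: top_unique)
  have "{a<..b} \<times> (A \<union> B) = {a<..b} \<times> A \<union> {a<..b} \<times> B" "({a<..b} \<times> A) \<inter> ({a<..b} \<times> B) = {}" using A by auto
  then show ?thesis using measure_Union[OF f[OF A(1) fin(1)] f[OF A(2) fin(2)] S S] A t by auto
qed

lemma N_diff:
  assumes A: "A \<in> sets \<nu>" "emeasure \<nu> A < \<infinity>" and t: "0 \<le> a" "a \<le> b" "b \<le> T"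
  shows "AE \<omega> in M. N A b \<omega> - N A a \<omega> = count a b A \<omega> - (LBINT r:{a<..b}. \<Lambda> r) * measure \<nu> A"
  using \<mu>_finite[OF A] AE_space
proof eventually_elim
  case (elim \<omega>)
  then show ?case
    using count_add_finite[OF A(1), of 0 a b \<omega>] t by (simp add: N_def \<Lambda>\<^sub>I_diff algebra_simps)
qed

lemma N_measurable_F: "A \<in> sets \<nu> \<Longrightarrow> t \<in> {0..T} \<Longrightarrow> N A t \<in> borel_measurable (F t)"
  unfolding N_def by (intro borel_measurable_diff borel_measurable_const count_measurable_F) auto

lemma count_measurable: "A \<in> sets \<nu> \<Longrightarrow> 0 \<le> a \<Longrightarrow> a \<le> b \<Longrightarrow> b \<le> T \<Longrightarrow> count a b A \<in> borel_measurable M"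
  using measurable_F[OF _ count_measurable_F[of A a b b]] by auto

lemma N_measurable: "A \<in> sets \<nu> \<Longrightarrow> t \<in> {0..T} \<Longrightarrow> N A t \<in> borel_measurable M"
  using measurable_F N_measurable_F by blast

lemma count_integrable:
  "A \<in> sets \<nu> \<Longrightarrow> emeasure \<nu> A < \<infinity> \<Longrightarrow> 0 \<le> a \<Longrightarrow> a \<le> b \<Longrightarrow> b \<le> T \<Longrightarrow> integrable M (count a b A)"
  by (rule integrable_of_square[OF count_measurable count_square])

lemma N_square:
  assumes "A \<in> sets \<nu>" "emeasure \<nu> A < \<infinity>" "t \<in> {0..T}"
  shows "integrable M (\<lambda>\<omega>. (N A t \<omega>)\<^sup>2)"
  unfolding N_def using assms by (intro integrable_square_diff count_square count_measurable) auto

lemma N_martingale: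
  assumes A: "A \<in> sets \<nu>" "emeasure \<nu> A < \<infinity>" and t: "0 \<le> a" "a \<le> b" "b \<le> T"
    and k: "k \<in> borel_measurable (F a)" "bounded (k ` space M)"
  shows "(\<integral>\<omega>. k \<omega> * (N A b \<omega> - N A a \<omega>) \<partial>M) = 0"
proof -
  have kM: "k \<in> borel_measurable M" by (rule measurable_F[OF _ k(1)]) (use t in auto)
  have "(\<integral>\<omega>. k \<omega> * (N A b \<omega> - N A a \<omega>) \<partial>M)
      = (\<integral>\<omega>. k \<omega> * count a b A \<omega> - k \<omega> * ((LBINT r:{a<..b}. \<Lambda> r) * measure \<nu> A) \<partial>M)"
  proof (rule integral_cong_AE)
    show "AE \<omega> in M. k \<omega> * (N A b \<omega> - N A a \<omega>) =
        k \<omega> * count a b A \<omega> - k \<omega> * ((LBINT r:{a<..b}. \<Lambda> r) * measure \<nu> A)"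
      using N_diff[OF A t] by eventually_elim (simp add: right_diff_distrib)
  qed (use kM N_measurable[OF A(1), of a] N_measurable[OF A(1), of b] count_measurable[OF A(1) t] t in simp_all)
  also have "\<dots> = (\<integral>\<omega>. k \<omega> * count a b A \<omega> \<partial>M) - (\<integral>\<omega>. k \<omega> * ((LBINT r:{a<..b}. \<Lambda> r) * measure \<nu> A) \<partial>M)"
    by (intro Bochner_Integration.integral_diff integrable_bounded_mult[OF kM k(2)] count_integrable A t) simp
  also have "\<dots> = 0" using count_moment1[OF A t k] by simp
  finally show ?thesis .
qed

text \<open>With \<open>L\<close> the mean of the count, expanding the square gives (L + L^2) - 2 L
  L + L^2 = L: variance and mean agree, as for a Poisson variable.\<close>

lemma N_bracket_same:
  assumes A: "A \<in> sets \<nu>" "emeasure \<nu> A < \<infinity>" and t: "0 \<le> a" "a \<le> b" "b \<le> T"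
    and k: "k \<in> borel_measurable (F a)" "bounded (k ` space M)"
  shows "(\<integral>\<omega>. k \<omega> * (N A b \<omega> - N A a \<omega>)\<^sup>2 \<partial>M) = (\<integral>\<omega>. k \<omega> \<partial>M) * ((\<Lambda>\<^sub>I b - \<Lambda>\<^sub>I a) * measure \<nu> A)"
proof -
  define L where "L = (LBINT r:{a<..b}. \<Lambda> r) * measure \<nu> A"
  have kM: "k \<in> borel_measurable M" by (rule measurable_F[OF _ k(1)]) (use t in auto)
  have "(\<integral>\<omega>. k \<omega> * (N A b \<omega> - N A a \<omega>)\<^sup>2 \<partial>M)
      = (\<integral>\<omega>. k \<omega> * (count a b A \<omega>)\<^sup>2 - 2 * L * (k \<omega> * count a b A \<omega>) + k \<omega> * L\<^sup>2 \<partial>M)"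
  proof (rule integral_cong_AE)
    show "AE \<omega> in M. k \<omega> * (N A b \<omega> - N A a \<omega>)\<^sup>2 =
        k \<omega> * (count a b A \<omega>)\<^sup>2 - 2 * L * (k \<omega> * count a b A \<omega>) + k \<omega> * L\<^sup>2"
      using N_diff[OF A t] unfolding L_def[symmetric]
    proof eventually_elim
      case (elim \<omega>)
      show ?case unfolding elim by (simp add: power2_diff algebra_simps)
    qed
  qed (use kM N_measurable[OF A(1), of a] N_measurable[OF A(1), of b] count_measurable[OF A(1) t] t in simp_all)
  also have "\<dots> = (\<integral>\<omega>. k \<omega> * (count a b A \<omega>)\<^sup>2 \<partial>M) - 2 * L * (\<integral>\<omega>. k \<omega> * count a b A \<omega> \<partial>M) + (\<integral>\<omega>. k \<omega> \<partial>M) * L\<^sup>2"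
    using integrable_bounded_mult[OF kM k(2) count_integrable[OF A t]]
      integrable_bounded_mult[OF kM k(2) count_square[OF A t]] integrable_bounded_mult[OF kM k(2), of "\<lambda>_. L\<^sup>2"]
    by simp
  also have "\<dots> = (\<integral>\<omega>. k \<omega> \<partial>M) * L"
    using count_moment1[OF A t k] count_moment2[OF A t k] unfolding L_def[symmetric]
    by (simp add: power2_eq_square algebra_simps)
  finally show ?thesis by (simp add: L_def \<Lambda>\<^sub>I_diff[OF t])
qed

lemma N_disjoint:
  assumes A: "A \<in> sets \<nu>" "emeasure \<nu> A < \<infinity>" "B \<in> sets \<nu>" "emeasure \<nu> B < \<infinity>" "A \<inter> B = {}"
    and t: "0 \<le> t" "t \<le> T"
  shows "AE \<omega> in M. N (A \<union> B) t \<omega> = N A t \<omega> + N B t \<omega>"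
  using \<mu>_finite[OF A(1,2)] \<mu>_finite[OF A(3,4)] AE_space
proof eventually_elim
  case (elim \<omega>)
  have "measure \<nu> (A \<union> B) = measure \<nu> A + measure \<nu> B"
    using A by (intro measure_Union) auto
  then show ?case
    using count_disjoint_finite[OF A(1,3,5), of 0 t \<omega>] t elim by (simp add: N_def algebra_simps)
qed

lemma N_mult_integrable:
  assumes A: "A \<in> sets \<nu>" "emeasure \<nu> A < \<infinity>" "B \<in> sets \<nu>" "emeasure \<nu> B < \<infinity>"
    and t: "a \<in> {0..T}" "b \<in> {0..T}" and k: "k \<in> borel_measurable M" "bounded (k ` space M)"
  shows "integrable M (\<lambda>\<omega>. k \<omega> * ((N A b \<omega> - N A a \<omega>) * (N B b \<omega> - N B a \<omega>)))"
proof -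
  have m: "(\<lambda>\<omega>. N X b \<omega> - N X a \<omega>) \<in> borel_measurable M" "integrable M (\<lambda>\<omega>. (N X b \<omega> - N X a \<omega>)\<^sup>2)"
    if "X \<in> sets \<nu>" "emeasure \<nu> X < \<infinity>" for X
    using integrable_square_diff[OF N_measurable N_measurable N_square N_square, OF that(1) t(2) that(1) t(1) that t(2) that t(1)]
      borel_measurable_diff[OF N_measurable N_measurable, OF that(1) t(2) that(1) t(1)] by simp_all
  show ?thesis
    by (rule integrable_bounded_mult[OF k integrable_mult_L2[OF m(1) m(1) m(2) m(2)]]) (rule A)+
qed

text \<open>Polarisation. The compensated count of the union is the sum of the two, and
  \<open>\<nu>\<close> is additive, so the brackets of \<open>A\<close>, \<open>B\<close> and
  \<open>A \<union> B\<close> leave nothing for the cross term. Orthogonality over disjoint mark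
  sets thus follows from the moments of single sets.\<close>

lemma N_bracket_disjoint:
  assumes A: "A \<in> sets \<nu>" "emeasure \<nu> A < \<infinity>" "B \<in> sets \<nu>" "emeasure \<nu> B < \<infinity>" "A \<inter> B = {}"
    and t: "0 \<le> a" "a \<le> b" "b \<le> T" and k: "k \<in> borel_measurable (F a)" "bounded (k ` space M)"
  shows "(\<integral>\<omega>. k \<omega> * ((N A b \<omega> - N A a \<omega>) * (N B b \<omega> - N B a \<omega>)) \<partial>M) = 0"
proof -
  have kM: "k \<in> borel_measurable M" by (rule measurable_F[OF _ k(1)]) (use t in auto)
  have AB: "A \<union> B \<in> sets \<nu>" "emeasure \<nu> (A \<union> B) < \<infinity>"
    using A by (auto simp: plus_emeasure[symmetric])
  have m: "measure \<nu> (A \<union> B) = measure \<nu> A + measure \<nu> B"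
    using A by (intro measure_Union) auto
  have ta: "a \<in> {0..T}" "b \<in> {0..T}" using t by auto
  note I = N_mult_integrable[OF _ _ _ _ ta kM k(2)]
  have "(\<integral>\<omega>. k \<omega> * (N (A \<union> B) b \<omega> - N (A \<union> B) a \<omega>)\<^sup>2 \<partial>M) =
     (\<integral>\<omega>. k \<omega> * (N A b \<omega> - N A a \<omega>)\<^sup>2 + k \<omega> * (N B b \<omega> - N B a \<omega>)\<^sup>2 + 2 * (k \<omega> * ((N A b \<omega> - N A a \<omega>) * (N B b \<omega> - N B a \<omega>))) \<partial>M)"
  proof (rule integral_cong_AE)
    show "AE \<omega> in M. k \<omega> * (N (A \<union> B) b \<omega> - N (A \<union> B) a \<omega>)\<^sup>2 =
      k \<omega> * (N A b \<omega> - N A a \<omega>)\<^sup>2 + k \<omega> * (N B b \<omega> - N B a \<omega>)\<^sup>2 + 2 * (k \<omega> * ((N A b \<omega> - N A a \<omega>) * (N B b \<omega> - N B a \<omega>)))"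
      using N_disjoint[OF A t(1) order_trans[OF t(2,3)]] N_disjoint[OF A order_trans[OF t(1,2)] t(3)]
      by eventually_elim (simp add: power2_eq_square algebra_simps)
  qed (intro borel_measurable_add borel_measurable_times borel_measurable_diff borel_measurable_power
      borel_measurable_const kM N_measurable AB(1) A(1,3) ta)+
  also have "\<dots> = (\<integral>\<omega>. k \<omega> * (N A b \<omega> - N A a \<omega>)\<^sup>2 \<partial>M) + (\<integral>\<omega>. k \<omega> * (N B b \<omega> - N B a \<omega>)\<^sup>2 \<partial>M)
     + 2 * (\<integral>\<omega>. k \<omega> * ((N A b \<omega> - N A a \<omega>) * (N B b \<omega> - N B a \<omega>)) \<partial>M)"
  proof -
    note i = I[OF A(1,2,1,2)] I[OF A(3,4,3,4)] I[OF A(1-4)]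
    note i12 = Bochner_Integration.integrable_add[OF i(1,2)]
    show ?thesis
      unfolding power2_eq_square Bochner_Integration.integral_add[OF i12 integrable_mult_right[OF i(3)]]
        Bochner_Integration.integral_add[OF i(1,2)] Bochner_Integration.integral_mult_right_zero by (rule refl)
  qed
  finally have "(\<integral>\<omega>. k \<omega> * ((N A b \<omega> - N A a \<omega>) * (N B b \<omega> - N B a \<omega>)) \<partial>M) * 2 =
      (\<integral>\<omega>. k \<omega> \<partial>M) * ((\<Lambda>\<^sub>I b - \<Lambda>\<^sub>I a) * (measure \<nu> (A \<union> B) - measure \<nu> A - measure \<nu> B))"
    unfolding N_bracket_same[OF AB t k] N_bracket_same[OF A(1,2) t k] N_bracket_same[OF A(3,4) t k]
    by (simp add: algebra_simps)
  then show ?thesis by (simp add: m)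
qed

text \<open>Split both sets into their common part \<open>C\<close> and the differences
  \<open>D\<close>, \<open>E\<close>. Of the four resulting products, three pair disjoint sets and
  vanish.\<close>

lemma N_bracket:
  assumes A: "A \<in> sets \<nu>" "emeasure \<nu> A < \<infinity>" "B \<in> sets \<nu>" "emeasure \<nu> B < \<infinity>"
    and t: "0 \<le> a" "a \<le> b" "b \<le> T" and k: "k \<in> borel_measurable (F a)" "bounded (k ` space M)"
  shows "(\<integral>\<omega>. k \<omega> * ((N A b \<omega> - N A a \<omega>) * (N B b \<omega> - N B a \<omega>)) \<partial>M) =
     (\<integral>\<omega>. k \<omega> \<partial>M) * ((\<Lambda>\<^sub>I b - \<Lambda>\<^sub>I a) * measure \<nu> (A \<inter> B))"
proof -
  have kM: "k \<in> borel_measurable M" by (rule measurable_F[OF _ k(1)]) (use t in auto)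
  define C D E where "C = A \<inter> B" and "D = A - B" and "E = B - A"
  have fin: "emeasure \<nu> X < \<infinity>" if "X \<subseteq> A \<or> X \<subseteq> B" for X
    using that emeasure_mono[OF _ A(1), of X] emeasure_mono[OF _ A(3), of X] A by (meson le_less_trans)
  have S: "C \<in> sets \<nu>" "D \<in> sets \<nu>" "E \<in> sets \<nu>" "emeasure \<nu> C < \<infinity>" "emeasure \<nu> D < \<infinity>" "emeasure \<nu> E < \<infinity>"
    using A(1,3) by (auto simp: C_def D_def E_def) (auto intro!: fin[simplified])
  have d: "C \<inter> D = {}" "C \<inter> E = {}" "D \<inter> E = {}" "D \<inter> C = {}" and u: "C \<union> D = A" "C \<union> E = B"
    by (auto simp: C_def D_def E_def)
  have ta: "a \<in> {0..T}" "b \<in> {0..T}" using t by auto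
  let ?d = "\<lambda>X \<omega>. N X b \<omega> - N X a \<omega>"
  note I = N_mult_integrable[OF _ _ _ _ ta kM k(2)]
  have "(\<integral>\<omega>. k \<omega> * (?d A \<omega> * ?d B \<omega>) \<partial>M) =
    (\<integral>\<omega>. k \<omega> * (?d C \<omega> * ?d C \<omega>) + k \<omega> * (?d C \<omega> * ?d E \<omega>) + k \<omega> * (?d D \<omega> * ?d C \<omega>) + k \<omega> * (?d D \<omega> * ?d E \<omega>) \<partial>M)"
  proof (rule integral_cong_AE)
    show "AE \<omega> in M. k \<omega> * (?d A \<omega> * ?d B \<omega>) =
      k \<omega> * (?d C \<omega> * ?d C \<omega>) + k \<omega> * (?d C \<omega> * ?d E \<omega>) + k \<omega> * (?d D \<omega> * ?d C \<omega>) + k \<omega> * (?d D \<omega> * ?d E \<omega>)"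
      using N_disjoint[OF S(1,4,2,5) d(1) t(1) order_trans[OF t(2,3)]] N_disjoint[OF S(1,4,2,5) d(1) order_trans[OF t(1,2)] t(3)]
        N_disjoint[OF S(1,4,3,6) d(2) t(1) order_trans[OF t(2,3)]] N_disjoint[OF S(1,4,3,6) d(2) order_trans[OF t(1,2)] t(3)]
      unfolding u by eventually_elim (simp add: algebra_simps)
  qed (intro borel_measurable_add borel_measurable_times borel_measurable_diff kM N_measurable A(1,3) S(1-3) ta)+
  also have "\<dots> = (\<integral>\<omega>. k \<omega> * (?d C \<omega> * ?d C \<omega>) \<partial>M) + (\<integral>\<omega>. k \<omega> * (?d C \<omega> * ?d E \<omega>) \<partial>M)
     + (\<integral>\<omega>. k \<omega> * (?d D \<omega> * ?d C \<omega>) \<partial>M) + (\<integral>\<omega>. k \<omega> * (?d D \<omega> * ?d E \<omega>) \<partial>M)"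
  proof -
    note i = I[OF S(1,4,1,4)] I[OF S(1,4,3,6)] I[OF S(2,5,1,4)] I[OF S(2,5,3,6)]
    note i12 = Bochner_Integration.integrable_add[OF i(1,2)]
    note i123 = Bochner_Integration.integrable_add[OF i12 i(3)]
    show ?thesis
      unfolding Bochner_Integration.integral_add[OF i123 i(4)] Bochner_Integration.integral_add[OF i12 i(3)]
        Bochner_Integration.integral_add[OF i(1,2)] by (rule refl)
  qed
  also have "\<dots> = (\<integral>\<omega>. k \<omega> * (?d C \<omega>)\<^sup>2 \<partial>M)"
    unfolding N_bracket_disjoint[OF S(1,4,3,6) d(2) t k] N_bracket_disjoint[OF S(2,5,1,4) d(4) t k]
      N_bracket_disjoint[OF S(2,5,3,6) d(3) t k] power2_eq_square by simp
  also have "\<dots> = (\<integral>\<omega>. k \<omega> \<partial>M) * ((\<Lambda>\<^sub>I b - \<Lambda>\<^sub>I a) * measure \<nu> C)"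
    by (rule N_bracket_same[OF S(1,4) t k])
  finally show ?thesis by (simp add: C_def)
qed

end

text \<open>In a product of increments over two different cells, the later increment is orthogonal
  to the earlier one, so only products over the same cell survive. No bracket is assumed here,
  because the identity serves to compute one.\<close>

lemma (in martingales) bracket_partition:
  assumes i: "i \<in> J" and j: "j \<in> J" and t: "0 \<le> t 0" "\<And>m. m < n \<Longrightarrow> t m \<le> t (Suc m)" "t n \<le> T"
    and k: "k \<in> borel_measurable (F (t 0))" "bounded (k ` space M)"
  shows "(\<integral>\<omega>. k \<omega> * ((N i (t n) \<omega> - N i (t 0) \<omega>) * (N j (t n) \<omega> - N j (t 0) \<omega>)) \<partial>M)
    = (\<Sum>m<n. \<integral>\<omega>. k \<omega> * ((N i (t (Suc m)) \<omega> - N i (t m) \<omega>) * (N j (t (Suc m)) \<omega> - N j (t m) \<omega>)) \<partial>M)"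
  using t
proof (induction n)
  case (Suc n)
  have mono: "t 0 \<le> t n"
    using Suc.prems(2) by (induction n) (auto intro: order_trans)
  have tn: "t n \<le> t (Suc n)" using Suc.prems by simp
  have kM: "k \<in> borel_measurable M" by (rule measurable_F[OF _ k(1)]) (use mono tn Suc.prems(1,3) in auto)
  have kn: "k \<in> borel_measurable (F (t n))" by (rule measurable_F_mono[OF _ _ _ k(1)]) (use mono tn Suc.prems(1,3) in auto)
  have tt: "t 0 \<in> {0..T}" "t n \<in> {0..T}" "t (Suc n) \<in> {0..T}" using mono tn Suc.prems(1,3) by auto
  let ?x = "\<lambda>i \<omega>. N i (t n) \<omega> - N i (t 0) \<omega>" and ?y = "\<lambda>i \<omega>. N i (t (Suc n)) \<omega> - N i (t n) \<omega>"
  have I: "integrable M (\<lambda>\<omega>. k \<omega> * (?x i \<omega> * ?x j \<omega>))" "integrable M (\<lambda>\<omega>. k \<omega> * (?x i \<omega> * ?y j \<omega>))"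
    "integrable M (\<lambda>\<omega>. k \<omega> * (?x j \<omega> * ?y i \<omega>))" "integrable M (\<lambda>\<omega>. k \<omega> * (?y i \<omega> * ?y j \<omega>))"
    by (rule N_mult_integrable[OF _ _ _ _ _ _ kM k(2)]; (rule i j tt))+
  have "(\<integral>\<omega>. k \<omega> * ((N i (t (Suc n)) \<omega> - N i (t 0) \<omega>) * (N j (t (Suc n)) \<omega> - N j (t 0) \<omega>)) \<partial>M)
     = (\<integral>\<omega>. k \<omega> * (?x i \<omega> * ?x j \<omega>) + k \<omega> * (?x i \<omega> * ?y j \<omega>) + k \<omega> * (?x j \<omega> * ?y i \<omega>) + k \<omega> * (?y i \<omega> * ?y j \<omega>) \<partial>M)"
    by (simp add: algebra_simps)
  also have "\<dots> = (\<integral>\<omega>. k \<omega> * (?x i \<omega> * ?x j \<omega>) \<partial>M) + (\<integral>\<omega>. k \<omega> * (?x i \<omega> * ?y j \<omega>) \<partial>M)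
     + (\<integral>\<omega>. k \<omega> * (?x j \<omega> * ?y i \<omega>) \<partial>M) + (\<integral>\<omega>. k \<omega> * (?y i \<omega> * ?y j \<omega>) \<partial>M)"
  proof -
    note i12 = Bochner_Integration.integrable_add[OF I(1,2)]
    note i123 = Bochner_Integration.integrable_add[OF i12 I(3)]
    show ?thesis
      unfolding Bochner_Integration.integral_add[OF i123 I(4)] Bochner_Integration.integral_add[OF i12 I(3)]
        Bochner_Integration.integral_add[OF I(1,2)] by (rule refl)
  qed
  also have "(\<integral>\<omega>. k \<omega> * (?x i \<omega> * ?y j \<omega>) \<partial>M) = 0"
    by (rule N_orthogonal_consecutive[OF i j _ _ _ _ _ kn k(2)]) (use mono tn Suc.prems(1,3) in auto)
  also have "(\<integral>\<omega>. k \<omega> * (?x j \<omega> * ?y i \<omega>) \<partial>M) = 0"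
    by (rule N_orthogonal_consecutive[OF j i _ _ _ _ _ kn k(2)]) (use mono tn Suc.prems(1,3) in auto)
  finally show ?case using Suc.IH Suc.prems tn by simp
qed simp

text \<open>The order of the limits matters: first \<open>n\<close> tends to infinity for fixed
  \<open>\<epsilon>\<close>, then \<open>\<epsilon>\<close> tends to 0.\<close>

lemma le_zero_by_parameters:
  fixes y \<alpha> \<beta> :: real
  assumes "0 \<le> \<alpha>" and le: "\<And>n \<epsilon>. \<epsilon> > 0 \<Longrightarrow> y \<le> \<alpha> * \<epsilon> + \<beta> / (real (Suc n) * \<epsilon> ^ 3)"
  shows "y \<le> 0"
proof -
  have e: "y \<le> \<alpha> * \<epsilon>" if "\<epsilon> > 0" for \<epsilon>
  proof (rule LIMSEQ_le_const)
    have "(\<lambda>n. \<alpha> * \<epsilon> + \<beta> / \<epsilon> ^ 3 * inverse (real (Suc n))) \<longlonglongrightarrow> \<alpha> * \<epsilon> + \<beta> / \<epsilon> ^ 3 * 0"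
      by (intro tendsto_intros LIMSEQ_inverse_real_of_nat)
    then show "(\<lambda>n. \<alpha> * \<epsilon> + \<beta> / (real (Suc n) * \<epsilon> ^ 3)) \<longlonglongrightarrow> \<alpha> * \<epsilon>"
      by (simp add: field_simps)
    show "\<exists>N. \<forall>n\<ge>N. y \<le> \<alpha> * \<epsilon> + \<beta> / (real (Suc n) * \<epsilon> ^ 3)" using le[OF that] by blast
  qed
  show ?thesis
  proof (rule field_le_epsilon)
    fix e :: real assume "e > 0"
    then have "y \<le> \<alpha> * (e / (\<alpha> + 1))" using assms by (intro e) auto
    also have "\<dots> \<le> e" using assms \<open>e > 0\<close> by (simp add: field_simps)
    finally show "y \<le> 0 + e" by simp
  qed
qed

text \<open>The Brownian increments \<open>x m\<close> over a fine partition have small fourth powers, whereas the total variation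
  of the increments \<open>d m\<close> of the compensated jump count is square-integrable: hence the two are orthogonal.\<close>

lemma sum_mult_le_fourth_powers:
  fixes x v :: "nat \<Rightarrow> real"
  assumes v: "\<And>m. m < n \<Longrightarrow> \<bar>d m\<bar> \<le> v m" and \<epsilon>: "\<epsilon> > 0"
  shows "\<bar>\<Sum>m<n. x m * d m\<bar> \<le> \<epsilon> * ((\<Sum>m<n. v m)\<^sup>2 + 1) + (\<Sum>m<n. x m ^ 4) / \<epsilon> ^ 3"
proof -
  define S where "S = (\<Sum>m<n. x m ^ 4)"
  define V where "V = (\<Sum>m<n. v m)"
  \<comment> \<open>The fourth root of the sum of fourth powers, hence a bound for every single
    \<open>\<bar>x m\<bar>\<close>.\<close>
  define q where "q = sqrt (sqrt S)"
  have S0: "0 \<le> S" unfolding S_def by (intro sum_nonneg) simp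
  have v0: "0 \<le> v m" if "m < n" for m using v[OF that] by linarith
  have xq: "\<bar>x m\<bar> \<le> q" if "m < n" for m
  proof -
    have "x m ^ 4 \<le> S" unfolding S_def using that by (intro member_le_sum) auto
    then have "sqrt (sqrt (x m ^ 4)) \<le> q" unfolding q_def by simp
    moreover have "sqrt (sqrt (x m ^ 4)) = \<bar>x m\<bar>"
    proof -
      have "x m ^ 4 = ((x m)\<^sup>2)\<^sup>2" by (simp flip: power_mult)
      also have "sqrt \<dots> = (x m)\<^sup>2" by (rule real_sqrt_unique) auto
      finally show ?thesis by simp
    qed
    ultimately show ?thesis by simp
  qed
  have "\<bar>\<Sum>m<n. x m * d m\<bar> \<le> (\<Sum>m<n. \<bar>x m * d m\<bar>)" by (rule sum_abs)
  also have "\<dots> \<le> (\<Sum>m<n. q * v m)"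
    unfolding abs_mult by (intro sum_mono mult_mono xq v) (auto simp: q_def S0)
  also have "\<dots> = q * V" by (simp add: V_def sum_distrib_left)
  \<comment> \<open>Young's inequality is used twice, here and for
    \<open>sqrt S / \<epsilon>\<close> below, until only \<open>V\<close> squared and
    \<open>S\<close> itself are left: unlike roots of \<open>S\<close>, these have directly
    computable expectations.\<close>
  also have "\<dots> \<le> \<epsilon> * V\<^sup>2 + sqrt S / \<epsilon>"
  proof -
    have "q\<^sup>2 = sqrt S" unfolding q_def using S0 by simp
    moreover have "0 \<le> (\<epsilon> * V - q / 2)\<^sup>2" by simp
    ultimately have "\<epsilon> * V * q \<le> \<epsilon>\<^sup>2 * V\<^sup>2 + sqrt S / 4"
      by (simp add: power2_eq_square algebra_simps)
    also have "\<dots> \<le> \<epsilon>\<^sup>2 * V\<^sup>2 + sqrt S" using S0 by simp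
    finally have "\<epsilon> * (q * V) \<le> \<epsilon> * (\<epsilon> * V\<^sup>2 + sqrt S / \<epsilon>)"
      using \<epsilon> by (simp add: power2_eq_square algebra_simps)
    then show ?thesis using \<epsilon> by simp
  qed
  also have "sqrt S / \<epsilon> \<le> \<epsilon> + S / \<epsilon> ^ 3"
  proof -
    have "0 \<le> (\<epsilon>\<^sup>2 - sqrt S / 2)\<^sup>2" by simp
    then have "\<epsilon>\<^sup>2 * sqrt S \<le> \<epsilon> ^ 4 + (sqrt S)\<^sup>2 / 4"
      by (simp add: power2_eq_square power4_eq_xxxx algebra_simps)
    then have "\<epsilon>\<^sup>2 * sqrt S \<le> \<epsilon> ^ 4 + S" using S0 by simp
    then have "\<epsilon>\<^sup>2 * sqrt S / \<epsilon> ^ 3 \<le> (\<epsilon> ^ 4 + S) / \<epsilon> ^ 3" using \<epsilon> by (intro divide_right_mono) auto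
    then show ?thesis using \<epsilon> by (simp add: add_divide_distrib power2_eq_square power3_eq_cube power4_eq_xxxx)
  qed
  finally show ?thesis unfolding S_def V_def by (simp add: algebra_simps)
qed

locale jump_brownian = brownian M F T W + jump_moments M F T \<nu> \<mu> \<Lambda>
  for M :: "'w measure" and F T W \<nu> and \<mu> :: "'w \<Rightarrow> (real \<times> real) measure" and \<Lambda>
begin

text \<open>The index \<open>None\<close> stands for the Brownian motion, \<open>Some A\<close> for the compensated number of jumps
  with mark in \<open>A\<close>.\<close>

definition indices :: "real set option set" where
  "indices = insert None (Some ` {A \<in> sets \<nu>. emeasure \<nu> A < \<infinity>})"

definition driver :: "real set option \<Rightarrow> real \<Rightarrow> 'w \<Rightarrow> real" where
  "driver i = (case i of None \<Rightarrow> W | Some A \<Rightarrow> N A)"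

definition bracket :: "real set option \<Rightarrow> real set option \<Rightarrow> real \<Rightarrow> real" where
  "bracket i j t = (case i of None \<Rightarrow> (case j of None \<Rightarrow> t | Some B \<Rightarrow> 0)
     | Some A \<Rightarrow> (case j of None \<Rightarrow> 0 | Some B \<Rightarrow> \<Lambda>\<^sub>I t * measure \<nu> (A \<inter> B)))"

text \<open>The martingale part is established on its own, because the mixed bracket is then
  computed with \<open>driver.bracket_partition\<close> before any bracket structure is
  available.\<close>

sublocale driver: martingales M F T indices driver
proof
  fix i and t :: real assume "i \<in> indices" "t \<in> {0..T}"
  then show "driver i t \<in> borel_measurable (F t)" "integrable M (\<lambda>\<omega>. (driver i t \<omega>)\<^sup>2)"
    by (auto simp: driver_def indices_def W_adapted N_measurable_F W_square N_square split: option.splits)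
next
  fix i and a b :: real and k :: "'w \<Rightarrow> real"
  assume "i \<in> indices" "0 \<le> a" "a \<le> b" "b \<le> T" "k \<in> borel_measurable (F a)" "bounded (k ` space M)"
  then show "(\<integral>\<omega>. k \<omega> * (driver i b \<omega> - driver i a \<omega>) \<partial>M) = 0"
    by (auto simp: driver_def indices_def W_martingale N_martingale split: option.splits)
qed

text \<open>Independence of each driver from the past gives no information on the joint behaviour of
  the two. The proof refines \<open>(a, b]\<close>: the expectation to be computed stays the same
  for every partition, while \<open>sum_mult_le_fourth_powers\<close> bounds it by a quantity that
  becomes arbitrarily small.\<close>

lemma bracket_mixed:
  assumes A: "A \<in> sets \<nu>" "emeasure \<nu> A < \<infinity>" and t: "0 \<le> a" "a \<le> b" "b \<le> T"
    and k: "k \<in> borel_measurable (F a)" "bounded (k ` space M)"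
  shows "(\<integral>\<omega>. k \<omega> * ((W b \<omega> - W a \<omega>) * (N A b \<omega> - N A a \<omega>)) \<partial>M) = 0"
proof (cases "a = b")
  case False
  then have ab: "a < b" using t by simp
  have kM: "k \<in> borel_measurable M" by (rule measurable_F[OF _ k(1)]) (use t in auto)
  obtain C where C: "0 \<le> C" "\<And>\<omega>. \<omega> \<in> space M \<Longrightarrow> \<bar>k \<omega>\<bar> \<le> C" by (rule bounded_imageD[OF k(2)]) blast
  \<comment> \<open>Count plus compensator over \<open>(a, b]\<close>. It bounds the sum of the
    absolute increments of the compensated count over every partition, uniformly in the
    mesh.\<close>
  define V where "V \<omega> = count a b A \<omega> + (\<Lambda>\<^sub>I b - \<Lambda>\<^sub>I a) * measure \<nu> A" for \<omega>
  have Vm: "V \<in> borel_measurable M" unfolding V_def using count_measurable[OF A(1) t] by simp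
  have V2: "integrable M (\<lambda>\<omega>. (V \<omega>)\<^sup>2)"
    unfolding V_def using count_measurable[OF A(1) t] count_square[OF A t] by (intro integrable_square_add) auto
  define E where "E = (\<integral>\<omega>. k \<omega> * ((W b \<omega> - W a \<omega>) * (N A b \<omega> - N A a \<omega>)) \<partial>M)"
  \<comment> \<open>\<open>C\<close> bounds the test variable \<open>k\<close>. The term
    \<open>3 * (b - a)\<^sup>2 / real (Suc n)\<close> is the expected sum of fourth powers:
    \<open>Suc n\<close> cells, each contributing \<open>3 * h\<^sup>2\<close> with
    \<open>h = (b - a) / real (Suc n)\<close>.\<close>
  have key: "\<bar>E\<bar> \<le> C * ((\<integral>\<omega>. (V \<omega>)\<^sup>2 \<partial>M) + 1) * \<epsilon> + C * 3 * (b - a)\<^sup>2 / (real (Suc n) * \<epsilon> ^ 3)" if \<epsilon>: "\<epsilon> > 0" for n \<epsilon>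
  proof -
    define h where "h = (b - a) / real (Suc n)"
    define t' where "t' m = a + h * real m" for m
    have h: "h > 0" using ab by (simp add: h_def)
    have t'0: "t' 0 = a" by (simp add: t'_def)
    have t'n: "t' (Suc n) = b" by (simp add: t'_def h_def del: of_nat_Suc)
    have t'S: "t' (Suc m) - t' m = h" "t' m < t' (Suc m)" for m using h by (simp_all add: t'_def algebra_simps)
    have t'r: "a \<le> t' m \<and> t' m \<le> b" if "m \<le> Suc n" for m
    proof -
      have "t' m \<le> t' (Suc n)" unfolding t'_def by (intro add_left_mono mult_left_mono) (use that h in auto)
      moreover have "a \<le> t' m" using h by (simp add: t'_def)
      ultimately show ?thesis unfolding t'n by blast
    qed
    have t'T: "t' m \<in> {0..T}" if "m \<le> Suc n" for m using t'r[OF that] t by auto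
    let ?w = "\<lambda>m \<omega>. W (t' (Suc m)) \<omega> - W (t' m) \<omega>" and ?d = "\<lambda>m \<omega>. N A (t' (Suc m)) \<omega> - N A (t' m) \<omega>"
    have wM: "W (t' m) \<in> borel_measurable M" if "m \<le> Suc n" for m using W_measurable t'T[OF that] by simp
    have NM: "N A (t' m) \<in> borel_measurable M" if "m \<le> Suc n" for m using N_measurable[OF A(1)] t'T[OF that] by simp
    have int: "integrable M (\<lambda>\<omega>. k \<omega> * (?w m \<omega> * ?d m \<omega>))" if "m < Suc n" for m
      using driver.N_mult_integrable[of None "Some A" "t' m" "t' (Suc m)" "t' m" "t' (Suc m)" k] kM k(2) t'T that A
      by (simp add: driver_def indices_def)
    have w4: "integrable M (\<lambda>\<omega>. ?w m \<omega> ^ 4)" "(\<integral>\<omega>. ?w m \<omega> ^ 4 \<partial>M) = 3 * h\<^sup>2" if "m < Suc n" for m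
      using W_moments(5,6)[of "t' m" "t' (Suc m)"] t'S[of m] t'T[of m] t'T[of "Suc m"] that by auto
    have "E = (\<Sum>m<Suc n. \<integral>\<omega>. k \<omega> * (?w m \<omega> * ?d m \<omega>) \<partial>M)"
      using driver.bracket_partition[of None "Some A" t' "Suc n" k] t k A t'S(2) unfolding t'n t'0 E_def
      by (simp add: driver_def indices_def less_imp_le)
    also have "\<dots> = (\<integral>\<omega>. (\<Sum>m<Suc n. k \<omega> * (?w m \<omega> * ?d m \<omega>)) \<partial>M)"
      by (rule Bochner_Integration.integral_sum[symmetric]) (use int in auto)
    finally have "\<bar>E\<bar> \<le> (\<integral>\<omega>. \<bar>\<Sum>m<Suc n. k \<omega> * (?w m \<omega> * ?d m \<omega>)\<bar> \<partial>M)"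
      by (simp only: integral_abs_bound)
    also have "\<dots> \<le> (\<integral>\<omega>. C * (\<epsilon> * ((V \<omega>)\<^sup>2 + 1) + (\<Sum>m<Suc n. ?w m \<omega> ^ 4) / \<epsilon> ^ 3) \<partial>M)"
    proof (rule integral_mono_AE)
      show "integrable M (\<lambda>\<omega>. \<bar>\<Sum>m<Suc n. k \<omega> * (?w m \<omega> * ?d m \<omega>)\<bar>)"
        by (intro integrable_abs Bochner_Integration.integrable_sum int) simp
      show "integrable M (\<lambda>\<omega>. C * (\<epsilon> * ((V \<omega>)\<^sup>2 + 1) + (\<Sum>m<Suc n. ?w m \<omega> ^ 4) / \<epsilon> ^ 3))"
        by (intro integrable_mult_right Bochner_Integration.integrable_add V2 integrable_divide Bochner_Integration.integrable_sum w4) auto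
      have AE1: "AE \<omega> in M. ?d m \<omega> = count (t' m) (t' (Suc m)) A \<omega> - (LBINT r:{t' m<..t' (Suc m)}. \<Lambda> r) * measure \<nu> A" if "m < Suc n" for m
        by (rule N_diff[OF A]) (use t'T[of m] t'T[of "Suc m"] t'S(2)[of m] that in auto)
      then have "AE \<omega> in M. \<forall>m\<in>{..<Suc n}. ?d m \<omega> = count (t' m) (t' (Suc m)) A \<omega> - (LBINT r:{t' m<..t' (Suc m)}. \<Lambda> r) * measure \<nu> A"
        by (intro AE_finite_allI) auto
      then show "AE \<omega> in M. \<bar>\<Sum>m<Suc n. k \<omega> * (?w m \<omega> * ?d m \<omega>)\<bar> \<le> C * (\<epsilon> * ((V \<omega>)\<^sup>2 + 1) + (\<Sum>m<Suc n. ?w m \<omega> ^ 4) / \<epsilon> ^ 3)"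
        using \<mu>_finite[OF A] AE_space
      proof eventually_elim
        case (elim \<omega>)
        define v where "v m = count (t' m) (t' (Suc m)) A \<omega> + (LBINT r:{t' m<..t' (Suc m)}. \<Lambda> r) * measure \<nu> A" for m
        have vd: "\<bar>?d m \<omega>\<bar> \<le> v m" if "m < Suc n" for m
        proof -
          have "0 \<le> (LBINT r:{t' m<..t' (Suc m)}. \<Lambda> r) * measure \<nu> A"
            using t'T[of m] t'T[of "Suc m"] that by (intro mult_nonneg_nonneg \<Lambda>_integral_nonneg) auto
          moreover have "?d m \<omega> = count (t' m) (t' (Suc m)) A \<omega> - (LBINT r:{t' m<..t' (Suc m)}. \<Lambda> r) * measure \<nu> A"
            using elim(1) that by blast
          moreover have "0 \<le> count (t' m) (t' (Suc m)) A \<omega>" by simp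
          ultimately show ?thesis unfolding v_def by linarith
        qed
        have vs: "(\<Sum>m<p. v m) = count a (t' p) A \<omega> + (\<Lambda>\<^sub>I (t' p) - \<Lambda>\<^sub>I a) * measure \<nu> A" if "p \<le> Suc n" for p
          using that
        proof (induction p)
          case 0
          then show ?case by (simp add: t'0)
        next
          case (Suc p)
          have "count a (t' (Suc p)) A \<omega> = count a (t' p) A \<omega> + count (t' p) (t' (Suc p)) A \<omega>"
            by (rule count_add_finite[OF A(1)]) (use elim t t'r[of p] t'r[of "Suc p"] t'S(2)[of p] Suc.prems in auto)
          moreover have "(LBINT r:{t' p<..t' (Suc p)}. \<Lambda> r) = \<Lambda>\<^sub>I (t' (Suc p)) - \<Lambda>\<^sub>I (t' p)"
            by (rule \<Lambda>\<^sub>I_diff) (use t t'r[of p] t'r[of "Suc p"] t'S(2)[of p] Suc.prems in auto)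
          then have "v p = count (t' p) (t' (Suc p)) A \<omega> + (\<Lambda>\<^sub>I (t' (Suc p)) - \<Lambda>\<^sub>I (t' p)) * measure \<nu> A"
            by (simp only: v_def)
          ultimately show ?case using Suc.IH Suc.prems by (simp add: algebra_simps)
        qed
        have vV: "(\<Sum>m<Suc n. v m) = V \<omega>" using vs[of "Suc n"] unfolding t'n V_def by simp
        have "\<bar>\<Sum>m<Suc n. k \<omega> * (?w m \<omega> * ?d m \<omega>)\<bar> = \<bar>k \<omega>\<bar> * \<bar>\<Sum>m<Suc n. ?w m \<omega> * ?d m \<omega>\<bar>"
          by (simp only: sum_distrib_left[symmetric] abs_mult)
        also have "\<dots> \<le> C * (\<epsilon> * ((V \<omega>)\<^sup>2 + 1) + (\<Sum>m<Suc n. ?w m \<omega> ^ 4) / \<epsilon> ^ 3)"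
        proof (rule mult_mono)
          show "\<bar>\<Sum>m<Suc n. ?w m \<omega> * ?d m \<omega>\<bar> \<le> \<epsilon> * ((V \<omega>)\<^sup>2 + 1) + (\<Sum>m<Suc n. ?w m \<omega> ^ 4) / \<epsilon> ^ 3"
            unfolding vV[symmetric] by (rule sum_mult_le_fourth_powers[OF _ \<epsilon>]) (rule vd)
        qed (use elim C in auto)
        finally show ?case .
      qed
    qed
    also have "\<dots> = C * (\<epsilon> * ((\<integral>\<omega>. (V \<omega>)\<^sup>2 \<partial>M) + 1) + (\<Sum>m<Suc n. \<integral>\<omega>. ?w m \<omega> ^ 4 \<partial>M) / \<epsilon> ^ 3)"
    proof -
      have i4: "integrable M (\<lambda>\<omega>. \<Sum>m<Suc n. ?w m \<omega> ^ 4)" by (intro Bochner_Integration.integrable_sum w4) auto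
      have e4: "(\<integral>\<omega>. (\<Sum>m<Suc n. ?w m \<omega> ^ 4) \<partial>M) = (\<Sum>m<Suc n. \<integral>\<omega>. ?w m \<omega> ^ 4 \<partial>M)"
        by (rule Bochner_Integration.integral_sum) (use w4 in auto)
      have e1: "(\<integral>\<omega>. (V \<omega>)\<^sup>2 + 1 \<partial>M) = (\<integral>\<omega>. (V \<omega>)\<^sup>2 \<partial>M) + 1"
        using V2 by (simp add: prob_space)
      have i1: "integrable M (\<lambda>\<omega>. \<epsilon> * ((V \<omega>)\<^sup>2 + 1))" using V2 by simp
      show ?thesis
        unfolding Bochner_Integration.integral_mult_right_zero
          Bochner_Integration.integral_add[OF i1 integrable_divide[OF i4]] integral_divide_zero e4 e1 by (rule refl)
    qed
    also have "(\<Sum>m<Suc n. \<integral>\<omega>. ?w m \<omega> ^ 4 \<partial>M) = (\<Sum>m<Suc n. 3 * h\<^sup>2)"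
      by (intro sum.cong refl w4) auto
    also have "\<dots> = 3 * (b - a)\<^sup>2 / real (Suc n)"
      by (simp add: h_def power2_eq_square del: of_nat_Suc)
    finally show ?thesis by (simp add: algebra_simps del: of_nat_Suc)
  qed
  have "\<bar>E\<bar> \<le> 0"
    by (rule le_zero_by_parameters[OF _ key]) (use C in \<open>auto intro!: mult_nonneg_nonneg add_nonneg_nonneg integral_nonneg\<close>)
  then show ?thesis by (simp add: E_def)
qed simp

sublocale driver: bracket_martingales M F T indices driver bracket
proof
  fix i j t assume "i \<in> indices" "j \<in> indices"
  then show "bracket i j t = bracket j i t" by (auto simp: bracket_def Int_commute split: option.splits)
next
  fix i j and a b :: real and k :: "'w \<Rightarrow> real"
  assume i: "i \<in> indices" and j: "j \<in> indices" and t: "0 \<le> a" "a \<le> b" "b \<le> T"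
    and k: "k \<in> borel_measurable (F a)" "bounded (k ` space M)"
  have c: "(W b \<omega> - W a \<omega>) * (N A b \<omega> - N A a \<omega>) = (N A b \<omega> - N A a \<omega>) * (W b \<omega> - W a \<omega>)" for A \<omega>
    by (rule mult.commute)
  show "(\<integral>\<omega>. k \<omega> * ((driver i b \<omega> - driver i a \<omega>) * (driver j b \<omega> - driver j a \<omega>)) \<partial>M) =
    (\<integral>\<omega>. k \<omega> \<partial>M) * (bracket i j b - bracket i j a)"
  proof (cases i)
    case None
    show ?thesis
    proof (cases j)
      case None
      then show ?thesis using \<open>i = None\<close> W_bracket[OF t k] by (simp add: driver_def bracket_def)
    next
      case (Some A)
      then show ?thesis using \<open>i = None\<close> bracket_mixed[OF _ _ t k] j by (auto simp: driver_def bracket_def indices_def)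
    qed
  next
    case i': (Some A)
    show ?thesis
    proof (cases j)
      case None
      then show ?thesis using i' bracket_mixed[OF _ _ t k, unfolded c] i
        by (auto simp: driver_def bracket_def indices_def)
    next
      case (Some B)
      then show ?thesis using i' i j N_bracket[OF _ _ _ _ t k, of A B]
        by (auto simp: driver_def bracket_def indices_def left_diff_distrib)
    qed
  qed
qed

end

subsection \<open>Isometry for the stochastic integrals\<close>

lemma finite_measure_time_leb: "finite_measure (time_leb T)"
  by (rule finite_measureI)
     (simp add: time_leb_def emeasure_restrict_space space_restrict_space emeasure_lborel_Icc_eq)

lemma sigma_finite_time_leb: "sigma_finite_measure (time_leb T)"
  using finite_measure_time_leb by (rule finite_measure.axioms)

lemma interval_time_leb: "{a<..b} \<inter> {0..T} \<in> sets (time_leb T)"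
  unfolding sets_time_leb sets_restrict_space by auto

lemma integral_time_leb:
  fixes g :: "real \<Rightarrow> real"
  assumes "0 \<le> a" "b \<le> T"
  shows "(\<integral>r. indicator {a<..b} r * g r \<partial>time_leb T) = (LBINT r:{a<..b}. g r)"
    and "integrable (time_leb T) (\<lambda>r. indicator {a<..b} r * g r) \<longleftrightarrow> set_integrable lborel {a<..b} g"
proof -
  have e: "indicator {0..T} r * (indicator {a<..b} r * g r) = indicator {a<..b} r * g r" for r
    using assms by (auto simp: indicator_def)
  show "(\<integral>r. indicator {a<..b} r * g r \<partial>time_leb T) = (LBINT r:{a<..b}. g r)"
    unfolding time_leb_def set_lebesgue_integral_def by (subst integral_restrict_space) (auto simp: e)
  show "integrable (time_leb T) (\<lambda>r. indicator {a<..b} r * g r) \<longleftrightarrow> set_integrable lborel {a<..b} g"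
    unfolding time_leb_def set_integrable_def by (subst integrable_restrict_space) (auto simp: e)
qed

lemma (in pair_sigma_finite) product_function:
  fixes f :: "'a \<Rightarrow> real" and g :: "'b \<Rightarrow> real"
  assumes f: "integrable M1 f" and g: "integrable M2 g"
  shows integrable_product_function: "integrable (M1 \<Otimes>\<^sub>M M2) (\<lambda>p. f (fst p) * g (snd p))"
    and integral_product_function: "(\<integral>p. f (fst p) * g (snd p) \<partial>(M1 \<Otimes>\<^sub>M M2)) = (\<integral>x. f x \<partial>M1) * (\<integral>y. g y \<partial>M2)"
proof -
  have m: "f \<in> borel_measurable M1" "g \<in> borel_measurable M2" using f g by auto
  show i: "integrable (M1 \<Otimes>\<^sub>M M2) (\<lambda>p. f (fst p) * g (snd p))"
  proof (rule Fubini_integrable)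
    show "(\<lambda>p. f (fst p) * g (snd p)) \<in> borel_measurable (M1 \<Otimes>\<^sub>M M2)" using m by measurable
    show "integrable M1 (\<lambda>x. \<integral>y. norm (f (fst (x, y)) * g (snd (x, y))) \<partial>M2)"
      using f by (simp add: abs_mult)
    show "AE x in M1. integrable M2 (\<lambda>y. f (fst (x, y)) * g (snd (x, y)))"
      using g by simp
  qed
  show "(\<integral>p. f (fst p) * g (snd p) \<partial>(M1 \<Otimes>\<^sub>M M2)) = (\<integral>x. f x \<partial>M1) * (\<integral>y. g y \<partial>M2)"
    by (simp flip: integral_fst'[OF i])
qed

text \<open>The square of an L^2 norm over times in \<open>(s, T]\<close>. It is extended-real
  valued so that estimates can be written before finiteness is known, and it is applied not only to
  integrands but also to \<open>Y - y0\<close> and to differences of drivers.\<close>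

definition ito_norm :: "'w measure \<Rightarrow> real \<Rightarrow> real \<Rightarrow> (real \<Rightarrow> 'w \<Rightarrow> real) \<Rightarrow> ennreal" where
  "ito_norm M T s Z = (\<integral>\<^sup>+p. indicator {s<..} (fst p) * ennreal ((Z (fst p) (snd p))\<^sup>2) \<partial>(time_leb T \<Otimes>\<^sub>M M))"

definition jump_norm :: "'w measure \<Rightarrow> real \<Rightarrow> real measure \<Rightarrow> real \<Rightarrow> (real \<Rightarrow> 'w \<Rightarrow> real \<Rightarrow> real) \<Rightarrow> ennreal" where
  "jump_norm M T \<nu> s \<psi> = (\<integral>\<^sup>+p. indicator {s<..} (fst (fst p)) * ennreal ((\<psi> (fst (fst p)) (snd (fst p)) (snd p))\<^sup>2)
     \<partial>((time_leb T \<Otimes>\<^sub>M M) \<Otimes>\<^sub>M \<nu>))"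

text \<open>The sums run over positions and not over the set of entries, since a list may contain
  the same entry twice.\<close>

lemma sum_list_nth_4:
  "(\<Sum>(a, b, A, h)\<leftarrow>xs. g a b A h) = (\<Sum>p<length xs. case xs ! p of (a, b, A, h) \<Rightarrow> g a b A h)"
  for g :: "_ \<Rightarrow> _ \<Rightarrow> _ \<Rightarrow> _ \<Rightarrow> real"
  by (simp add: sum_list_sum_nth atLeast0LessThan)

lemma sum_list_nth_3:
  "(\<Sum>(a, b, h)\<leftarrow>xs. g a b h) = (\<Sum>p<length xs. case xs ! p of (a, b, h) \<Rightarrow> g a b h)"
  for g :: "_ \<Rightarrow> _ \<Rightarrow> _ \<Rightarrow> real"
  by (simp add: sum_list_sum_nth atLeast0LessThan)

context filtered_prob_space
begin

lemma cadlag_adapted_measurable: "cadlag_adapted M F T I \<Longrightarrow> s \<in> {0..T} \<Longrightarrow> I s \<in> borel_measurable M"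
  using measurable_F[of s "I s" borel] by (auto simp: cadlag_adapted_def adapted_def)

lemma simple_process_nth:
  assumes "simple_process M F T H" "p < length H" "H ! p = (a, b, h)"
  shows "0 \<le> a" "a \<le> b" "b \<le> T" "h \<in> borel_measurable (F a)" "bounded (h ` space M)" "h \<in> borel_measurable M"
proof -
  have "(a, b, h) \<in> set H" using assms(2,3) by (metis nth_mem)
  then show *: "0 \<le> a" "a \<le> b" "b \<le> T" "h \<in> borel_measurable (F a)" "bounded (h ` space M)"
    using assms(1) by (auto simp: simple_process_def)
  show "h \<in> borel_measurable M" by (rule measurable_F[OF _ *(4)]) (use * in auto)
qed

lemma simple_field_nth:
  assumes "simple_field M F T \<nu> G" "p < length G" "G ! p = (a, b, A, h)"
  shows "0 \<le> a" "a \<le> b" "b \<le> T" "h \<in> borel_measurable (F a)" "bounded (h ` space M)" "h \<in> borel_measurable M"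
    "A \<in> sets \<nu>" "emeasure \<nu> A < \<infinity>"
proof -
  have "(a, b, A, h) \<in> set G" using assms(2,3) by (metis nth_mem)
  then show *: "0 \<le> a" "a \<le> b" "b \<le> T" "h \<in> borel_measurable (F a)" "bounded (h ` space M)" "A \<in> sets \<nu>" "emeasure \<nu> A < \<infinity>"
    using assms(1) by (auto simp: simple_field_def)
  show "h \<in> borel_measurable M" by (rule measurable_F[OF _ *(4)]) (use * in auto)
qed

lemma simple_process_eval_measurable:
  assumes H: "simple_process M F T H"
  shows "(\<lambda>x. simple_process_eval H (fst x) (snd x)) \<in> borel_measurable (time_leb T \<Otimes>\<^sub>M M)"
proof -
  have "(\<lambda>x. \<Sum>p<length H. snd (snd (H ! p)) (snd x) * indicator {fst (H ! p)<..fst (snd (H ! p))} (fst x) :: real) \<in> borel_measurable (time_leb T \<Otimes>\<^sub>M M)"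
  proof (intro borel_measurable_sum borel_measurable_times)
    fix p assume "p \<in> {..<length H}"
    then have p: "p < length H" by simp
    obtain a b h where e: "H ! p = (a, b, h)" by (cases "H ! p")
    have [measurable]: "h \<in> borel_measurable M" by (rule simple_process_nth[OF H p e])
    show "(\<lambda>x. snd (snd (H ! p)) (snd x)) \<in> borel_measurable (time_leb T \<Otimes>\<^sub>M M)" unfolding e by simp
    show "(\<lambda>x. indicator {fst (H ! p)<..fst (snd (H ! p))} (fst x) :: real) \<in> borel_measurable (time_leb T \<Otimes>\<^sub>M M)"
      by (rule measurable_compose[OF measurable_compose[OF measurable_fst measurable_time_id]]) simp
  qed
  then show ?thesis
    unfolding simple_process_eval_def[abs_def] sum_list_nth_3 by (simp add: case_prod_beta')
qed

lemma simple_field_eval_measurable: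
  assumes G: "simple_field M F T \<nu> G"
  shows "(\<lambda>x. simple_field_eval G (fst (fst x)) (snd (fst x)) (snd x)) \<in> borel_measurable ((time_leb T \<Otimes>\<^sub>M M) \<Otimes>\<^sub>M \<nu>)"
proof -
  have "(\<lambda>x. \<Sum>p<length G. snd (snd (snd (G ! p))) (snd (fst x)) * indicator {fst (G ! p)<..fst (snd (G ! p))} (fst (fst x))
     * indicator (fst (snd (snd (G ! p)))) (snd x) :: real) \<in> borel_measurable ((time_leb T \<Otimes>\<^sub>M M) \<Otimes>\<^sub>M \<nu>)"
  proof (intro borel_measurable_sum borel_measurable_times)
    fix p assume "p \<in> {..<length G}"
    then have p: "p < length G" by simp
    obtain a b A h where e: "G ! p = (a, b, A, h)" by (cases "G ! p")
    have [measurable]: "h \<in> borel_measurable M" "A \<in> sets \<nu>" by (rule simple_field_nth[OF G p e])+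
    show "(\<lambda>x. snd (snd (snd (G ! p))) (snd (fst x))) \<in> borel_measurable ((time_leb T \<Otimes>\<^sub>M M) \<Otimes>\<^sub>M \<nu>)" unfolding e by simp
    show "(\<lambda>x. indicator (fst (snd (snd (G ! p)))) (snd x) :: real) \<in> borel_measurable ((time_leb T \<Otimes>\<^sub>M M) \<Otimes>\<^sub>M \<nu>)"
      unfolding e by simp
    show "(\<lambda>x. indicator {fst (G ! p)<..fst (snd (G ! p))} (fst (fst x)) :: real) \<in> borel_measurable ((time_leb T \<Otimes>\<^sub>M M) \<Otimes>\<^sub>M \<nu>)"
      by (rule measurable_compose[OF measurable_compose[OF measurable_compose[OF measurable_fst measurable_fst] measurable_time_id]]) simp
  qed
  then show ?thesis
    unfolding simple_field_eval_def[abs_def] sum_list_nth_4 by (simp add: case_prod_beta')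
qed

end

text \<open>The two-sided bound on the intensity makes the norm of the exact isometry, which is
  weighted by \<open>\<Lambda>\<close>, equivalent to the unweighted norm in which integrands are
  approximated and in which the driver is Lipschitz.\<close>

locale jump_brownian_bounded = jump_brownian M F T W \<nu> \<mu> \<Lambda>
  for M :: "'w measure" and F T W \<nu> and \<mu> :: "'w \<Rightarrow> (real \<times> real) measure" and \<Lambda> +
  fixes c1 c2 :: real
  assumes c1_pos: "0 < c1" and \<Lambda>_bounds: "\<And>r. r \<in> {0..T} \<Longrightarrow> c1 \<le> \<Lambda> r \<and> \<Lambda> r \<le> c2"
    and \<nu>_sigma_finite: "sigma_finite_measure \<nu>"
begin

lemma time_pair: "pair_sigma_finite (time_leb T) M"
  using sigma_finite_time_leb sigma_finite_measure_axioms by (simp add: pair_sigma_finite_def)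

lemma triple_pair: "pair_sigma_finite (time_leb T \<Otimes>\<^sub>M M) \<nu>"
  using sigma_finite_pair_measure[OF sigma_finite_time_leb sigma_finite_measure_axioms] \<nu>_sigma_finite
  by (simp add: pair_sigma_finite_def)

text \<open>Both integrals are treated together: the backward equation contains only the sum of
  their increments, and the orthogonality of the drivers is what recovers the separate norms from
  it.\<close>

definition increment :: "'w simple_process \<Rightarrow> 'w simple_field \<Rightarrow> real \<Rightarrow> 'w \<Rightarrow> real" where
  "increment H G s \<omega> = (simple_ito_integral W H T \<omega> - simple_ito_integral W H s \<omega>) +
     (simple_jump_integral \<nu> \<mu> (\<lambda>r _. \<Lambda> r) G T \<omega> - simple_jump_integral \<nu> \<mu> (\<lambda>r _. \<Lambda> r) G s \<omega>)"

lemma \<Lambda>_set_integrable_time: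
  "0 \<le> a \<Longrightarrow> b \<le> T \<Longrightarrow> integrable (time_leb T) (\<lambda>r. indicator {a<..b} r * \<Lambda> r)"
  using integral_time_leb(2)[of a b T \<Lambda>] \<Lambda>_int_sub by simp

text \<open>By Fubini the square of the step function integrates to a double sum over overlapping
  intervals. Written with the same \<open>max\<close> and \<open>min\<close> terms as in
  \<open>elementary_isometry\<close>, it matches the Brownian part of the second moment of
  \<open>increment\<close> term by term.\<close>

lemma simple_process_norm:
  assumes H: "simple_process M F T H" and s: "s \<in> {0..T}"
  defines "a \<equiv> \<lambda>p. fst (H ! p)" and "b \<equiv> \<lambda>p. fst (snd (H ! p))" and "h \<equiv> \<lambda>p. snd (snd (H ! p))"
  defines "S \<equiv> (\<Sum>p<length H. \<Sum>q<length H. (\<integral>\<omega>. h p \<omega> * h q \<omega> \<partial>M) *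
      (max (max (max (a p) (a q)) s) (min (b p) (b q)) - max (max (a p) (a q)) s))"
  shows "ito_norm M T s (simple_process_eval H) = ennreal S" and "0 \<le> S"
proof -
  interpret P: pair_sigma_finite "time_leb T" M by (rule time_pair)
  have nth: "H ! p = (a p, b p, h p)" for p by (simp add: a_def b_def h_def)
  note HH = simple_process_nth[OF H _ nth]
  \<comment> \<open>\<open>(U p q, V p q]\<close> is the intersection of the two intervals with the
    times after \<open>s\<close>. The outer \<open>max\<close> in \<open>V\<close> makes an empty
    intersection an interval of length 0 and not one of negative length.\<close>
  define U where "U p q = max (max (a p) (a q)) s" for p q
  define V where "V p q = max (U p q) (min (b p) (b q))" for p q
  have UV: "0 \<le> U p q" "U p q \<le> V p q" "V p q \<le> T" if "p < length H" "q < length H" for p q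
    using HH[OF that(1)] HH[OF that(2)] s by (auto simp: U_def V_def)
  define u where "u p q = (\<lambda>x. (indicator {U p q<..V p q} (fst x) * 1) * (h p (snd x) * h q (snd x)))" for p q :: nat
  have i1: "integrable (time_leb T) (\<lambda>r. indicator {U p q<..V p q} r * 1 :: real)" (is "?A")
    and e1: "(\<integral>r. indicator {U p q<..V p q} r * 1 \<partial>time_leb T) = (V p q - U p q :: real)" (is ?B)
    if "p < length H" "q < length H" for p q
  proof -
    show ?A using integral_time_leb(2)[of "U p q" "V p q" T "\<lambda>_. 1"] UV[OF that]
      by (simp add: set_integrable_def)
    show ?B using integral_time_leb(1)[of "U p q" "V p q" T "\<lambda>_. 1"] UV[OF that]
      by (simp add: set_lebesgue_integral_def)
  qed
  have i2: "integrable M (\<lambda>\<omega>. h p \<omega> * h q \<omega>)" if "p < length H" "q < length H" for p q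
    by (rule integrable_of_bounded[OF _ bounded_image_mult]) (use HH[OF that(1)] HH[OF that(2)] in auto)
  have iu: "integrable (time_leb T \<Otimes>\<^sub>M M) (u p q)" if "p < length H" "q < length H" for p q
    unfolding u_def by (rule P.integrable_product_function[OF i1[OF that] i2[OF that]])
  have eu: "(\<integral>x. u p q x \<partial>(time_leb T \<Otimes>\<^sub>M M)) = (\<integral>\<omega>. h p \<omega> * h q \<omega> \<partial>M) * (V p q - U p q)"
    if "p < length H" "q < length H" for p q
    unfolding u_def P.integral_product_function[OF i1[OF that] i2[OF that]] e1[OF that] by simp
  have sq: "indicator {s<..} r * (simple_process_eval H r \<omega>)\<^sup>2 = (\<Sum>p<length H. \<Sum>q<length H. u p q (r, \<omega>))"
    if "r \<in> {0..T}" for r \<omega>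
  proof -
    have "indicator {s<..} r * (simple_process_eval H r \<omega>)\<^sup>2 =
      (\<Sum>p<length H. \<Sum>q<length H. indicator {s<..} r * ((h p \<omega> * indicator {a p<..b p} r) * (h q \<omega> * indicator {a q<..b q} r)))"
      unfolding simple_process_eval_def sum_list_nth_3 nth prod.case power2_eq_square sum_product
      by (simp add: sum_distrib_left)
    also have "\<dots> = (\<Sum>p<length H. \<Sum>q<length H. u p q (r, \<omega>))"
      by (intro sum.cong refl) (auto simp: u_def U_def V_def indicator_def)
    finally show ?thesis .
  qed
  have int: "integrable (time_leb T \<Otimes>\<^sub>M M) (\<lambda>x. \<Sum>p<length H. \<Sum>q<length H. u p q x)"
    by (intro Bochner_Integration.integrable_sum iu) auto
  have "(\<integral>x. (\<Sum>p<length H. \<Sum>q<length H. u p q x) \<partial>(time_leb T \<Otimes>\<^sub>M M)) = (\<Sum>p<length H. \<Sum>q<length H. \<integral>x. u p q x \<partial>(time_leb T \<Otimes>\<^sub>M M))"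
    by (subst Bochner_Integration.integral_sum)
       (auto intro!: Bochner_Integration.integrable_sum iu sum.cong Bochner_Integration.integral_sum)
  also have "\<dots> = S"
    unfolding S_def by (intro sum.cong refl) (simp add: eu U_def V_def)
  finally have S: "(\<integral>x. (\<Sum>p<length H. \<Sum>q<length H. u p q x) \<partial>(time_leb T \<Otimes>\<^sub>M M)) = S" .
  have "ito_norm M T s (simple_process_eval H) = (\<integral>\<^sup>+x. ennreal (\<Sum>p<length H. \<Sum>q<length H. u p q x) \<partial>(time_leb T \<Otimes>\<^sub>M M))"
    unfolding ito_norm_def
    by (intro nn_integral_cong)
       (auto simp: space_pair_measure simp flip: sq split: split_indicator)
  also have "\<dots> = ennreal S"
    unfolding S[symmetric]
    by (intro nn_integral_eq_integral int) (auto intro!: AE_I2 simp: space_pair_measure simp flip: sq)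
  finally show "ito_norm M T s (simple_process_eval H) = ennreal S" .
  show "0 \<le> S" unfolding S[symmetric]
    by (intro integral_nonneg_AE AE_I2) (auto simp: space_pair_measure simp flip: sq)
qed

text \<open>The weighted norm is the one for which the isometry is exact.\<close>

lemma simple_field_norm:
  assumes G: "simple_field M F T \<nu> G" and s: "s \<in> {0..T}"
  defines "a \<equiv> \<lambda>p. fst (G ! p)" and "b \<equiv> \<lambda>p. fst (snd (G ! p))" and "A \<equiv> \<lambda>p. fst (snd (snd (G ! p)))"
    and "h \<equiv> \<lambda>p. snd (snd (snd (G ! p)))"
  defines "S \<equiv> (\<Sum>p<length G. \<Sum>q<length G. (\<integral>\<omega>. h p \<omega> * h q \<omega> \<partial>M) *
      (\<Lambda>\<^sub>I (max (max (max (a p) (a q)) s) (min (b p) (b q))) * measure \<nu> (A p \<inter> A q)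
       - \<Lambda>\<^sub>I (max (max (a p) (a q)) s) * measure \<nu> (A p \<inter> A q)))"
  shows "(\<integral>\<^sup>+x. indicator {s<..} (fst (fst x)) * ennreal (\<Lambda> (fst (fst x)) * (simple_field_eval G (fst (fst x)) (snd (fst x)) (snd x))\<^sup>2)
     \<partial>((time_leb T \<Otimes>\<^sub>M M) \<Otimes>\<^sub>M \<nu>)) = ennreal S" and "0 \<le> S"
proof -
  interpret P: pair_sigma_finite "time_leb T" M by (rule time_pair)
  interpret PP: pair_sigma_finite "time_leb T \<Otimes>\<^sub>M M" \<nu> by (rule triple_pair)
  have nth: "G ! p = (a p, b p, A p, h p)" for p by (simp add: a_def b_def h_def A_def)
  note HH = simple_field_nth[OF G _ nth]
  define U where "U p q = max (max (a p) (a q)) s" for p q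
  define V where "V p q = max (U p q) (min (b p) (b q))" for p q
  have UV: "0 \<le> U p q" "U p q \<le> V p q" "V p q \<le> T" if "p < length G" "q < length G" for p q
    using HH[OF that(1)] HH[OF that(2)] s by (auto simp: U_def V_def)
  define u where "u p q = (\<lambda>x. ((indicator {U p q<..V p q} (fst (fst x)) * \<Lambda> (fst (fst x))) * (h p (snd (fst x)) * h q (snd (fst x)))) * indicator (A p \<inter> A q) (snd x))" for p q :: nat
  have i1: "integrable (time_leb T) (\<lambda>r. indicator {U p q<..V p q} r * \<Lambda> r)"
    and e1: "(\<integral>r. indicator {U p q<..V p q} r * \<Lambda> r \<partial>time_leb T) = \<Lambda>\<^sub>I (V p q) - \<Lambda>\<^sub>I (U p q)"
    if "p < length G" "q < length G" for p q
    using UV[OF that] \<Lambda>_set_integrable_time[of "U p q" "V p q"] integral_time_leb(1)[of "U p q" "V p q" T \<Lambda>]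
      \<Lambda>\<^sub>I_diff[of "U p q" "V p q"] by simp_all
  have i2: "integrable M (\<lambda>\<omega>. h p \<omega> * h q \<omega>)" if "p < length G" "q < length G" for p q
    by (rule integrable_of_bounded[OF _ bounded_image_mult]) (use HH[OF that(1)] HH[OF that(2)] in auto)
  have i3: "integrable \<nu> (indicator (A p \<inter> A q) :: real \<Rightarrow> real)"
     if "p < length G" "q < length G" for p q
  proof (rule integrable_real_indicator)
    show "A p \<inter> A q \<in> sets \<nu>" using HH[OF that(1)] HH[OF that(2)] by auto
    have "emeasure \<nu> (A p \<inter> A q) \<le> emeasure \<nu> (A p)" using HH[OF that(1)] by (intro emeasure_mono) auto
    then show "emeasure \<nu> (A p \<inter> A q) < \<infinity>" using HH(8)[OF that(1)] by (rule le_less_trans)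
  qed
  have e3: "(\<integral>z. indicator (A p \<inter> A q) z \<partial>\<nu>) = measure \<nu> (A p \<inter> A q)" if "p < length G" "q < length G" for p q
    using HH[OF that(1)] HH[OF that(2)] by simp
  have iu: "integrable ((time_leb T \<Otimes>\<^sub>M M) \<Otimes>\<^sub>M \<nu>) (u p q)" if "p < length G" "q < length G" for p q
    unfolding u_def by (rule PP.integrable_product_function[OF P.integrable_product_function[OF i1[OF that] i2[OF that]] i3[OF that]])
  have eu: "(\<integral>x. u p q x \<partial>((time_leb T \<Otimes>\<^sub>M M) \<Otimes>\<^sub>M \<nu>)) = (\<integral>\<omega>. h p \<omega> * h q \<omega> \<partial>M) * ((\<Lambda>\<^sub>I (V p q) - \<Lambda>\<^sub>I (U p q)) * measure \<nu> (A p \<inter> A q))"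
    if "p < length G" "q < length G" for p q
    unfolding u_def PP.integral_product_function[OF P.integrable_product_function[OF i1[OF that] i2[OF that]] i3[OF that]]
      P.integral_product_function[OF i1[OF that] i2[OF that]] e1[OF that] e3[OF that] by simp
  have sq: "indicator {s<..} r * (\<Lambda> r * (simple_field_eval G r \<omega> z)\<^sup>2) = (\<Sum>p<length G. \<Sum>q<length G. u p q ((r, \<omega>), z))"
    if "r \<in> {0..T}" for r \<omega> z
  proof -
    have "indicator {s<..} r * (\<Lambda> r * (simple_field_eval G r \<omega> z)\<^sup>2) =
      (\<Sum>p<length G. \<Sum>q<length G. indicator {s<..} r * (\<Lambda> r * ((h p \<omega> * indicator {a p<..b p} r * indicator (A p) z) * (h q \<omega> * indicator {a q<..b q} r * indicator (A q) z))))"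
      unfolding simple_field_eval_def sum_list_nth_4 nth prod.case power2_eq_square sum_product
      by (simp add: sum_distrib_left)
    also have "\<dots> = (\<Sum>p<length G. \<Sum>q<length G. u p q ((r, \<omega>), z))"
      by (intro sum.cong refl) (auto simp: u_def U_def V_def indicator_def)
    finally show ?thesis .
  qed
  have int: "integrable ((time_leb T \<Otimes>\<^sub>M M) \<Otimes>\<^sub>M \<nu>) (\<lambda>x. \<Sum>p<length G. \<Sum>q<length G. u p q x)"
    by (intro Bochner_Integration.integrable_sum iu) auto
  have "(\<integral>x. (\<Sum>p<length G. \<Sum>q<length G. u p q x) \<partial>((time_leb T \<Otimes>\<^sub>M M) \<Otimes>\<^sub>M \<nu>)) = (\<Sum>p<length G. \<Sum>q<length G. \<integral>x. u p q x \<partial>((time_leb T \<Otimes>\<^sub>M M) \<Otimes>\<^sub>M \<nu>))"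
    by (subst Bochner_Integration.integral_sum)
       (auto intro!: Bochner_Integration.integrable_sum iu sum.cong Bochner_Integration.integral_sum)
  also have "\<dots> = S"
    unfolding S_def by (intro sum.cong refl) (simp add: eu U_def V_def left_diff_distrib)
  finally have S: "(\<integral>x. (\<Sum>p<length G. \<Sum>q<length G. u p q x) \<partial>((time_leb T \<Otimes>\<^sub>M M) \<Otimes>\<^sub>M \<nu>)) = S" .
  have "(\<integral>\<^sup>+x. indicator {s<..} (fst (fst x)) * ennreal (\<Lambda> (fst (fst x)) * (simple_field_eval G (fst (fst x)) (snd (fst x)) (snd x))\<^sup>2)
     \<partial>((time_leb T \<Otimes>\<^sub>M M) \<Otimes>\<^sub>M \<nu>)) = (\<integral>\<^sup>+x. ennreal (\<Sum>p<length G. \<Sum>q<length G. u p q x) \<partial>((time_leb T \<Otimes>\<^sub>M M) \<Otimes>\<^sub>M \<nu>))"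
    by (intro nn_integral_cong)
       (auto simp: space_pair_measure simp flip: sq split: split_indicator)
  also have "\<dots> = ennreal S"
    unfolding S[symmetric]
    by (intro nn_integral_eq_integral int) (auto intro!: AE_I2 mult_nonneg_nonneg \<Lambda>_nonneg simp: space_pair_measure simp flip: sq)
  finally show "(\<integral>\<^sup>+x. indicator {s<..} (fst (fst x)) * ennreal (\<Lambda> (fst (fst x)) * (simple_field_eval G (fst (fst x)) (snd (fst x)) (snd x))\<^sup>2)
     \<partial>((time_leb T \<Otimes>\<^sub>M M) \<Otimes>\<^sub>M \<nu>)) = ennreal S" .
  show "0 \<le> S" unfolding S[symmetric]
    by (intro integral_nonneg_AE AE_I2) (auto intro!: mult_nonneg_nonneg \<Lambda>_nonneg simp: space_pair_measure simp flip: sq)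
qed

end

section \<open>From simple integrands to square-integrable ones\<close>

lemma nn_integral_square_triangle:
  fixes f g :: "'a \<Rightarrow> real"
  assumes [measurable]: "f \<in> borel_measurable M" "g \<in> borel_measurable M" "w \<in> borel_measurable M"
    and w: "\<And>x. w x \<le> (1 :: ennreal)"
  shows "(\<integral>\<^sup>+x. w x * ennreal ((f x)\<^sup>2) \<partial>M)
    \<le> 2 * (\<integral>\<^sup>+x. w x * ennreal ((g x)\<^sup>2) \<partial>M) + 2 * (\<integral>\<^sup>+x. ennreal ((g x - f x)\<^sup>2) \<partial>M)"
proof -
  \<comment> \<open>The squared triangle inequality with constant 2 avoids roots of extended reals.
    The weight stays in front of \<open>g\<close>, and is estimated by 1 in the error term, where
    only convergence to 0 matters.\<close>
  have *: "w x * ennreal ((f x)\<^sup>2) \<le> 2 * (w x * ennreal ((g x)\<^sup>2)) + 2 * ennreal ((g x - f x)\<^sup>2)" for x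
  proof -
    have "(f x)\<^sup>2 \<le> 2 * (g x)\<^sup>2 + 2 * (g x - f x)\<^sup>2"
      using zero_le_power2[of "2 * g x - f x"] by (simp add: power2_eq_square algebra_simps)
    then have "ennreal ((f x)\<^sup>2) \<le> ennreal (2 * (g x)\<^sup>2 + 2 * (g x - f x)\<^sup>2)" by (rule ennreal_leI)
    also have "\<dots> = 2 * ennreal ((g x)\<^sup>2) + 2 * ennreal ((g x - f x)\<^sup>2)"
      by (simp add: ennreal_plus ennreal_mult)
    finally have "w x * ennreal ((f x)\<^sup>2) \<le> w x * (2 * ennreal ((g x)\<^sup>2) + 2 * ennreal ((g x - f x)\<^sup>2))"
      by (rule mult_left_mono) simp
    also have "\<dots> = 2 * (w x * ennreal ((g x)\<^sup>2)) + w x * (2 * ennreal ((g x - f x)\<^sup>2))"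
      by (simp add: distrib_left mult_ac)
    also have "\<dots> \<le> 2 * (w x * ennreal ((g x)\<^sup>2)) + 1 * (2 * ennreal ((g x - f x)\<^sup>2))"
      by (intro add_left_mono mult_right_mono w) simp
    finally show ?thesis by simp
  qed
  have "(\<integral>\<^sup>+x. w x * ennreal ((f x)\<^sup>2) \<partial>M) \<le> (\<integral>\<^sup>+x. 2 * (w x * ennreal ((g x)\<^sup>2)) + 2 * ennreal ((g x - f x)\<^sup>2) \<partial>M)"
    by (intro nn_integral_mono *)
  also have "\<dots> = 2 * (\<integral>\<^sup>+x. w x * ennreal ((g x)\<^sup>2) \<partial>M) + 2 * (\<integral>\<^sup>+x. ennreal ((g x - f x)\<^sup>2) \<partial>M)"
    by (simp add: nn_integral_add nn_integral_cmult)
  finally show ?thesis .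
qed

lemma nn_integral_square_sum4:
  fixes f1 f2 f3 f4 :: "'a \<Rightarrow> real"
  assumes [measurable]: "f1 \<in> borel_measurable M" "f2 \<in> borel_measurable M" "f3 \<in> borel_measurable M" "f4 \<in> borel_measurable M"
  shows "(\<integral>\<^sup>+x. ennreal ((f1 x - f2 x + (f3 x - f4 x))\<^sup>2) \<partial>M)
    \<le> 4 * ((\<integral>\<^sup>+x. ennreal ((f1 x)\<^sup>2) \<partial>M) + (\<integral>\<^sup>+x. ennreal ((f2 x)\<^sup>2) \<partial>M)
      + ((\<integral>\<^sup>+x. ennreal ((f3 x)\<^sup>2) \<partial>M) + (\<integral>\<^sup>+x. ennreal ((f4 x)\<^sup>2) \<partial>M)))"
proof -
  have *: "ennreal ((a - b + (c - d))\<^sup>2) \<le> 4 * (ennreal (a\<^sup>2) + ennreal (b\<^sup>2) + (ennreal (c\<^sup>2) + ennreal (d\<^sup>2)))" for a b c d :: real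
  proof -
    have "(a - b + (c - d))\<^sup>2 \<le> 4 * (a\<^sup>2 + b\<^sup>2 + (c\<^sup>2 + d\<^sup>2))"
      using zero_le_power2[of "a + b"] zero_le_power2[of "a - c"] zero_le_power2[of "a + d"]
        zero_le_power2[of "b + c"] zero_le_power2[of "b - d"] zero_le_power2[of "c + d"]
      by (simp add: power2_eq_square algebra_simps)
    then have "ennreal ((a - b + (c - d))\<^sup>2) \<le> ennreal (4 * (a\<^sup>2 + b\<^sup>2 + (c\<^sup>2 + d\<^sup>2)))" by (rule ennreal_leI)
    also have "\<dots> = 4 * (ennreal (a\<^sup>2) + ennreal (b\<^sup>2) + (ennreal (c\<^sup>2) + ennreal (d\<^sup>2)))"
      by (simp add: ennreal_plus ennreal_mult)
    finally show ?thesis .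
  qed
  have "(\<integral>\<^sup>+x. ennreal ((f1 x - f2 x + (f3 x - f4 x))\<^sup>2) \<partial>M)
    \<le> (\<integral>\<^sup>+x. 4 * (ennreal ((f1 x)\<^sup>2) + ennreal ((f2 x)\<^sup>2) + (ennreal ((f3 x)\<^sup>2) + ennreal ((f4 x)\<^sup>2))) \<partial>M)"
    by (intro nn_integral_mono *)
  also have "\<dots> = 4 * ((\<integral>\<^sup>+x. ennreal ((f1 x)\<^sup>2) \<partial>M) + (\<integral>\<^sup>+x. ennreal ((f2 x)\<^sup>2) \<partial>M)
      + ((\<integral>\<^sup>+x. ennreal ((f3 x)\<^sup>2) \<partial>M) + (\<integral>\<^sup>+x. ennreal ((f4 x)\<^sup>2) \<partial>M)))"
    by (subst nn_integral_cmult, simp, subst nn_integral_add, simp, simp, subst nn_integral_add, simp, simp,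
        subst nn_integral_add, simp, simp, rule refl)
  finally show ?thesis .
qed

context jump_brownian_bounded
begin

lemma compensated_N:
  assumes "A \<in> sets \<nu>" "emeasure \<nu> A < \<infinity>" "0 \<le> a" "a \<le> b" "b \<le> T"
  shows "AE \<omega> in M. compensated \<nu> \<mu> (\<lambda>r _. \<Lambda> r) a b A \<omega> = N A b \<omega> - N A a \<omega>"
  using N_diff[OF assms] by eventually_elim (simp add: compensated_def)

lemma increment_eq:
  assumes H: "simple_process M F T H" and G: "simple_field M F T \<nu> G" and s: "s \<in> {0..T}"
  shows "AE \<omega> in M. increment H G s \<omega> =
    (\<Sum>p<length H. snd (snd (H ! p)) \<omega> * (W (max (fst (snd (H ! p))) s) \<omega> - W (max (fst (H ! p)) s) \<omega>)) +
    (\<Sum>p<length G. snd (snd (snd (G ! p))) \<omega> *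
       (N (fst (snd (snd (G ! p)))) (max (fst (snd (G ! p))) s) \<omega> - N (fst (snd (snd (G ! p)))) (max (fst (G ! p)) s) \<omega>))"
proof -
  define a where "a = (\<lambda>p. fst (G ! p))"
  define b where "b = (\<lambda>p. fst (snd (G ! p)))"
  define A where "A = (\<lambda>p. fst (snd (snd (G ! p))))"
  define h where "h = (\<lambda>p. snd (snd (snd (G ! p))))"
  have nth: "G ! p = (a p, b p, A p, h p)" for p by (simp add: a_def b_def h_def A_def)
  note HH = simple_field_nth[OF G _ nth]
  define a' where "a' = (\<lambda>p. fst (H ! p))"
  define b' where "b' = (\<lambda>p. fst (snd (H ! p)))"
  define h' where "h' = (\<lambda>p. snd (snd (H ! p)))"
  have nth': "H ! p = (a' p, b' p, h' p)" for p by (simp add: a'_def b'_def h'_def)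
  note HH' = simple_process_nth[OF H _ nth']
  \<comment> \<open>Since all end points are at most \<open>T\<close>, stopping at \<open>T\<close>
    changes nothing, and \<open>W b - W (min b s) = W (max b s) - W s\<close>. The terms
    \<open>W s\<close> from the two end points cancel, which turns stopping at \<open>s\<close> into
    starting at \<open>s\<close>.\<close>
  have W: "W (min (b' p) T) \<omega> - W (min (a' p) T) \<omega> - (W (min (b' p) s) \<omega> - W (min (a' p) s) \<omega>) = W (max (b' p) s) \<omega> - W (max (a' p) s) \<omega>"
    if "p < length H" for p \<omega>
    using HH'[OF that] by (simp add: min_def max_def)
  have "AE \<omega> in M. \<forall>p\<in>{..<length G}.
     compensated \<nu> \<mu> (\<lambda>r _. \<Lambda> r) (min (a p) T) (min (b p) T) (A p) \<omega> = N (A p) (min (b p) T) \<omega> - N (A p) (min (a p) T) \<omega> \<and>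
     compensated \<nu> \<mu> (\<lambda>r _. \<Lambda> r) (min (a p) s) (min (b p) s) (A p) \<omega> = N (A p) (min (b p) s) \<omega> - N (A p) (min (a p) s) \<omega>"
  proof (intro AE_finite_allI AE_conjI)
    fix p assume "p \<in> {..<length G}"
    then have p: "p < length G" by simp
    show "AE \<omega> in M. compensated \<nu> \<mu> (\<lambda>r _. \<Lambda> r) (min (a p) T) (min (b p) T) (A p) \<omega> = N (A p) (min (b p) T) \<omega> - N (A p) (min (a p) T) \<omega>"
      by (rule compensated_N[OF HH(7,8)[OF p]]) (use HH(1-3)[OF p] s in auto)
    show "AE \<omega> in M. compensated \<nu> \<mu> (\<lambda>r _. \<Lambda> r) (min (a p) s) (min (b p) s) (A p) \<omega> = N (A p) (min (b p) s) \<omega> - N (A p) (min (a p) s) \<omega>"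
      by (rule compensated_N[OF HH(7,8)[OF p]]) (use HH(1-3)[OF p] s in auto)
  qed simp
  then show ?thesis
  proof eventually_elim
    case (elim \<omega>)
    have N: "compensated \<nu> \<mu> (\<lambda>r _. \<Lambda> r) (min (a p) T) (min (b p) T) (A p) \<omega> - compensated \<nu> \<mu> (\<lambda>r _. \<Lambda> r) (min (a p) s) (min (b p) s) (A p) \<omega>
       = N (A p) (max (b p) s) \<omega> - N (A p) (max (a p) s) \<omega>" if "p < length G" for p
    proof -
      have "compensated \<nu> \<mu> (\<lambda>r _. \<Lambda> r) (min (a p) T) (min (b p) T) (A p) \<omega> - compensated \<nu> \<mu> (\<lambda>r _. \<Lambda> r) (min (a p) s) (min (b p) s) (A p) \<omega>
        = N (A p) (min (b p) T) \<omega> - N (A p) (min (a p) T) \<omega> - (N (A p) (min (b p) s) \<omega> - N (A p) (min (a p) s) \<omega>)"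
        using elim that by simp
      then show ?thesis using HH(1-3)[OF that] by (simp add: min_def max_def split: if_splits)
    qed
    have "simple_ito_integral W H T \<omega> - simple_ito_integral W H s \<omega> = (\<Sum>p<length H. h' p \<omega> * (W (max (b' p) s) \<omega> - W (max (a' p) s) \<omega>))"
      unfolding simple_ito_integral_def sum_list_nth_3 nth' prod.case sum_subtractf[symmetric] right_diff_distrib[symmetric]
      by (intro sum.cong refl) (simp add: W)
    moreover have "simple_jump_integral \<nu> \<mu> (\<lambda>r _. \<Lambda> r) G T \<omega> - simple_jump_integral \<nu> \<mu> (\<lambda>r _. \<Lambda> r) G s \<omega> =
       (\<Sum>p<length G. h p \<omega> * (N (A p) (max (b p) s) \<omega> - N (A p) (max (a p) s) \<omega>))"
      unfolding simple_jump_integral_def sum_list_nth_4 nth prod.case sum_subtractf[symmetric] right_diff_distrib[symmetric]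
      by (intro sum.cong refl) (simp add: N)
    ultimately show ?case unfolding increment_def nth nth' by simp
  qed
qed

lemma simple_ito_measurable:
  assumes H: "simple_process M F T H" and s: "s \<in> {0..T}"
  shows "simple_ito_integral W H s \<in> borel_measurable M"
proof -
  have "(\<lambda>\<omega>. \<Sum>p<length H. snd (snd (H ! p)) \<omega> * (W (min (fst (snd (H ! p))) s) \<omega> - W (min (fst (H ! p)) s) \<omega>)) \<in> borel_measurable M"
  proof (intro borel_measurable_sum borel_measurable_times borel_measurable_diff)
    fix p assume "p \<in> {..<length H}"
    then have p: "p < length H" by simp
    obtain a b h where e: "H ! p = (a, b, h)" by (cases "H ! p")
    note HH = simple_process_nth[OF H p e]
    show "snd (snd (H ! p)) \<in> borel_measurable M" "W (min (fst (snd (H ! p))) s) \<in> borel_measurable M"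
      "W (min (fst (H ! p)) s) \<in> borel_measurable M"
      using HH s by (auto simp: e intro!: W_measurable)
  qed
  then show ?thesis
    unfolding simple_ito_integral_def[abs_def] sum_list_nth_3 by (simp add: case_prod_beta')
qed

lemma simple_jump_measurable:
  assumes G: "simple_field M F T \<nu> G" and s: "s \<in> {0..T}"
  shows "simple_jump_integral \<nu> \<mu> (\<lambda>r _. \<Lambda> r) G s \<in> borel_measurable M"
proof -
  have "(\<lambda>\<omega>. \<Sum>p<length G. snd (snd (snd (G ! p))) \<omega> *
     compensated \<nu> \<mu> (\<lambda>r _. \<Lambda> r) (min (fst (G ! p)) s) (min (fst (snd (G ! p))) s) (fst (snd (snd (G ! p)))) \<omega>) \<in> borel_measurable M"
    unfolding compensated_def
  proof (intro borel_measurable_sum borel_measurable_times borel_measurable_diff borel_measurable_const)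
    fix p assume "p \<in> {..<length G}"
    then have p: "p < length G" by simp
    obtain a b A h where e: "G ! p = (a, b, A, h)" by (cases "G ! p")
    note HH = simple_field_nth[OF G p e]
    show "snd (snd (snd (G ! p))) \<in> borel_measurable M"
      "(\<lambda>\<omega>. measure (\<mu> \<omega>) ({min (fst (G ! p)) s<..min (fst (snd (G ! p))) s} \<times> fst (snd (snd (G ! p))))) \<in> borel_measurable M"
      using HH s by (auto simp: e intro!: count_measurable)
  qed
  then show ?thesis
    unfolding simple_jump_integral_def[abs_def] sum_list_nth_4 by (simp add: case_prod_beta')
qed

lemma after_measurable:
  "(\<lambda>x. indicator {s<..} (fst x) :: ennreal) \<in> borel_measurable (time_leb T \<Otimes>\<^sub>M M)"
  "(\<lambda>x. indicator {s<..} (fst (fst x)) :: ennreal) \<in> borel_measurable ((time_leb T \<Otimes>\<^sub>M M) \<Otimes>\<^sub>M \<nu>)"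
  by (rule measurable_compose[OF measurable_compose[OF measurable_fst measurable_time_id]], simp,
      rule measurable_compose[OF measurable_compose[OF measurable_compose[OF measurable_fst measurable_fst] measurable_time_id]], simp)

text \<open>The Brownian and the jump terms are put into one family, indexed by a disjoint sum, so
  that a single application of \<open>elementary_isometry\<close> yields everything. The cross terms
  carry the mixed bracket 0, and the two diagonal blocks are exactly the norms of the two simple
  integrands.\<close>

lemma increment_properties:
  assumes H: "simple_process M F T H" and G: "simple_field M F T \<nu> G" and s: "s \<in> {0..T}"
  shows increment_measurable: "increment H G s \<in> borel_measurable M"
    and increment_square: "integrable M (\<lambda>\<omega>. (increment H G s \<omega>)\<^sup>2)"
    and increment_orthogonal: "\<And>k :: 'w \<Rightarrow> real. k \<in> borel_measurable (F s) \<Longrightarrow> integrable M (\<lambda>\<omega>. (k \<omega>)\<^sup>2) \<Longrightarrow>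
       (\<integral>\<omega>. k \<omega> * increment H G s \<omega> \<partial>M) = 0"
    and increment_isometry: "(\<integral>\<^sup>+\<omega>. ennreal ((increment H G s \<omega>)\<^sup>2) \<partial>M) = ito_norm M T s (simple_process_eval H) +
       (\<integral>\<^sup>+x. indicator {s<..} (fst (fst x)) * ennreal (\<Lambda> (fst (fst x)) * (simple_field_eval G (fst (fst x)) (snd (fst x)) (snd x))\<^sup>2)
         \<partial>((time_leb T \<Otimes>\<^sub>M M) \<Otimes>\<^sub>M \<nu>))"
proof -
  let ?P = "{..<length H} <+> {..<length G}"
  define a where "a = case_sum (\<lambda>p. fst (H ! p)) (\<lambda>p. fst (G ! p))"
  define b where "b = case_sum (\<lambda>p. fst (snd (H ! p))) (\<lambda>p. fst (snd (G ! p)))"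
  define h where "h = case_sum (\<lambda>p. snd (snd (H ! p))) (\<lambda>p. snd (snd (snd (G ! p))))"
  define \<iota> where "\<iota> = case_sum (\<lambda>p::nat. None) (\<lambda>p. Some (fst (snd (snd (G ! p)))))"
  define D where "D \<omega> = (\<Sum>p\<in>?P. h p \<omega> * (driver (\<iota> p) (max (b p) s) \<omega> - driver (\<iota> p) (max (a p) s) \<omega>))" for \<omega>
  have ok: "0 \<le> a p \<and> a p \<le> b p \<and> b p \<le> T" "\<iota> p \<in> indices" "h p \<in> borel_measurable (F (a p))" "bounded (h p ` space M)"
    if "p \<in> ?P" for p
    using that
  proof (induction p)
    fix q assume q: "Inl q \<in> ?P"
    obtain a' b' h' where e: "H ! q = (a', b', h')" by (cases "H ! q")
    show "0 \<le> a (Inl q) \<and> a (Inl q) \<le> b (Inl q) \<and> b (Inl q) \<le> T" "\<iota> (Inl q) \<in> indices"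
      "h (Inl q) \<in> borel_measurable (F (a (Inl q)))" "bounded (h (Inl q) ` space M)"
      using simple_process_nth[OF H _ e] q by (auto simp: a_def b_def h_def \<iota>_def e indices_def)
  next
    fix q assume q: "Inr q \<in> ?P"
    obtain a' b' A' h' where e: "G ! q = (a', b', A', h')" by (cases "G ! q")
    show "0 \<le> a (Inr q) \<and> a (Inr q) \<le> b (Inr q) \<and> b (Inr q) \<le> T" "\<iota> (Inr q) \<in> indices"
      "h (Inr q) \<in> borel_measurable (F (a (Inr q)))" "bounded (h (Inr q) ` space M)"
      using simple_field_nth[OF G _ e] q by (auto simp: a_def b_def h_def \<iota>_def e indices_def)
  qed
  have fP: "finite ?P" by simp
  note el = driver.elementary_isometry[where P = ?P and a = a and b = b and \<iota> = \<iota> and h = h, OF fP s ok, folded D_def]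
  have eq: "AE \<omega> in M. increment H G s \<omega> = D \<omega>"
    using increment_eq[OF H G s]
    by eventually_elim (simp add: D_def sum.Plus a_def b_def h_def \<iota>_def driver_def)
  show m: "increment H G s \<in> borel_measurable M"
    unfolding increment_def[abs_def]
    by (intro borel_measurable_add borel_measurable_diff simple_ito_measurable simple_jump_measurable H G s)
       (use T_nonneg in auto)
  have Dm: "D \<in> borel_measurable M" using el(1) by (simp add: D_def[abs_def])
  show "integrable M (\<lambda>\<omega>. (increment H G s \<omega>)\<^sup>2)"
    using el(2) eq m Dm by (subst integrable_cong_AE[of _ M "\<lambda>\<omega>. (D \<omega>)\<^sup>2"]) auto
  { fix k :: "'w \<Rightarrow> real" assume k: "k \<in> borel_measurable (F s)" "integrable M (\<lambda>\<omega>. (k \<omega>)\<^sup>2)"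
    have "(\<integral>\<omega>. k \<omega> * increment H G s \<omega> \<partial>M) = (\<integral>\<omega>. k \<omega> * D \<omega> \<partial>M)"
      using eq m Dm measurable_F[OF s k(1)] by (intro integral_cong_AE) auto
    then show "(\<integral>\<omega>. k \<omega> * increment H G s \<omega> \<partial>M) = 0" using el(4)[OF _ _ _ _ k] by simp }
  have "(\<integral>\<^sup>+\<omega>. ennreal ((increment H G s \<omega>)\<^sup>2) \<partial>M) = (\<integral>\<^sup>+\<omega>. ennreal ((D \<omega>)\<^sup>2) \<partial>M)"
    using eq by (intro nn_integral_cong_AE) auto
  also have "\<dots> = ennreal (\<integral>\<omega>. (D \<omega>)\<^sup>2 \<partial>M)"
    by (rule nn_integral_eq_integral) (use el(2) in auto)
  also have "\<dots> = ennreal ((\<Sum>p<length H. \<Sum>q<length H. (\<integral>\<omega>. snd (snd (H ! p)) \<omega> * snd (snd (H ! q)) \<omega> \<partial>M) *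
      (max (max (max (fst (H ! p)) (fst (H ! q))) s) (min (fst (snd (H ! p))) (fst (snd (H ! q)))) - max (max (fst (H ! p)) (fst (H ! q))) s)) +
      (\<Sum>p<length G. \<Sum>q<length G. (\<integral>\<omega>. snd (snd (snd (G ! p))) \<omega> * snd (snd (snd (G ! q))) \<omega> \<partial>M) *
      (\<Lambda>\<^sub>I (max (max (max (fst (G ! p)) (fst (G ! q))) s) (min (fst (snd (G ! p))) (fst (snd (G ! q))))) * measure \<nu> (fst (snd (snd (G ! p))) \<inter> fst (snd (snd (G ! q))))
       - \<Lambda>\<^sub>I (max (max (fst (G ! p)) (fst (G ! q))) s) * measure \<nu> (fst (snd (snd (G ! p))) \<inter> fst (snd (snd (G ! q)))))))"
    by (subst el(3)) (simp_all add: sum.Plus a_def b_def h_def \<iota>_def bracket_def)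
  also have "\<dots> = ito_norm M T s (simple_process_eval H) +
       (\<integral>\<^sup>+x. indicator {s<..} (fst (fst x)) * ennreal (\<Lambda> (fst (fst x)) * (simple_field_eval G (fst (fst x)) (snd (fst x)) (snd x))\<^sup>2)
         \<partial>((time_leb T \<Otimes>\<^sub>M M) \<Otimes>\<^sub>M \<nu>))"
    unfolding simple_process_norm(1)[OF H s] simple_field_norm(1)[OF G s]
    by (rule ennreal_plus[OF simple_process_norm(2)[OF H s] simple_field_norm(2)[OF G s]])
  finally show "(\<integral>\<^sup>+\<omega>. ennreal ((increment H G s \<omega>)\<^sup>2) \<partial>M) = ito_norm M T s (simple_process_eval H) +
       (\<integral>\<^sup>+x. indicator {s<..} (fst (fst x)) * ennreal (\<Lambda> (fst (fst x)) * (simple_field_eval G (fst (fst x)) (snd (fst x)) (snd x))\<^sup>2)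
         \<partial>((time_leb T \<Otimes>\<^sub>M M) \<Otimes>\<^sub>M \<nu>))" .
qed

lemma c2_pos: "0 < c2"
  using \<Lambda>_bounds[of 0] T_nonneg c1_pos by auto

lemma weighted_norm_bounds:
  fixes s :: real
  assumes [measurable]: "(\<lambda>x. \<psi> (fst (fst x)) (snd (fst x)) (snd x)) \<in> borel_measurable ((time_leb T \<Otimes>\<^sub>M M) \<Otimes>\<^sub>M \<nu>)"
  defines "w \<equiv> (\<integral>\<^sup>+x. indicator {s<..} (fst (fst x)) * ennreal (\<Lambda> (fst (fst x)) * (\<psi> (fst (fst x)) (snd (fst x)) (snd x))\<^sup>2)
         \<partial>((time_leb T \<Otimes>\<^sub>M M) \<Otimes>\<^sub>M \<nu>))"
  shows "ennreal c1 * jump_norm M T \<nu> s \<psi> \<le> w" "w \<le> ennreal c2 * jump_norm M T \<nu> s \<psi>"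
proof -
  note after_measurable(2)[measurable]
  have m: "ennreal c * jump_norm M T \<nu> s \<psi> = (\<integral>\<^sup>+x. ennreal c * (indicator {s<..} (fst (fst x)) * ennreal ((\<psi> (fst (fst x)) (snd (fst x)) (snd x))\<^sup>2))
         \<partial>((time_leb T \<Otimes>\<^sub>M M) \<Otimes>\<^sub>M \<nu>))" for c
    unfolding jump_norm_def by (rule nn_integral_cmult[symmetric]) measurable
  show "ennreal c1 * jump_norm M T \<nu> s \<psi> \<le> w"
    unfolding m w_def
  proof (rule nn_integral_mono)
    fix x assume "x \<in> space ((time_leb T \<Otimes>\<^sub>M M) \<Otimes>\<^sub>M \<nu>)"
    then have "c1 \<le> \<Lambda> (fst (fst x))" using \<Lambda>_bounds by (auto simp: space_pair_measure)
    then show "ennreal c1 * (indicator {s<..} (fst (fst x)) * ennreal ((\<psi> (fst (fst x)) (snd (fst x)) (snd x))\<^sup>2))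
      \<le> indicator {s<..} (fst (fst x)) * ennreal (\<Lambda> (fst (fst x)) * (\<psi> (fst (fst x)) (snd (fst x)) (snd x))\<^sup>2)"
      using c1_pos by (auto simp: indicator_def simp flip: ennreal_mult intro!: ennreal_leI mult_right_mono)
  qed
  show "w \<le> ennreal c2 * jump_norm M T \<nu> s \<psi>"
    unfolding m w_def
  proof (rule nn_integral_mono)
    fix x assume "x \<in> space ((time_leb T \<Otimes>\<^sub>M M) \<Otimes>\<^sub>M \<nu>)"
    then have "\<Lambda> (fst (fst x)) \<le> c2" using \<Lambda>_bounds by (auto simp: space_pair_measure)
    then show "indicator {s<..} (fst (fst x)) * ennreal (\<Lambda> (fst (fst x)) * (\<psi> (fst (fst x)) (snd (fst x)) (snd x))\<^sup>2)
      \<le> ennreal c2 * (indicator {s<..} (fst (fst x)) * ennreal ((\<psi> (fst (fst x)) (snd (fst x)) (snd x))\<^sup>2))"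
      using c2_pos by (auto simp: indicator_def simp flip: ennreal_mult intro!: ennreal_leI mult_right_mono)
  qed
qed

definition total_norm where "total_norm s Z \<psi> = ito_norm M T s Z + jump_norm M T \<nu> s \<psi>"

lemma increment_bounds:
  assumes H: "simple_process M F T H" and G: "simple_field M F T \<nu> G" and s: "s \<in> {0..T}"
  shows "ennreal (min 1 c1) * total_norm s (simple_process_eval H) (simple_field_eval G) \<le> (\<integral>\<^sup>+\<omega>. ennreal ((increment H G s \<omega>)\<^sup>2) \<partial>M)"
    and "(\<integral>\<^sup>+\<omega>. ennreal ((increment H G s \<omega>)\<^sup>2) \<partial>M) \<le> ennreal (max 1 c2) * total_norm s (simple_process_eval H) (simple_field_eval G)"
proof -
  note w = weighted_norm_bounds[OF simple_field_eval_measurable[OF G], of s]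
  have "ennreal (min 1 c1) * ito_norm M T s (simple_process_eval H) \<le> 1 * ito_norm M T s (simple_process_eval H)"
    using c1_pos by (intro mult_right_mono) (auto simp: min_def simp flip: ennreal_1 intro!: ennreal_leI)
  moreover have "ennreal (min 1 c1) * jump_norm M T \<nu> s (simple_field_eval G) \<le> ennreal c1 * jump_norm M T \<nu> s (simple_field_eval G)"
    by (intro mult_right_mono ennreal_leI) auto
  ultimately show "ennreal (min 1 c1) * total_norm s (simple_process_eval H) (simple_field_eval G) \<le> (\<integral>\<^sup>+\<omega>. ennreal ((increment H G s \<omega>)\<^sup>2) \<partial>M)"
    unfolding increment_isometry[OF H G s] total_norm_def distrib_left
    using w(1) by (intro add_mono) auto
  have "1 * ito_norm M T s (simple_process_eval H) \<le> ennreal (max 1 c2) * ito_norm M T s (simple_process_eval H)"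
    by (intro mult_right_mono) (auto simp flip: ennreal_1 intro!: ennreal_leI)
  moreover have "ennreal c2 * jump_norm M T \<nu> s (simple_field_eval G) \<le> ennreal (max 1 c2) * jump_norm M T \<nu> s (simple_field_eval G)"
    by (intro mult_right_mono ennreal_leI) auto
  ultimately show "(\<integral>\<^sup>+\<omega>. ennreal ((increment H G s \<omega>)\<^sup>2) \<partial>M) \<le> ennreal (max 1 c2) * total_norm s (simple_process_eval H) (simple_field_eval G)"
    unfolding increment_isometry[OF H G s] total_norm_def distrib_left
    using w(2) by (intro add_mono) (auto intro: order_trans)
qed

lemma total_norm_triangle:
  assumes Z: "(\<lambda>x. Z (fst x) (snd x)) \<in> borel_measurable (time_leb T \<Otimes>\<^sub>M M)"
    and Z': "(\<lambda>x. Z' (fst x) (snd x)) \<in> borel_measurable (time_leb T \<Otimes>\<^sub>M M)"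
    and \<psi>: "(\<lambda>x. \<psi> (fst (fst x)) (snd (fst x)) (snd x)) \<in> borel_measurable ((time_leb T \<Otimes>\<^sub>M M) \<Otimes>\<^sub>M \<nu>)"
    and \<psi>': "(\<lambda>x. \<psi>' (fst (fst x)) (snd (fst x)) (snd x)) \<in> borel_measurable ((time_leb T \<Otimes>\<^sub>M M) \<Otimes>\<^sub>M \<nu>)"
  shows "total_norm s Z \<psi> \<le> 2 * total_norm s Z' \<psi>' +
    2 * ((\<integral>\<^sup>+x. ennreal ((Z' (fst x) (snd x) - Z (fst x) (snd x))\<^sup>2) \<partial>(time_leb T \<Otimes>\<^sub>M M)) +
      (\<integral>\<^sup>+x. ennreal ((\<psi>' (fst (fst x)) (snd (fst x)) (snd x) - \<psi> (fst (fst x)) (snd (fst x)) (snd x))\<^sup>2) \<partial>((time_leb T \<Otimes>\<^sub>M M) \<Otimes>\<^sub>M \<nu>)))"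
proof -
  have i: "indicator A x \<le> (1 :: ennreal)" for A :: "real set" and x by (simp add: indicator_def)
  have "ito_norm M T s Z + jump_norm M T \<nu> s \<psi> \<le>
     (2 * ito_norm M T s Z' + 2 * (\<integral>\<^sup>+x. ennreal ((Z' (fst x) (snd x) - Z (fst x) (snd x))\<^sup>2) \<partial>(time_leb T \<Otimes>\<^sub>M M))) +
     (2 * jump_norm M T \<nu> s \<psi>' + 2 * (\<integral>\<^sup>+x. ennreal ((\<psi>' (fst (fst x)) (snd (fst x)) (snd x) - \<psi> (fst (fst x)) (snd (fst x)) (snd x))\<^sup>2) \<partial>((time_leb T \<Otimes>\<^sub>M M) \<Otimes>\<^sub>M \<nu>)))"
    unfolding ito_norm_def jump_norm_def
    by (intro add_mono nn_integral_square_triangle[OF Z Z' after_measurable(1) i]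
        nn_integral_square_triangle[OF \<psi> \<psi>' after_measurable(2) i])
  then show ?thesis unfolding total_norm_def by (simp add: distrib_left add_ac)
qed

lemma total_norm_triangle':
  assumes Z: "(\<lambda>x. Z (fst x) (snd x)) \<in> borel_measurable (time_leb T \<Otimes>\<^sub>M M)"
    and Z': "(\<lambda>x. Z' (fst x) (snd x)) \<in> borel_measurable (time_leb T \<Otimes>\<^sub>M M)"
    and \<psi>: "(\<lambda>x. \<psi> (fst (fst x)) (snd (fst x)) (snd x)) \<in> borel_measurable ((time_leb T \<Otimes>\<^sub>M M) \<Otimes>\<^sub>M \<nu>)"
    and \<psi>': "(\<lambda>x. \<psi>' (fst (fst x)) (snd (fst x)) (snd x)) \<in> borel_measurable ((time_leb T \<Otimes>\<^sub>M M) \<Otimes>\<^sub>M \<nu>)"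
  shows "total_norm s Z' \<psi>' \<le> 2 * total_norm s Z \<psi> +
    2 * ((\<integral>\<^sup>+x. ennreal ((Z' (fst x) (snd x) - Z (fst x) (snd x))\<^sup>2) \<partial>(time_leb T \<Otimes>\<^sub>M M)) +
      (\<integral>\<^sup>+x. ennreal ((\<psi>' (fst (fst x)) (snd (fst x)) (snd x) - \<psi> (fst (fst x)) (snd (fst x)) (snd x))\<^sup>2) \<partial>((time_leb T \<Otimes>\<^sub>M M) \<Otimes>\<^sub>M \<nu>)))"
proof -
  have c: "(a - b)\<^sup>2 = (b - a)\<^sup>2" for a b :: real by (rule power2_commute)
  show ?thesis
    using total_norm_triangle[OF Z' Z \<psi>' \<psi>, of s]
    by (subst c, subst (2) c)
qed

text \<open>The properties of \<open>increment\<close> pass to the limit. Each direction of the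
  isometry uses two squared triangle inequalities, one for the integrands and one for the integrals;
  each costs a factor 2, whence the 4. The lower bound additionally loses \<open>min 1 c1\<close>
  and the upper one \<open>max 1 c2\<close>, from comparing weighted and unweighted norms.\<close>

lemma stochastic_integral_properties:
  assumes I: "has_ito_integral M F T W Z I" and J: "has_jump_integral M F T \<nu> \<mu> (\<lambda>r _. \<Lambda> r) \<psi> J"
    and s: "s \<in> {0..T}"
  defines "D \<equiv> \<lambda>\<omega>. I T \<omega> - I s \<omega> + (J T \<omega> - J s \<omega>)"
  shows "D \<in> borel_measurable M"
    and "integrable M (\<lambda>\<omega>. (D \<omega>)\<^sup>2)"
    and "ennreal (min 1 c1) * total_norm s Z \<psi> \<le> 4 * (\<integral>\<^sup>+\<omega>. ennreal ((D \<omega>)\<^sup>2) \<partial>M)"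
    and "(\<integral>\<^sup>+\<omega>. ennreal ((D \<omega>)\<^sup>2) \<partial>M) \<le> 4 * (ennreal (max 1 c2) * total_norm s Z \<psi>)"
    and "\<And>k :: 'w \<Rightarrow> real. k \<in> borel_measurable (F s) \<Longrightarrow> integrable M (\<lambda>\<omega>. (k \<omega>)\<^sup>2) \<Longrightarrow> (\<integral>\<omega>. k \<omega> * D \<omega> \<partial>M) = 0"
proof -
  have TT: "T \<in> {0..T}" using T_nonneg by simp
  obtain H where H: "\<And>n. simple_process M F T (H n)"
    and H1: "(\<lambda>n. \<integral>\<^sup>+x. ennreal ((simple_process_eval (H n) (fst x) (snd x) - Z (fst x) (snd x))\<^sup>2) \<partial>(time_leb T \<Otimes>\<^sub>M M)) \<longlonglongrightarrow> 0"
    and H2: "\<And>s. s \<in> {0..T} \<Longrightarrow> (\<lambda>n. \<integral>\<^sup>+\<omega>. ennreal ((simple_ito_integral W (H n) s \<omega> - I s \<omega>)\<^sup>2) \<partial>M) \<longlonglongrightarrow> 0"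
    using I unfolding has_ito_integral_def case_prod_beta' by blast
  obtain G where G: "\<And>n. simple_field M F T \<nu> (G n)"
    and G1: "(\<lambda>n. \<integral>\<^sup>+x. ennreal ((simple_field_eval (G n) (fst (fst x)) (snd (fst x)) (snd x) - \<psi> (fst (fst x)) (snd (fst x)) (snd x))\<^sup>2) \<partial>((time_leb T \<Otimes>\<^sub>M M) \<Otimes>\<^sub>M \<nu>)) \<longlonglongrightarrow> 0"
    and G2: "\<And>s. s \<in> {0..T} \<Longrightarrow> (\<lambda>n. \<integral>\<^sup>+\<omega>. ennreal ((simple_jump_integral \<nu> \<mu> (\<lambda>r _. \<Lambda> r) (G n) s \<omega> - J s \<omega>)\<^sup>2) \<partial>M) \<longlonglongrightarrow> 0"
    using J unfolding has_jump_integral_def case_prod_beta' by blast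
  have Zm: "(\<lambda>x. Z (fst x) (snd x)) \<in> borel_measurable (time_leb T \<Otimes>\<^sub>M M)"
    using I unfolding has_ito_integral_def case_prod_beta' by blast
  have \<psi>m: "(\<lambda>x. \<psi> (fst (fst x)) (snd (fst x)) (snd x)) \<in> borel_measurable ((time_leb T \<Otimes>\<^sub>M M) \<Otimes>\<^sub>M \<nu>)"
    using J unfolding has_jump_integral_def case_prod_beta' by blast
  have Im: "I t \<in> borel_measurable M" "J t \<in> borel_measurable M" if "t \<in> {0..T}" for t
    using I J that cadlag_adapted_measurable by (auto simp: has_ito_integral_def has_jump_integral_def)
  \<comment> \<open>\<open>e n\<close> is the approximation error of the integrands, and
    \<open>d n\<close> below that of the increment of the integrals. Both tend to 0, but they enter
    the estimates separately.\<close>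
  define e where "e n = (\<integral>\<^sup>+x. ennreal ((simple_process_eval (H n) (fst x) (snd x) - Z (fst x) (snd x))\<^sup>2) \<partial>(time_leb T \<Otimes>\<^sub>M M)) +
    (\<integral>\<^sup>+x. ennreal ((simple_field_eval (G n) (fst (fst x)) (snd (fst x)) (snd x) - \<psi> (fst (fst x)) (snd (fst x)) (snd x))\<^sup>2) \<partial>((time_leb T \<Otimes>\<^sub>M M) \<Otimes>\<^sub>M \<nu>))" for n
  have e0: "e \<longlonglongrightarrow> 0" unfolding e_def using tendsto_add[OF H1 G1] by simp
  let ?i = "\<lambda>n. increment (H n) (G n) s"
  define d where "d n = (\<integral>\<^sup>+\<omega>. ennreal ((?i n \<omega> - D \<omega>)\<^sup>2) \<partial>M)" for n
  have im: "?i n \<in> borel_measurable M" for n by (rule increment_measurable[OF H G s])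
  show Dm: "D \<in> borel_measurable M" unfolding D_def using Im s TT by simp
  have d0: "d \<longlonglongrightarrow> 0"
  proof (rule tendsto_sandwich[OF _ _ tendsto_const])
    let ?a = "\<lambda>t n. \<integral>\<^sup>+\<omega>. ennreal ((simple_ito_integral W (H n) t \<omega> - I t \<omega>)\<^sup>2) \<partial>M"
    let ?b = "\<lambda>t n. \<integral>\<^sup>+\<omega>. ennreal ((simple_jump_integral \<nu> \<mu> (\<lambda>r _. \<Lambda> r) (G n) t \<omega> - J t \<omega>)\<^sup>2) \<partial>M"
    have "d n \<le> 4 * (?a T n + ?a s n + (?b T n + ?b s n))" for n
    proof -
      have "d n = (\<integral>\<^sup>+\<omega>. ennreal (((simple_ito_integral W (H n) T \<omega> - I T \<omega>) - (simple_ito_integral W (H n) s \<omega> - I s \<omega>)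
         + ((simple_jump_integral \<nu> \<mu> (\<lambda>r _. \<Lambda> r) (G n) T \<omega> - J T \<omega>) - (simple_jump_integral \<nu> \<mu> (\<lambda>r _. \<Lambda> r) (G n) s \<omega> - J s \<omega>)))\<^sup>2) \<partial>M)"
        unfolding d_def increment_def D_def
        by (intro nn_integral_cong arg_cong[where f = ennreal] arg_cong[where f = "\<lambda>x. x\<^sup>2"]) simp
      also have "\<dots> \<le> 4 * (?a T n + ?a s n + (?b T n + ?b s n))"
        by (intro nn_integral_square_sum4 borel_measurable_diff simple_ito_measurable[OF H] simple_jump_measurable[OF G] Im s TT)
      finally show ?thesis .
    qed
    then show "\<forall>\<^sub>F n in sequentially. d n \<le> 4 * (?a T n + ?a s n + (?b T n + ?b s n))" by simp
    have "(\<lambda>n. 4 * (?a T n + ?a s n + (?b T n + ?b s n))) \<longlonglongrightarrow> 4 * (0 + 0 + (0 + 0))"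
      by (intro ennreal_tendsto_cmult tendsto_add H2 G2 TT s) simp
    then show "(\<lambda>n. 4 * (?a T n + ?a s n + (?b T n + ?b s n))) \<longlonglongrightarrow> 0" by simp
  qed simp
  have tri1: "(\<integral>\<^sup>+\<omega>. ennreal ((D \<omega>)\<^sup>2) \<partial>M) \<le> 2 * (\<integral>\<^sup>+\<omega>. ennreal ((?i n \<omega>)\<^sup>2) \<partial>M) + 2 * d n" for n
    using nn_integral_square_triangle[OF Dm im[of n], of "\<lambda>_. 1"] by (simp add: d_def)
  have tri2: "(\<integral>\<^sup>+\<omega>. ennreal ((?i n \<omega>)\<^sup>2) \<partial>M) \<le> 2 * (\<integral>\<^sup>+\<omega>. ennreal ((D \<omega>)\<^sup>2) \<partial>M) + 2 * d n" for n
    using nn_integral_square_triangle[OF im[of n] Dm, of "\<lambda>_. 1"] by (simp add: d_def power2_commute)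
  have Hm: "(\<lambda>x. simple_process_eval (H n) (fst x) (snd x)) \<in> borel_measurable (time_leb T \<Otimes>\<^sub>M M)" for n
    by (rule simple_process_eval_measurable[OF H])
  have Gm: "(\<lambda>x. simple_field_eval (G n) (fst (fst x)) (snd (fst x)) (snd x)) \<in> borel_measurable ((time_leb T \<Otimes>\<^sub>M M) \<Otimes>\<^sub>M \<nu>)" for n
    by (rule simple_field_eval_measurable[OF G])
  have tn1: "total_norm s Z \<psi> \<le> 2 * total_norm s (simple_process_eval (H n)) (simple_field_eval (G n)) + 2 * e n" for n
    using total_norm_triangle[OF Zm Hm \<psi>m Gm, of s n] by (simp add: e_def)
  have tn2: "total_norm s (simple_process_eval (H n)) (simple_field_eval (G n)) \<le> 2 * total_norm s Z \<psi> + 2 * e n" for n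
    using total_norm_triangle'[OF Zm Hm \<psi>m Gm, of s n] by (simp add: e_def)
  show D2: "integrable M (\<lambda>\<omega>. (D \<omega>)\<^sup>2)"
  proof (rule integrableI_bounded)
    \<comment> \<open>A single approximating integral at finite distance already shows that the
      limit is square-integrable.\<close>
    have "eventually (\<lambda>n. d n < 1) sequentially" by (rule order_tendstoD[OF d0]) simp
    then obtain n where n: "d n < 1" by (auto simp: eventually_sequentially)
    have "(\<integral>\<^sup>+\<omega>. ennreal ((?i n \<omega>)\<^sup>2) \<partial>M) < \<infinity>"
      using increment_square[OF H G s, of n n] by (simp add: integrable_iff_bounded)
    then have "(\<integral>\<^sup>+\<omega>. ennreal ((?i n \<omega>)\<^sup>2) \<partial>M) \<noteq> top" by simp
    moreover have "d n < top" using n by (rule less_trans) simp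
    ultimately have "2 * (\<integral>\<^sup>+\<omega>. ennreal ((?i n \<omega>)\<^sup>2) \<partial>M) + 2 * d n < \<infinity>"
      by (simp add: less_top[symmetric] ennreal_mult_eq_top_iff)
    then show "(\<integral>\<^sup>+\<omega>. ennreal (norm ((D \<omega>)\<^sup>2)) \<partial>M) < \<infinity>"
      using le_less_trans[OF tri1] by simp
  qed (use Dm in simp)
  show "ennreal (min 1 c1) * total_norm s Z \<psi> \<le> 4 * (\<integral>\<^sup>+\<omega>. ennreal ((D \<omega>)\<^sup>2) \<partial>M)"
  proof (rule LIMSEQ_le_const)
    let ?c = "ennreal (min 1 c1)"
    have "ennreal (min 1 c1) * total_norm s Z \<psi> \<le> 4 * (\<integral>\<^sup>+\<omega>. ennreal ((D \<omega>)\<^sup>2) \<partial>M) + (4 * d n + ?c * (2 * e n))" for n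
    proof -
      have "?c * total_norm s Z \<psi> \<le> ?c * (2 * total_norm s (simple_process_eval (H n)) (simple_field_eval (G n)) + 2 * e n)"
        by (intro mult_left_mono tn1) simp
      also have "\<dots> = 2 * (?c * total_norm s (simple_process_eval (H n)) (simple_field_eval (G n))) + ?c * (2 * e n)"
        by (simp add: distrib_left mult_ac)
      also have "\<dots> \<le> 2 * (2 * (\<integral>\<^sup>+\<omega>. ennreal ((D \<omega>)\<^sup>2) \<partial>M) + 2 * d n) + ?c * (2 * e n)"
        by (intro add_right_mono mult_left_mono order_trans[OF increment_bounds(1)[OF H G s] tri2]) simp
      also have "\<dots> = 4 * (\<integral>\<^sup>+\<omega>. ennreal ((D \<omega>)\<^sup>2) \<partial>M) + (4 * d n + ?c * (2 * e n))"
        by (simp add: distrib_left add_ac flip: mult.assoc)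
      finally show ?thesis .
    qed
    then show "\<exists>N. \<forall>n\<ge>N. ennreal (min 1 c1) * total_norm s Z \<psi> \<le> 4 * (\<integral>\<^sup>+\<omega>. ennreal ((D \<omega>)\<^sup>2) \<partial>M) + (4 * d n + ?c * (2 * e n))" by blast
    have "(\<lambda>n. 4 * (\<integral>\<^sup>+\<omega>. ennreal ((D \<omega>)\<^sup>2) \<partial>M) + (4 * d n + ?c * (2 * e n))) \<longlonglongrightarrow> 4 * (\<integral>\<^sup>+\<omega>. ennreal ((D \<omega>)\<^sup>2) \<partial>M) + (4 * 0 + ?c * (2 * 0))"
      by (intro tendsto_add tendsto_const ennreal_tendsto_cmult d0 e0) auto
    then show "(\<lambda>n. 4 * (\<integral>\<^sup>+\<omega>. ennreal ((D \<omega>)\<^sup>2) \<partial>M) + (4 * d n + ?c * (2 * e n))) \<longlonglongrightarrow> 4 * (\<integral>\<^sup>+\<omega>. ennreal ((D \<omega>)\<^sup>2) \<partial>M)"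
      by simp
  qed
  show "(\<integral>\<^sup>+\<omega>. ennreal ((D \<omega>)\<^sup>2) \<partial>M) \<le> 4 * (ennreal (max 1 c2) * total_norm s Z \<psi>)"
  proof (rule LIMSEQ_le_const)
    let ?c = "ennreal (max 1 c2)"
    have "(\<integral>\<^sup>+\<omega>. ennreal ((D \<omega>)\<^sup>2) \<partial>M) \<le> 4 * (?c * total_norm s Z \<psi>) + (2 * d n + 2 * (?c * (2 * e n)))" for n
    proof -
      have "(\<integral>\<^sup>+\<omega>. ennreal ((D \<omega>)\<^sup>2) \<partial>M) \<le> 2 * (?c * (2 * total_norm s Z \<psi> + 2 * e n)) + 2 * d n"
        by (intro order_trans[OF tri1[of n]] add_right_mono mult_left_mono order_trans[OF increment_bounds(2)[OF H G s]] tn2) simp_all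
      also have "\<dots> = 4 * (?c * total_norm s Z \<psi>) + (2 * d n + 2 * (?c * (2 * e n)))"
        by (simp add: distrib_left mult_ac add_ac)
      finally show ?thesis .
    qed
    then show "\<exists>N. \<forall>n\<ge>N. (\<integral>\<^sup>+\<omega>. ennreal ((D \<omega>)\<^sup>2) \<partial>M) \<le> 4 * (?c * total_norm s Z \<psi>) + (2 * d n + 2 * (?c * (2 * e n)))" by blast
    have "(\<lambda>n. 4 * (?c * total_norm s Z \<psi>) + (2 * d n + 2 * (?c * (2 * e n)))) \<longlonglongrightarrow> 4 * (?c * total_norm s Z \<psi>) + (2 * 0 + 2 * (?c * (2 * 0)))"
      by (intro tendsto_add tendsto_const ennreal_tendsto_cmult d0 e0) auto
    then show "(\<lambda>n. 4 * (?c * total_norm s Z \<psi>) + (2 * d n + 2 * (?c * (2 * e n)))) \<longlonglongrightarrow> 4 * (?c * total_norm s Z \<psi>)" by simp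
  qed
  fix k :: "'w \<Rightarrow> real" assume k: "k \<in> borel_measurable (F s)" "integrable M (\<lambda>\<omega>. (k \<omega>)\<^sup>2)"
  have kM: "k \<in> borel_measurable M" by (rule measurable_F[OF s k(1)])
  define E where "E = (\<integral>\<omega>. k \<omega> * D \<omega> \<partial>M)"
  define K where "K = (\<integral>\<omega>. (k \<omega>)\<^sup>2 \<partial>M)"
  have K0: "0 \<le> K" unfolding K_def by (rule Bochner_Integration.integral_nonneg) simp
  \<comment> \<open>Orthogonality passes to the limit through |x y| \<le> \<eta> x^2 + y^2/\<eta>:
    for fixed \<open>\<eta>\<close> the second term disappears as \<open>n\<close> grows, and then
    \<open>\<eta>\<close> is sent to 0.\<close>
  have bound: "\<bar>E\<bar> \<le> \<eta> * K" if \<eta>: "\<eta> > 0" for \<eta>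
  proof -
    have rsq: "integrable M (\<lambda>\<omega>. (?i n \<omega> - D \<omega>)\<^sup>2)" for n
      by (rule integrable_square_diff[OF im Dm increment_square[OF H G s] D2])
    have dn: "d n = ennreal (\<integral>\<omega>. (?i n \<omega> - D \<omega>)\<^sup>2 \<partial>M)" for n
      unfolding d_def by (rule nn_integral_eq_integral[OF rsq]) simp
    have "(\<lambda>n. \<integral>\<omega>. (?i n \<omega> - D \<omega>)\<^sup>2 \<partial>M) \<longlonglongrightarrow> 0"
      using d0 unfolding dn[abs_def] by (subst (asm) ennreal_0[symmetric], subst (asm) tendsto_ennreal_iff) auto
    then have lim: "(\<lambda>n. \<eta> * K + (\<integral>\<omega>. (?i n \<omega> - D \<omega>)\<^sup>2 \<partial>M) / \<eta>) \<longlonglongrightarrow> \<eta> * K + 0 / \<eta>"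
      using \<eta> by (intro tendsto_intros) auto
    have "\<bar>E\<bar> \<le> \<eta> * K + (\<integral>\<omega>. (?i n \<omega> - D \<omega>)\<^sup>2 \<partial>M) / \<eta>" for n
    proof -
      have ki: "integrable M (\<lambda>\<omega>. k \<omega> * (?i n \<omega> - D \<omega>))"
        by (rule integrable_mult_L2[OF kM _ k(2) rsq]) (use im Dm in simp)
      have "(\<integral>\<omega>. k \<omega> * (?i n \<omega> - D \<omega>) \<partial>M) = (\<integral>\<omega>. k \<omega> * ?i n \<omega> \<partial>M) - (\<integral>\<omega>. k \<omega> * D \<omega> \<partial>M)"
        unfolding right_diff_distrib
        by (intro Bochner_Integration.integral_diff integrable_mult_L2 kM im Dm k D2 increment_square[OF H G s])
      then have "\<bar>E\<bar> = \<bar>\<integral>\<omega>. k \<omega> * (?i n \<omega> - D \<omega>) \<partial>M\<bar>"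
        using increment_orthogonal[OF H G s k, of n n] by (simp add: E_def)
      also have "\<dots> \<le> (\<integral>\<omega>. \<bar>k \<omega> * (?i n \<omega> - D \<omega>)\<bar> \<partial>M)" by (rule integral_abs_bound)
      also have "\<dots> \<le> (\<integral>\<omega>. \<eta> * (k \<omega>)\<^sup>2 + (?i n \<omega> - D \<omega>)\<^sup>2 / \<eta> \<partial>M)"
      proof (rule integral_mono)
        show "integrable M (\<lambda>\<omega>. \<eta> * (k \<omega>)\<^sup>2 + (?i n \<omega> - D \<omega>)\<^sup>2 / \<eta>)" using k(2) rsq by simp
        fix \<omega>
        have *: "\<bar>x * y\<bar> \<le> \<eta> * x\<^sup>2 + y\<^sup>2 / \<eta>" for x y :: real
        proof -
          have "0 \<le> (\<eta> * \<bar>x\<bar> - \<bar>y\<bar> / 2)\<^sup>2" by simp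
          then have "\<eta> * \<bar>x\<bar> * \<bar>y\<bar> \<le> \<eta>\<^sup>2 * x\<^sup>2 + y\<^sup>2 / 4"
            by (simp add: power2_diff power_mult_distrib power_divide)
          also have "\<dots> \<le> \<eta>\<^sup>2 * x\<^sup>2 + y\<^sup>2" by simp
          finally have "\<eta> * \<bar>x * y\<bar> \<le> \<eta> * (\<eta> * x\<^sup>2 + y\<^sup>2 / \<eta>)"
            using \<eta> by (simp add: abs_mult distrib_left power2_eq_square mult.assoc)
          then show ?thesis using \<eta> by simp
        qed
        show "\<bar>k \<omega> * (?i n \<omega> - D \<omega>)\<bar> \<le> \<eta> * (k \<omega>)\<^sup>2 + (?i n \<omega> - D \<omega>)\<^sup>2 / \<eta>" by (rule *)
      qed (use ki in simp)
      also have "\<dots> = \<eta> * K + (\<integral>\<omega>. (?i n \<omega> - D \<omega>)\<^sup>2 \<partial>M) / \<eta>"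
        using k(2) rsq by (simp add: K_def)
      finally show ?thesis .
    qed
    then have "\<bar>E\<bar> \<le> \<eta> * K + 0 / \<eta>" by (intro LIMSEQ_le_const[OF lim]) blast
    then show ?thesis by simp
  qed
  have "\<bar>E\<bar> \<le> 0"
  proof (rule field_le_epsilon)
    fix \<epsilon> :: real assume \<epsilon>: "\<epsilon> > 0"
    have "\<bar>E\<bar> \<le> \<epsilon> / (K + 1) * K" by (rule bound) (use \<epsilon> K0 in auto)
    also have "\<dots> \<le> \<epsilon>" using \<epsilon> K0 by (simp add: field_simps)
    finally show "\<bar>E\<bar> \<le> 0 + \<epsilon>" by simp
  qed
  then show "(\<integral>\<omega>. k \<omega> * D \<omega> \<partial>M) = 0" by (simp add: E_def)
qed

end

subsection \<open>Moments of the jump counts\<close>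

text \<open>Factorial moments: the factors k and k (k - 1) cancel against the factorial and shift
  the exponential series by one or two places. The second moment is then the sum of the first two
  factorial moments.\<close>

lemma sums_poisson:
  fixes m :: real
  shows "(\<lambda>k. m ^ k / fact k * exp (- m)) sums 1"
    and "(\<lambda>k. real k * (m ^ k / fact k * exp (- m))) sums m"
    and "(\<lambda>k. (real k)\<^sup>2 * (m ^ k / fact k * exp (- m))) sums (m + m\<^sup>2)"
proof -
  have e: "(\<lambda>k. m ^ k / fact k) sums exp m"
    using exp_converges[of m] by (simp add: divide_inverse_commute)
  show 0: "(\<lambda>k. m ^ k / fact k * exp (- m)) sums 1"
    using sums_mult2[OF e, of "exp (- m)"] by (simp flip: exp_add)
  have "(\<lambda>k. real (Suc k) * (m ^ Suc k / fact (Suc k) * exp (- m))) sums (m * 1)"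
    using sums_mult[OF 0, of m] by (simp add: fact_Suc field_simps del: of_nat_Suc)
  from sums_Suc[OF this] show 1: "(\<lambda>k. real k * (m ^ k / fact k * exp (- m))) sums m"
    by simp
  have "real (Suc (Suc k)) * real (Suc k) * (m ^ Suc (Suc k) / fact (Suc (Suc k)) * exp (- m)) = m\<^sup>2 * (m ^ k / fact k * exp (- m))" for k
    by (simp add: fact_Suc power2_eq_square field_simps del: of_nat_Suc)
  then have "(\<lambda>k. real (Suc (Suc k)) * real (Suc k) * (m ^ Suc (Suc k) / fact (Suc (Suc k)) * exp (- m))) sums (m\<^sup>2 * 1)"
    by (simp only: sums_mult[OF 0])
  from sums_Suc[OF this] have "(\<lambda>k. real (Suc k) * real k * (m ^ Suc k / fact (Suc k) * exp (- m))) sums m\<^sup>2"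
    by simp
  then have "(\<lambda>k. real (Suc k) * (real (Suc k) - 1) * (m ^ Suc k / fact (Suc k) * exp (- m))) sums m\<^sup>2" by simp
  from sums_Suc[OF this] have "(\<lambda>k. real k * (real k - 1) * (m ^ k / fact k * exp (- m))) sums m\<^sup>2" by simp
  from sums_add[OF 1 this] show "(\<lambda>k. (real k)\<^sup>2 * (m ^ k / fact k * exp (- m))) sums (m + m\<^sup>2)"
    unfolding distrib_right[symmetric] by (simp add: power2_eq_square right_diff_distrib)
qed

text \<open>Only the probabilities of the natural values are given. They add up to 1, so the
  extended-valued count is almost surely a natural number, and expectations become series over these
  values.\<close>

lemma (in prob_space) poisson_moments:
  fixes n :: "'a \<Rightarrow> ennreal"
  assumes [measurable]: "n \<in> borel_measurable M" and m: "0 \<le> m"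
    and dist: "\<And>k::nat. measure M {\<omega>\<in>space M. n \<omega> = of_nat k} = m ^ k / fact k * exp (- m)"
  shows "AE \<omega> in M. n \<omega> < \<infinity>"
    and "integrable M (\<lambda>\<omega>. enn2real (n \<omega>))" "(\<integral>\<omega>. enn2real (n \<omega>) \<partial>M) = m"
    and "integrable M (\<lambda>\<omega>. (enn2real (n \<omega>))\<^sup>2)" "(\<integral>\<omega>. (enn2real (n \<omega>))\<^sup>2 \<partial>M) = m + m\<^sup>2"
proof -
  let ?E = "\<lambda>k::nat. {\<omega>\<in>space M. n \<omega> = of_nat k}"
  have E: "?E k \<in> sets M" for k by simp
  have "(\<lambda>k. measure M (?E k)) sums measure M (\<Union>k. ?E k)"
    by (rule finite_measure_UNION) (use E in \<open>auto simp: disjoint_family_on_def\<close>)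
  then have "measure M (\<Union>k. ?E k) = 1"
    unfolding dist using sums_poisson(1)[of m] sums_unique2 by blast
  then have AE: "AE \<omega> in M. \<omega> \<in> (\<Union>k. ?E k)"
    using E by (subst (asm) prob_eq_1) auto
  then show "AE \<omega> in M. n \<omega> < \<infinity>" by eventually_elim (auto simp: of_nat_less_top)
  \<comment> \<open>A nonnegative integrand keeps the computation in extended reals, with
    integrability as a consequence. This is why the first moment is obtained from
    \<open>\<lambda>x. \<bar>x\<bar>\<close> and not from the identity.\<close>
  have main: "(\<integral>\<^sup>+\<omega>. ennreal (g (enn2real (n \<omega>))) \<partial>M) = ennreal s"
    if g: "\<And>x. 0 \<le> g x" "g \<in> borel_measurable borel" and s: "(\<lambda>k. g (real k) * (m ^ k / fact k * exp (- m))) sums s" for g s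
  proof -
    have "(\<integral>\<^sup>+\<omega>. ennreal (g (enn2real (n \<omega>))) \<partial>M) = (\<integral>\<^sup>+\<omega>. (\<Sum>k. ennreal (g (real k)) * indicator (?E k) \<omega>) \<partial>M)"
    proof (rule nn_integral_cong_AE)
      show "AE \<omega> in M. ennreal (g (enn2real (n \<omega>))) = (\<Sum>k. ennreal (g (real k)) * indicator (?E k) \<omega>)"
        using AE
      proof eventually_elim
        case (elim \<omega>)
        then obtain j where j: "n \<omega> = of_nat j" "\<omega> \<in> space M" by auto
        have "(\<Sum>k. ennreal (g (real k)) * indicator (?E k) \<omega>) = (\<Sum>k\<in>{j}. ennreal (g (real k)) * indicator (?E k) \<omega>)"
          using j by (intro suminf_finite) auto
        then show ?case using j by (simp add: ennreal_of_nat_eq_real_of_nat)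
      qed
    qed
    also have "\<dots> = (\<Sum>k. ennreal (g (real k)) * emeasure M (?E k))"
      by (subst nn_integral_suminf) (auto simp: nn_integral_cmult_indicator)
    also have "\<dots> = (\<Sum>k. ennreal (g (real k) * (m ^ k / fact k * exp (- m))))"
      using m by (intro suminf_cong) (simp only: emeasure_eq_measure dist, intro ennreal_mult[symmetric] g, simp)
    also have "\<dots> = ennreal s"
      unfolding sums_unique[OF s]
      by (rule suminf_ennreal2[OF _ sums_summable[OF s]]) (use m g in simp)
    finally show ?thesis .
  qed
  have m2: "0 \<le> m + m\<^sup>2" using m by simp
  have 1: "(\<integral>\<^sup>+\<omega>. ennreal (enn2real (n \<omega>)) \<partial>M) = ennreal m"
    using main[of "\<lambda>x. \<bar>x\<bar>" m] sums_poisson(2)[of m] by simp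
  have 2: "(\<integral>\<^sup>+\<omega>. ennreal ((enn2real (n \<omega>))\<^sup>2) \<partial>M) = ennreal (m + m\<^sup>2)"
    using main[of "\<lambda>x. x\<^sup>2" "m + m\<^sup>2"] sums_poisson(3)[of m] by simp
  show "integrable M (\<lambda>\<omega>. enn2real (n \<omega>))" "integrable M (\<lambda>\<omega>. (enn2real (n \<omega>))\<^sup>2)"
    by (rule integrableI_nonneg; simp add: 1 2)+
  show "(\<integral>\<omega>. enn2real (n \<omega>) \<partial>M) = m" using 1 m by (subst integral_eq_nn_integral) auto
  show "(\<integral>\<omega>. (enn2real (n \<omega>))\<^sup>2 \<partial>M) = m + m\<^sup>2" using 2 m2 by (subst integral_eq_nn_integral) auto
qed

lemma emeasure_time_leb_interval:
  assumes "0 \<le> a" "a \<le> b" "b \<le> T"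
  shows "emeasure (time_leb T) {a<..b} = ennreal (b - a)" "{a<..b} \<in> sets (time_leb T)"
proof -
  have s: "{a<..b} \<subseteq> {0..T}" using assms by auto
  show "emeasure (time_leb T) {a<..b} = ennreal (b - a)"
    unfolding time_leb_def using assms s by (subst emeasure_restrict_space) auto
  show "{a<..b} \<in> sets (time_leb T)"
    using interval_time_leb[of a b T] s by (simp add: Int_absorb2)
qed

lemma poisson_jump_moments:
  assumes F: "filtered_prob_space M F T" and T: "0 \<le> T" and \<nu>: "sets \<nu> = sets R0" "sigma_finite_measure \<nu>"
    and P: "poisson_random_measure M F T \<nu> \<mu>"
  shows "jump_moments M F T \<nu> \<mu> (\<lambda>_. 1)"
proof -
  interpret filtered_prob_space M F T by (rule F)
  interpret \<nu>: sigma_finite_measure \<nu> by (rule \<nu>)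
  have rm: "random_measure M F T \<mu>" using P by (simp add: poisson_random_measure_def)
  { fix A a b assume A: "A \<in> sets \<nu>" "emeasure \<nu> A < \<infinity>" and t: "0 \<le> a" "a \<le> b" "b \<le> T"
    define B where "B = {a<..b} \<times> A"
    have B: "B \<in> sets (mark_space T)"
      unfolding B_def using A t by (intro interval_times_mark_space) (auto simp: \<nu>)
    have Bb: "B \<subseteq> {0..b} \<times> UNIV" using t by (auto simp: B_def)
    have nb: "(\<lambda>\<omega>. emeasure (\<mu> \<omega>) B) \<in> borel_measurable (F b)"
      using rm t B Bb unfolding random_measure_def by auto
    have n: "(\<lambda>\<omega>. emeasure (\<mu> \<omega>) B) \<in> borel_measurable M" by (rule measurable_F[OF _ nb]) (use t in auto)
    have eB: "emeasure (time_leb T \<Otimes>\<^sub>M \<nu>) B = ennreal (b - a) * emeasure \<nu> A"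
      unfolding B_def using \<nu>.emeasure_pair_measure_Times[OF emeasure_time_leb_interval(2)[OF t] A(1)]
      by (simp add: emeasure_time_leb_interval[OF t])
    then have fin: "emeasure (time_leb T \<Otimes>\<^sub>M \<nu>) B < \<infinity>" using A by (simp add: ennreal_mult_less_top)
    have mB: "measure (time_leb T \<Otimes>\<^sub>M \<nu>) B = (b - a) * measure \<nu> A"
      using eB t by (simp add: measure_def enn2real_mult)
    have dist: "measure M {\<omega>\<in>space M. emeasure (\<mu> \<omega>) B = of_nat k} =
        ((b - a) * measure \<nu> A) ^ k / fact k * exp (- ((b - a) * measure \<nu> A))" for k :: nat
      using P B fin unfolding poisson_random_measure_def mB[symmetric] by blast
    have L: "(LBINT r:{a<..b}. (1::real)) = b - a" using t by (simp add: set_lebesgue_integral_def)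
    note pm = poisson_moments[OF n _ dist]
    have m0: "0 \<le> (b - a) * measure \<nu> A" using t by simp
    \<comment> \<open>The count over \<open>(a, b]\<close> is determined by the points of
      \<open>\<mu>\<close> after time \<open>a\<close>, which are independent of \<open>F a\<close>.
      It is stated for a function \<open>g\<close> of the count so that both moments are
      covered.\<close>
    have indep: "(\<integral>\<omega>. k \<omega> * g (measure (\<mu> \<omega>) B) \<partial>M) = (\<integral>\<omega>. k \<omega> \<partial>M) * (\<integral>\<omega>. g (measure (\<mu> \<omega>) B) \<partial>M)"
      if k: "k \<in> borel_measurable (F a)" "bounded (k ` space M)"
        and g: "g \<in> borel_measurable borel" "integrable M (\<lambda>\<omega>. g (measure (\<mu> \<omega>) B))" for k g :: "_ \<Rightarrow> real"
    proof (rule indep_F_integral[OF _ _ _ _ g(2) k(1)])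
      show "a \<in> {0..T}" using t by auto
      then show "indep_set (sets (F a)) (random_measure_algebra M T \<mu> ({a<..T} \<times> UNIV))"
        using P by (simp add: poisson_random_measure_def)
      fix S :: "real set" assume "S \<in> sets borel"
      then have "g -` S \<in> sets borel" using measurable_sets[OF g(1)] by force
      then have "enn2real -` (g -` S) \<in> sets borel" using measurable_sets[OF borel_measurable_enn2real[OF measurable_ident]] by force
      then have "{\<omega>\<in>space M. emeasure (\<mu> \<omega>) B \<in> enn2real -` (g -` S)} \<in> random_measure_algebra M T \<mu> ({a<..T} \<times> UNIV)"
        unfolding random_measure_algebra_def using B t
        by (intro sigma_sets.Basic CollectI exI[of _ B] exI[of _ "enn2real -` g -` S"] conjI refl) (auto simp: B_def)
      moreover have "{\<omega>\<in>space M. emeasure (\<mu> \<omega>) B \<in> enn2real -` (g -` S)} = (\<lambda>\<omega>. g (measure (\<mu> \<omega>) B)) -` S \<inter> space M"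
        by (auto simp: measure_def)
      ultimately show "(\<lambda>\<omega>. g (measure (\<mu> \<omega>) B)) -` S \<inter> space M \<in> random_measure_algebra M T \<mu> ({a<..T} \<times> UNIV)" by simp
    next
      show "integrable M k"
        by (rule integrable_of_bounded[OF measurable_F[OF _ k(1)] k(2)]) (use t in auto)
    qed (use g in auto)
    have "AE \<omega> in M. emeasure (\<mu> \<omega>) B < \<infinity>" by (rule pm(1)[OF m0])
    moreover have sq: "integrable M (\<lambda>\<omega>. (measure (\<mu> \<omega>) B)\<^sup>2)" "integrable M (\<lambda>\<omega>. measure (\<mu> \<omega>) B)"
      using pm(2,4)[OF m0] by (simp_all add: measure_def)
    moreover have "(\<integral>\<omega>. k \<omega> * measure (\<mu> \<omega>) B \<partial>M) = (\<integral>\<omega>. k \<omega> \<partial>M) * ((LBINT r:{a<..b}. 1) * measure \<nu> A)"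
       "(\<integral>\<omega>. k \<omega> * (measure (\<mu> \<omega>) B)\<^sup>2 \<partial>M) =
       (\<integral>\<omega>. k \<omega> \<partial>M) * ((LBINT r:{a<..b}. 1) * measure \<nu> A + ((LBINT r:{a<..b}. 1) * measure \<nu> A)\<^sup>2)"
      if "k \<in> borel_measurable (F a)" "bounded (k ` space M)" for k :: "_ \<Rightarrow> real"
      unfolding L using indep[OF that, of "\<lambda>x. x"] indep[OF that, of "\<lambda>x. x\<^sup>2"] pm(3,5)[OF m0] sq by (simp_all add: measure_def)
    ultimately have "AE \<omega> in M. emeasure (\<mu> \<omega>) ({a<..b} \<times> A) < \<infinity>"
      "integrable M (\<lambda>\<omega>. (measure (\<mu> \<omega>) ({a<..b} \<times> A))\<^sup>2)"
      "\<And>k. k \<in> borel_measurable (F a) \<Longrightarrow> bounded (k ` space M) \<Longrightarrow>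
         (\<integral>\<omega>. k \<omega> * measure (\<mu> \<omega>) ({a<..b} \<times> A) \<partial>M) = (\<integral>\<omega>. k \<omega> \<partial>M) * ((LBINT r:{a<..b}. 1) * measure \<nu> A)"
      "\<And>k. k \<in> borel_measurable (F a) \<Longrightarrow> bounded (k ` space M) \<Longrightarrow>
         (\<integral>\<omega>. k \<omega> * (measure (\<mu> \<omega>) ({a<..b} \<times> A))\<^sup>2 \<partial>M) =
         (\<integral>\<omega>. k \<omega> \<partial>M) * ((LBINT r:{a<..b}. 1) * measure \<nu> A + ((LBINT r:{a<..b}. 1) * measure \<nu> A)\<^sup>2)"
      unfolding B_def by blast+ }
  note main = this
  show ?thesis
  proof
    show "set_integrable lborel {0..T} (\<lambda>_. 1 :: real)" by (rule borel_integrable_atLeastAtMost') simp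
  qed (use \<nu> rm T in \<open>auto intro!: main main(1)[simplified]\<close>)
qed

text \<open>The degenerate driver without jumps. It makes the isometry available for
  \<open>W\<close> alone at a stage where the true intensity may still be random.\<close>

lemma null_jump_moments:
  assumes F: "filtered_prob_space M F T"
  shows "jump_moments M F T (null_measure R0) (\<lambda>_. null_measure (mark_space T)) (\<lambda>_. 1)"
proof -
  interpret filtered_prob_space M F T by (rule F)
  show ?thesis
  proof
    show "set_integrable lborel {0..T} (\<lambda>_. 1 :: real)" by (rule borel_integrable_atLeastAtMost') simp
  qed (auto simp: random_measure_def)
qed

section \<open>Counts of a random measure known through its compensator\<close>

lemma predictable_algebra_sets:
  assumes F: "filtered_prob_space M F T" and T: "0 \<le> T"
  shows "space (predictable_algebra M F T) = {0..T} \<times> space M"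
    and "sets (predictable_algebra M F T) = sigma_sets ({0..T} \<times> space M)
     ({{0} \<times> A | A. A \<in> sets (F 0)} \<union>
      {{s<..t} \<times> A | s t A. 0 \<le> s \<and> s \<le> t \<and> t \<le> T \<and> A \<in> sets (F s)})"
proof -
  interpret filtered_prob_space M F T by (rule F)
  have "A \<subseteq> space M" if "A \<in> sets (F s)" "0 \<le> s" "s \<le> T" for A s
    using sets.sets_into_space[OF that(1)] space_F[of s] that by simp
  then have "({{0} \<times> A | A. A \<in> sets (F 0)} \<union>
      {{s<..t} \<times> A | s t A. 0 \<le> s \<and> s \<le> t \<and> t \<le> T \<and> A \<in> sets (F s)}) \<subseteq> Pow ({0..T} \<times> space M)"
    using T by fastforce
  then show "space (predictable_algebra M F T) = {0..T} \<times> space M"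
    "sets (predictable_algebra M F T) = sigma_sets ({0..T} \<times> space M)
     ({{0} \<times> A | A. A \<in> sets (F 0)} \<union>
      {{s<..t} \<times> A | s t A. 0 \<le> s \<and> s \<le> t \<and> t \<le> T \<and> A \<in> sets (F s)})"
    unfolding predictable_algebra_def by (simp_all add: space_measure_of_conv sets_measure_of)
qed

lemma predictable_rectangle:
  fixes k :: "'w \<Rightarrow> ennreal"
  assumes F: "filtered_prob_space M F T" and t: "0 \<le> a" "a \<le> b" "b \<le> T" and k: "k \<in> borel_measurable (F a)"
  shows "(\<lambda>p. k (snd p) * indicator {a<..b} (fst p)) \<in> borel_measurable (predictable_algebra M F T)"
proof (rule borel_measurableI_greater)
  interpret filtered_prob_space M F T by (rule F)
  have T: "0 \<le> T" using t by linarith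
  note p = predictable_algebra_sets[OF F T]
  fix y :: ennreal
  have e: "{x \<in> space (predictable_algebra M F T). y < k (snd x) * indicator {a<..b} (fst x)} = {a<..b} \<times> {\<omega> \<in> space (F a). y < k \<omega>}"
    unfolding p(1) using t space_F[of a] by (auto simp: indicator_def split: if_splits)
  have "{\<omega> \<in> space (F a). y < k \<omega>} \<in> sets (F a)" using k by measurable
  then show "{x \<in> space (predictable_algebra M F T). y < k (snd x) * indicator {a<..b} (fst x)} \<in> sets (predictable_algebra M F T)"
    unfolding e p(2) using t by (intro sigma_sets.Basic) blast
qed

text \<open>Punctured neighbourhoods of a time \<open>t\<close> decrease to the empty set, so their
  measure, being an integer, is eventually 0, while the time \<open>t\<close> itself carries at most
  one point. Hence every time has a neighbourhood with at most one point, and a Lebesgue number of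
  this cover of \<open>[0, T]\<close> serves as \<open>\<delta>\<close>.\<close>

lemma integer_valued_short_interval:
  assumes S: "sets \<mu>\<^sub>\<omega> = sets (mark_space T)" and A: "A \<in> sets R0" and T: "0 \<le> T"
    and fin: "emeasure \<mu>\<^sub>\<omega> ({0<..T} \<times> A) < \<infinity>"
    and int: "\<And>B. B \<in> sets (mark_space T) \<Longrightarrow> emeasure \<mu>\<^sub>\<omega> B = \<infinity> \<or> emeasure \<mu>\<^sub>\<omega> B \<in> range of_nat"
    and simple: "\<And>t. t \<in> {0..T} \<Longrightarrow> emeasure \<mu>\<^sub>\<omega> ({t} \<times> (- {0})) \<le> 1"
  obtains \<delta> where "\<delta> > 0"
    "\<And>u v. 0 \<le> u \<Longrightarrow> u \<le> v \<Longrightarrow> v \<le> T \<Longrightarrow> v - u < \<delta> \<Longrightarrow> measure \<mu>\<^sub>\<omega> ({u<..v} \<times> A) \<in> {0, 1}"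
proof -
  have rect: "U \<times> C \<in> sets \<mu>\<^sub>\<omega>" if "U \<in> sets borel" "U \<subseteq> {0..T}" "C \<in> sets R0" for U C
  proof -
    have "U \<in> sets (restrict_space borel {0..T})"
      using that by (auto simp: sets_restrict_space_iff)
    then show ?thesis unfolding S mark_space_def using that by (intro pair_measureI)
  qed
  have R0: "- {0} \<in> sets R0" unfolding R0_def sets_restrict_space by auto
  have A0: "A \<subseteq> - {0}" using sets.sets_into_space[OF A] by (simp add: R0_def space_restrict_space)
  have mono: "emeasure \<mu>\<^sub>\<omega> (U \<times> A) \<le> emeasure \<mu>\<^sub>\<omega> ({0<..T} \<times> A)" if "U \<subseteq> {0<..T}" for U
    using that T by (intro emeasure_mono rect A) auto
  have "\<exists>e>0. emeasure \<mu>\<^sub>\<omega> (({t - e<..<t + e} \<inter> {0<..T}) \<times> A) \<le> 1" if t: "t \<in> {0..T}" for t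
  proof -
    define V where "V n = ({t - 1 / real (Suc n)<..<t + 1 / real (Suc n)} - {t}) \<inter> {0<..T}" for n
    have VS: "V n \<times> A \<in> sets \<mu>\<^sub>\<omega>" for n unfolding V_def by (intro rect A) auto
    have Vf: "emeasure \<mu>\<^sub>\<omega> (V n \<times> A) \<noteq> \<infinity>" for n
      using mono[of "V n"] fin by (fastforce simp: V_def top_unique)
    have dec: "decseq (\<lambda>n. V n \<times> A)"
    proof (rule decseq_SucI)
      fix n
      have "1 / real (Suc (Suc n)) \<le> 1 / real (Suc n)" by (rule divide_left_mono) auto
      then show "V (Suc n) \<times> A \<le> V n \<times> A" unfolding V_def by fastforce
    qed
    have "(\<Inter>n. V n \<times> A) = {}"
    proof (rule ccontr)
      assume "(\<Inter>n. V n \<times> A) \<noteq> {}"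
      then obtain u z where u: "\<And>n. u \<in> V n" by auto
      have "u \<noteq> t" using u[of 0] by (auto simp: V_def)
      then have "0 < \<bar>u - t\<bar>" by simp
      then obtain n where "inverse (real (Suc n)) < \<bar>u - t\<bar>" using reals_Archimedean by blast
      then have "1 / real (Suc n) < \<bar>u - t\<bar>" by (simp only: inverse_eq_divide)
      then show False using u[of n] unfolding V_def by (simp del: of_nat_Suc) linarith
    qed
    then have "(\<lambda>n. emeasure \<mu>\<^sub>\<omega> (V n \<times> A)) \<longlonglongrightarrow> 0"
      using Lim_emeasure_decseq[OF _ dec Vf] VS by auto
    then have "eventually (\<lambda>n. emeasure \<mu>\<^sub>\<omega> (V n \<times> A) < 1) sequentially"
      by (rule order_tendstoD) simp
    then obtain n where n: "emeasure \<mu>\<^sub>\<omega> (V n \<times> A) < 1" by (auto simp: eventually_sequentially)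
    obtain j :: nat where j: "emeasure \<mu>\<^sub>\<omega> (V n \<times> A) = of_nat j"
      using int[of "V n \<times> A"] VS[of n] Vf[of n] S by auto
    have z: "emeasure \<mu>\<^sub>\<omega> (V n \<times> A) = 0" using n unfolding j by simp
    have "emeasure \<mu>\<^sub>\<omega> (({t - 1 / real (Suc n)<..<t + 1 / real (Suc n)} \<inter> {0<..T}) \<times> A) \<le> emeasure \<mu>\<^sub>\<omega> (V n \<times> A \<union> {t} \<times> (- {0}))"
      using VS A0 rect[OF _ _ R0, of "{t}"] t by (intro emeasure_mono) (auto simp: V_def)
    also have "\<dots> \<le> emeasure \<mu>\<^sub>\<omega> (V n \<times> A) + emeasure \<mu>\<^sub>\<omega> ({t} \<times> (- {0}))"
      using VS rect[OF _ _ R0, of "{t}"] t by (intro emeasure_subadditive) auto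
    also have "\<dots> \<le> 1" using z simple[OF t] by simp
    finally show ?thesis by (intro exI[of _ "1 / real (Suc n)"]) (simp del: of_nat_Suc)
  qed
  then obtain e where e: "\<And>t. t \<in> {0..T} \<Longrightarrow> e t > 0 \<and> emeasure \<mu>\<^sub>\<omega> (({t - e t<..<t + e t} \<inter> {0<..T}) \<times> A) \<le> 1"
    by metis
  define C where "C = (\<lambda>t. {t - e t<..<t + e t}) ` {0..T}"
  obtain \<delta> where \<delta>: "0 < \<delta>" "\<And>U. U \<subseteq> {0..T} \<Longrightarrow> diameter U < \<delta> \<Longrightarrow> \<exists>B\<in>C. U \<subseteq> B"
  proof (rule Lebesgue_number_lemma[of "{0..T}" C])
    show "C \<noteq> {}" using T by (auto simp: C_def)
    show "{0..T} \<subseteq> \<Union> C"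
    proof
      fix t assume t: "t \<in> {0..T}"
      have "t \<in> {t - e t<..<t + e t}" using e[OF t] by simp
      then show "t \<in> \<Union> C" unfolding C_def using t by blast
    qed
  qed (auto simp: C_def)
  show ?thesis
  proof
    show "\<delta> > 0" by (rule \<delta>)
    fix u v assume uv: "0 \<le> u" "u \<le> v" "v \<le> T" "v - u < \<delta>"
    then obtain t where t: "t \<in> {0..T}" "{u..v} \<subseteq> {t - e t<..<t + e t}"
      using \<delta>(2)[of "{u..v}"] by (auto simp: C_def diameter_closed_interval)
    have "emeasure \<mu>\<^sub>\<omega> ({u<..v} \<times> A) \<le> emeasure \<mu>\<^sub>\<omega> (({t - e t<..<t + e t} \<inter> {0<..T}) \<times> A)"
    proof (rule emeasure_mono)
      have "{u<..v} \<subseteq> {t - e t<..<t + e t} \<inter> {0<..T}" using t uv by fastforce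
      then show "{u<..v} \<times> A \<subseteq> ({t - e t<..<t + e t} \<inter> {0<..T}) \<times> A" by blast
    qed (intro rect A, auto)
    also have "\<dots> \<le> 1" using e t by blast
    finally have le: "emeasure \<mu>\<^sub>\<omega> ({u<..v} \<times> A) \<le> 1" .
    have "{u<..v} \<times> A \<in> sets (mark_space T)" using interval_times_mark_space uv A by blast
    then obtain j :: nat where j: "emeasure \<mu>\<^sub>\<omega> ({u<..v} \<times> A) = of_nat j"
      using int[of "{u<..v} \<times> A"] le by (auto simp: top_unique)
    then have "j \<le> 1" using le by simp
    then show "measure \<mu>\<^sub>\<omega> ({u<..v} \<times> A) \<in> {0, 1}" using j by (auto simp: measure_def le_Suc_eq)
  qed
qed

text \<open>The compensator is applied to the integrand k 1_(a,b] 1_A, which is predictable because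
  \<open>k\<close> is already known at time \<open>a\<close>.\<close>

lemma compensator_count:
  fixes k :: "'w \<Rightarrow> ennreal"
  assumes F: "filtered_prob_space M F T" and \<nu>: "sets \<nu> = sets R0" "sigma_finite_measure \<nu>"
    and rm: "random_measure M F T \<mu>" and comp: "has_compensator M F T \<nu> \<mu> (\<lambda>r _. \<Lambda> r)"
    and \<Lambda>: "set_integrable lborel {0..T} \<Lambda>" "\<And>r. r \<in> {0..T} \<Longrightarrow> 0 \<le> \<Lambda> r"
    and A: "A \<in> sets \<nu>" "emeasure \<nu> A < \<infinity>" and t: "0 \<le> a" "a \<le> b" "b \<le> T"
    and k: "k \<in> borel_measurable (F a)"
  shows "(\<integral>\<^sup>+\<omega>. k \<omega> * emeasure (\<mu> \<omega>) ({a<..b} \<times> A) \<partial>M) = (\<integral>\<^sup>+\<omega>. k \<omega> \<partial>M) * ennreal ((LBINT r:{a<..b}. \<Lambda> r) * measure \<nu> A)"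
proof -
  interpret filtered_prob_space M F T by (rule F)
  interpret \<nu>: sigma_finite_measure \<nu> by (rule \<nu>)
  have kM: "k \<in> borel_measurable M" by (rule measurable_F[OF _ k]) (use t in auto)
  have AR: "A \<in> sets R0" using A \<nu> by simp
  have "(\<lambda>p. (k (snd (fst p)) * indicator {a<..b} (fst (fst p))) * indicator A (snd p)) \<in> borel_measurable (predictable_algebra M F T \<Otimes>\<^sub>M R0)"
    by (intro borel_measurable_times_ennreal measurable_compose[OF measurable_fst predictable_rectangle[OF F t k]]
        measurable_compose[OF measurable_snd borel_measurable_indicator[OF AR]])
  then have "(\<integral>\<^sup>+\<omega>. (\<integral>\<^sup>+x. (k \<omega> * indicator {a<..b} (fst x)) * indicator A (snd x) \<partial>\<mu> \<omega>) \<partial>M) =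
      (\<integral>\<^sup>+\<omega>. (\<integral>\<^sup>+x. (k \<omega> * indicator {a<..b} (fst x)) * indicator A (snd x) * ennreal (\<Lambda> (fst x)) \<partial>(time_leb T \<Otimes>\<^sub>M \<nu>)) \<partial>M)"
    using comp unfolding has_compensator_def case_prod_beta' by fastforce
  moreover have "(\<integral>\<^sup>+x. (k \<omega> * indicator {a<..b} (fst x)) * indicator A (snd x) \<partial>\<mu> \<omega>) = k \<omega> * emeasure (\<mu> \<omega>) ({a<..b} \<times> A)"
    if "\<omega> \<in> space M" for \<omega>
  proof -
    have B: "{a<..b} \<times> A \<in> sets (\<mu> \<omega>)"
      using interval_times_mark_space[of a b T A] t AR rm that by (auto simp: random_measure_def)
    have "(\<integral>\<^sup>+x. (k \<omega> * indicator {a<..b} (fst x)) * indicator A (snd x) \<partial>\<mu> \<omega>) = (\<integral>\<^sup>+x. k \<omega> * indicator ({a<..b} \<times> A) x \<partial>\<mu> \<omega>)"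
      by (intro nn_integral_cong) (auto simp: indicator_def split: if_splits)
    then show ?thesis using nn_integral_cmult_indicator[OF B] by simp
  qed
  moreover have "(\<integral>\<^sup>+x. (k \<omega> * indicator {a<..b} (fst x)) * indicator A (snd x) * ennreal (\<Lambda> (fst x)) \<partial>(time_leb T \<Otimes>\<^sub>M \<nu>))
      = k \<omega> * ennreal ((LBINT r:{a<..b}. \<Lambda> r) * measure \<nu> A)" for \<omega>
  proof -
    have "set_integrable lborel {a<..b} \<Lambda>" by (rule set_integrable_subset[OF \<Lambda>(1)]) (use t in auto)
    then have i: "integrable (time_leb T) (\<lambda>r. indicator {a<..b} r * \<Lambda> r)"
      using integral_time_leb(2)[of a b T \<Lambda>] t by blast
    then have im: "(\<lambda>r. indicator {a<..b} r * \<Lambda> r) \<in> borel_measurable (time_leb T)" by simp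
    have nn: "0 \<le> indicator {a<..b} r * \<Lambda> r" if "r \<in> {0..T}" for r using \<Lambda>(2)[OF that] by simp
    have L0: "0 \<le> (LBINT r:{a<..b}. \<Lambda> r)"
      unfolding integral_time_leb(1)[OF t(1,3), symmetric]
      by (intro Bochner_Integration.integral_nonneg_AE AE_I2) (use nn in auto)
    have "(\<integral>\<^sup>+x. (k \<omega> * indicator {a<..b} (fst x)) * indicator A (snd x) * ennreal (\<Lambda> (fst x)) \<partial>(time_leb T \<Otimes>\<^sub>M \<nu>))
       = (\<integral>\<^sup>+x. k \<omega> * (ennreal (indicator {a<..b} (fst x) * \<Lambda> (fst x)) * indicator A (snd x)) \<partial>(time_leb T \<Otimes>\<^sub>M \<nu>))"
      by (intro nn_integral_cong) (auto simp: indicator_def)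
    also have "\<dots> = (\<integral>\<^sup>+r. (\<integral>\<^sup>+z. k \<omega> * (ennreal (indicator {a<..b} r * \<Lambda> r) * indicator A z) \<partial>\<nu>) \<partial>time_leb T)"
      by (subst \<nu>.nn_integral_fst[symmetric])
         (auto intro!: borel_measurable_times_ennreal measurable_compose[OF measurable_fst measurable_compose[OF im measurable_ennreal]]
           measurable_compose[OF measurable_snd borel_measurable_indicator[OF A(1)]])
    also have "\<dots> = (\<integral>\<^sup>+r. (k \<omega> * emeasure \<nu> A) * ennreal (indicator {a<..b} r * \<Lambda> r) \<partial>time_leb T)"
      unfolding mult.assoc[symmetric] nn_integral_cmult_indicator[OF A(1)] by (simp add: mult_ac)
    also have "\<dots> = (k \<omega> * emeasure \<nu> A) * (\<integral>\<^sup>+r. ennreal (indicator {a<..b} r * \<Lambda> r) \<partial>time_leb T)"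
      by (rule nn_integral_cmult) (use im in measurable)
    also have "(\<integral>\<^sup>+r. ennreal (indicator {a<..b} r * \<Lambda> r) \<partial>time_leb T) = ennreal (LBINT r:{a<..b}. \<Lambda> r)"
      unfolding integral_time_leb(1)[OF t(1,3), symmetric]
      by (intro nn_integral_eq_integral i AE_I2) (use nn in auto)
    also have "emeasure \<nu> A = ennreal (measure \<nu> A)" using A by (simp add: emeasure_eq_ennreal_measure less_top)
    finally show ?thesis using L0 by (simp add: ennreal_mult mult_ac)
  qed
  ultimately have "(\<integral>\<^sup>+\<omega>. k \<omega> * emeasure (\<mu> \<omega>) ({a<..b} \<times> A) \<partial>M) = (\<integral>\<^sup>+\<omega>. k \<omega> * ennreal ((LBINT r:{a<..b}. \<Lambda> r) * measure \<nu> A) \<partial>M)"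
    by (simp cong: nn_integral_cong)
  also have "\<dots> = (\<integral>\<^sup>+\<omega>. k \<omega> \<partial>M) * ennreal ((LBINT r:{a<..b}. \<Lambda> r) * measure \<nu> A)"
    by (rule nn_integral_multc[OF kM])
  finally show ?thesis .
qed

text \<open>The discrete form of d(N^2) = 2 N_- dN + d[N]. It is applied twice: to the counts along
  a path, and to their deterministic means.\<close>

lemma square_eq_cross_terms:
  fixes n :: "nat \<Rightarrow> real"
  assumes N: "\<And>m. m < p \<Longrightarrow> N (Suc m) = N m + n m" and N0: "N 0 = 0"
  shows "(N p)\<^sup>2 = (\<Sum>m<p. 2 * N m * n m) + (\<Sum>m<p. (n m)\<^sup>2)" "N p = (\<Sum>m<p. n m)"
  using N by (induction p) (auto simp: N0 power2_eq_square algebra_simps)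

text \<open>Over a partition the square of the number of points is the sum of the cross terms, whose expectations
  the compensator determines because their first factor is predictable, and of the squared increments, which
  eventually are \<open>0\<close> or \<open>1\<close> and thus add up to the number of points itself. So the second moment needs neither
  independence of increments nor a stochastic calculus.\<close>

lemma compensator_jump_moments:
  assumes F: "filtered_prob_space M F T" and T: "0 \<le> T" and \<nu>: "sets \<nu> = sets R0" "sigma_finite_measure \<nu>"
    and rm: "random_measure M F T \<mu>" and iv: "integer_valued M T \<mu>" and comp: "has_compensator M F T \<nu> \<mu> (\<lambda>r _. \<Lambda> r)"
    and \<Lambda>: "set_integrable lborel {0..T} \<Lambda>" "\<And>r. r \<in> {0..T} \<Longrightarrow> 0 \<le> \<Lambda> r" "\<And>r. r \<in> {0..T} \<Longrightarrow> \<Lambda> r \<le> c2"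
  shows "jump_moments M F T \<nu> \<mu> \<Lambda>"
proof -
  interpret filtered_prob_space M F T by (rule F)
  { fix A assume A: "A \<in> sets \<nu>" "emeasure \<nu> A < \<infinity>"
    have AR: "A \<in> sets R0" using A \<nu> by simp
    define L where "L a b = (LBINT r:{a<..b}. \<Lambda> r) * measure \<nu> A" for a b
    define c where "c a b \<omega> = measure (\<mu> \<omega>) ({a<..b} \<times> A)" for a b \<omega>
    have \<Lambda>i: "set_integrable lborel {a<..b} \<Lambda>" if "0 \<le> a" "b \<le> T" for a b
      by (rule set_integrable_subset[OF \<Lambda>(1)]) (use that in auto)
    have L0: "0 \<le> L a b" if "0 \<le> a" "b \<le> T" for a b
      unfolding L_def set_lebesgue_integral_def
      by (intro mult_nonneg_nonneg Bochner_Integration.integral_nonneg) (use that \<Lambda>(2) in \<open>auto simp: indicator_def\<close>)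
    have Lle: "L a b \<le> c2 * measure \<nu> A * (b - a)" if "0 \<le> a" "a \<le> b" "b \<le> T" for a b
    proof -
      have "(LBINT r:{a<..b}. \<Lambda> r) \<le> (LBINT r:{a<..b}. c2)"
        by (rule set_integral_mono[OF \<Lambda>i]) (use that \<Lambda>(3) in \<open>auto simp: set_integrable_def\<close>)
      also have "\<dots> = c2 * (b - a)" using that by (simp add: set_lebesgue_integral_def)
      finally have "L a b \<le> c2 * (b - a) * measure \<nu> A"
        unfolding L_def by (rule mult_right_mono) simp
      then show ?thesis by (simp add: mult_ac)
    qed
    have Ladd: "L a d = L a b + L b d" if "0 \<le> a" "a \<le> b" "b \<le> d" "d \<le> T" for a b d
    proof -
      have "{a<..d} = {a<..b} \<union> {b<..d}" using that by auto
      then have "(LBINT r:{a<..d}. \<Lambda> r) = (LBINT r:{a<..b}. \<Lambda> r) + (LBINT r:{b<..d}. \<Lambda> r)"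
        using that by (simp add: set_integral_Un \<Lambda>i)
      then show ?thesis by (simp add: L_def distrib_right)
    qed
    have e_meas: "(\<lambda>\<omega>. emeasure (\<mu> \<omega>) ({a<..b} \<times> A)) \<in> borel_measurable (F b)" if t: "0 \<le> a" "a \<le> b" "b \<le> T" for a b
    proof -
      have "{a<..b} \<times> A \<in> sets (mark_space T)" using AR t by (intro interval_times_mark_space) auto
      moreover have "{a<..b} \<times> A \<subseteq> {0..b} \<times> UNIV" using t by auto
      ultimately show ?thesis using rm t unfolding random_measure_def by auto
    qed
    have e_measM: "(\<lambda>\<omega>. emeasure (\<mu> \<omega>) ({a<..b} \<times> A)) \<in> borel_measurable M" if t: "0 \<le> a" "a \<le> b" "b \<le> T" for a b
      by (rule measurable_F[OF _ e_meas[OF t]]) (use t in auto)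
    have c_meas: "c a b \<in> borel_measurable (F b)" if t: "0 \<le> a" "a \<le> b" "b \<le> T" for a b
      unfolding c_def measure_def using e_meas[OF t] by measurable
    have c_measM: "c a b \<in> borel_measurable M" if t: "0 \<le> a" "a \<le> b" "b \<le> T" for a b
      unfolding c_def measure_def using e_measM[OF t] by measurable
    note star = compensator_count[OF F \<nu> rm comp \<Lambda>(1,2) A, folded L_def]
    have fin: "AE \<omega> in M. emeasure (\<mu> \<omega>) ({0<..T} \<times> A) < \<infinity>"
    proof -
      have "(\<integral>\<^sup>+\<omega>. emeasure (\<mu> \<omega>) ({0<..T} \<times> A) \<partial>M) \<noteq> \<infinity>"
        using star[of 0 T "\<lambda>_. 1"] T by (simp add: emeasure_space_1)
      then have "AE \<omega> in M. emeasure (\<mu> \<omega>) ({0<..T} \<times> A) \<noteq> \<infinity>"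
        by (intro nn_integral_PInf_AE e_measM) (use T in auto)
      then show ?thesis by eventually_elim (simp add: less_top)
    qed
    have ce: "AE \<omega> in M. ennreal (c a b \<omega>) = emeasure (\<mu> \<omega>) ({a<..b} \<times> A)" if t: "0 \<le> a" "a \<le> b" "b \<le> T" for a b
      using fin AE_space
    proof eventually_elim
      case (elim \<omega>)
      have "emeasure (\<mu> \<omega>) ({a<..b} \<times> A) \<le> emeasure (\<mu> \<omega>) ({0<..T} \<times> A)"
        using interval_times_mark_space[of 0 T T A] AR rm elim(2) T t
        by (intro emeasure_mono) (auto simp: random_measure_def)
      then have "emeasure (\<mu> \<omega>) ({a<..b} \<times> A) < \<infinity>" using elim(1) by (rule le_less_trans)
      then show ?case unfolding c_def by (simp add: emeasure_eq_ennreal_measure less_top)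
    qed
    \<comment> \<open>The weight is only required to be integrable, not bounded: for the cross terms
      it will be a test variable times the unbounded count \<open>c a (s j m)\<close>.\<close>
    have star_nn: "integrable M (\<lambda>\<omega>. k \<omega> * c a b \<omega>)" "(\<integral>\<omega>. k \<omega> * c a b \<omega> \<partial>M) = (\<integral>\<omega>. k \<omega> \<partial>M) * L a b"
      if t: "0 \<le> a" "a \<le> b" "b \<le> T" and k: "k \<in> borel_measurable (F a)" "integrable M k" "\<And>\<omega>. 0 \<le> k \<omega>" for a b k
    proof -
      have kM: "k \<in> borel_measurable M" using k(2) by simp
      have k0: "0 \<le> (\<integral>\<omega>. k \<omega> \<partial>M)" by (intro Bochner_Integration.integral_nonneg k(3))
      have "(\<integral>\<^sup>+\<omega>. ennreal (k \<omega> * c a b \<omega>) \<partial>M) = (\<integral>\<^sup>+\<omega>. ennreal (k \<omega>) * emeasure (\<mu> \<omega>) ({a<..b} \<times> A) \<partial>M)"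
      proof (rule nn_integral_cong_AE)
        show "AE \<omega> in M. ennreal (k \<omega> * c a b \<omega>) = ennreal (k \<omega>) * emeasure (\<mu> \<omega>) ({a<..b} \<times> A)"
          using ce[OF t] by eventually_elim (simp add: ennreal_mult k(3) c_def)
      qed
      also have "\<dots> = (\<integral>\<^sup>+\<omega>. ennreal (k \<omega>) \<partial>M) * ennreal (L a b)"
        by (rule star[OF _ t]) (use k(1) in simp_all)
      also have "\<dots> = ennreal ((\<integral>\<omega>. k \<omega> \<partial>M) * L a b)"
        using k0 L0[of a b] t by (simp add: nn_integral_eq_integral[OF k(2)] k(3) ennreal_mult)
      finally have nn: "(\<integral>\<^sup>+\<omega>. ennreal (k \<omega> * c a b \<omega>) \<partial>M) = ennreal ((\<integral>\<omega>. k \<omega> \<partial>M) * L a b)" .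
      have pos: "0 \<le> k \<omega> * c a b \<omega>" for \<omega> using k(3) by (simp add: c_def)
      show int: "integrable M (\<lambda>\<omega>. k \<omega> * c a b \<omega>)"
        by (rule integrableI_nonneg) (use kM c_measM[OF t] pos nn in auto)
      show "(\<integral>\<omega>. k \<omega> * c a b \<omega> \<partial>M) = (\<integral>\<omega>. k \<omega> \<partial>M) * L a b"
        by (subst integral_eq_nn_integral) (use kM c_measM[OF t] pos nn k0 L0[of a b] t in auto)
    qed
    have star_real: "integrable M (\<lambda>\<omega>. k \<omega> * c a b \<omega>)" "(\<integral>\<omega>. k \<omega> * c a b \<omega> \<partial>M) = (\<integral>\<omega>. k \<omega> \<partial>M) * L a b"
      if t: "0 \<le> a" "a \<le> b" "b \<le> T" and k: "k \<in> borel_measurable (F a)" "integrable M k" for a b k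
    proof -
      have p: "(\<lambda>\<omega>. max (k \<omega>) 0) \<in> borel_measurable (F a)" "integrable M (\<lambda>\<omega>. max (k \<omega>) 0)"
        and n: "(\<lambda>\<omega>. max (- k \<omega>) 0) \<in> borel_measurable (F a)" "integrable M (\<lambda>\<omega>. max (- k \<omega>) 0)"
        using k by (auto intro!: borel_measurable_max)
      have split: "k \<omega> = max (k \<omega>) 0 - max (- k \<omega>) 0" for \<omega> by simp
      have e: "k \<omega> * c a b \<omega> = max (k \<omega>) 0 * c a b \<omega> - max (- k \<omega>) 0 * c a b \<omega>" for \<omega>
        by (subst split) (simp only: left_diff_distrib)
      note ip = star_nn[OF t p] and ine = star_nn[OF t n]
      show "integrable M (\<lambda>\<omega>. k \<omega> * c a b \<omega>)"
        unfolding e by (intro Bochner_Integration.integrable_diff ip ine) auto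
      have "(\<integral>\<omega>. k \<omega> * c a b \<omega> \<partial>M) = ((\<integral>\<omega>. max (k \<omega>) 0 \<partial>M) - (\<integral>\<omega>. max (- k \<omega>) 0 \<partial>M)) * L a b"
        unfolding e by (subst Bochner_Integration.integral_diff) (auto simp: ip ine left_diff_distrib)
      also have "(\<integral>\<omega>. max (k \<omega>) 0 \<partial>M) - (\<integral>\<omega>. max (- k \<omega>) 0 \<partial>M) = (\<integral>\<omega>. k \<omega> \<partial>M)"
        unfolding Bochner_Integration.integral_diff[OF p(2) n(2), symmetric] split[symmetric] ..
      finally show "(\<integral>\<omega>. k \<omega> * c a b \<omega> \<partial>M) = (\<integral>\<omega>. k \<omega> \<partial>M) * L a b" .
    qed
    have c_int: "integrable M (c a b)" if t: "0 \<le> a" "a \<le> b" "b \<le> T" for a b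
    proof -
      have "integrable M (\<lambda>\<omega>. 1 * c a b \<omega>)" by (rule star_real(1)[OF t]) simp_all
      then show ?thesis by (simp only: mult_1_left)
    qed
    have L_empty: "L a a = 0" for a by (simp add: L_def set_lebesgue_integral_def)
    { fix a b assume t: "0 \<le> a" "a \<le> b" "b \<le> T"
      define h where "h j = (b - a) / real (Suc j)" for j
      have h0: "0 \<le> h j" for j using t by (simp add: h_def)
      define s where "s j m = a + h j * real m" for j m
      have s0: "s j 0 = a" for j by (simp add: s_def)
      have sn: "s j (Suc j) = b" for j by (simp add: s_def h_def del: of_nat_Suc)
      have sS: "s j (Suc m) = s j m + h j" for j m by (simp add: s_def algebra_simps)
      have sm: "s j m \<le> s j (Suc m)" for j m unfolding sS using h0 by simp
      have sr: "a \<le> s j m \<and> s j m \<le> b" if "m \<le> Suc j" for j m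
      proof -
        have "s j m \<le> s j (Suc j)" unfolding s_def by (intro add_left_mono mult_left_mono) (use that h0 in auto)
        moreover have "a \<le> s j m" unfolding s_def using h0 by simp
        ultimately show ?thesis unfolding sn by blast
      qed
      \<comment> \<open>\<open>cr j\<close> collects the cross terms of the squared count over the
        \<open>j\<close>-th partition. The mean of the count satisfies the same identity, so the
        expectation of \<open>cr j\<close> is \<open>(L a b)\<^sup>2\<close> up to
        \<open>lam j\<close>, the sum of the squared means over the cells, which vanishes with the
        mesh because the intensity is bounded.\<close>
      define cr where "cr j \<omega> = (\<Sum>m<Suc j. 2 * c a (s j m) \<omega> * c (s j m) (s j (Suc m)) \<omega>)" for j \<omega>
      define lam where "lam j = (\<Sum>m<Suc j. (L (s j m) (s j (Suc m)))\<^sup>2)" for j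
      have tm: "0 \<le> s j m" "a \<le> s j m" "s j m \<le> s j (Suc m)" "s j (Suc m) \<le> T" "s j m \<le> T" if "m < Suc j" for j m
        using sr[of m j] sr[of "Suc m" j] sm[of j m] that t by auto
      have crm: "cr j \<in> borel_measurable M" for j
        unfolding cr_def[abs_def] using tm t by (intro borel_measurable_sum borel_measurable_times c_measM borel_measurable_const) auto
      have cross: "integrable M (\<lambda>\<omega>. k \<omega> * cr j \<omega>)" "(\<integral>\<omega>. k \<omega> * cr j \<omega> \<partial>M) = (\<integral>\<omega>. k \<omega> \<partial>M) * ((L a b)\<^sup>2 - lam j)"
        if k: "k \<in> borel_measurable (F a)" "bounded (k ` space M)" for k j
      proof -
        have kM: "k \<in> borel_measurable M" by (rule measurable_F[OF _ k(1)]) (use t in auto)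
        have ki: "integrable M k" by (rule integrable_of_bounded[OF kM k(2)])
        have km: "(\<lambda>\<omega>. k \<omega> * c a (s j m) \<omega>) \<in> borel_measurable (F (s j m))" if "m < Suc j" for m
          by (intro borel_measurable_times measurable_F_mono[OF _ _ _ k(1)] c_meas) (use tm[OF that] t in auto)
        have k1: "integrable M (\<lambda>\<omega>. k \<omega> * c a (s j m) \<omega>)" "(\<integral>\<omega>. k \<omega> * c a (s j m) \<omega> \<partial>M) = (\<integral>\<omega>. k \<omega> \<partial>M) * L a (s j m)" if "m < Suc j" for m
          by (rule star_real[OF _ _ _ k(1) ki]; use tm[OF that] t in auto)+
        have k2: "integrable M (\<lambda>\<omega>. k \<omega> * c a (s j m) \<omega> * c (s j m) (s j (Suc m)) \<omega>)"
           "(\<integral>\<omega>. k \<omega> * c a (s j m) \<omega> * c (s j m) (s j (Suc m)) \<omega> \<partial>M) = (\<integral>\<omega>. k \<omega> \<partial>M) * (L a (s j m) * L (s j m) (s j (Suc m)))" if "m < Suc j" for m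
          using star_real[OF _ _ _ km[OF that] k1(1)[OF that], of "s j (Suc m)"] tm[OF that] k1(2)[OF that] by auto
        have e: "k \<omega> * cr j \<omega> = (\<Sum>m<Suc j. 2 * (k \<omega> * c a (s j m) \<omega> * c (s j m) (s j (Suc m)) \<omega>))" for \<omega>
          unfolding cr_def sum_distrib_left by (intro sum.cong refl) simp
        show "integrable M (\<lambda>\<omega>. k \<omega> * cr j \<omega>)"
          unfolding e by (intro Bochner_Integration.integrable_sum integrable_mult_right k2) simp
        have "(\<integral>\<omega>. k \<omega> * cr j \<omega> \<partial>M) = (\<Sum>m<Suc j. 2 * ((\<integral>\<omega>. k \<omega> \<partial>M) * (L a (s j m) * L (s j m) (s j (Suc m)))))"
          unfolding e
          by (subst Bochner_Integration.integral_sum)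
             (auto intro!: integrable_mult_right k2 sum.cong simp: k2(2) simp del: sum.lessThan_Suc)
        also have "\<dots> = (\<integral>\<omega>. k \<omega> \<partial>M) * (\<Sum>m<Suc j. 2 * L a (s j m) * L (s j m) (s j (Suc m)))"
          unfolding sum_distrib_left by (intro sum.cong refl) simp
        also have "(\<Sum>m<Suc j. 2 * L a (s j m) * L (s j m) (s j (Suc m))) = (L a b)\<^sup>2 - lam j"
        proof -
          have "(L a (s j (Suc j)))\<^sup>2 = (\<Sum>m<Suc j. 2 * L a (s j m) * L (s j m) (s j (Suc m))) + lam j"
            unfolding lam_def
            by (rule square_eq_cross_terms(1)) (use tm t in \<open>auto simp: s0 L_empty intro!: Ladd\<close>)
          then show ?thesis unfolding sn by simp
        qed
        finally show "(\<integral>\<omega>. k \<omega> * cr j \<omega> \<partial>M) = (\<integral>\<omega>. k \<omega> \<partial>M) * ((L a b)\<^sup>2 - lam j)" .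
      qed
      have lam0: "lam \<longlonglongrightarrow> 0"
      proof (rule tendsto_sandwich[OF _ _ tendsto_const])
        define D where "D = c2 * measure \<nu> A * (b - a)"
        have D: "L (s j m) (s j (Suc m)) \<le> D / real (Suc j)" if "m < Suc j" for j m
          using Lle[of "s j m" "s j (Suc m)"] tm[OF that] unfolding sS D_def h_def by simp
        have "lam j \<le> D\<^sup>2 * inverse (real (Suc j))" for j
        proof -
          have "lam j \<le> (\<Sum>m<Suc j. (D / real (Suc j))\<^sup>2)"
            unfolding lam_def by (intro sum_mono power_mono D L0) (use tm in auto)
          also have "\<dots> = D\<^sup>2 * inverse (real (Suc j))"
            by (simp add: power2_eq_square field_simps del: of_nat_Suc)
          finally show ?thesis .
        qed
        then show "\<forall>\<^sub>F j in sequentially. lam j \<le> D\<^sup>2 * inverse (real (Suc j))" by simp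
        show "(\<lambda>j. D\<^sup>2 * inverse (real (Suc j))) \<longlonglongrightarrow> 0"
          using tendsto_mult[OF tendsto_const LIMSEQ_inverse_real_of_nat, of "D\<^sup>2"] by simp
      qed (simp add: lam_def sum_nonneg)
      \<comment> \<open>Along a path the convergence is exact from some \<open>j\<close> on: once
        the mesh is below the \<open>\<delta>\<close> of that path, every cell holds 0 or 1 points,
        squares of increments equal the increments, and they add up to the count.\<close>
      have conv: "AE \<omega> in M. (\<forall>j. 0 \<le> cr j \<omega> \<and> cr j \<omega> \<le> (c a b \<omega>)\<^sup>2) \<and> eventually (\<lambda>j. cr j \<omega> = (c a b \<omega>)\<^sup>2 - c a b \<omega>) sequentially"
        using fin iv[unfolded integer_valued_def] AE_space
      proof eventually_elim
        case (elim \<omega>)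
        have S: "sets (\<mu> \<omega>) = sets (mark_space T)" using rm elim(3) by (simp add: random_measure_def)
        have add: "c a (s j (Suc m)) \<omega> = c a (s j m) \<omega> + c (s j m) (s j (Suc m)) \<omega>" if "m < Suc j" for j m
          unfolding c_def by (rule measure_interval_times_add[OF S AR _ _ _ _ elim(1)]) (use tm[OF that] t in auto)
        have c0: "c a (s j 0) \<omega> = 0" for j by (simp add: s0 c_def)
        have sq: "(c a b \<omega>)\<^sup>2 = cr j \<omega> + (\<Sum>m<Suc j. (c (s j m) (s j (Suc m)) \<omega>)\<^sup>2)"
          and su: "c a b \<omega> = (\<Sum>m<Suc j. c (s j m) (s j (Suc m)) \<omega>)" for j
          using square_eq_cross_terms[where N = "\<lambda>m. c a (s j m) \<omega>" and n = "\<lambda>m. c (s j m) (s j (Suc m)) \<omega>" and p = "Suc j", OF add c0]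
          unfolding sn cr_def by auto
        have cr0: "0 \<le> cr j \<omega>" for j unfolding cr_def by (intro sum_nonneg) (simp add: c_def)
        have crle: "cr j \<omega> \<le> (c a b \<omega>)\<^sup>2" for j
          using sq[of j] sum_nonneg[of "{..<Suc j}" "\<lambda>m. (c (s j m) (s j (Suc m)) \<omega>)\<^sup>2"] by simp
        obtain \<delta> where \<delta>: "\<delta> > 0" "\<And>u v. 0 \<le> u \<Longrightarrow> u \<le> v \<Longrightarrow> v \<le> T \<Longrightarrow> v - u < \<delta> \<Longrightarrow> measure (\<mu> \<omega>) ({u<..v} \<times> A) \<in> {0, 1}"
          using integer_valued_short_interval[OF S AR T elim(1)] elim(2) by metis
        have "(\<lambda>j. (b - a) * inverse (real (Suc j))) \<longlonglongrightarrow> (b - a) * 0"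
          by (intro tendsto_intros LIMSEQ_inverse_real_of_nat)
        then have "eventually (\<lambda>j. (b - a) * inverse (real (Suc j)) < \<delta>) sequentially"
          by (rule order_tendstoD) (use \<delta>(1) in simp)
        then have "eventually (\<lambda>j. cr j \<omega> = (c a b \<omega>)\<^sup>2 - c a b \<omega>) sequentially"
        proof eventually_elim
          case (elim j)
          have "(\<Sum>m<Suc j. (c (s j m) (s j (Suc m)) \<omega>)\<^sup>2) = (\<Sum>m<Suc j. c (s j m) (s j (Suc m)) \<omega>)"
          proof (intro sum.cong refl)
            fix m assume "m \<in> {..<Suc j}"
            then have m: "m < Suc j" by simp
            have "c (s j m) (s j (Suc m)) \<omega> \<in> {0, 1}"
              unfolding c_def by (rule \<delta>(2)) (use tm[OF m] elim in \<open>auto simp: sS h_def divide_inverse simp del: of_nat_Suc\<close>)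
            then show "(c (s j m) (s j (Suc m)) \<omega>)\<^sup>2 = c (s j m) (s j (Suc m)) \<omega>" by auto
          qed
          then show ?case using sq[of j] su[of j] by linarith
        qed
        then show ?case using cr0 crle by blast
      qed
      let ?X = "\<lambda>\<omega>. (c a b \<omega>)\<^sup>2 - c a b \<omega>"
      have cM: "c a b \<in> borel_measurable M" by (rule c_measM[OF t])
      have lim: "AE \<omega> in M. (\<lambda>j. cr j \<omega>) \<longlonglongrightarrow> ?X \<omega>"
        using conv
      proof eventually_elim
        case (elim \<omega>)
        then have "eventually (\<lambda>j. cr j \<omega> = ?X \<omega>) sequentially" by blast
        then show ?case by (rule tendsto_eventually)
      qed
      have X0: "AE \<omega> in M. 0 \<le> ?X \<omega>"
        using conv
      proof eventually_elim
        case (elim \<omega>)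
        then obtain j where "cr j \<omega> = ?X \<omega>" unfolding eventually_sequentially by blast
        moreover have "0 \<le> cr j \<omega>" using elim by blast
        ultimately show ?case by simp
      qed
      \<comment> \<open>Fatou's lemma comes first: a majorant for dominated convergence would be the
        squared count, whose integrability is what is being proved. Afterwards it does serve as the
        majorant, in \<open>mom2\<close>.\<close>
      have Xint: "integrable M ?X"
      proof (rule integrableI_nonneg)
        have "(\<integral>\<^sup>+\<omega>. ennreal (?X \<omega>) \<partial>M) = (\<integral>\<^sup>+\<omega>. liminf (\<lambda>j. ennreal (cr j \<omega>)) \<partial>M)"
        proof (rule nn_integral_cong_AE)
          show "AE \<omega> in M. ennreal (?X \<omega>) = liminf (\<lambda>j. ennreal (cr j \<omega>))"
            using lim by eventually_elim (rule lim_imp_Liminf[symmetric], simp, rule tendsto_ennrealI)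
        qed
        also have "\<dots> \<le> liminf (\<lambda>j. \<integral>\<^sup>+\<omega>. ennreal (cr j \<omega>) \<partial>M)"
          by (rule nn_integral_liminf) (use crm in measurable)
        also have "\<dots> \<le> ennreal ((L a b)\<^sup>2)"
        proof (rule Liminf_le)
          have "(\<integral>\<^sup>+\<omega>. ennreal (cr j \<omega>) \<partial>M) \<le> ennreal ((L a b)\<^sup>2)" for j
          proof -
            have i: "integrable M (cr j)" "(\<integral>\<omega>. cr j \<omega> \<partial>M) = (L a b)\<^sup>2 - lam j"
            proof -
              have "bounded ((\<lambda>_. 1 :: real) ` space M)" unfolding bounded_iff by (intro exI[of _ 1]) simp
              then show "integrable M (cr j)" "(\<integral>\<omega>. cr j \<omega> \<partial>M) = (L a b)\<^sup>2 - lam j"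
                using cross[of "\<lambda>_. 1" j, unfolded mult_1_left] by (simp_all add: prob_space)
            qed
            have "0 \<le> cr j \<omega>" for \<omega> unfolding cr_def by (intro sum_nonneg) (simp add: c_def)
            then have "(\<integral>\<^sup>+\<omega>. ennreal (cr j \<omega>) \<partial>M) = ennreal ((L a b)\<^sup>2 - lam j)"
              unfolding i(2)[symmetric] by (intro nn_integral_eq_integral[OF i(1)] AE_I2)
            moreover have "0 \<le> lam j" unfolding lam_def by (intro sum_nonneg) simp
            then have "ennreal ((L a b)\<^sup>2 - lam j) \<le> ennreal ((L a b)\<^sup>2)"
              by (intro ennreal_leI) simp
            ultimately show ?thesis by simp
          qed
          then show "\<forall>\<^sub>F j in sequentially. (\<integral>\<^sup>+\<omega>. ennreal (cr j \<omega>) \<partial>M) \<le> ennreal ((L a b)\<^sup>2)" by simp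
        qed simp
        also have "\<dots> < \<infinity>" by simp
        finally show "(\<integral>\<^sup>+\<omega>. ennreal (?X \<omega>) \<partial>M) < \<infinity>" .
      qed (use cM X0 in auto)
      have c2int: "integrable M (\<lambda>\<omega>. (c a b \<omega>)\<^sup>2)"
        using Bochner_Integration.integrable_add[OF Xint c_int[OF t]] by simp
      have mom2: "(\<integral>\<omega>. k \<omega> * (c a b \<omega>)\<^sup>2 \<partial>M) = (\<integral>\<omega>. k \<omega> \<partial>M) * (L a b + (L a b)\<^sup>2)"
        if k: "k \<in> borel_measurable (F a)" "bounded (k ` space M)" for k
      proof -
        have kM: "k \<in> borel_measurable M" by (rule measurable_F[OF _ k(1)]) (use t in auto)
        have ki: "integrable M k" by (rule integrable_of_bounded[OF kM k(2)])
        obtain C where C: "0 \<le> C" "\<And>\<omega>. \<omega> \<in> space M \<Longrightarrow> \<bar>k \<omega>\<bar> \<le> C" by (rule bounded_imageD[OF k(2)]) blast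
        have "(\<lambda>j. \<integral>\<omega>. k \<omega> * cr j \<omega> \<partial>M) \<longlonglongrightarrow> (\<integral>\<omega>. k \<omega> * ?X \<omega> \<partial>M)"
        proof (rule integral_dominated_convergence[where w = "\<lambda>\<omega>. C * (c a b \<omega>)\<^sup>2"])
          show "AE \<omega> in M. (\<lambda>j. k \<omega> * cr j \<omega>) \<longlonglongrightarrow> k \<omega> * ?X \<omega>"
            using lim by eventually_elim (intro tendsto_intros)
          show "AE \<omega> in M. norm (k \<omega> * cr j \<omega>) \<le> C * (c a b \<omega>)\<^sup>2" for j
            using conv AE_space
          proof eventually_elim
            case (elim \<omega>)
            then show ?case using C by (auto simp: abs_mult intro!: mult_mono)
          qed
        qed (use kM cM crm c2int in auto)
        moreover have "(\<lambda>j. \<integral>\<omega>. k \<omega> * cr j \<omega> \<partial>M) \<longlonglongrightarrow> (\<integral>\<omega>. k \<omega> \<partial>M) * ((L a b)\<^sup>2 - 0)"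
          unfolding cross(2)[OF k] by (intro tendsto_intros lam0)
        ultimately have X: "(\<integral>\<omega>. k \<omega> * ?X \<omega> \<partial>M) = (\<integral>\<omega>. k \<omega> \<partial>M) * (L a b)\<^sup>2"
          using LIMSEQ_unique by fastforce
        have "(\<integral>\<omega>. k \<omega> * (c a b \<omega>)\<^sup>2 \<partial>M) = (\<integral>\<omega>. k \<omega> * ?X \<omega> + k \<omega> * c a b \<omega> \<partial>M)"
          by (simp add: algebra_simps)
        also have "\<dots> = (\<integral>\<omega>. k \<omega> * ?X \<omega> \<partial>M) + (\<integral>\<omega>. k \<omega> * c a b \<omega> \<partial>M)"
          by (intro Bochner_Integration.integral_add integrable_bounded_mult kM k Xint c_int t)
        finally show ?thesis unfolding X star_real(2)[OF t k(1) ki] by (simp add: algebra_simps)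
      qed
      have mom1: "(\<integral>\<omega>. k \<omega> * c a b \<omega> \<partial>M) = (\<integral>\<omega>. k \<omega> \<partial>M) * L a b"
        if k: "k \<in> borel_measurable (F a)" "bounded (k ` space M)" for k
      proof (rule star_real(2)[OF t k(1)])
        have "k \<in> borel_measurable M" by (rule measurable_F[OF _ k(1)]) (use t in auto)
        then show "integrable M k" using integrable_of_bounded k(2) by blast
      qed
      note c2int mom1 mom2 }
    note fin this[unfolded c_def L_def] }
  note main = this
  show ?thesis
    by unfold_locales (use \<nu> rm \<Lambda> in \<open>auto intro!: main main(1)[simplified]\<close>)
qed

subsection \<open>Coefficients and the forward equation\<close>

lemma borel_measurable_continuous_compose:
  fixes g :: "'a::topological_space \<Rightarrow> real"
  assumes "continuous_on S g" "f \<in> N \<rightarrow>\<^sub>M borel" "\<And>x. x \<in> space N \<Longrightarrow> f x \<in> S"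
  shows "(\<lambda>x. g (f x)) \<in> borel_measurable N"
proof -
  have "f \<in> N \<rightarrow>\<^sub>M restrict_space borel S"
    by (rule measurable_restrict_space2) (use assms in auto)
  from measurable_compose[OF this borel_measurable_continuous_on_restrict[OF assms(1)]] show ?thesis .
qed

text \<open>Extracts from \<open>AX\<close> the continuity and the Lipschitz constant of the drift
  at \<epsilon> = 0, the data of the ordinary differential equation that the forward equation
  reduces to.\<close>

lemma AX_drift:
  assumes AX: "AX T n \<eta> b \<sigma> \<gamma> K" and n: "1 \<le> n"
  shows "continuous_on ({0..T} \<times> UNIV) (\<lambda>(t, x). b t x 0)"
    and "\<And>t x y. t \<in> {0..T} \<Longrightarrow> \<bar>b t x 0 - b t y 0\<bar> \<le> K * \<bar>x - y\<bar>"
proof -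
  let ?S = "{0..T} \<times> (UNIV :: real set) \<times> {0..1 :: real}" and ?e = "(0, 1, 0) :: real \<times> real \<times> real"
  obtain Db and D\<sigma> :: "(real \<times> real) list \<Rightarrow> real \<times> real \<Rightarrow> real" where c: "has_continuous_partials n ?S {(0, 1, 0), (0, 0, 1)} (\<lambda>(t, x, \<epsilon>). b t x \<epsilon>) Db"
    and bd: "\<forall>t\<in>{0..T}. \<forall>x. \<forall>\<epsilon>\<in>{0..1}. \<forall>i\<in>{1..n}. \<forall>j\<le>n.
           \<bar>Db (replicate i (0, 1, 0) @ replicate j (0, 0, 1)) (t, x, \<epsilon>)\<bar> + \<bar>D\<sigma> (replicate i (0, 1)) (t, x)\<bar> \<le> K"
    using AX unfolding AX_def by (elim exE conjE) (rule that; assumption)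
  have eq: "Db [] p = (\<lambda>(t, x, \<epsilon>). b t x \<epsilon>) p" if "p \<in> ?S" for p
    using c that unfolding has_continuous_partials_def has_partials_def by blast
  have c0: "continuous_on ?S (Db [])"
    using c by (auto simp: has_continuous_partials_def words_def)
  have "continuous_on ({0..T} \<times> UNIV) (\<lambda>q. Db [] (fst q, snd q, 0))"
    by (rule continuous_on_compose2[OF c0]) (auto intro!: continuous_intros)
  then show "continuous_on ({0..T} \<times> UNIV) (\<lambda>(t, x). b t x 0)"
    by (rule continuous_on_eq) (auto simp: eq)
  have e: "[?e] \<in> words {(0, 1, 0), (0, 0, 1)} n" using n by (simp add: words_def)
  fix t x y :: real assume t: "t \<in> {0..T}"
  \<comment> \<open>The argument runs in the slice with \<open>t\<close> fixed and \<epsilon> = 0.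
    This \<epsilon> is a boundary value of \<open>[0, 1]\<close>, but a line in direction x stays
    inside the slice, so its derivatives are two-sided. The bound \<open>K\<close> is the case
    \<open>i = 1\<close>, \<open>j = 0\<close> of the one in \<open>AX\<close>.\<close>
  have "\<bar>Db [] ((t, y, 0) + (x - y) *\<^sub>R ?e) - Db [] (t, y, 0)\<bar> \<le> K * \<bar>x - y\<bar>"
  proof (rule lipschitz_direction[where g = "Db []" and S = "{t} \<times> UNIV \<times> {0}" and D = "Db [?e]"])
    fix p assume p: "p \<in> {t} \<times> (UNIV :: real set) \<times> {0 :: real}"
    then have pS: "p \<in> ?S" using t by auto
    have "((\<lambda>h. Db [] (p + h *\<^sub>R ?e)) has_real_derivative Db [?e] p) (at 0 within {h. p + h *\<^sub>R ?e \<in> ?S})"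
      using c e pS unfolding has_continuous_partials_def has_partials_def by blast
    moreover have "{h. p + h *\<^sub>R ?e \<in> ?S} = {h. p + h *\<^sub>R ?e \<in> {t} \<times> UNIV \<times> {0}}"
      using p t by auto
    ultimately show "((\<lambda>h. Db [] (p + h *\<^sub>R ?e)) has_real_derivative Db [?e] p) (at 0 within {h. p + h *\<^sub>R ?e \<in> {t} \<times> UNIV \<times> {0}})"
      by simp
    obtain x' where x': "p = (t, x', 0)" using p by auto
    have "\<bar>Db (replicate 1 (0, 1, 0) @ replicate 0 (0, 0, 1)) (t, x', 0)\<bar> + \<bar>D\<sigma> (replicate 1 (0, 1)) (t, x')\<bar> \<le> K"
      using bd t n by (metis atLeastAtMost_iff order_refl zero_le_one le0)
    then show "\<bar>Db [?e] p\<bar> \<le> K" unfolding x' by simp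
  qed auto
  then show "\<bar>b t x 0 - b t y 0\<bar> \<le> K * \<bar>x - y\<bar>"
    using eq[of "(t, y, 0)"] eq[of "(t, x, 0)"] t by simp
qed

text \<open>The Lipschitz bound concerns \<open>(y, z, u)\<close> with \<open>x\<close> frozen: both
  drivers to be compared will be evaluated along the same deterministic path, so the polynomial
  growth of the x-derivatives does not enter.\<close>

lemma AY_driver:
  assumes AY: "AY T n \<eta> \<rho> \<xi> f K q" and n: "1 \<le> n"
  shows "continuous_on ({0..T} \<times> UNIV) (\<lambda>(t, x, y, z, u). f t x y z u)"
    and "\<And>t x y z u y' z' u'. t \<in> {0..T} \<Longrightarrow> \<bar>f t x y z u - f t x y' z' u'\<bar> \<le> K * (\<bar>y - y'\<bar> + \<bar>z - z'\<bar> + \<bar>u - u'\<bar>)"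
    and "\<rho> \<in> borel_measurable R0" and "\<And>z. z \<noteq> 0 \<Longrightarrow> \<bar>\<rho> z\<bar> \<le> K * \<eta> z"
proof -
  define dx dy dz du :: "real \<times> real \<times> real \<times> real \<times> real"
    where "dx = (0, 1, 0, 0, 0)" and "dy = (0, 0, 1, 0, 0)" and "dz = (0, 0, 0, 1, 0)" and "du = (0, 0, 0, 0, 1)"
  let ?S = "{0..T} \<times> (UNIV :: (real \<times> real \<times> real \<times> real) set)" and ?g = "\<lambda>(t, x, y, z, u). f t x y z u"
  obtain Df where c: "has_continuous_partials n ?S {dx, dy, dz, du} ?g Df"
    and bd: "\<forall>t\<in>{0..T}. \<forall>x y z u.
           (\<forall>i\<in>{1..n}. \<bar>Df (replicate i dx) (t, x, y, z, u)\<bar> \<le> K * (1 + \<bar>x\<bar> powr q)) \<and>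
           (\<forall>es\<in>words {dx, dy, dz, du} n. \<not> set es \<subseteq> {dx} \<longrightarrow> \<bar>Df es (t, x, y, z, u)\<bar> \<le> K)"
    using AY unfolding AY_def Let_def dx_def dy_def dz_def du_def
    by (elim exE conjE) (rule that[unfolded dx_def dy_def dz_def du_def]; assumption)
  have eq: "Df [] p = ?g p" if "p \<in> ?S" for p
    using c that unfolding has_continuous_partials_def has_partials_def by blast
  have c0: "continuous_on ?S (Df [])"
    using c by (auto simp: has_continuous_partials_def words_def)
  then show "continuous_on ?S ?g" by (rule continuous_on_eq) (use eq in auto)
  show "\<rho> \<in> borel_measurable R0" "\<And>z. z \<noteq> 0 \<Longrightarrow> \<bar>\<rho> z\<bar> \<le> K * \<eta> z" using AY by (auto simp: AY_def)
  have lip: "\<bar>Df [] (p + h *\<^sub>R e) - Df [] p\<bar> \<le> K * \<bar>h\<bar>" if p: "p \<in> ?S" and e: "e \<in> {dy, dz, du}" for p h e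
  proof (rule lipschitz_direction[where g = "Df []" and S = ?S and D = "Df [e]"])
    have e0: "fst e = 0" using e by (auto simp: dy_def dz_def du_def)
    show "p + h *\<^sub>R e \<in> ?S" for h using p e0 by (cases p; cases e) auto
    fix p' assume p': "p' \<in> ?S"
    have w: "[e] \<in> words {dx, dy, dz, du} n" using n e by (auto simp: words_def)
    show "((\<lambda>h. Df [] (p' + h *\<^sub>R e)) has_real_derivative Df [e] p') (at 0 within {h. p' + h *\<^sub>R e \<in> ?S})"
      by (rule c[unfolded has_continuous_partials_def has_partials_def, THEN conjunct1, THEN conjunct2, rule_format, OF w p'])
    have "fst (snd e) = 0" "fst (snd dx) = 1" using e by (auto simp: dx_def dy_def dz_def du_def)
    then have "e \<noteq> dx" by (metis zero_neq_one)
    \<comment> \<open>A one-letter word different from \<open>dx\<close> falls under the uniform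
      bound \<open>K\<close>; the words consisting of \<open>dx\<close> only are those with
      polynomial growth.\<close>
    then have ne: "\<not> set [e] \<subseteq> {dx}" by simp
    obtain t x y z u where q: "p' = (t, x, y, z, u)" by (cases p')
    have tT: "t \<in> {0..T}" using p' unfolding q by simp
    show "\<bar>Df [e] p'\<bar> \<le> K" unfolding q
      by (rule bd[THEN bspec, OF tT, THEN spec, THEN spec, THEN spec, THEN spec, THEN conjunct2, THEN bspec, OF w, THEN mp, OF ne])
  qed
  fix t x y z u y' z' u' assume t: "t \<in> {0..T}"
  have "\<bar>f t x y z u - f t x y' z u\<bar> \<le> K * \<bar>y - y'\<bar>"
    using lip[of "(t, x, y', z, u)" dy "y - y'"] t eq by (simp add: dy_def)
  moreover have "\<bar>f t x y' z u - f t x y' z' u\<bar> \<le> K * \<bar>z - z'\<bar>"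
    using lip[of "(t, x, y', z', u)" dz "z - z'"] t eq by (simp add: dz_def)
  moreover have "\<bar>f t x y' z' u - f t x y' z' u'\<bar> \<le> K * \<bar>u - u'\<bar>"
    using lip[of "(t, x, y', z', u')" du "u - u'"] t eq by (simp add: du_def)
  ultimately show "\<bar>f t x y z u - f t x y' z' u'\<bar> \<le> K * (\<bar>y - y'\<bar> + \<bar>z - z'\<bar> + \<bar>u - u'\<bar>)"
    unfolding distrib_left by linarith
qed

text \<open>A cadlag path stays in a compact interval, on which the continuous coefficient is
  bounded.\<close>

lemma set_integrable_continuous_cadlag:
  fixes \<beta> :: "real \<Rightarrow> real \<Rightarrow> real"
  assumes \<beta>: "continuous_on ({0..T} \<times> UNIV) (\<lambda>(t, x). \<beta> t x)" and g: "cadlag_on T g"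
  shows "set_integrable lborel {0..T} (\<lambda>r. \<beta> r (g r))"
proof -
  obtain R where R: "\<And>t. t \<in> {0..T} \<Longrightarrow> \<bar>g t\<bar> \<le> R"
    by (rule bounded_imageD[OF cadlag_on_bounded[OF g]]) blast
  have "compact ((\<lambda>(t, x). \<beta> t x) ` ({0..T} \<times> {-R..R}))"
    by (intro compact_continuous_image continuous_on_subset[OF \<beta>] compact_Times) auto
  from compact_imp_bounded[OF this] obtain B where "\<And>p. p \<in> {0..T} \<times> {-R..R} \<Longrightarrow> \<bar>(\<lambda>(t, x). \<beta> t x) p\<bar> \<le> B"
    by (rule bounded_imageD) blast
  from this[OF SigmaI] have B: "\<And>t x. t \<in> {0..T} \<Longrightarrow> x \<in> {-R..R} \<Longrightarrow> \<bar>\<beta> t x\<bar> \<le> B"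
    by simp
  have m: "(\<lambda>r. \<beta> r (g r)) \<in> borel_measurable (restrict_space borel {0..T})"
    using borel_measurable_continuous_compose[OF \<beta>, of "\<lambda>r. (r, g r)" "restrict_space borel {0..T}"] cadlag_on_measurable[OF g]
    by (auto simp: space_restrict_space intro!: borel_measurable_Pair measurable_restrict_space1)
  have i: "integrable (time_leb T) (\<lambda>r. \<beta> r (g r))"
  proof (rule finite_measure.integrable_const_bound[OF finite_measure_time_leb, of _ B])
    show "AE r in time_leb T. norm (\<beta> r (g r)) \<le> B"
    proof (rule AE_I2)
      fix r assume "r \<in> space (time_leb T)"
      then have "r \<in> {0..T}" by simp
      then show "norm (\<beta> r (g r)) \<le> B" using B[of r "g r"] R[of r] by (simp add: abs_le_iff)
    qed
    show "(\<lambda>r. \<beta> r (g r)) \<in> borel_measurable (time_leb T)"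
      using m by (simp add: measurable_cong_sets[OF sets_time_leb refl])
  qed
  then show ?thesis
    unfolding time_leb_def set_integrable_def by (subst (asm) integrable_restrict_space) auto
qed

text \<open>Existence comes for free: almost every path of \<open>X\<close> solves the integral
  equation, so some path does and is taken as \<open>x0\<close>. Gronwall's inequality then
  identifies almost all other paths with it.\<close>

lemma (in prob_space) forward_deterministic:
  assumes T: "0 \<le> T" and \<beta>: "continuous_on ({0..T} \<times> UNIV) (\<lambda>(t, x). \<beta> t x)" and K: "K > 0"
    and lip: "\<And>t x y. t \<in> {0..T} \<Longrightarrow> \<bar>\<beta> t x - \<beta> t y\<bar> \<le> K * \<bar>x - y\<bar>"
    and X: "\<And>\<omega>. \<omega> \<in> space M \<Longrightarrow> cadlag_on T (\<lambda>t. X t \<omega>)"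
    and eq: "AE \<omega> in M. \<forall>s\<in>{0..T}. X s \<omega> = x + (LBINT r:{0..s}. \<beta> r (X r \<omega>))"
  obtains x0 where "continuous_on {0..T} x0" "\<And>s. s \<in> {0..T} \<Longrightarrow> x0 s = x + (LBINT r:{0..s}. \<beta> r (x0 r))"
    "AE \<omega> in M. \<forall>s\<in>{0..T}. X s \<omega> = x0 s"
proof -
  let ?P = "\<lambda>g. \<forall>s\<in>{0..T}. g s = x + (LBINT r:{0..s}. \<beta> r (g r))"
  have cont: "continuous_on {0..T} g" if "cadlag_on T g" "?P g" for g
  proof -
    have "continuous_on {0..T} (\<lambda>s. x + (LBINT r:{0..s}. \<beta> r (g r)))"
      by (intro continuous_intros continuous_on_set_integral set_integrable_continuous_cadlag[OF \<beta> that(1)])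
    then show ?thesis by (rule continuous_on_eq) (use that(2) in auto)
  qed
  have uniq: "g s = g' s" if g: "cadlag_on T g" "?P g" and g': "cadlag_on T g'" "?P g'" and s: "s \<in> {0..T}" for g g' s
  proof -
    have "\<bar>g s - g' s\<bar> = 0"
    proof (rule gronwall_zero[OF _ K _ _ s])
      show "continuous_on {0..T} (\<lambda>s. \<bar>g s - g' s\<bar>)" by (intro continuous_intros cont g g')
      fix s assume s: "s \<in> {0..T}"
      have sub: "{0..s} \<subseteq> {0..T}" using s by auto
      have i: "set_integrable lborel {0..s} (\<lambda>r. \<beta> r (g r))" "set_integrable lborel {0..s} (\<lambda>r. \<beta> r (g' r))"
        by (rule set_integrable_subset[OF set_integrable_continuous_cadlag[OF \<beta>]]; use g g' sub in simp)+
      have id: "set_integrable lborel {0..s} (\<lambda>r. K * \<bar>g r - g' r\<bar>)"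
        by (rule borel_integrable_atLeastAtMost') (intro continuous_intros continuous_on_subset[OF cont sub] g g')
      have "g s - g' s = (LBINT r:{0..s}. \<beta> r (g r) - \<beta> r (g' r))"
        using g(2) g'(2) s set_integral_diff(2)[OF i] by auto
      then have "\<bar>g s - g' s\<bar> \<le> (LBINT r:{0..s}. \<bar>\<beta> r (g r) - \<beta> r (g' r)\<bar>)"
        using set_integral_norm_bound[OF set_integral_diff(1)[OF i]] by simp
      also have "\<dots> \<le> (LBINT r:{0..s}. K * \<bar>g r - g' r\<bar>)"
        by (rule set_integral_mono[OF _ id]) (use set_integrable_norm[OF set_integral_diff(1)[OF i]] lip sub in auto)
      finally show "\<bar>g s - g' s\<bar> \<le> K * (LBINT r:{0..s}. \<bar>g r - g' r\<bar>)" by simp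
    qed simp
    then show ?thesis by simp
  qed
  have "\<exists>\<omega>\<in>space M. ?P (\<lambda>t. X t \<omega>)"
  proof (rule ccontr)
    assume "\<not> (\<exists>\<omega>\<in>space M. ?P (\<lambda>t. X t \<omega>))"
    then have "AE \<omega> in M. ?P (\<lambda>t. X t \<omega>) \<longrightarrow> False" by (intro AE_I2) blast
    from AE_mp[OF eq this] show False by simp
  qed
  then obtain \<omega>0 where \<omega>0: "\<omega>0 \<in> space M" "?P (\<lambda>t. X t \<omega>0)" by blast
  show ?thesis
  proof
    show "continuous_on {0..T} (\<lambda>t. X t \<omega>0)" by (rule cont[OF X[OF \<omega>0(1)] \<omega>0(2)])
    show "X s \<omega>0 = x + (LBINT r:{0..s}. \<beta> r (X r \<omega>0))" if "s \<in> {0..T}" for s using \<omega>0(2) that by blast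
    show "AE \<omega> in M. \<forall>s\<in>{0..T}. X s \<omega> = X s \<omega>0"
      using eq AE_space
    proof eventually_elim
      case (elim \<omega>)
      then show ?case using uniq[OF X[OF elim(2)] elim(1) X[OF \<omega>0(1)] \<omega>0(2)] by blast
    qed
  qed
qed

section \<open>Stochastic integrals of vanishing integrands\<close>

lemma AE_cadlag_zero:
  assumes X: "\<And>\<omega>. \<omega> \<in> space M \<Longrightarrow> cadlag_on T (\<lambda>t. X t \<omega> :: real)"
    and AE: "\<And>s. s \<in> {0..T} \<Longrightarrow> AE \<omega> in M. X s \<omega> = 0"
  shows "AE \<omega> in M. \<forall>s\<in>{0..T}. X s \<omega> = 0"
proof -
  \<comment> \<open>The exceptional null sets depend on the time. They are united over the rationals
    and \<open>T\<close>, and right-continuity extends the conclusion to all times outside this one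
    null set.\<close>
  have "AE \<omega> in M. \<forall>s\<in>{0..T} \<inter> (\<rat> \<union> {T}). X s \<omega> = 0"
  proof (subst AE_ball_countable)
    show "countable ({0..T} \<inter> (\<rat> \<union> {T}))" by (intro countable_Int2 countable_Un countable_rat) auto
  qed (use AE in auto)
  then show ?thesis using AE_space
  proof eventually_elim
    case (elim \<omega>)
    show ?case
    proof
      fix s assume "s \<in> {0..T}"
      then show "X s \<omega> = 0" by (rule cadlag_on_zero[OF X[OF elim(2)], rotated]) (use elim in blast)
    qed
  qed
qed

lemma AE_zero_of_square_limit:
  fixes I :: "'a \<Rightarrow> real"
  assumes [measurable]: "I \<in> borel_measurable M" and lim: "(\<lambda>n::nat. \<integral>\<^sup>+\<omega>. ennreal ((0 - I \<omega>)\<^sup>2) \<partial>M) \<longlonglongrightarrow> 0"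
  shows "AE \<omega> in M. I \<omega> = 0"
proof -
  have "(\<integral>\<^sup>+\<omega>. ennreal ((I \<omega>)\<^sup>2) \<partial>M) = 0" using lim by (simp add: LIMSEQ_const_iff)
  then show ?thesis by (subst (asm) nn_integral_0_iff_AE) auto
qed

text \<open>The initial value is not prescribed by \<open>has_ito_integral\<close> itself. It
  follows from the L^2 convergence at time 0, where every elementary integral vanishes because its
  intervals start at nonnegative times.\<close>

lemma ito_integral_initial:
  assumes F: "filtered_prob_space M F T" and T: "0 \<le> T" and I: "has_ito_integral M F T W Z I"
  shows "AE \<omega> in M. I 0 \<omega> = 0"
proof -
  interpret filtered_prob_space M F T by (rule F)
  obtain H where H: "\<And>n. simple_process M F T (H n)"
    "(\<lambda>n. \<integral>\<^sup>+\<omega>. ennreal ((simple_ito_integral W (H n) 0 \<omega> - I 0 \<omega>)\<^sup>2) \<partial>M) \<longlonglongrightarrow> 0"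
    using I T unfolding has_ito_integral_def by fastforce
  have z: "simple_ito_integral W (H n) 0 \<omega> = 0" for n \<omega>
  proof -
    have "simple_ito_integral W (H n) 0 \<omega> = (\<Sum>p\<leftarrow>H n. 0)"
      unfolding simple_ito_integral_def
    proof (intro arg_cong[where f = sum_list] map_cong refl)
      fix p assume p: "p \<in> set (H n)"
      obtain a b h where e: "p = (a, b, h)" by (cases p)
      have "0 \<le> a" "a \<le> b" using H(1)[of n] p unfolding e simple_process_def by auto
      then show "(case p of (a, b, h) \<Rightarrow> h \<omega> * (W (min b 0) \<omega> - W (min a 0) \<omega>)) = 0"
        by (simp add: e min_absorb2)
    qed
    then show ?thesis by simp
  qed
  have "I 0 \<in> borel_measurable M"
    using I T measurable_F[of 0 "I 0" borel] by (auto simp: has_ito_integral_def cadlag_adapted_def adapted_def)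
  then show ?thesis using H(2) unfolding z by (rule AE_zero_of_square_limit)
qed

lemma jump_integral_initial:
  assumes F: "filtered_prob_space M F T" and T: "0 \<le> T" and J: "has_jump_integral M F T \<nu> \<mu> \<Lambda> \<psi> J"
  shows "AE \<omega> in M. J 0 \<omega> = 0"
proof -
  interpret filtered_prob_space M F T by (rule F)
  obtain G where G: "\<And>n. simple_field M F T \<nu> (G n)"
    "(\<lambda>n. \<integral>\<^sup>+\<omega>. ennreal ((simple_jump_integral \<nu> \<mu> \<Lambda> (G n) 0 \<omega> - J 0 \<omega>)\<^sup>2) \<partial>M) \<longlonglongrightarrow> 0"
    using J T unfolding has_jump_integral_def by fastforce
  have z: "simple_jump_integral \<nu> \<mu> \<Lambda> (G n) 0 \<omega> = 0" for n \<omega>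
  proof -
    have "simple_jump_integral \<nu> \<mu> \<Lambda> (G n) 0 \<omega> = (\<Sum>p\<leftarrow>G n. 0)"
      unfolding simple_jump_integral_def
    proof (intro arg_cong[where f = sum_list] map_cong refl)
      fix p assume p: "p \<in> set (G n)"
      obtain a b A h where e: "p = (a, b, A, h)" by (cases p)
      have "0 \<le> a" "a \<le> b" using G(1)[of n] p unfolding e simple_field_def by auto
      then show "(case p of (a, b, A, h) \<Rightarrow> h \<omega> * compensated \<nu> \<mu> \<Lambda> (min a 0) (min b 0) A \<omega>) = 0"
        by (simp add: e min_absorb2 compensated_def set_lebesgue_integral_def)
    qed
    then show ?thesis by simp
  qed
  have "J 0 \<in> borel_measurable M"
    using J T measurable_F[of 0 "J 0" borel] by (auto simp: has_jump_integral_def cadlag_adapted_def adapted_def)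
  then show ?thesis using G(2) unfolding z by (rule AE_zero_of_square_limit)
qed

lemma cadlag_adapted_zero: "cadlag_adapted M F T (\<lambda>_ _. 0)"
  by (auto simp: cadlag_adapted_def adapted_def cadlag_on_def)

lemma has_ito_integral_zero: "has_ito_integral M F T W (\<lambda>_ _. 0) (\<lambda>_ _. 0)"
  unfolding has_ito_integral_def
  by (intro conjI exI[of _ "\<lambda>_. []"])
     (auto simp: cadlag_adapted_zero simple_process_def simple_process_eval_def simple_ito_integral_def case_prod_beta')

lemma has_jump_integral_zero: "has_jump_integral M F T \<nu> \<mu> \<Lambda> (\<lambda>_ _ _. 0) (\<lambda>_ _. 0)"
  unfolding has_jump_integral_def
  by (intro conjI exI[of _ "\<lambda>_. []"])
     (auto simp: cadlag_adapted_zero simple_field_def simple_field_eval_def simple_jump_integral_def case_prod_beta')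

text \<open>The isometry controls increments over \<open>(s, T]\<close>. The case
  \<open>s = 0\<close> together with the initial values gives \<open>I T + J T = 0\<close>, and then
  the general case gives \<open>I s + J s = 0\<close>. Only the sum is obtained; one of the
  integrals is isolated by pairing it with the zero integral of the other kind.\<close>

lemma (in jump_brownian_bounded) zero_integrands:
  assumes I: "has_ito_integral M F T W (\<lambda>_ _. 0) I" and J: "has_jump_integral M F T \<nu> \<mu> (\<lambda>r _. \<Lambda> r) (\<lambda>_ _ _. 0) J"
  shows "AE \<omega> in M. \<forall>s\<in>{0..T}. I s \<omega> + J s \<omega> = 0"
proof (rule AE_cadlag_zero)
  show "cadlag_on T (\<lambda>t. I t \<omega> + J t \<omega>)" if "\<omega> \<in> space M" for \<omega>
    using I J that by (intro cadlag_on_add) (auto simp: has_ito_integral_def has_jump_integral_def cadlag_adapted_def)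
  have F: "filtered_prob_space M F T" by unfold_locales
  have D: "AE \<omega> in M. I T \<omega> - I s \<omega> + (J T \<omega> - J s \<omega>) = 0" if s: "s \<in> {0..T}" for s
  proof -
    note p = stochastic_integral_properties[OF I J s]
    have "total_norm s (\<lambda>_ _. 0) (\<lambda>_ _ _. 0) = 0" by (simp add: total_norm_def ito_norm_def jump_norm_def)
    then have "(\<integral>\<^sup>+\<omega>. ennreal ((I T \<omega> - I s \<omega> + (J T \<omega> - J s \<omega>))\<^sup>2) \<partial>M) = 0" using p(4) by simp
    then show ?thesis using p(1) by (subst (asm) nn_integral_0_iff_AE) auto
  qed
  fix s assume s: "s \<in> {0..T}"
  have "0 \<in> {0..T}" using T_nonneg by simp
  from D[OF s] D[OF this] ito_integral_initial[OF F T_nonneg I] jump_integral_initial[OF F T_nonneg J]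
  show "AE \<omega> in M. I s \<omega> + J s \<omega> = 0" by eventually_elim simp
qed

subsection \<open>Jump integrals with random intensity\<close>

lemma predictable_rectangle_real:
  fixes k :: "'w \<Rightarrow> real"
  assumes F: "filtered_prob_space M F T" and t: "0 \<le> a" "a \<le> b" "b \<le> T" and k: "k \<in> borel_measurable (F a)"
  shows "(\<lambda>p. k (snd p) * indicator {a<..b} (fst p)) \<in> borel_measurable (predictable_algebra M F T)"
proof -
  have p: "(\<lambda>p. enn2real (ennreal (k (snd p)) * indicator {a<..b} (fst p))) \<in> borel_measurable (predictable_algebra M F T)"
    by (intro borel_measurable_enn2real predictable_rectangle[OF F t, of "\<lambda>\<omega>. ennreal (k \<omega>)"]) (use k in measurable)
  have n: "(\<lambda>p. enn2real (ennreal (- k (snd p)) * indicator {a<..b} (fst p))) \<in> borel_measurable (predictable_algebra M F T)"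
    by (intro borel_measurable_enn2real predictable_rectangle[OF F t, of "\<lambda>\<omega>. ennreal (- k \<omega>)"]) (use k in measurable)
  have e: "k (snd p) * indicator {a<..b} (fst p) =
     enn2real (ennreal (k (snd p)) * indicator {a<..b} (fst p)) - enn2real (ennreal (- k (snd p)) * indicator {a<..b} (fst p))" for p :: "real \<times> 'w"
    by (cases "0 \<le> k (snd p)") (auto simp: indicator_def ennreal_neg)
  show ?thesis unfolding e by (intro borel_measurable_diff p n)
qed

lemma random_measure_measurable:
  assumes "random_measure M F T \<mu>" "B \<in> sets (mark_space T)" "B \<subseteq> {0..t} \<times> UNIV" "t \<in> {0..T}"
  shows "(\<lambda>\<omega>. emeasure (\<mu> \<omega>) B) \<in> borel_measurable (F t)"
  using assms unfolding random_measure_def by blast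

text \<open>Predictability is what allows the compensator to be applied to the absolute value of a
  simple field.\<close>

lemma simple_field_predictable:
  assumes F: "filtered_prob_space M F T" and \<nu>: "sets \<nu> = sets R0" and G: "simple_field M F T \<nu> G"
  shows "(\<lambda>x. simple_field_eval G (fst (fst x)) (snd (fst x)) (snd x)) \<in> borel_measurable (predictable_algebra M F T \<Otimes>\<^sub>M R0)"
proof -
  have "(\<lambda>x. \<Sum>p<length G. (snd (snd (snd (G ! p))) (snd (fst x)) * indicator {fst (G ! p)<..fst (snd (G ! p))} (fst (fst x)))
     * indicator (fst (snd (snd (G ! p)))) (snd x) :: real) \<in> borel_measurable (predictable_algebra M F T \<Otimes>\<^sub>M R0)"
  proof (rule borel_measurable_sum)
    fix p assume "p \<in> {..<length G}"
    then have p: "p < length G" by simp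
    obtain a b A h where e: "G ! p = (a, b, A, h)" by (cases "G ! p")
    have "(a, b, A, h) \<in> set G" using e p by (metis nth_mem)
    then have H: "0 \<le> a" "a \<le> b" "b \<le> T" "h \<in> borel_measurable (F a)" "A \<in> sets R0"
      using G \<nu> by (auto simp: simple_field_def)
    have "(\<lambda>x. snd (snd (snd (G ! p))) (snd (fst x)) * indicator {fst (G ! p)<..fst (snd (G ! p))} (fst (fst x))) \<in> borel_measurable (predictable_algebra M F T \<Otimes>\<^sub>M R0)"
      unfolding e fst_conv snd_conv by (rule measurable_compose[OF measurable_fst predictable_rectangle_real[OF F H(1-4)]])
    moreover have "(\<lambda>x. indicator (fst (snd (snd (G ! p)))) (snd x) :: real) \<in> borel_measurable (predictable_algebra M F T \<Otimes>\<^sub>M R0)"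
      unfolding e by (simp, rule measurable_compose[OF measurable_snd borel_measurable_indicator[OF H(5)]])
    ultimately show "(\<lambda>x. (snd (snd (snd (G ! p))) (snd (fst x)) * indicator {fst (G ! p)<..fst (snd (G ! p))} (fst (fst x)))
      * indicator (fst (snd (snd (G ! p)))) (snd x) :: real) \<in> borel_measurable (predictable_algebra M F T \<Otimes>\<^sub>M R0)"
      by (rule borel_measurable_times)
  qed
  then show ?thesis
    unfolding simple_field_eval_def[abs_def] sum_list_nth_4 by (simp add: case_prod_beta')
qed

lemma tonelli_time_omega_mark:
  assumes M: "prob_space M" and \<nu>: "sigma_finite_measure \<nu>"
    and g[measurable]: "g \<in> borel_measurable ((time_leb T \<Otimes>\<^sub>M M) \<Otimes>\<^sub>M \<nu>)"
  shows "(\<integral>\<^sup>+\<omega>. (\<integral>\<^sup>+x. g ((fst x, \<omega>), snd x) \<partial>(time_leb T \<Otimes>\<^sub>M \<nu>)) \<partial>M) = (\<integral>\<^sup>+x. g x \<partial>((time_leb T \<Otimes>\<^sub>M M) \<Otimes>\<^sub>M \<nu>))"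
proof -
  interpret prob_space M by (rule M)
  interpret \<nu>: sigma_finite_measure \<nu> by (rule \<nu>)
  interpret P: pair_sigma_finite "time_leb T" M
    using sigma_finite_time_leb sigma_finite_measure_axioms by (simp add: pair_sigma_finite_def)
  have m: "(\<lambda>p. \<integral>\<^sup>+z. g (p, z) \<partial>\<nu>) \<in> borel_measurable (time_leb T \<Otimes>\<^sub>M M)"
    by (rule \<nu>.borel_measurable_nn_integral_fst) (rule g)
  have "(\<integral>\<^sup>+x. g x \<partial>((time_leb T \<Otimes>\<^sub>M M) \<Otimes>\<^sub>M \<nu>)) = (\<integral>\<^sup>+p. (\<integral>\<^sup>+z. g (p, z) \<partial>\<nu>) \<partial>(time_leb T \<Otimes>\<^sub>M M))"
    by (rule \<nu>.nn_integral_fst[symmetric]) (rule g)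
  also have "\<dots> = (\<integral>\<^sup>+r. (\<integral>\<^sup>+\<omega>. (\<integral>\<^sup>+z. g ((r, \<omega>), z) \<partial>\<nu>) \<partial>M) \<partial>time_leb T)"
    by (rule nn_integral_fst[OF m, symmetric])
  also have "\<dots> = (\<integral>\<^sup>+\<omega>. (\<integral>\<^sup>+r. (\<integral>\<^sup>+z. g ((r, \<omega>), z) \<partial>\<nu>) \<partial>time_leb T) \<partial>M)"
    by (rule P.Fubini[OF m, symmetric])
  also have "\<dots> = (\<integral>\<^sup>+\<omega>. (\<integral>\<^sup>+x. g ((fst x, \<omega>), snd x) \<partial>(time_leb T \<Otimes>\<^sub>M \<nu>)) \<partial>M)"
  proof (rule nn_integral_cong)
    fix \<omega> assume [measurable]: "\<omega> \<in> space M"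
    have "(\<lambda>x. g ((fst x, \<omega>), snd x)) \<in> borel_measurable (time_leb T \<Otimes>\<^sub>M \<nu>)" by measurable
    from \<nu>.nn_integral_fst[OF this]
    show "(\<integral>\<^sup>+r. (\<integral>\<^sup>+z. g ((r, \<omega>), z) \<partial>\<nu>) \<partial>time_leb T) = (\<integral>\<^sup>+x. g ((fst x, \<omega>), snd x) \<partial>(time_leb T \<Otimes>\<^sub>M \<nu>))"
      by simp
  qed
  finally show ?thesis by simp
qed

text \<open>Turns smallness in L^2 into smallness in L^1 on a finite measure space, through |y|
  \<le> \<epsilon> + y^2/\<epsilon> and hence without roots.\<close>

lemma nn_integral_abs_le:
  fixes f :: "'a \<Rightarrow> real"
  assumes [measurable]: "f \<in> borel_measurable M" and \<epsilon>: "\<epsilon> > 0"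
  shows "(\<integral>\<^sup>+x. ennreal \<bar>f x\<bar> \<partial>M) \<le> ennreal \<epsilon> * emeasure M (space M) + ennreal (1 / \<epsilon>) * (\<integral>\<^sup>+x. ennreal ((f x)\<^sup>2) \<partial>M)"
proof -
  have *: "ennreal \<bar>y\<bar> \<le> ennreal \<epsilon> + ennreal (1 / \<epsilon>) * ennreal (y\<^sup>2)" for y
  proof -
    have "0 \<le> (\<epsilon> - \<bar>y\<bar> / 2)\<^sup>2" by simp
    then have "\<epsilon> * \<bar>y\<bar> \<le> \<epsilon>\<^sup>2 + y\<^sup>2 / 4" by (simp add: power2_diff power_divide)
    also have "\<dots> \<le> \<epsilon>\<^sup>2 + y\<^sup>2" by simp
    also have "\<dots> = \<epsilon> * (\<epsilon> + 1 / \<epsilon> * y\<^sup>2)" using \<epsilon> by (simp add: distrib_left power2_eq_square)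
    finally have "\<bar>y\<bar> \<le> \<epsilon> + 1 / \<epsilon> * y\<^sup>2" using \<epsilon> by simp
    then have "ennreal \<bar>y\<bar> \<le> ennreal (\<epsilon> + 1 / \<epsilon> * y\<^sup>2)" by (rule ennreal_leI)
    also have "\<dots> = ennreal \<epsilon> + ennreal (1 / \<epsilon>) * ennreal (y\<^sup>2)"
      using \<epsilon> by (simp add: ennreal_plus flip: ennreal_mult)
    finally show ?thesis .
  qed
  have "(\<integral>\<^sup>+x. ennreal \<bar>f x\<bar> \<partial>M) \<le> (\<integral>\<^sup>+x. ennreal \<epsilon> + ennreal (1 / \<epsilon>) * ennreal ((f x)\<^sup>2) \<partial>M)"
    by (intro nn_integral_mono *)
  also have "\<dots> = ennreal \<epsilon> * emeasure M (space M) + ennreal (1 / \<epsilon>) * (\<integral>\<^sup>+x. ennreal ((f x)\<^sup>2) \<partial>M)"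
    by (simp add: nn_integral_add nn_integral_cmult)
  finally show ?thesis .
qed

text \<open>For a random intensity only the \<open>L\<^sup>1\<close> bound of the jump integral through the compensator is at hand;
  since \<open>\<nu>\<close> is finite it suffices for the vanishing integrand.\<close>

lemma jump_integral_zero:
  assumes F: "filtered_prob_space M F T" and T: "0 \<le> T" and \<nu>: "sets \<nu> = sets R0" "emeasure \<nu> (- {0}) = 1"
    and rm: "random_measure M F T \<mu>" and comp: "has_compensator M F T \<nu> \<mu> \<Lambda>"
    and \<Lambda>m: "(\<lambda>x. \<Lambda> (fst x) (snd x)) \<in> borel_measurable (time_leb T \<Otimes>\<^sub>M M)"
    and \<Lambda>: "\<And>r \<omega>. r \<in> {0..T} \<Longrightarrow> \<omega> \<in> space M \<Longrightarrow> 0 \<le> \<Lambda> r \<omega> \<and> \<Lambda> r \<omega> \<le> c2"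
    and J: "has_jump_integral M F T \<nu> \<mu> \<Lambda> (\<lambda>_ _ _. 0) J" and s: "s \<in> {0..T}"
  shows "AE \<omega> in M. J s \<omega> = 0"
proof -
  interpret filtered_prob_space M F T by (rule F)
  have spR0: "space R0 = - {0}" by (simp add: R0_def space_restrict_space)
  have sp\<nu>: "space \<nu> = - {0}" using sets_eq_imp_space_eq[OF \<nu>(1)] spR0 by simp
  interpret \<nu>: prob_space \<nu> by (rule prob_spaceI) (simp add: sp\<nu> \<nu>)
  interpret PN: pair_sigma_finite "time_leb T" \<nu>
    using sigma_finite_time_leb \<nu>.sigma_finite_measure_axioms by (simp add: pair_sigma_finite_def)
  have U: "- {0} \<in> sets R0" using sets.top[of R0] by (simp add: spR0)
  have c20: "0 \<le> c2"
  proof -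
    obtain \<omega> where "\<omega> \<in> space M" using not_empty by blast
    then show ?thesis using \<Lambda>[of 0 \<omega>] T by fastforce
  qed
  \<comment> \<open>\<open>A1\<close> and \<open>A2\<close> are the pathwise L^1 sizes of a simple
    field under \<open>\<mu>\<close> and under its compensator. Their expectations agree by
    \<open>comp\<close>, and the bound on the intensity reduces both to \<open>q\<close>, the L^1
    norm under the product measure.\<close>
  define A1 where "A1 G \<omega> = (\<integral>\<^sup>+x. ennreal \<bar>simple_field_eval G (fst x) \<omega> (snd x)\<bar> \<partial>\<mu> \<omega>)" for G \<omega>
  define A2 where "A2 G \<omega> = (\<integral>\<^sup>+x. ennreal \<bar>simple_field_eval G (fst x) \<omega> (snd x)\<bar> * ennreal (\<Lambda> (fst x) \<omega>) \<partial>(time_leb T \<Otimes>\<^sub>M \<nu>))" for G \<omega>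
  define q where "q G = (\<integral>\<^sup>+x. ennreal \<bar>simple_field_eval G (fst (fst x)) (snd (fst x)) (snd x)\<bar> \<partial>((time_leb T \<Otimes>\<^sub>M M) \<Otimes>\<^sub>M \<nu>))" for G
  have A12: "(\<integral>\<^sup>+\<omega>. A1 G \<omega> \<partial>M) = (\<integral>\<^sup>+\<omega>. A2 G \<omega> \<partial>M)" if G: "simple_field M F T \<nu> G" for G
  proof -
    have m: "(\<lambda>x. ennreal \<bar>simple_field_eval G (fst (fst x)) (snd (fst x)) (snd x)\<bar>) \<in> borel_measurable (predictable_algebra M F T \<Otimes>\<^sub>M R0)"
      using simple_field_predictable[OF F \<nu>(1) G] by measurable
    show ?thesis
      using comp[unfolded has_compensator_def case_prod_beta', rule_format, OF m] by (simp add: A1_def A2_def)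
  qed
  have A2q: "(\<integral>\<^sup>+\<omega>. A2 G \<omega> \<partial>M) \<le> ennreal c2 * q G" if G: "simple_field M F T \<nu> G" for G
  proof -
    note fm = simple_field_eval_measurable[OF G]
    have "(\<integral>\<^sup>+\<omega>. A2 G \<omega> \<partial>M) \<le> (\<integral>\<^sup>+\<omega>. (\<integral>\<^sup>+x. ennreal c2 * ennreal \<bar>simple_field_eval G (fst x) \<omega> (snd x)\<bar> \<partial>(time_leb T \<Otimes>\<^sub>M \<nu>)) \<partial>M)"
      unfolding A2_def
    proof (intro nn_integral_mono)
      fix \<omega> x assume "\<omega> \<in> space M" "x \<in> space (time_leb T \<Otimes>\<^sub>M \<nu>)"
      then have "\<Lambda> (fst x) \<omega> \<le> c2" using \<Lambda> by (auto simp: space_pair_measure)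
      then show "ennreal \<bar>simple_field_eval G (fst x) \<omega> (snd x)\<bar> * ennreal (\<Lambda> (fst x) \<omega>) \<le> ennreal c2 * ennreal \<bar>simple_field_eval G (fst x) \<omega> (snd x)\<bar>"
        by (subst mult.commute) (intro mult_right_mono ennreal_leI, auto)
    qed
    also have "\<dots> = (\<integral>\<^sup>+x. ennreal c2 * ennreal \<bar>simple_field_eval G (fst (fst x)) (snd (fst x)) (snd x)\<bar> \<partial>((time_leb T \<Otimes>\<^sub>M M) \<Otimes>\<^sub>M \<nu>))"
      using tonelli_time_omega_mark[OF prob_space_axioms \<nu>.sigma_finite_measure_axioms,
          of "\<lambda>x. ennreal c2 * ennreal \<bar>simple_field_eval G (fst (fst x)) (snd (fst x)) (snd x)\<bar>" T] fm by simp
    also have "\<dots> = ennreal c2 * q G" unfolding q_def by (rule nn_integral_cmult) (use fm in simp)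
    finally show ?thesis .
  qed
  have total: "emeasure ((time_leb T \<Otimes>\<^sub>M M) \<Otimes>\<^sub>M \<nu>) (space ((time_leb T \<Otimes>\<^sub>M M) \<Otimes>\<^sub>M \<nu>)) = ennreal T"
  proof -
    have tT: "emeasure (time_leb T) {0..T} = ennreal T"
      unfolding time_leb_def using T by (subst emeasure_restrict_space) auto
    have st: "{0..T} \<in> sets (time_leb T)" using sets.top[of "time_leb T"] by simp
    have 1: "emeasure (time_leb T \<Otimes>\<^sub>M M) ({0..T} \<times> space M) = ennreal T"
      using emeasure_pair_measure_Times[OF st sets.top] tT by (simp add: emeasure_space_1)
    have "{0..T} \<times> space M \<in> sets (time_leb T \<Otimes>\<^sub>M M)" using st by auto
    from \<nu>.emeasure_pair_measure_Times[OF this sets.top] 1 show ?thesis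
      by (simp add: space_pair_measure \<nu>.emeasure_space_1)
  qed
  have fin: "AE \<omega> in M. emeasure (\<mu> \<omega>) ({0<..T} \<times> (- {0})) < \<infinity>"
  proof -
    \<comment> \<open>The field that is 1 on \<open>(0, T]\<close> times all marks: its integral is
      the total number of jumps, whose expectation is thus at most \<open>c2 * T\<close>.\<close>
    define G0 :: "'a simple_field" where "G0 = [(0, T, - {0}, \<lambda>_. 1)]"
    have G0: "simple_field M F T \<nu> G0"
      using T U \<nu> by (auto simp: simple_field_def G0_def bounded_iff)
    have B: "{0<..T} \<times> (- {0}) \<in> sets (mark_space T)" by (rule interval_times_mark_space[OF _ _ U]) auto
    have A1e: "A1 G0 \<omega> = emeasure (\<mu> \<omega>) ({0<..T} \<times> (- {0}))" if "\<omega> \<in> space M" for \<omega>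
    proof -
      have "A1 G0 \<omega> = (\<integral>\<^sup>+x. indicator ({0<..T} \<times> (- {0})) x \<partial>\<mu> \<omega>)"
        unfolding A1_def by (intro nn_integral_cong) (auto simp: G0_def simple_field_eval_def indicator_def)
      then show ?thesis using B rm that by (simp add: random_measure_def)
    qed
    have "q G0 \<le> (\<integral>\<^sup>+x. 1 \<partial>((time_leb T \<Otimes>\<^sub>M M) \<Otimes>\<^sub>M \<nu>))"
      unfolding q_def by (intro nn_integral_mono) (auto simp: G0_def simple_field_eval_def indicator_def)
    also have "\<dots> = ennreal T" using total by simp
    finally have "(\<integral>\<^sup>+\<omega>. A1 G0 \<omega> \<partial>M) \<le> ennreal c2 * ennreal T"
      unfolding A12[OF G0] by (intro order_trans[OF A2q[OF G0]] mult_left_mono) auto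
    also have "\<dots> < \<infinity>" by (simp add: ennreal_mult_less_top)
    finally have lt: "(\<integral>\<^sup>+\<omega>. emeasure (\<mu> \<omega>) ({0<..T} \<times> (- {0})) \<partial>M) < \<infinity>"
      by (simp add: A1e cong: nn_integral_cong)
    have "{0<..T} \<times> (- {0}) \<subseteq> {0..T} \<times> UNIV" by auto
    then have "(\<lambda>\<omega>. emeasure (\<mu> \<omega>) ({0<..T} \<times> (- {0}))) \<in> borel_measurable (F T)"
      by (rule random_measure_measurable[OF rm B]) (use T in simp)
    then have "(\<lambda>\<omega>. emeasure (\<mu> \<omega>) ({0<..T} \<times> (- {0}))) \<in> borel_measurable M"
      by (rule measurable_F[rotated]) (use T in auto)
    then have "AE \<omega> in M. emeasure (\<mu> \<omega>) ({0<..T} \<times> (- {0})) \<noteq> \<infinity>"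
      by (rule nn_integral_PInf_AE) (use lt in auto)
    then show ?thesis by eventually_elim (simp add: less_top)
  qed
  define S where "S G = simple_jump_integral \<nu> \<mu> \<Lambda> G s" for G
  \<comment> \<open>The elementary integral is split into its jump part \<open>P\<close> and its
    compensator part \<open>Q\<close>: each is an ordinary Lebesgue integral along almost every path
    and can be estimated by absolute values.\<close>
  define P where "P G \<omega> = (\<Sum>(a, b, A, h)\<leftarrow>G. h \<omega> * measure (\<mu> \<omega>) ({min a s<..min b s} \<times> A))" for G \<omega>
  define Q where "Q G \<omega> = (\<Sum>(a, b, A, h)\<leftarrow>G. h \<omega> * ((LBINT r:{min a s<..min b s}. \<Lambda> r \<omega>) * measure \<nu> A))" for G \<omega>
  have SPQ: "S G \<omega> = P G \<omega> - Q G \<omega>" for G \<omega>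
    unfolding S_def P_def Q_def simple_jump_integral_def compensated_def
    by (induction G) (auto simp: right_diff_distrib)
  have \<Lambda>s: "(\<lambda>r. \<Lambda> r \<omega>) \<in> borel_measurable (time_leb T)" if "\<omega> \<in> space M" for \<omega>
    using measurable_compose[OF measurable_Pair2'[OF that] \<Lambda>m] by simp
  have \<Lambda>i: "integrable (time_leb T) (\<lambda>r. indicator {a<..b} r * \<Lambda> r \<omega>)" if "\<omega> \<in> space M" for a b \<omega>
  proof (rule finite_measure.integrable_const_bound[OF finite_measure_time_leb, of _ c2])
    show "AE r in time_leb T. norm (indicator {a<..b} r * \<Lambda> r \<omega>) \<le> c2"
      using \<Lambda>[OF _ that] c20 by (intro AE_I2) (auto simp: indicator_def)
    show "(\<lambda>r. indicator {a<..b} r * \<Lambda> r \<omega>) \<in> borel_measurable (time_leb T)"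
      by (intro borel_measurable_times \<Lambda>s[OF that] measurable_compose[OF measurable_time_id]) simp
  qed
  have PQ_le: "AE \<omega> in M. ennreal \<bar>P G \<omega>\<bar> \<le> A1 G \<omega> \<and> ennreal \<bar>Q G \<omega>\<bar> \<le> A2 G \<omega>" if G: "simple_field M F T \<nu> G" for G
    using fin AE_space
  proof eventually_elim
    case (elim \<omega>)
    define a where "a = (\<lambda>p. fst (G ! p))"
    define b where "b = (\<lambda>p. fst (snd (G ! p)))"
    define A where "A = (\<lambda>p. fst (snd (snd (G ! p))))"
    define h where "h = (\<lambda>p. snd (snd (snd (G ! p))))"
    have nth: "G ! p = (a p, b p, A p, h p)" for p by (simp add: a_def b_def h_def A_def)
    have H: "0 \<le> a p" "a p \<le> b p" "b p \<le> T" "A p \<in> sets \<nu>" if "p < length G" for p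
    proof -
      have "(a p, b p, A p, h p) \<in> set G" using nth that by (metis nth_mem)
      then show "0 \<le> a p" "a p \<le> b p" "b p \<le> T" "A p \<in> sets \<nu>" using G by (auto simp: simple_field_def)
    qed
    define I where "I p = {min (a p) s<..min (b p) s}" for p
    have Bs: "I p \<times> A p \<in> sets (\<mu> \<omega>)" if "p < length G" for p
      using interval_times_mark_space[of "min (a p) s" "min (b p) s" T "A p"] H[OF that] s \<nu> rm elim(2)
      by (auto simp: I_def random_measure_def)
    have Bf: "emeasure (\<mu> \<omega>) (I p \<times> A p) < \<infinity>" if "p < length G" for p
    proof -
      have "A p \<subseteq> - {0}" using sets.sets_into_space[OF H(4)[OF that]] sp\<nu> by simp
      then have "I p \<times> A p \<subseteq> {0<..T} \<times> (- {0})" using H[OF that] s by (auto simp: I_def)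
      then have "emeasure (\<mu> \<omega>) (I p \<times> A p) \<le> emeasure (\<mu> \<omega>) ({0<..T} \<times> (- {0}))"
        using interval_times_mark_space[OF _ _ U, of 0 T T] rm elim(2) by (intro emeasure_mono) (auto simp: random_measure_def)
      then show ?thesis using elim(1) by (rule le_less_trans)
    qed
    \<comment> \<open>The simple field stopped at time \<open>s\<close>, at the fixed \<omega>. Its
      integrals under \<open>\<mu>\<close> and under the compensator are \<open>P\<close> and
      \<open>Q\<close>, and stopping can only decrease its absolute value.\<close>
    define f where "f x = (\<Sum>p<length G. h p \<omega> * indicator (I p \<times> A p) x)" for x
    have fe: "\<bar>f x\<bar> \<le> \<bar>simple_field_eval G (fst x) \<omega> (snd x)\<bar>" for x
    proof -
      have "f x = indicator {..s} (fst x) * simple_field_eval G (fst x) \<omega> (snd x)"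
        unfolding f_def simple_field_eval_def sum_list_nth_4 nth prod.case sum_distrib_left
        by (intro sum.cong refl) (auto simp: I_def indicator_def mem_Times_iff)
      then show ?thesis by (simp add: indicator_def)
    qed
    have i1: "integrable (\<mu> \<omega>) (\<lambda>x. h p \<omega> * indicator (I p \<times> A p) x)" if "p < length G" for p
      by (intro integrable_mult_right integrable_real_indicator Bs[OF that] Bf[OF that])
    have f1: "(\<integral>x. f x \<partial>\<mu> \<omega>) = (\<Sum>p<length G. h p \<omega> * measure (\<mu> \<omega>) (I p \<times> A p))"
    proof -
      have "(\<integral>x. f x \<partial>\<mu> \<omega>) = (\<Sum>p<length G. \<integral>x. h p \<omega> * indicator (I p \<times> A p) x \<partial>\<mu> \<omega>)"
        unfolding f_def by (rule Bochner_Integration.integral_sum) (rule i1, simp)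
      also have "\<dots> = (\<Sum>p<length G. h p \<omega> * measure (\<mu> \<omega>) (I p \<times> A p))"
        by (intro sum.cong refl) (simp add: Bs)
      finally show ?thesis .
    qed
    have fi1: "integrable (\<mu> \<omega>) f" unfolding f_def by (intro Bochner_Integration.integrable_sum i1) simp
    have iA: "integrable \<nu> (indicator (A p) :: real \<Rightarrow> real)" if "p < length G" for p
      using H(4)[OF that] by (intro integrable_real_indicator) (auto simp: \<nu>.emeasure_eq_measure)
    note prod = PN.product_function[OF \<Lambda>i[OF elim(2)] iA]
    have e2: "f x * \<Lambda> (fst x) \<omega> = (\<Sum>p<length G. h p \<omega> * ((indicator {min (a p) s<..min (b p) s} (fst x) * \<Lambda> (fst x) \<omega>) * indicator (A p) (snd x)))" for x
      unfolding f_def sum_distrib_right by (intro sum.cong refl) (auto simp: I_def indicator_def mem_Times_iff)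
    have fi2: "integrable (time_leb T \<Otimes>\<^sub>M \<nu>) (\<lambda>x. f x * \<Lambda> (fst x) \<omega>)"
      unfolding e2 by (intro Bochner_Integration.integrable_sum integrable_mult_right prod(1)) simp
    have f2: "(\<integral>x. f x * \<Lambda> (fst x) \<omega> \<partial>(time_leb T \<Otimes>\<^sub>M \<nu>)) = (\<Sum>p<length G. h p \<omega> * ((LBINT r:{min (a p) s<..min (b p) s}. \<Lambda> r \<omega>) * measure \<nu> (A p)))"
      unfolding e2
    proof (subst Bochner_Integration.integral_sum)
      show "(\<Sum>p<length G. \<integral>x. h p \<omega> * ((indicator {min (a p) s<..min (b p) s} (fst x) * \<Lambda> (fst x) \<omega>) * indicator (A p) (snd x)) \<partial>(time_leb T \<Otimes>\<^sub>M \<nu>)) =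
        (\<Sum>p<length G. h p \<omega> * ((LBINT r:{min (a p) s<..min (b p) s}. \<Lambda> r \<omega>) * measure \<nu> (A p)))"
      proof (intro sum.cong refl)
        fix p assume "p \<in> {..<length G}"
        then have p: "p < length G" by simp
        show "(\<integral>x. h p \<omega> * ((indicator {min (a p) s<..min (b p) s} (fst x) * \<Lambda> (fst x) \<omega>) * indicator (A p) (snd x)) \<partial>(time_leb T \<Otimes>\<^sub>M \<nu>)) =
          h p \<omega> * ((LBINT r:{min (a p) s<..min (b p) s}. \<Lambda> r \<omega>) * measure \<nu> (A p))"
          unfolding Bochner_Integration.integral_mult_right_zero prod(2)[OF p]
          using integral_time_leb(1)[of "min (a p) s" "min (b p) s" T "\<lambda>r. \<Lambda> r \<omega>"] H[OF p] s by simp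
      qed
    qed (use prod(1) in auto)
    have Pe: "P G \<omega> = (\<integral>x. f x \<partial>\<mu> \<omega>)" and Qe: "Q G \<omega> = (\<integral>x. f x * \<Lambda> (fst x) \<omega> \<partial>(time_leb T \<Otimes>\<^sub>M \<nu>))"
      unfolding f1 f2 P_def Q_def sum_list_nth_4 nth prod.case I_def by (rule refl)+
    show ?case unfolding Pe Qe
    proof
      have "ennreal \<bar>\<integral>x. f x \<partial>\<mu> \<omega>\<bar> \<le> (\<integral>\<^sup>+x. ennreal \<bar>f x\<bar> \<partial>\<mu> \<omega>)"
        using integral_norm_bound_ennreal[OF fi1] by simp
      also have "\<dots> \<le> A1 G \<omega>" unfolding A1_def by (intro nn_integral_mono ennreal_leI fe)
      finally show "ennreal \<bar>\<integral>x. f x \<partial>\<mu> \<omega>\<bar> \<le> A1 G \<omega>" .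
      have "ennreal \<bar>\<integral>x. f x * \<Lambda> (fst x) \<omega> \<partial>(time_leb T \<Otimes>\<^sub>M \<nu>)\<bar> \<le> (\<integral>\<^sup>+x. ennreal \<bar>f x * \<Lambda> (fst x) \<omega>\<bar> \<partial>(time_leb T \<Otimes>\<^sub>M \<nu>))"
        using integral_norm_bound_ennreal[OF fi2] by simp
      also have "\<dots> \<le> A2 G \<omega>" unfolding A2_def
      proof (intro nn_integral_mono)
        fix x assume "x \<in> space (time_leb T \<Otimes>\<^sub>M \<nu>)"
        then have "0 \<le> \<Lambda> (fst x) \<omega>" using \<Lambda> elim(2) by (auto simp: space_pair_measure)
        then show "ennreal \<bar>f x * \<Lambda> (fst x) \<omega>\<bar> \<le> ennreal \<bar>simple_field_eval G (fst x) \<omega> (snd x)\<bar> * ennreal (\<Lambda> (fst x) \<omega>)"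
          using fe[of x] by (simp add: abs_mult flip: ennreal_mult) (intro ennreal_leI mult_right_mono)
      qed
      finally show "ennreal \<bar>\<integral>x. f x * \<Lambda> (fst x) \<omega> \<partial>(time_leb T \<Otimes>\<^sub>M \<nu>)\<bar> \<le> A2 G \<omega>" .
    qed
  qed
  have SM: "P G \<in> borel_measurable M" "Q G \<in> borel_measurable M" if G: "simple_field M F T \<nu> G" for G
  proof -
    have parts: "snd (snd (snd (G ! p))) \<in> borel_measurable M"
      "(\<lambda>\<omega>. measure (\<mu> \<omega>) ({min (fst (G ! p)) s<..min (fst (snd (G ! p))) s} \<times> fst (snd (snd (G ! p))))) \<in> borel_measurable M"
      "(\<lambda>\<omega>. LBINT r:{min (fst (G ! p)) s<..min (fst (snd (G ! p))) s}. \<Lambda> r \<omega>) \<in> borel_measurable M" if p: "p < length G" for p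
    proof -
      obtain a b A h where e: "G ! p = (a, b, A, h)" by (cases "G ! p")
      have "(a, b, A, h) \<in> set G" using e p by (metis nth_mem)
      then have H: "0 \<le> a" "a \<le> b" "b \<le> T" "h \<in> borel_measurable (F a)" "A \<in> sets R0"
        using G \<nu> by (auto simp: simple_field_def)
      show "snd (snd (snd (G ! p))) \<in> borel_measurable M"
        unfolding e using measurable_F[OF _ H(4)] H by simp
      have B: "{min a s<..min b s} \<times> A \<in> sets (mark_space T)" "{min a s<..min b s} \<times> A \<subseteq> {0..T} \<times> UNIV"
        using H s by (auto intro!: interval_times_mark_space)
      then have "(\<lambda>\<omega>. emeasure (\<mu> \<omega>) ({min a s<..min b s} \<times> A)) \<in> borel_measurable (F T)"
        by (intro random_measure_measurable[OF rm B]) (use T in simp)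
      then have "(\<lambda>\<omega>. emeasure (\<mu> \<omega>) ({min a s<..min b s} \<times> A)) \<in> borel_measurable M"
        by (rule measurable_F[rotated]) (use T in auto)
      then show "(\<lambda>\<omega>. measure (\<mu> \<omega>) ({min (fst (G ! p)) s<..min (fst (snd (G ! p))) s} \<times> fst (snd (snd (G ! p))))) \<in> borel_measurable M"
        unfolding e measure_def by simp
      have le: "0 \<le> min a s" "min b s \<le> T" using H s by auto
      have "(\<lambda>x. indicator {min a s<..min b s} (snd x) * \<Lambda> (snd x) (fst x)) \<in> borel_measurable (M \<Otimes>\<^sub>M time_leb T)"
        by (intro borel_measurable_times measurable_compose[OF measurable_compose[OF measurable_snd measurable_time_id]]
            measurable_compose[OF measurable_pair_swap' \<Lambda>m, simplified case_prod_beta' fst_conv snd_conv]) simp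
      then have "(\<lambda>\<omega>. \<integral>r. indicator {min a s<..min b s} r * \<Lambda> r \<omega> \<partial>time_leb T) \<in> borel_measurable M"
        by (intro sigma_finite_measure.borel_measurable_lebesgue_integral[OF sigma_finite_time_leb]) (simp add: case_prod_beta')
      then show "(\<lambda>\<omega>. LBINT r:{min (fst (G ! p)) s<..min (fst (snd (G ! p))) s}. \<Lambda> r \<omega>) \<in> borel_measurable M"
        unfolding e fst_conv snd_conv integral_time_leb(1)[OF le] .
    qed
    have m: "(\<lambda>\<omega>. \<Sum>p<length G. snd (snd (snd (G ! p))) \<omega> * measure (\<mu> \<omega>) ({min (fst (G ! p)) s<..min (fst (snd (G ! p))) s} \<times> fst (snd (snd (G ! p))))) \<in> borel_measurable M"
      "(\<lambda>\<omega>. \<Sum>p<length G. snd (snd (snd (G ! p))) \<omega> * ((LBINT r:{min (fst (G ! p)) s<..min (fst (snd (G ! p))) s}. \<Lambda> r \<omega>) * measure \<nu> (fst (snd (snd (G ! p)))))) \<in> borel_measurable M"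
      by (rule borel_measurable_sum, intro borel_measurable_times borel_measurable_const, (rule parts, simp)+)+
    show "P G \<in> borel_measurable M" "Q G \<in> borel_measurable M"
      using m unfolding P_def[abs_def] Q_def[abs_def] sum_list_nth_4 by (simp_all add: case_prod_beta')
  qed
  \<comment> \<open>The factor 2 stands for the two parts: the jump part and the compensator part
    have the same L^1 bound.\<close>
  have Sq: "(\<integral>\<^sup>+\<omega>. ennreal \<bar>S G \<omega>\<bar> \<partial>M) \<le> 2 * (ennreal c2 * q G)" if G: "simple_field M F T \<nu> G" for G
  proof -
    have "(\<integral>\<^sup>+\<omega>. ennreal \<bar>S G \<omega>\<bar> \<partial>M) \<le> (\<integral>\<^sup>+\<omega>. ennreal \<bar>P G \<omega>\<bar> + ennreal \<bar>Q G \<omega>\<bar> \<partial>M)"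
    proof (intro nn_integral_mono)
      fix \<omega>
      have "ennreal \<bar>S G \<omega>\<bar> \<le> ennreal (\<bar>P G \<omega>\<bar> + \<bar>Q G \<omega>\<bar>)"
        unfolding SPQ by (intro ennreal_leI abs_triangle_ineq4)
      then show "ennreal \<bar>S G \<omega>\<bar> \<le> ennreal \<bar>P G \<omega>\<bar> + ennreal \<bar>Q G \<omega>\<bar>" by (simp add: ennreal_plus)
    qed
    also have "\<dots> = (\<integral>\<^sup>+\<omega>. ennreal \<bar>P G \<omega>\<bar> \<partial>M) + (\<integral>\<^sup>+\<omega>. ennreal \<bar>Q G \<omega>\<bar> \<partial>M)"
      by (rule nn_integral_add) (use SM[OF G] in measurable)
    also have "\<dots> \<le> (\<integral>\<^sup>+\<omega>. A1 G \<omega> \<partial>M) + (\<integral>\<^sup>+\<omega>. A2 G \<omega> \<partial>M)"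
      by (intro add_mono nn_integral_mono_AE; use PQ_le[OF G] in \<open>eventually_elim, blast\<close>)
    also have "\<dots> \<le> 2 * (ennreal c2 * q G)"
      unfolding A12[OF G] mult_2 by (intro add_mono A2q[OF G])
    finally show ?thesis .
  qed
  obtain G where G: "\<And>n. simple_field M F T \<nu> (G n)"
    and G1: "(\<lambda>n. \<integral>\<^sup>+x. ennreal ((simple_field_eval (G n) (fst (fst x)) (snd (fst x)) (snd x))\<^sup>2) \<partial>((time_leb T \<Otimes>\<^sub>M M) \<Otimes>\<^sub>M \<nu>)) \<longlonglongrightarrow> 0"
    and G2: "(\<lambda>n. \<integral>\<^sup>+\<omega>. ennreal ((S (G n) \<omega> - J s \<omega>)\<^sup>2) \<partial>M) \<longlonglongrightarrow> 0"
    using J s unfolding has_jump_integral_def case_prod_beta' S_def diff_0_right by blast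
  have Jm: "J s \<in> borel_measurable M"
    using J s cadlag_adapted_measurable by (auto simp: has_jump_integral_def)
  have Sm: "S (G n) \<in> borel_measurable M" for n
    unfolding SPQ[abs_def] using SM[OF G[of n]] by simp
  define E where "E = (\<integral>\<^sup>+\<omega>. ennreal \<bar>J s \<omega>\<bar> \<partial>M)"
  \<comment> \<open>For fixed \<open>\<epsilon>\<close> both L^2 errors disappear as
    \<open>n\<close> grows. What remains is \<open>\<epsilon>\<close> from the distance to the
    elementary integral and \<open>2 * c2 * \<epsilon> * T\<close> from its own L^1 norm.\<close>
  have E_le: "E \<le> ennreal (\<epsilon> * (1 + 2 * c2 * T))" if \<epsilon>: "\<epsilon> > 0" for \<epsilon>
  proof (rule LIMSEQ_le_const)
    let ?e = "\<lambda>n. \<integral>\<^sup>+x. ennreal ((simple_field_eval (G n) (fst (fst x)) (snd (fst x)) (snd x))\<^sup>2) \<partial>((time_leb T \<Otimes>\<^sub>M M) \<Otimes>\<^sub>M \<nu>)"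
    let ?d = "\<lambda>n. \<integral>\<^sup>+\<omega>. ennreal ((S (G n) \<omega> - J s \<omega>)\<^sup>2) \<partial>M"
    let ?r = "\<lambda>n. (ennreal \<epsilon> + ennreal (1 / \<epsilon>) * ?d n) + 2 * (ennreal c2 * (ennreal \<epsilon> * ennreal T + ennreal (1 / \<epsilon>) * ?e n))"
    have "E \<le> ?r n" for n
    proof -
      have "E \<le> (\<integral>\<^sup>+\<omega>. ennreal \<bar>S (G n) \<omega> - J s \<omega>\<bar> + ennreal \<bar>S (G n) \<omega>\<bar> \<partial>M)"
        unfolding E_def
      proof (intro nn_integral_mono)
        fix \<omega>
        have "ennreal \<bar>J s \<omega>\<bar> \<le> ennreal (\<bar>S (G n) \<omega> - J s \<omega>\<bar> + \<bar>S (G n) \<omega>\<bar>)" by (intro ennreal_leI) linarith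
        then show "ennreal \<bar>J s \<omega>\<bar> \<le> ennreal \<bar>S (G n) \<omega> - J s \<omega>\<bar> + ennreal \<bar>S (G n) \<omega>\<bar>" by (simp add: ennreal_plus)
      qed
      also have "\<dots> = (\<integral>\<^sup>+\<omega>. ennreal \<bar>S (G n) \<omega> - J s \<omega>\<bar> \<partial>M) + (\<integral>\<^sup>+\<omega>. ennreal \<bar>S (G n) \<omega>\<bar> \<partial>M)"
        by (rule nn_integral_add) (use Sm[of n] Jm in measurable)
      also have "\<dots> \<le> ?r n"
      proof (rule add_mono)
        show "(\<integral>\<^sup>+\<omega>. ennreal \<bar>S (G n) \<omega> - J s \<omega>\<bar> \<partial>M) \<le> ennreal \<epsilon> + ennreal (1 / \<epsilon>) * ?d n"
          using nn_integral_abs_le[of "\<lambda>\<omega>. S (G n) \<omega> - J s \<omega>" M \<epsilon>] Sm[of n] Jm \<epsilon> by (simp add: emeasure_space_1)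
        have "q (G n) \<le> ennreal \<epsilon> * ennreal T + ennreal (1 / \<epsilon>) * ?e n"
          unfolding q_def using nn_integral_abs_le[OF simple_field_eval_measurable[OF G[of n]] \<epsilon>] unfolding total .
        then show "(\<integral>\<^sup>+\<omega>. ennreal \<bar>S (G n) \<omega>\<bar> \<partial>M) \<le> 2 * (ennreal c2 * (ennreal \<epsilon> * ennreal T + ennreal (1 / \<epsilon>) * ?e n))"
          by (intro order_trans[OF Sq[OF G]] mult_left_mono) auto
      qed
      finally show ?thesis .
    qed
    then show "\<exists>N. \<forall>n\<ge>N. E \<le> ?r n" by blast
    have "?r \<longlonglongrightarrow> (ennreal \<epsilon> + ennreal (1 / \<epsilon>) * 0) + 2 * (ennreal c2 * (ennreal \<epsilon> * ennreal T + ennreal (1 / \<epsilon>) * 0))"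
      by (intro tendsto_add tendsto_const ennreal_tendsto_cmult G1 G2) auto
    moreover have "(ennreal \<epsilon> + ennreal (1 / \<epsilon>) * 0) + 2 * (ennreal c2 * (ennreal \<epsilon> * ennreal T + ennreal (1 / \<epsilon>) * 0)) = ennreal (\<epsilon> * (1 + 2 * c2 * T))"
    proof -
      have "ennreal (\<epsilon> * (1 + 2 * c2 * T)) = ennreal (\<epsilon> + 2 * (c2 * (\<epsilon> * T)))" by (simp add: algebra_simps)
      also have "\<dots> = ennreal \<epsilon> + ennreal (2 * (c2 * (\<epsilon> * T)))" using \<epsilon> c20 T by (intro ennreal_plus) auto
      also have "ennreal (2 * (c2 * (\<epsilon> * T))) = 2 * (ennreal c2 * (ennreal \<epsilon> * ennreal T))"
        using \<epsilon> c20 T by (simp add: ennreal_mult)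
      finally show ?thesis by simp
    qed
    ultimately show "?r \<longlonglongrightarrow> ennreal (\<epsilon> * (1 + 2 * c2 * T))" by simp
  qed
  have "E \<le> 0"
  proof (rule LIMSEQ_le_const)
    have "(\<lambda>n. inverse (real (Suc n)) * (1 + 2 * c2 * T)) \<longlonglongrightarrow> 0 * (1 + 2 * c2 * T)"
      by (intro tendsto_intros LIMSEQ_inverse_real_of_nat)
    from tendsto_ennrealI[OF this]
    show "(\<lambda>n. ennreal (inverse (real (Suc n)) * (1 + 2 * c2 * T))) \<longlonglongrightarrow> 0" by simp
    show "\<exists>N. \<forall>n\<ge>N. E \<le> ennreal (inverse (real (Suc n)) * (1 + 2 * c2 * T))"
      using E_le[of "inverse (real (Suc n))" for n] by simp
  qed
  then have "E = 0" by simp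
  then have "AE \<omega> in M. ennreal \<bar>J s \<omega>\<bar> = 0" unfolding E_def by (subst (asm) nn_integral_0_iff_AE) (use Jm in auto)
  then show ?thesis by eventually_elim simp
qed

subsection \<open>The backward equation\<close>

text \<open>Cauchy-Schwarz in time against the indicator of \<open>(s, t]\<close>. The factor is the
  length \<open>t - s\<close> and not \<open>T - s\<close> because \<open>g\<close> vanishes after
  \<open>t\<close>; this gain is what makes short steps contractive. If the integrand fails to be
  integrable, the integral on the left is 0 by convention.\<close>

lemma square_integral_le:
  fixes g :: "real \<Rightarrow> real"
  assumes t: "0 \<le> s" "s \<le> t" "t \<le> T" and [measurable]: "g \<in> borel_measurable (time_leb T)"
    and zero: "AE r in time_leb T. t < r \<longrightarrow> g r = 0"
  shows "ennreal ((\<integral>r. indicator {s<..} r * g r \<partial>time_leb T)\<^sup>2) \<le>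
    ennreal (t - s) * (\<integral>\<^sup>+r. indicator {s<..} r * ennreal ((g r)\<^sup>2) \<partial>time_leb T)"
proof -
  have [measurable]: "(\<lambda>r. indicator {s<..} r :: ennreal) \<in> borel_measurable (time_leb T)"
    "(\<lambda>r. indicator {s<..t} r :: ennreal) \<in> borel_measurable (time_leb T)"
    by (rule measurable_compose[OF measurable_time_id], simp)+
  have "ennreal \<bar>\<integral>r. indicator {s<..} r * g r \<partial>time_leb T\<bar> \<le> (\<integral>\<^sup>+r. ennreal \<bar>indicator {s<..} r * g r\<bar> \<partial>time_leb T)"
  proof (cases "integrable (time_leb T) (\<lambda>r. indicator {s<..} r * g r)")
    case True
    then show ?thesis using integral_norm_bound_ennreal[OF True] by simp
  qed (simp add: not_integrable_integral_eq)
  also have "\<dots> = (\<integral>\<^sup>+r. indicator {s<..t} r * (indicator {s<..} r * ennreal \<bar>g r\<bar>) \<partial>time_leb T)"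
    using zero by (intro nn_integral_cong_AE) (auto simp: indicator_def)
  finally have 1: "ennreal \<bar>\<integral>r. indicator {s<..} r * g r \<partial>time_leb T\<bar> \<le> \<dots>" .
  have "ennreal ((\<integral>r. indicator {s<..} r * g r \<partial>time_leb T)\<^sup>2) = (ennreal \<bar>\<integral>r. indicator {s<..} r * g r \<partial>time_leb T\<bar>)\<^sup>2"
    by (simp add: ennreal_power)
  also have "\<dots> \<le> (\<integral>\<^sup>+r. indicator {s<..t} r * (indicator {s<..} r * ennreal \<bar>g r\<bar>) \<partial>time_leb T)\<^sup>2"
    by (rule power_mono[OF 1]) simp
  also have "\<dots> \<le> (\<integral>\<^sup>+r. (indicator {s<..t} r)\<^sup>2 \<partial>time_leb T) * (\<integral>\<^sup>+r. (indicator {s<..} r * ennreal \<bar>g r\<bar>)\<^sup>2 \<partial>time_leb T)"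
    by (rule Cauchy_Schwarz_nn_integral) measurable
  also have "(\<integral>\<^sup>+r. (indicator {s<..t} r)\<^sup>2 \<partial>time_leb T) = (\<integral>\<^sup>+r. indicator {s<..t} r \<partial>time_leb T)"
    by (intro nn_integral_cong) (simp add: indicator_def)
  also have "\<dots> = ennreal (t - s)"
    using emeasure_time_leb_interval[OF t] by simp
  also have "(\<integral>\<^sup>+r. (indicator {s<..} r * ennreal \<bar>g r\<bar>)\<^sup>2 \<partial>time_leb T) = (\<integral>\<^sup>+r. indicator {s<..} r * ennreal ((g r)\<^sup>2) \<partial>time_leb T)"
    by (intro nn_integral_cong) (simp add: indicator_def ennreal_power)
  finally show ?thesis .
qed

lemma set_integral_time_leb_Icc:
  fixes g :: "real \<Rightarrow> real"
  assumes "0 \<le> s" "s \<le> T" and [measurable]: "g \<in> borel_measurable (time_leb T)"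
  shows "(LBINT r:{s..T}. g r) = (\<integral>r. indicator {s<..} r * g r \<partial>time_leb T)"
proof -
  have "(\<integral>r. indicator {s<..} r * g r \<partial>time_leb T) = (LINT r|lborel. indicator {0..T} r *\<^sub>R (indicator {s<..} r * g r))"
    unfolding time_leb_def by (rule integral_restrict_space) simp
  also have "\<dots> = (LINT r|lborel. indicator {s<..T} r *\<^sub>R g r)"
    using assms by (intro Bochner_Integration.integral_cong) (auto simp: indicator_def)
  also have "\<dots> = (LINT r|lborel. indicator {s..T} r *\<^sub>R g r)"
  proof (rule integral_cong_AE)
    have gm: "(\<lambda>r. indicator {0..T} r *\<^sub>R g r) \<in> borel_measurable lborel"
      using assms(3) unfolding time_leb_def by (subst (asm) borel_measurable_restrict_space_iff) auto
    have e: "indicator A r *\<^sub>R g r = indicator A r *\<^sub>R (indicator {0..T} r *\<^sub>R g r)" if "A \<subseteq> {0..T}" for A r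
      using that by (auto simp: indicator_def)
    show "(\<lambda>r. indicator {s<..T} r *\<^sub>R g r) \<in> borel_measurable lborel"
      by (subst e) (use assms gm in auto)
    show "(\<lambda>r. indicator {s..T} r *\<^sub>R g r) \<in> borel_measurable lborel"
      by (subst e) (use assms gm in auto)
    show "AE r in lborel. indicator {s<..T} r *\<^sub>R g r = indicator {s..T} r *\<^sub>R g r"
      using AE_lborel_singleton[of s] by eventually_elim (auto simp: indicator_def)
  qed
  finally show ?thesis by (simp add: set_lebesgue_integral_def)
qed

lemma set_integrable_time_leb_Icc:
  fixes g :: "real \<Rightarrow> real"
  assumes "0 \<le> s" "integrable (time_leb T) g"
  shows "set_integrable lborel {s..T} g"
proof -
  have "set_integrable lborel {0..T} g"
    using assms(2) unfolding time_leb_def set_integrable_def by (subst (asm) integrable_restrict_space) auto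
  then show ?thesis by (rule set_integrable_subset) (use assms in auto)
qed

lemma ennreal_contraction_zero:
  fixes x :: ennreal
  assumes "x \<le> ennreal (1 / 2) * x" "x < \<infinity>"
  shows "x = 0"
proof -
  obtain y where y: "x = ennreal y" "0 \<le> y" using assms(2) by (cases x) auto
  have "ennreal (1 / 2 * y) = ennreal (1 / 2) * ennreal y" by (rule ennreal_mult) (use y in auto)
  then have "ennreal y \<le> ennreal (1 / 2 * y)" using assms(1) unfolding y(1) by (simp only:)
  then have "y \<le> 1 / 2 * y" using y(2) by (simp add: ennreal_le_iff)
  then show ?thesis using y by simp
qed

context jump_brownian_bounded
begin

lemma total_norm_mono: "s \<le> t \<Longrightarrow> total_norm t Z \<psi> \<le> total_norm s Z \<psi>"
  unfolding total_norm_def ito_norm_def jump_norm_def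
  by (intro add_mono nn_integral_mono mult_right_mono) (auto simp: indicator_def)

lemma ito_norm_mono: "s \<le> t \<Longrightarrow> ito_norm M T t Z \<le> ito_norm M T s Z"
  unfolding ito_norm_def by (intro nn_integral_mono mult_right_mono) (auto simp: indicator_def)

lemma mark_integral_measurable:
  fixes \<rho> :: "real \<Rightarrow> real" and \<psi> :: "real \<Rightarrow> 'w \<Rightarrow> real \<Rightarrow> real"
  assumes \<psi>: "(\<lambda>x. \<psi> (fst (fst x)) (snd (fst x)) (snd x)) \<in> borel_measurable ((time_leb T \<Otimes>\<^sub>M M) \<Otimes>\<^sub>M \<nu>)"
    and \<rho>: "\<rho> \<in> borel_measurable \<nu>"
  shows "(\<lambda>p. LINT z|\<nu>. \<rho> z * \<psi> (fst p) (snd p) z) \<in> borel_measurable (time_leb T \<Otimes>\<^sub>M M)"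
proof (rule sigma_finite_measure.borel_measurable_lebesgue_integral[OF \<nu>_sigma_finite])
  have "(\<lambda>x. \<rho> (snd x) * \<psi> (fst (fst x)) (snd (fst x)) (snd x)) \<in> borel_measurable ((time_leb T \<Otimes>\<^sub>M M) \<Otimes>\<^sub>M \<nu>)"
    by (intro borel_measurable_times \<psi> measurable_compose[OF measurable_snd \<rho>])
  then show "(\<lambda>(p, z). \<rho> z * \<psi> (fst p) (snd p) z) \<in> borel_measurable ((time_leb T \<Otimes>\<^sub>M M) \<Otimes>\<^sub>M \<nu>)"
    by (simp add: case_prod_beta')
qed

text \<open>Cauchy-Schwarz in the mark variable, for fixed time and \<omega>. Through it the
  square-integrability of \<open>\<rho>\<close> makes the driver Lipschitz in \<open>\<psi>\<close>
  with respect to \<open>jump_norm\<close>.\<close>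

lemma ito_norm_mark_integral:
  fixes \<rho> :: "real \<Rightarrow> real" and \<psi> :: "real \<Rightarrow> 'w \<Rightarrow> real \<Rightarrow> real"
  assumes \<psi>: "(\<lambda>x. \<psi> (fst (fst x)) (snd (fst x)) (snd x)) \<in> borel_measurable ((time_leb T \<Otimes>\<^sub>M M) \<Otimes>\<^sub>M \<nu>)"
    and \<rho>: "\<rho> \<in> borel_measurable \<nu>"
  shows "ito_norm M T s (\<lambda>r \<omega>. LINT z|\<nu>. \<rho> z * \<psi> r \<omega> z) \<le> (\<integral>\<^sup>+z. ennreal ((\<rho> z)\<^sup>2) \<partial>\<nu>) * jump_norm M T \<nu> s \<psi>"
proof -
  interpret \<nu>: sigma_finite_measure \<nu> by (rule \<nu>_sigma_finite)
  let ?R = "\<integral>\<^sup>+z. ennreal ((\<rho> z)\<^sup>2) \<partial>\<nu>"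
  have pw: "ennreal ((LINT z|\<nu>. \<rho> z * \<psi> r \<omega> z)\<^sup>2) \<le> ?R * (\<integral>\<^sup>+z. ennreal ((\<psi> r \<omega> z)\<^sup>2) \<partial>\<nu>)"
    if r: "(r, \<omega>) \<in> space (time_leb T \<Otimes>\<^sub>M M)" for r \<omega>
  proof -
    have [measurable]: "\<psi> r \<omega> \<in> borel_measurable \<nu>"
      using measurable_compose[OF measurable_Pair1'[OF r] \<psi>] by simp
    note \<rho>[measurable]
    have "ennreal \<bar>LINT z|\<nu>. \<rho> z * \<psi> r \<omega> z\<bar> \<le> (\<integral>\<^sup>+z. ennreal \<bar>\<rho> z * \<psi> r \<omega> z\<bar> \<partial>\<nu>)"
    proof (cases "integrable \<nu> (\<lambda>z. \<rho> z * \<psi> r \<omega> z)")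
      case True
      then show ?thesis using integral_norm_bound_ennreal[OF True] by simp
    qed (simp add: not_integrable_integral_eq)
    also have "\<dots> = (\<integral>\<^sup>+z. ennreal \<bar>\<rho> z\<bar> * ennreal \<bar>\<psi> r \<omega> z\<bar> \<partial>\<nu>)"
      by (simp add: abs_mult ennreal_mult)
    finally have 1: "ennreal \<bar>LINT z|\<nu>. \<rho> z * \<psi> r \<omega> z\<bar> \<le> \<dots>" .
    have "ennreal ((LINT z|\<nu>. \<rho> z * \<psi> r \<omega> z)\<^sup>2) = (ennreal \<bar>LINT z|\<nu>. \<rho> z * \<psi> r \<omega> z\<bar>)\<^sup>2"
      by (simp add: ennreal_power)
    also have "\<dots> \<le> (\<integral>\<^sup>+z. ennreal \<bar>\<rho> z\<bar> * ennreal \<bar>\<psi> r \<omega> z\<bar> \<partial>\<nu>)\<^sup>2"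
      by (rule power_mono[OF 1]) simp
    also have "\<dots> \<le> (\<integral>\<^sup>+z. (ennreal \<bar>\<rho> z\<bar>)\<^sup>2 \<partial>\<nu>) * (\<integral>\<^sup>+z. (ennreal \<bar>\<psi> r \<omega> z\<bar>)\<^sup>2 \<partial>\<nu>)"
      by (rule Cauchy_Schwarz_nn_integral) measurable
    finally show ?thesis by (simp add: ennreal_power)
  qed
  have m: "(\<lambda>x. indicator {s<..} (fst (fst x)) * ennreal ((\<psi> (fst (fst x)) (snd (fst x)) (snd x))\<^sup>2)) \<in> borel_measurable ((time_leb T \<Otimes>\<^sub>M M) \<Otimes>\<^sub>M \<nu>)"
    using \<psi> by (intro borel_measurable_times_ennreal after_measurable) simp
  have "ito_norm M T s (\<lambda>r \<omega>. LINT z|\<nu>. \<rho> z * \<psi> r \<omega> z) \<le>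
     (\<integral>\<^sup>+p. ?R * (\<integral>\<^sup>+z. indicator {s<..} (fst (fst (p, z))) * ennreal ((\<psi> (fst (fst (p, z))) (snd (fst (p, z))) (snd (p, z)))\<^sup>2) \<partial>\<nu>) \<partial>(time_leb T \<Otimes>\<^sub>M M))"
    unfolding ito_norm_def
  proof (rule nn_integral_mono)
    fix p assume p: "p \<in> space (time_leb T \<Otimes>\<^sub>M M)"
    then show "indicator {s<..} (fst p) * ennreal ((LINT z|\<nu>. \<rho> z * \<psi> (fst p) (snd p) z)\<^sup>2) \<le>
       ?R * (\<integral>\<^sup>+z. indicator {s<..} (fst (fst (p, z))) * ennreal ((\<psi> (fst (fst (p, z))) (snd (fst (p, z))) (snd (p, z)))\<^sup>2) \<partial>\<nu>)"
      using pw[of "fst p" "snd p"] by (simp add: indicator_def)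
  qed
  also have "\<dots> = ?R * (\<integral>\<^sup>+p. (\<integral>\<^sup>+z. indicator {s<..} (fst (fst (p, z))) * ennreal ((\<psi> (fst (fst (p, z))) (snd (fst (p, z))) (snd (p, z)))\<^sup>2) \<partial>\<nu>) \<partial>(time_leb T \<Otimes>\<^sub>M M))"
    by (rule nn_integral_cmult) (rule \<nu>.borel_measurable_nn_integral_fst[OF m])
  also have "\<dots> = ?R * jump_norm M T \<nu> s \<psi>"
    unfolding jump_norm_def \<nu>.nn_integral_fst[OF m] by (rule refl)
  finally show ?thesis .
qed

text \<open>If the norms vanish on \<open>(t, T]\<close>, the estimate is a contraction on \<open>(s, T]\<close> for \<open>t - s \<le> h\<close>; hence
  they vanish on all of \<open>(0, T]\<close>, backwards in steps of length \<open>h\<close>.\<close>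

lemma backward_energy:
  assumes \<delta>: "\<And>t. t \<in> {0..T} \<Longrightarrow> \<delta> t \<in> borel_measurable (F t)" "\<And>t. t \<in> {0..T} \<Longrightarrow> integrable M (\<lambda>\<omega>. (\<delta> t \<omega>)\<^sup>2)"
    and \<delta>m: "(\<lambda>x. \<delta> (fst x) (snd x)) \<in> borel_measurable (time_leb T \<Otimes>\<^sub>M M)"
    and g: "(\<lambda>x. g (fst x) (snd x)) \<in> borel_measurable (time_leb T \<Otimes>\<^sub>M M)"
    and I: "has_ito_integral M F T W Z I" and J: "has_jump_integral M F T \<nu> \<mu> (\<lambda>r _. \<Lambda> r) \<psi> J"
    and eq: "AE \<omega> in M. \<forall>s\<in>{0..T}. \<delta> s \<omega> = (\<integral>r. indicator {s<..} r * g r \<omega> \<partial>time_leb T) - (I T \<omega> - I s \<omega> + (J T \<omega> - J s \<omega>))"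
    and C: "0 \<le> C" "\<And>s. s \<in> {0..T} \<Longrightarrow> ito_norm M T s g \<le> ennreal C * (ito_norm M T s \<delta> + total_norm s Z \<psi>)"
    and fin: "ito_norm M T 0 \<delta> + total_norm 0 Z \<psi> < \<infinity>"
  shows "ito_norm M T 0 \<delta> + total_norm 0 Z \<psi> = 0"
    and "\<And>s. s \<in> {0..T} \<Longrightarrow> AE \<omega> in M. \<delta> s \<omega> = 0"
proof -
  interpret P: pair_sigma_finite "time_leb T" M by (rule time_pair)
  define \<Phi> where "\<Phi> s = ito_norm M T s \<delta> + total_norm s Z \<psi>" for s
  define c where "c = min 1 c1"
  have c: "c > 0" using c1_pos by (simp add: c_def)
  have \<Phi>_mono: "\<Phi> t \<le> \<Phi> s" if "s \<le> t" for s t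
    unfolding \<Phi>_def by (intro add_mono ito_norm_mono total_norm_mono that)
  have \<Phi>_fin: "\<Phi> s < \<infinity>" if "0 \<le> s" for s
    by (rule le_less_trans[OF \<Phi>_mono[OF that] fin[folded \<Phi>_def]])
  have gs: "(\<lambda>r. g r \<omega>) \<in> borel_measurable (time_leb T)" if "\<omega> \<in> space M" for \<omega>
    using measurable_compose[OF measurable_Pair2'[OF that] g] by simp
  have gm: "(\<lambda>x. indicator {s<..} (fst x) * ennreal ((g (fst x) (snd x))\<^sup>2)) \<in> borel_measurable (time_leb T \<Otimes>\<^sub>M M)" for s
    using g by (intro borel_measurable_times_ennreal after_measurable) simp
  have gn: "ito_norm M T s g = (\<integral>\<^sup>+\<omega>. (\<integral>\<^sup>+r. indicator {s<..} r * ennreal ((g r \<omega>)\<^sup>2) \<partial>time_leb T) \<partial>M)" for s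
    unfolding ito_norm_def using P.nn_integral_snd[OF gm[of s]] by simp
  have gmM: "(\<lambda>\<omega>. \<integral>\<^sup>+r. indicator {s<..} r * ennreal ((g r \<omega>)\<^sup>2) \<partial>time_leb T) \<in> borel_measurable M" for s
  proof -
    have "(\<lambda>(\<omega>, r). indicator {s<..} r * ennreal ((g r \<omega>)\<^sup>2)) \<in> borel_measurable (M \<Otimes>\<^sub>M time_leb T)"
      using measurable_compose[OF measurable_pair_swap' gm[of s]] by (simp add: case_prod_beta')
    then show ?thesis
      by (rule sigma_finite_measure.borel_measurable_nn_integral[OF sigma_finite_time_leb])
  qed
  \<comment> \<open>The equation says that the time integral of \<open>g\<close> equals
    \<open>\<delta> s\<close> plus the increment of the stochastic integrals over
    \<open>(s, T]\<close>. The first summand is known at \<open>s\<close> and the second is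
    orthogonal to all such variables, so by Pythagoras each of them is bounded by the norm of the
    time integral.\<close>
  have energy: "(\<integral>\<^sup>+\<omega>. ennreal ((\<delta> s \<omega>)\<^sup>2) \<partial>M) \<le> ennreal (t - s) * (ennreal C * \<Phi> s)"
    "ennreal c * total_norm s Z \<psi> \<le> 4 * (ennreal (t - s) * (ennreal C * \<Phi> s))"
    if s: "0 \<le> s" "s \<le> t" "t \<le> T" and t: "\<Phi> t = 0" for s t
  proof -
    have sT: "s \<in> {0..T}" and tT: "t \<in> {0..T}" using s by auto
    let ?G = "\<lambda>\<omega>. \<integral>r. indicator {s<..} r * g r \<omega> \<partial>time_leb T"
    let ?D = "\<lambda>\<omega>. I T \<omega> - I s \<omega> + (J T \<omega> - J s \<omega>)"
    note D = stochastic_integral_properties[OF I J sT]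
    note \<delta>M = measurable_F[OF sT \<delta>(1)[OF sT]]
    have G: "AE \<omega> in M. \<delta> s \<omega> + ?D \<omega> = ?G \<omega>"
      using eq by eventually_elim (use sT in force)
    \<comment> \<open>Vanishing norms after \<open>t\<close> force the difference of the drivers to
      vanish there, so only times in \<open>(s, t]\<close> contribute to the time integral.\<close>
    have "ito_norm M T t g = 0" using C(2)[OF tT] t by (simp add: \<Phi>_def)
    then have z: "AE \<omega> in M. (\<integral>\<^sup>+r. indicator {t<..} r * ennreal ((g r \<omega>)\<^sup>2) \<partial>time_leb T) = 0"
      unfolding gn using gmM[of t] by (simp add: nn_integral_0_iff_AE)
    have "AE \<omega> in M. ennreal ((\<delta> s \<omega> + ?D \<omega>)\<^sup>2) \<le> ennreal (t - s) * (\<integral>\<^sup>+r. indicator {s<..} r * ennreal ((g r \<omega>)\<^sup>2) \<partial>time_leb T)"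
      using G z AE_space
    proof eventually_elim
      case (elim \<omega>)
      have im: "(\<lambda>r. indicator {t<..} r :: ennreal) \<in> borel_measurable (time_leb T)"
        by (rule measurable_compose[OF measurable_time_id]) simp
      have "AE r in time_leb T. indicator {t<..} r * ennreal ((g r \<omega>)\<^sup>2) = 0"
        using elim(2) gs[OF elim(3)] im by (subst (asm) nn_integral_0_iff_AE) auto
      then have "AE r in time_leb T. t < r \<longrightarrow> g r \<omega> = 0"
        by eventually_elim (auto simp: indicator_def split: if_splits)
      from square_integral_le[OF s gs[OF elim(3)] this] show ?case unfolding elim(1) .
    qed
    then have "(\<integral>\<^sup>+\<omega>. ennreal ((\<delta> s \<omega> + ?D \<omega>)\<^sup>2) \<partial>M) \<le> (\<integral>\<^sup>+\<omega>. ennreal (t - s) * (\<integral>\<^sup>+r. indicator {s<..} r * ennreal ((g r \<omega>)\<^sup>2) \<partial>time_leb T) \<partial>M)"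
      by (rule nn_integral_mono_AE)
    also have "\<dots> = ennreal (t - s) * ito_norm M T s g"
      unfolding gn by (rule nn_integral_cmult[OF gmM])
    also have "\<dots> \<le> ennreal (t - s) * (ennreal C * \<Phi> s)"
      unfolding \<Phi>_def by (intro mult_left_mono C(2) sT) simp
    finally have le: "(\<integral>\<^sup>+\<omega>. ennreal ((\<delta> s \<omega> + ?D \<omega>)\<^sup>2) \<partial>M) \<le> ennreal (t - s) * (ennreal C * \<Phi> s)" .
    have i2: "integrable M (\<lambda>\<omega>. \<delta> s \<omega> * ?D \<omega>)" by (rule integrable_mult_L2[OF \<delta>M D(1) \<delta>(2)[OF sT] D(2)])
    have isq: "integrable M (\<lambda>\<omega>. (\<delta> s \<omega> + ?D \<omega>)\<^sup>2)" by (rule integrable_square_add[OF \<delta>M D(1) \<delta>(2)[OF sT] D(2)])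
    have "(\<integral>\<omega>. (\<delta> s \<omega> + ?D \<omega>)\<^sup>2 \<partial>M) = (\<integral>\<omega>. (\<delta> s \<omega>)\<^sup>2 + (?D \<omega>)\<^sup>2 + 2 * (\<delta> s \<omega> * ?D \<omega>) \<partial>M)"
      by (simp only: power2_sum mult.assoc)
    also have "\<dots> = (\<integral>\<omega>. (\<delta> s \<omega>)\<^sup>2 \<partial>M) + (\<integral>\<omega>. (?D \<omega>)\<^sup>2 \<partial>M) + 2 * (\<integral>\<omega>. \<delta> s \<omega> * ?D \<omega> \<partial>M)"
      unfolding Bochner_Integration.integral_add[OF Bochner_Integration.integrable_add[OF \<delta>(2)[OF sT] D(2)] integrable_mult_right[OF i2]]
        Bochner_Integration.integral_add[OF \<delta>(2)[OF sT] D(2)] Bochner_Integration.integral_mult_right_zero by (rule refl)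
    also have "(\<integral>\<omega>. \<delta> s \<omega> * ?D \<omega> \<partial>M) = 0" by (rule D(5)[OF \<delta>(1)[OF sT] \<delta>(2)[OF sT]])
    finally have pyth: "(\<integral>\<omega>. (\<delta> s \<omega> + ?D \<omega>)\<^sup>2 \<partial>M) = (\<integral>\<omega>. (\<delta> s \<omega>)\<^sup>2 \<partial>M) + (\<integral>\<omega>. (?D \<omega>)\<^sup>2 \<partial>M)" by simp
    have nn: "(\<integral>\<^sup>+\<omega>. ennreal ((f \<omega>)\<^sup>2) \<partial>M) = ennreal (\<integral>\<omega>. (f \<omega>)\<^sup>2 \<partial>M)" if "integrable M (\<lambda>\<omega>. (f \<omega>)\<^sup>2)" for f :: "'w \<Rightarrow> real"
      by (rule nn_integral_eq_integral[OF that]) simp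
    have pos: "0 \<le> (\<integral>\<omega>. (f \<omega>)\<^sup>2 \<partial>M)" for f :: "'w \<Rightarrow> real"
      by (rule Bochner_Integration.integral_nonneg) simp
    have d1: "(\<integral>\<^sup>+\<omega>. ennreal ((\<delta> s \<omega>)\<^sup>2) \<partial>M) \<le> (\<integral>\<^sup>+\<omega>. ennreal ((\<delta> s \<omega> + ?D \<omega>)\<^sup>2) \<partial>M)"
      unfolding nn[OF \<delta>(2)[OF sT]] nn[OF isq] pyth using pos[of ?D] by (intro ennreal_leI) simp
    have d2: "(\<integral>\<^sup>+\<omega>. ennreal ((?D \<omega>)\<^sup>2) \<partial>M) \<le> (\<integral>\<^sup>+\<omega>. ennreal ((\<delta> s \<omega> + ?D \<omega>)\<^sup>2) \<partial>M)"
      unfolding nn[OF D(2)] nn[OF isq] pyth using pos[of "\<delta> s"] by (intro ennreal_leI) simp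
    show "(\<integral>\<^sup>+\<omega>. ennreal ((\<delta> s \<omega>)\<^sup>2) \<partial>M) \<le> ennreal (t - s) * (ennreal C * \<Phi> s)" using d1 le by (rule order_trans)
    have "ennreal c * total_norm s Z \<psi> \<le> 4 * (\<integral>\<^sup>+\<omega>. ennreal ((?D \<omega>)\<^sup>2) \<partial>M)" unfolding c_def by (rule D(3))
    also have "\<dots> \<le> 4 * (ennreal (t - s) * (ennreal C * \<Phi> s))" by (intro mult_left_mono order_trans[OF d2 le]) simp
    finally show "ennreal c * total_norm s Z \<psi> \<le> 4 * (ennreal (t - s) * (ennreal C * \<Phi> s))" .
  qed
  \<comment> \<open>The step length is read off from the two estimates below:
    \<open>\<delta>\<close> contributes \<open>h * h * C\<close>, and \<open>Z\<close>,
    \<open>\<psi>\<close> contribute \<open>4 * h * C / c\<close>. With \<open>h \<le> 1\<close>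
    their sum is at most \<open>h * (C + 4 * C / c)\<close>, hence at most 1/2. The summand 1 keeps
    the denominator positive when \<open>C = 0\<close>.\<close>
  define h where "h = min 1 (1 / (2 * (C + 4 * C / c + 1)))"
  have den: "C + 4 * C / c + 1 > 0" using C(1) c by (simp add: add_nonneg_pos)
  have h: "h > 0" "h \<le> 1" using den by (auto simp: h_def)
  have hC: "h * h * C + 4 * h * C / c \<le> 1 / 2"
  proof -
    have "h * h * C \<le> h * C" using h C(1) by (intro mult_right_mono) (auto intro: mult_left_le)
    then have "h * h * C + 4 * h * C / c \<le> h * (C + 4 * C / c)" by (simp add: algebra_simps)
    also have "\<dots> \<le> h * (C + 4 * C / c + 1)" using h by simp
    also have "\<dots> \<le> 1 / (2 * (C + 4 * C / c + 1)) * (C + 4 * C / c + 1)"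
      using den by (intro mult_right_mono) (auto simp: h_def)
    also have "\<dots> = 1 / 2" using den by simp
    finally show ?thesis .
  qed
  have step: "\<Phi> s = 0" if s: "0 \<le> s" "s \<le> t" "t \<le> T" "t - s \<le> h" and t: "\<Phi> t = 0" for s t
  proof (rule ennreal_contraction_zero)
    have a: "ennreal (t - s) * (ennreal C * \<Phi> s) \<le> ennreal h * (ennreal C * \<Phi> s)"
      using s by (intro mult_right_mono ennreal_leI) auto
    have tn: "total_norm s Z \<psi> \<le> ennreal (4 * h * C / c) * \<Phi> s"
    proof -
      have "total_norm s Z \<psi> = ennreal (1 / c) * (ennreal c * total_norm s Z \<psi>)"
        using c by (simp add: mult.assoc[symmetric] flip: ennreal_mult)
      also have "\<dots> \<le> ennreal (1 / c) * (4 * (ennreal h * (ennreal C * \<Phi> s)))"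
        by (intro mult_left_mono order_trans[OF energy(2)[OF s(1-3) t]] a) auto
      also have "\<dots> = ennreal (4 * h * C / c) * \<Phi> s"
      proof -
        have "ennreal (4 * h * C / c) = ennreal (1 / c) * (4 * (ennreal h * ennreal C))"
          using c h C(1) by (simp flip: ennreal_mult ennreal_numeral)
        then show ?thesis by (simp add: mult.assoc)
      qed
      finally show ?thesis .
    qed
    \<comment> \<open>\<open>energy\<close> is applied at every time \<open>r\<close> in
      \<open>(s, t]\<close> and then integrated over this interval: one factor \<open>h\<close>
      comes from the estimate at \<open>r\<close>, the other from the length of the
      interval.\<close>
    have it: "ito_norm M T s \<delta> \<le> ennreal (h * h * C) * \<Phi> s"
    proof -
      have m1: "(\<lambda>x. indicator {t<..} (fst x) * ennreal ((\<delta> (fst x) (snd x))\<^sup>2)) \<in> borel_measurable (time_leb T \<Otimes>\<^sub>M M)"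
        using \<delta>m by (intro borel_measurable_times_ennreal after_measurable) simp
      have i: "(\<lambda>x. indicator {s<..t} (fst x) :: ennreal) \<in> borel_measurable (time_leb T \<Otimes>\<^sub>M M)"
        by (rule measurable_compose[OF measurable_compose[OF measurable_fst measurable_time_id]]) simp
      have m2: "(\<lambda>x. indicator {s<..t} (fst x) * ennreal ((\<delta> (fst x) (snd x))\<^sup>2)) \<in> borel_measurable (time_leb T \<Otimes>\<^sub>M M)"
        using \<delta>m by (intro borel_measurable_times_ennreal i) simp
      have "ito_norm M T s \<delta> = (\<integral>\<^sup>+x. indicator {s<..t} (fst x) * ennreal ((\<delta> (fst x) (snd x))\<^sup>2) + indicator {t<..} (fst x) * ennreal ((\<delta> (fst x) (snd x))\<^sup>2) \<partial>(time_leb T \<Otimes>\<^sub>M M))"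
        unfolding ito_norm_def using s by (intro nn_integral_cong) (auto simp: indicator_def)
      also have "\<dots> = (\<integral>\<^sup>+x. indicator {s<..t} (fst x) * ennreal ((\<delta> (fst x) (snd x))\<^sup>2) \<partial>(time_leb T \<Otimes>\<^sub>M M)) + ito_norm M T t \<delta>"
        unfolding ito_norm_def by (rule nn_integral_add[OF m2 m1])
      also have "ito_norm M T t \<delta> = 0" using t by (simp add: \<Phi>_def)
      also have "(\<integral>\<^sup>+x. indicator {s<..t} (fst x) * ennreal ((\<delta> (fst x) (snd x))\<^sup>2) \<partial>(time_leb T \<Otimes>\<^sub>M M))
         = (\<integral>\<^sup>+r. (\<integral>\<^sup>+\<omega>. indicator {s<..t} r * ennreal ((\<delta> r \<omega>)\<^sup>2) \<partial>M) \<partial>time_leb T)"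
        using nn_integral_fst[OF m2] by simp
      also have "\<dots> \<le> (\<integral>\<^sup>+r. indicator {s<..t} r * (ennreal h * (ennreal C * \<Phi> s)) \<partial>time_leb T)"
      proof (rule nn_integral_mono)
        fix r assume "r \<in> space (time_leb T)"
        show "(\<integral>\<^sup>+\<omega>. indicator {s<..t} r * ennreal ((\<delta> r \<omega>)\<^sup>2) \<partial>M) \<le> indicator {s<..t} r * (ennreal h * (ennreal C * \<Phi> s))"
        proof (cases "r \<in> {s<..t}")
          case True
          then have r: "0 \<le> r" "r \<le> t" "s \<le> r" using s by auto
          have "(\<integral>\<^sup>+\<omega>. ennreal ((\<delta> r \<omega>)\<^sup>2) \<partial>M) \<le> ennreal (t - r) * (ennreal C * \<Phi> r)"
            by (rule energy(1)[OF r(1,2) s(3) t])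
          also have "\<dots> \<le> ennreal h * (ennreal C * \<Phi> s)"
            using r s by (intro mult_mono ennreal_leI mult_left_mono \<Phi>_mono) auto
          finally show ?thesis using True by simp
        qed simp
      qed
      also have "\<dots> = (ennreal h * (ennreal C * \<Phi> s)) * emeasure (time_leb T) {s<..t}"
        using emeasure_time_leb_interval(2)[OF s(1-3)] by (subst mult.commute) (rule nn_integral_cmult_indicator)
      also have "\<dots> \<le> (ennreal h * (ennreal C * \<Phi> s)) * ennreal h"
        unfolding emeasure_time_leb_interval(1)[OF s(1-3)] using s by (intro mult_left_mono ennreal_leI) auto
      also have "\<dots> = ennreal (h * h * C) * \<Phi> s"
        using h C(1) by (simp add: ennreal_mult mult_ac)
      finally show ?thesis by simp
    qed
    have "\<Phi> s \<le> ennreal (h * h * C) * \<Phi> s + ennreal (4 * h * C / c) * \<Phi> s"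
      unfolding \<Phi>_def[of s] by (intro add_mono it[unfolded \<Phi>_def] tn[unfolded \<Phi>_def])
    also have "\<dots> = ennreal (h * h * C + 4 * h * C / c) * \<Phi> s"
      using h C(1) c by (simp add: ennreal_plus distrib_right)
    also have "\<dots> \<le> ennreal (1 / 2) * \<Phi> s"
      by (intro mult_right_mono ennreal_leI hC) simp
    finally show "\<Phi> s \<le> ennreal (1 / 2) * \<Phi> s" .
    show "\<Phi> s < \<infinity>" by (rule \<Phi>_fin[OF s(1)])
  qed
  have \<Phi>T: "\<Phi> T = 0"
  proof -
    have "ito_norm M T T V = 0" for V :: "real \<Rightarrow> 'w \<Rightarrow> real"
    proof -
      have "ito_norm M T T V = (\<integral>\<^sup>+x. 0 \<partial>(time_leb T \<Otimes>\<^sub>M M))"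
        unfolding ito_norm_def by (intro nn_integral_cong) (auto simp: space_pair_measure)
      then show ?thesis by simp
    qed
    moreover have "jump_norm M T \<nu> T \<psi> = (\<integral>\<^sup>+x. 0 \<partial>((time_leb T \<Otimes>\<^sub>M M) \<Otimes>\<^sub>M \<nu>))"
      unfolding jump_norm_def by (intro nn_integral_cong) (auto simp: space_pair_measure)
    ultimately show ?thesis by (simp add: \<Phi>_def total_norm_def)
  qed
  have "\<Phi> (max 0 (T - real k * h)) = 0" for k
  proof (induction k)
    case 0
    then show ?case using \<Phi>T T_nonneg by simp
  next
    case (Suc k)
    show ?case
    proof (rule step[OF _ _ _ _ Suc])
      show "max 0 (T - real k * h) - max 0 (T - real (Suc k) * h) \<le> h"
        using h by (simp add: algebra_simps max_def)
      show "max 0 (T - real (Suc k) * h) \<le> max 0 (T - real k * h)"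
        using h by (simp add: algebra_simps max_def)
      show "max 0 (T - real k * h) \<le> T" using T_nonneg h by simp
    qed simp
  qed
  moreover obtain k where "T / h \<le> real k" using real_arch_simple by blast
  then have "max 0 (T - real k * h) = 0" using h by (simp add: pos_divide_le_eq)
  ultimately have \<Phi>0: "\<Phi> 0 = 0" by metis
  then show "ito_norm M T 0 \<delta> + total_norm 0 Z \<psi> = 0" by (simp add: \<Phi>_def)
  fix s assume s: "s \<in> {0..T}"
  \<comment> \<open>A vanishing time integral alone would give the claim at almost every time only.
    \<open>energy\<close> with \<open>t = T\<close> bounds the second moment of
    \<open>\<delta> s\<close> at each given time by a multiple of \<open>\<Phi> s\<close>, hence by
    0.\<close>
  have "\<Phi> s = 0" using \<Phi>_mono[of 0 s] \<Phi>0 s by simp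
  then have "(\<integral>\<^sup>+\<omega>. ennreal ((\<delta> s \<omega>)\<^sup>2) \<partial>M) = 0" using energy(1)[of s T] \<Phi>T s by simp
  then show "AE \<omega> in M. \<delta> s \<omega> = 0"
    using measurable_F[OF s \<delta>(1)[OF s]] by (subst (asm) nn_integral_0_iff_AE) auto
qed

end

section \<open>Identification of the backward solution\<close>

lemma AE_time_leb_pos: "AE r in time_leb T. 0 < r"
proof -
  have "AE r in lborel. r \<in> {0..T} \<longrightarrow> (0 :: real) < r"
    using AE_lborel_singleton[of 0] by eventually_elim auto
  then show ?thesis unfolding time_leb_def by (subst AE_restrict_space_iff) auto
qed

lemma square_sum3_le: "(a + b + c)\<^sup>2 \<le> 3 * (a\<^sup>2 + b\<^sup>2 + c\<^sup>2)" for a b c :: real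
proof -
  have "3 * (a\<^sup>2 + b\<^sup>2 + c\<^sup>2) - (a + b + c)\<^sup>2 = (a - b)\<^sup>2 + (b - c)\<^sup>2 + (a - c)\<^sup>2"
    by (simp add: power2_eq_square algebra_simps)
  moreover have "0 \<le> (a - b)\<^sup>2 + (b - c)\<^sup>2 + (a - c)\<^sup>2" by simp
  ultimately show ?thesis by linarith
qed

lemma AE_of_square_norm_zero:
  fixes f :: "'a \<Rightarrow> real"
  assumes [measurable]: "f \<in> borel_measurable N" and p: "AE x in N. p x"
    and m: "(\<lambda>x. i x * ennreal ((f x)\<^sup>2)) \<in> borel_measurable N"
    and i: "\<And>x. p x \<Longrightarrow> i x = 1" and z: "(\<integral>\<^sup>+x. i x * ennreal ((f x)\<^sup>2) \<partial>N) = 0"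
  shows "AE x in N. f x = 0"
proof -
  have "AE x in N. i x * ennreal ((f x)\<^sup>2) = 0" using z by (subst (asm) nn_integral_0_iff_AE[OF m])
  with p show ?thesis by eventually_elim (simp add: i)
qed

context jump_brownian_bounded
begin

lemma AE_pos_time: "AE x in time_leb T \<Otimes>\<^sub>M M. 0 < fst x"
proof (rule pair_sigma_finite.AE_pair_measure[OF time_pair])
  show "{x \<in> space (time_leb T \<Otimes>\<^sub>M M). 0 < fst x} \<in> sets (time_leb T \<Otimes>\<^sub>M M)"
    using measurable_compose[OF measurable_fst measurable_time_id] by measurable
  show "AE r in time_leb T. AE \<omega> in M. 0 < fst (r, \<omega>)"
    using AE_time_leb_pos by eventually_elim simp
qed

lemma AE_pos_time_mark: "AE x in (time_leb T \<Otimes>\<^sub>M M) \<Otimes>\<^sub>M \<nu>. 0 < fst (fst x)"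
proof (rule pair_sigma_finite.AE_pair_measure[OF triple_pair])
  show "{x \<in> space ((time_leb T \<Otimes>\<^sub>M M) \<Otimes>\<^sub>M \<nu>). 0 < fst (fst x)} \<in> sets ((time_leb T \<Otimes>\<^sub>M M) \<Otimes>\<^sub>M \<nu>)"
    using measurable_compose[OF measurable_compose[OF measurable_fst measurable_fst] measurable_time_id] by measurable
  show "AE p in time_leb T \<Otimes>\<^sub>M M. AE z in \<nu>. 0 < fst (fst (p, z))"
    using AE_pos_time by eventually_elim simp
qed

lemma ito_norm_le_sum3:
  assumes Z: "(\<lambda>x. Z1 (fst x) (snd x)) \<in> borel_measurable (time_leb T \<Otimes>\<^sub>M M)"
      "(\<lambda>x. Z2 (fst x) (snd x)) \<in> borel_measurable (time_leb T \<Otimes>\<^sub>M M)"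
      "(\<lambda>x. Z3 (fst x) (snd x)) \<in> borel_measurable (time_leb T \<Otimes>\<^sub>M M)"
    and K: "0 \<le> K" and le: "\<And>r \<omega>. r \<in> {0..T} \<Longrightarrow> \<bar>g r \<omega>\<bar> \<le> K * (\<bar>Z1 r \<omega>\<bar> + \<bar>Z2 r \<omega>\<bar> + \<bar>Z3 r \<omega>\<bar>)"
  shows "ito_norm M T s g \<le> ennreal (3 * K\<^sup>2) * (ito_norm M T s Z1 + ito_norm M T s Z2 + ito_norm M T s Z3)"
proof -
  have m: "(\<lambda>x. indicator {s<..} (fst x) * ennreal ((V (fst x) (snd x))\<^sup>2)) \<in> borel_measurable (time_leb T \<Otimes>\<^sub>M M)"
    if "(\<lambda>x. V (fst x) (snd x)) \<in> borel_measurable (time_leb T \<Otimes>\<^sub>M M)" for V :: "real \<Rightarrow> 'w \<Rightarrow> real"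
    using that by (intro borel_measurable_times_ennreal after_measurable) simp
  let ?i = "\<lambda>V x. indicator {s<..} (fst x) * ennreal ((V (fst x) (snd x))\<^sup>2)"
  have "ito_norm M T s g \<le> (\<integral>\<^sup>+x. ennreal (3 * K\<^sup>2) * (?i Z1 x + ?i Z2 x + ?i Z3 x) \<partial>(time_leb T \<Otimes>\<^sub>M M))"
    unfolding ito_norm_def
  proof (rule nn_integral_mono)
    fix x assume "x \<in> space (time_leb T \<Otimes>\<^sub>M M)"
    then have r: "fst x \<in> {0..T}" by (auto simp: space_pair_measure)
    let ?a = "\<bar>Z1 (fst x) (snd x)\<bar>" and ?b = "\<bar>Z2 (fst x) (snd x)\<bar>" and ?c = "\<bar>Z3 (fst x) (snd x)\<bar>"
    have "\<bar>g (fst x) (snd x)\<bar>\<^sup>2 \<le> (K * (?a + ?b + ?c))\<^sup>2" by (rule power_mono[OF le[OF r]]) simp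
    also have "\<dots> \<le> K\<^sup>2 * (3 * (?a\<^sup>2 + ?b\<^sup>2 + ?c\<^sup>2))"
      unfolding power_mult_distrib by (intro mult_left_mono square_sum3_le) simp
    finally have "(g (fst x) (snd x))\<^sup>2 \<le> (3 * K\<^sup>2) * ((Z1 (fst x) (snd x))\<^sup>2 + (Z2 (fst x) (snd x))\<^sup>2 + (Z3 (fst x) (snd x))\<^sup>2)"
      by (simp add: algebra_simps)
    then have "ennreal ((g (fst x) (snd x))\<^sup>2) \<le> ennreal \<dots>" by (rule ennreal_leI)
    also have "\<dots> = ennreal (3 * K\<^sup>2) * (ennreal ((Z1 (fst x) (snd x))\<^sup>2) + ennreal ((Z2 (fst x) (snd x))\<^sup>2) + ennreal ((Z3 (fst x) (snd x))\<^sup>2))"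
      by (simp add: ennreal_mult ennreal_plus)
    finally show "?i g x \<le> ennreal (3 * K\<^sup>2) * (?i Z1 x + ?i Z2 x + ?i Z3 x)"
      by (simp add: indicator_def)
  qed
  also have "\<dots> = ennreal (3 * K\<^sup>2) * (\<integral>\<^sup>+x. ?i Z1 x + ?i Z2 x + ?i Z3 x \<partial>(time_leb T \<Otimes>\<^sub>M M))"
    by (rule nn_integral_cmult) (intro borel_measurable_add m Z)
  also have "(\<integral>\<^sup>+x. ?i Z1 x + ?i Z2 x + ?i Z3 x \<partial>(time_leb T \<Otimes>\<^sub>M M)) =
      (\<integral>\<^sup>+x. ?i Z1 x + ?i Z2 x \<partial>(time_leb T \<Otimes>\<^sub>M M)) + (\<integral>\<^sup>+x. ?i Z3 x \<partial>(time_leb T \<Otimes>\<^sub>M M))"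
    by (rule nn_integral_add) (intro borel_measurable_add m Z)+
  also have "(\<integral>\<^sup>+x. ?i Z1 x + ?i Z2 x \<partial>(time_leb T \<Otimes>\<^sub>M M)) = (\<integral>\<^sup>+x. ?i Z1 x \<partial>(time_leb T \<Otimes>\<^sub>M M)) + (\<integral>\<^sup>+x. ?i Z2 x \<partial>(time_leb T \<Otimes>\<^sub>M M))"
    by (rule nn_integral_add) (intro m Z)+
  finally show ?thesis unfolding ito_norm_def .
qed

text \<open>Integrability along almost every path is required for splitting the time integral of the
  driver into its value at the candidate solution and the difference \<open>g\<close>: the integral
  of a sum splits only for integrable summands.\<close>

lemma AE_time_integrable:
  assumes g: "(\<lambda>x. g (fst x) (snd x)) \<in> borel_measurable (time_leb T \<Otimes>\<^sub>M M)" and fin: "ito_norm M T 0 g < \<infinity>"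
  shows "AE \<omega> in M. integrable (time_leb T) (\<lambda>r. g r \<omega> :: real)"
proof -
  interpret P: pair_sigma_finite "time_leb T" M by (rule time_pair)
  have g2: "(\<lambda>x. ennreal ((g (fst x) (snd x))\<^sup>2)) \<in> borel_measurable (time_leb T \<Otimes>\<^sub>M M)" using g by simp
  have "(\<integral>\<^sup>+\<omega>. (\<integral>\<^sup>+r. ennreal ((g (fst (r, \<omega>)) (snd (r, \<omega>)))\<^sup>2) \<partial>time_leb T) \<partial>M) = (\<integral>\<^sup>+x. ennreal ((g (fst x) (snd x))\<^sup>2) \<partial>(time_leb T \<Otimes>\<^sub>M M))"
    by (rule P.nn_integral_snd[OF g2])
  also have "\<dots> = ito_norm M T 0 g"
    unfolding ito_norm_def using AE_pos_time by (intro nn_integral_cong_AE) (auto simp: indicator_def)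
  finally have f: "(\<integral>\<^sup>+\<omega>. (\<integral>\<^sup>+r. ennreal ((g r \<omega>)\<^sup>2) \<partial>time_leb T) \<partial>M) \<noteq> \<infinity>" using fin by simp
  have "(\<lambda>(\<omega>, r). ennreal ((g r \<omega>)\<^sup>2)) \<in> borel_measurable (M \<Otimes>\<^sub>M time_leb T)"
    using measurable_compose[OF measurable_pair_swap' g2] by (simp add: case_prod_beta')
  then have "(\<lambda>\<omega>. \<integral>\<^sup>+r. ennreal ((g r \<omega>)\<^sup>2) \<partial>time_leb T) \<in> borel_measurable M"
    by (rule sigma_finite_measure.borel_measurable_nn_integral[OF sigma_finite_time_leb])
  from nn_integral_PInf_AE[OF this f] AE_space show ?thesis
  proof eventually_elim
    case (elim \<omega>)
    have m: "(\<lambda>r. g r \<omega>) \<in> borel_measurable (time_leb T)"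
      using measurable_compose[OF measurable_Pair2'[OF elim(2)] g] by simp
    have "integrable (time_leb T) (\<lambda>r. (g r \<omega>)\<^sup>2)"
    proof (rule integrableI_bounded)
      show "(\<lambda>r. (g r \<omega>)\<^sup>2) \<in> borel_measurable (time_leb T)" using m by simp
      show "(\<integral>\<^sup>+r. ennreal (norm ((g r \<omega>)\<^sup>2)) \<partial>time_leb T) < \<infinity>"
        using elim(1) by (simp add: top.not_eq_extremum)
    qed
    then show ?case by (rule finite_measure.square_integrable_imp_integrable[OF finite_measure_time_leb m])
  qed
qed

text \<open>The expected supremum bounds the second moment at each time by one constant, which is
  then integrated over the finite horizon; \<open>y0\<close> is bounded because it is continuous on
  a compact interval.\<close>

lemma S2_second_moment:
  assumes Y: "S2_space M F T Y" and y0: "continuous_on {0..T} y0"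
  shows "\<And>t. t \<in> {0..T} \<Longrightarrow> integrable M (\<lambda>\<omega>. (Y t \<omega> - y0 t)\<^sup>2)"
    and "ito_norm M T 0 (\<lambda>r \<omega>. Y r \<omega> - y0 r) < \<infinity>"
    and "(\<lambda>x. Y (fst x) (snd x) - y0 (fst x)) \<in> borel_measurable (time_leb T \<Otimes>\<^sub>M M)"
    and "(\<lambda>x. y0 (fst x)) \<in> borel_measurable (time_leb T \<Otimes>\<^sub>M M)"
proof -
  have ca: "cadlag_adapted M F T Y" using Y by (simp add: S2_space_def)
  have YM: "Y t \<in> borel_measurable M" if "t \<in> {0..T}" for t by (rule cadlag_adapted_measurable[OF ca that])
  define E where "E = (\<integral>\<^sup>+\<omega>. (SUP s\<in>{0..T}. ennreal ((Y s \<omega>)\<^sup>2)) \<partial>M)"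
  have E: "E < \<infinity>" using Y by (simp add: S2_space_def E_def)
  obtain B where B: "\<And>t. t \<in> {0..T} \<Longrightarrow> \<bar>y0 t\<bar> \<le> B"
    by (rule bounded_imageD[OF cadlag_on_bounded[OF cadlag_on_continuous[OF y0]]]) blast
  have le: "(\<integral>\<^sup>+\<omega>. ennreal ((Y t \<omega> - y0 t)\<^sup>2) \<partial>M) \<le> 2 * E + ennreal (2 * B\<^sup>2)" if t: "t \<in> {0..T}" for t
  proof -
    note [measurable] = YM[OF t]
    have "(y0 t)\<^sup>2 \<le> B\<^sup>2" using power_mono[OF B[OF t], of 2] by simp
    then have "(Y t \<omega> - y0 t)\<^sup>2 \<le> 2 * (Y t \<omega>)\<^sup>2 + 2 * B\<^sup>2" for \<omega>
      using sum_squares_bound[of "Y t \<omega>" "- y0 t"] by (simp add: power2_diff)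
    then have "(\<integral>\<^sup>+\<omega>. ennreal ((Y t \<omega> - y0 t)\<^sup>2) \<partial>M) \<le> (\<integral>\<^sup>+\<omega>. ennreal (2 * (Y t \<omega>)\<^sup>2 + 2 * B\<^sup>2) \<partial>M)"
      by (intro nn_integral_mono ennreal_leI)
    also have "\<dots> = (\<integral>\<^sup>+\<omega>. 2 * ennreal ((Y t \<omega>)\<^sup>2) + ennreal (2 * B\<^sup>2) \<partial>M)"
      by (intro nn_integral_cong) (simp add: ennreal_plus ennreal_mult)
    also have "\<dots> = (\<integral>\<^sup>+\<omega>. 2 * ennreal ((Y t \<omega>)\<^sup>2) \<partial>M) + (\<integral>\<^sup>+\<omega>. ennreal (2 * B\<^sup>2) \<partial>M)"
      by (rule nn_integral_add) auto
    also have "(\<integral>\<^sup>+\<omega>. 2 * ennreal ((Y t \<omega>)\<^sup>2) \<partial>M) = 2 * (\<integral>\<^sup>+\<omega>. ennreal ((Y t \<omega>)\<^sup>2) \<partial>M)"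
      by (rule nn_integral_cmult) simp
    also have "(\<integral>\<^sup>+\<omega>. ennreal (2 * B\<^sup>2) \<partial>M) = ennreal (2 * B\<^sup>2)" by (simp add: emeasure_space_1)
    also have "2 * (\<integral>\<^sup>+\<omega>. ennreal ((Y t \<omega>)\<^sup>2) \<partial>M) + ennreal (2 * B\<^sup>2) \<le> 2 * E + ennreal (2 * B\<^sup>2)"
      unfolding E_def by (intro add_right_mono mult_left_mono nn_integral_mono SUP_upper t) simp
    finally show ?thesis .
  qed
  have fin: "2 * E + ennreal (2 * B\<^sup>2) < \<infinity>" using E by (simp add: ennreal_mult_less_top)
  show "integrable M (\<lambda>\<omega>. (Y t \<omega> - y0 t)\<^sup>2)" if t: "t \<in> {0..T}" for t
  proof (rule integrableI_bounded)
    show "(\<lambda>\<omega>. (Y t \<omega> - y0 t)\<^sup>2) \<in> borel_measurable M" using YM[OF t] by simp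
    show "(\<integral>\<^sup>+\<omega>. ennreal (norm ((Y t \<omega> - y0 t)\<^sup>2)) \<partial>M) < \<infinity>" using le_less_trans[OF le[OF t] fin] by simp
  qed
  have "y0 \<in> borel_measurable (time_leb T)"
    using borel_measurable_continuous_compose[OF y0 measurable_time_id] by simp
  from measurable_compose[OF measurable_fst this]
  show y0m: "(\<lambda>x. y0 (fst x)) \<in> borel_measurable (time_leb T \<Otimes>\<^sub>M M)" .
  have Ym: "(\<lambda>x. Y (fst x) (snd x)) \<in> borel_measurable (time_leb T \<Otimes>\<^sub>M M)"
    using cadlag_measurable_pair[of T Y M] YM ca by (simp add: cadlag_adapted_def case_prod_beta')
  show m: "(\<lambda>x. Y (fst x) (snd x) - y0 (fst x)) \<in> borel_measurable (time_leb T \<Otimes>\<^sub>M M)"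
    by (rule borel_measurable_diff[OF Ym y0m])
  have m2: "(\<lambda>x. ennreal ((Y (fst x) (snd x) - y0 (fst x))\<^sup>2)) \<in> borel_measurable (time_leb T \<Otimes>\<^sub>M M)" using m by simp
  have "ito_norm M T 0 (\<lambda>r \<omega>. Y r \<omega> - y0 r) \<le> (\<integral>\<^sup>+x. ennreal ((Y (fst x) (snd x) - y0 (fst x))\<^sup>2) \<partial>(time_leb T \<Otimes>\<^sub>M M))"
    unfolding ito_norm_def by (intro nn_integral_mono) (simp add: indicator_def)
  also have "\<dots> = (\<integral>\<^sup>+r. (\<integral>\<^sup>+\<omega>. ennreal ((Y r \<omega> - y0 r)\<^sup>2) \<partial>M) \<partial>time_leb T)"
    using nn_integral_fst[OF m2] by simp
  also have "\<dots> \<le> (\<integral>\<^sup>+r. 2 * E + ennreal (2 * B\<^sup>2) \<partial>time_leb T)"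
    by (intro nn_integral_mono le) simp
  also have "\<dots> < \<infinity>"
    using fin finite_measure.emeasure_finite[OF finite_measure_time_leb, of T "{0..T}"]
    by (simp add: ennreal_mult_less_top top.not_eq_extremum)
  finally show "ito_norm M T 0 (\<lambda>r \<omega>. Y r \<omega> - y0 r) < \<infinity>" .
qed

text \<open>The candidate \<open>y0\<close> is constructed first. As \<open>X T = x0 T\<close>
  almost surely, the terminal values agree, and the triple formed by \<open>Y - y0\<close>,
  \<open>Z\<close> and \<open>\<psi>\<close> satisfies a backward equation with terminal value 0
  whose driver is controlled by the triple itself. This is the situation of
  \<open>backward_energy\<close>.\<close>

lemma backward_deterministic:
  assumes x0: "continuous_on {0..T} x0" and X: "AE \<omega> in M. \<forall>s\<in>{0..T}. X s \<omega> = x0 s"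
    and f: "continuous_on ({0..T} \<times> UNIV) (\<lambda>(t, x, y, z, u). f t x y z u)" and K: "0 < K"
    and lip: "\<And>t x y z u y' z' u'. t \<in> {0..T} \<Longrightarrow>
      \<bar>f t x y z u - f t x y' z' u'\<bar> \<le> K * (\<bar>y - y'\<bar> + \<bar>z - z'\<bar> + \<bar>u - u'\<bar>)"
    and \<rho>: "\<rho> \<in> borel_measurable \<nu>" "(\<integral>\<^sup>+z. ennreal ((\<rho> z)\<^sup>2) \<partial>\<nu>) < \<infinity>"
    and B: "backward_sde M F T W \<nu> \<mu> (\<lambda>r _. \<Lambda> r) \<xi> f \<rho> X Y Z \<psi>"
  obtains y0 where "continuous_on {0..T} y0"
    "\<And>s. s \<in> {0..T} \<Longrightarrow> y0 s = \<xi> (x0 T) + (LBINT r:{s..T}. f r (x0 r) (y0 r) 0 0)"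
    "AE \<omega> in M. \<forall>s\<in>{0..T}. Y s \<omega> = y0 s"
    "AE (r, \<omega>) in time_leb T \<Otimes>\<^sub>M M. Z r \<omega> = 0"
    "AE ((r, \<omega>), z) in (time_leb T \<Otimes>\<^sub>M M) \<Otimes>\<^sub>M \<nu>. \<psi> r \<omega> z = 0"
proof -
  have fc: "continuous_on S (\<lambda>s. f (t s) (x s) (y s) (z s) (u s))"
    if "continuous_on S t" "continuous_on S x" "continuous_on S y" "continuous_on S z" "continuous_on S u" "\<And>s. s \<in> S \<Longrightarrow> t s \<in> {0..T}"
    for S :: "'b::topological_space set" and t x y z u
  proof -
    have "continuous_on S (\<lambda>s. (\<lambda>(t, x, y, z, u). f t x y z u) (t s, x s, y s, z s, u s))"
      by (rule continuous_on_compose2[OF f]) (use that in \<open>auto intro!: continuous_intros\<close>)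
    then show ?thesis by simp
  qed
  have c0: "continuous_on ({0..T} \<times> UNIV) (\<lambda>(t, y). f t (x0 t) y 0 0)"
    unfolding case_prod_beta' by (intro fc continuous_intros continuous_on_compose2[OF x0]) auto
  have l0: "\<bar>f t (x0 t) y 0 0 - f t (x0 t) y' 0 0\<bar> \<le> K * \<bar>y - y'\<bar>" if "t \<in> {0..T}" for t y y'
    using lip[OF that, of "x0 t" y 0 0 y' 0 0] by simp
  obtain y0 where y0: "continuous_on {0..T} y0"
    "\<And>s. s \<in> {0..T} \<Longrightarrow> y0 s = \<xi> (x0 T) + (LBINT r:{s..T}. f r (x0 r) (y0 r) 0 0)"
    by (rule terminal_ode_exists[OF T_nonneg K c0 l0]) blast+
  obtain I J where I: "has_ito_integral M F T W Z I" and J: "has_jump_integral M F T \<nu> \<mu> (\<lambda>r _. \<Lambda> r) \<psi> J"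
    and eq: "AE \<omega> in M. \<forall>s\<in>{0..T}. Y s \<omega> = \<xi> (X T \<omega>)
      + (LBINT r:{s..T}. f r (X r \<omega>) (Y r \<omega>) (Z r \<omega>) (LINT z|\<nu>. \<rho> z * \<psi> r \<omega> z)) - (I T \<omega> - I s \<omega>) - (J T \<omega> - J s \<omega>)"
    and Y: "S2_space M F T Y" and Z: "H2_space M F T Z" and \<psi>: "J2_space M F T \<nu> \<psi>"
    using B unfolding backward_sde_def by blast
  define U where "U r \<omega> = (LINT z|\<nu>. \<rho> z * \<psi> r \<omega> z)" for r \<omega>
  define \<delta> where "\<delta> r \<omega> = Y r \<omega> - y0 r" for r \<omega>
  define g where "g r \<omega> = f r (x0 r) (Y r \<omega>) (Z r \<omega>) (U r \<omega>) - f r (x0 r) (y0 r) 0 0" for r \<omega>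
  define R where "R = enn2real (\<integral>\<^sup>+z. ennreal ((\<rho> z)\<^sup>2) \<partial>\<nu>)"
  have R: "(\<integral>\<^sup>+z. ennreal ((\<rho> z)\<^sup>2) \<partial>\<nu>) = ennreal R" "0 \<le> R"
    using \<rho>(2) by (simp_all add: R_def less_top)
  have Zm: "(\<lambda>x. Z (fst x) (snd x)) \<in> borel_measurable (time_leb T \<Otimes>\<^sub>M M)"
    using I by (simp add: has_ito_integral_def case_prod_beta')
  have \<psi>m: "(\<lambda>x. \<psi> (fst (fst x)) (snd (fst x)) (snd x)) \<in> borel_measurable ((time_leb T \<Otimes>\<^sub>M M) \<Otimes>\<^sub>M \<nu>)"
    using J by (simp add: has_jump_integral_def case_prod_beta')
  have Um: "(\<lambda>x. U (fst x) (snd x)) \<in> borel_measurable (time_leb T \<Otimes>\<^sub>M M)"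
    unfolding U_def by (rule mark_integral_measurable[OF \<psi>m \<rho>(1)])
  note y = S2_second_moment[OF Y y0(1), folded \<delta>_def]
  have \<delta>m: "(\<lambda>x. \<delta> (fst x) (snd x)) \<in> borel_measurable (time_leb T \<Otimes>\<^sub>M M)" using y(3) by (simp add: \<delta>_def)
  have Ym: "(\<lambda>x. Y (fst x) (snd x)) \<in> borel_measurable (time_leb T \<Otimes>\<^sub>M M)"
    using borel_measurable_add[OF y(3,4)] by (simp add: \<delta>_def)
  have fm: "(\<lambda>x. f (fst x) (x0 (fst x)) (y (fst x) (snd x)) (z (fst x) (snd x)) (u (fst x) (snd x))) \<in> borel_measurable (time_leb T \<Otimes>\<^sub>M M)"
    if m: "(\<lambda>x. y (fst x) (snd x)) \<in> borel_measurable (time_leb T \<Otimes>\<^sub>M M)"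
       "(\<lambda>x. z (fst x) (snd x)) \<in> borel_measurable (time_leb T \<Otimes>\<^sub>M M)"
       "(\<lambda>x. u (fst x) (snd x)) \<in> borel_measurable (time_leb T \<Otimes>\<^sub>M M)" for y z u
  proof -
    have "x0 \<in> borel_measurable (time_leb T)"
      using borel_measurable_continuous_compose[OF x0 measurable_time_id] by simp
    note x0m = measurable_compose[OF measurable_fst this] and tm = measurable_compose[OF measurable_fst measurable_time_id]
    have "(\<lambda>x. (fst x, x0 (fst x), y (fst x) (snd x), z (fst x) (snd x), u (fst x) (snd x))) \<in> borel_measurable (time_leb T \<Otimes>\<^sub>M M)"
      by (intro borel_measurable_Pair m x0m tm)
    from borel_measurable_continuous_compose[OF f this] show ?thesis by (auto simp: space_pair_measure)
  qed
  have gm: "(\<lambda>x. g (fst x) (snd x)) \<in> borel_measurable (time_leb T \<Otimes>\<^sub>M M)"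
    unfolding g_def using fm[OF Ym Zm Um] fm[of "\<lambda>r _. y0 r" "\<lambda>_ _. 0" "\<lambda>_ _. 0"] y(4) by simp
  have gle: "\<bar>g r \<omega>\<bar> \<le> K * (\<bar>\<delta> r \<omega>\<bar> + \<bar>Z r \<omega>\<bar> + \<bar>U r \<omega>\<bar>)" if "r \<in> {0..T}" for r \<omega>
    using lip[OF that, of "x0 r" "Y r \<omega>" "Z r \<omega>" "U r \<omega>" "y0 r" 0 0] by (simp add: g_def \<delta>_def)
  \<comment> \<open>The 3 comes from squaring a sum of three terms and \<open>K\<close> is the
    Lipschitz constant of the driver. \<open>R\<close> is the Cauchy-Schwarz constant of the mark
    integral \<open>U\<close>; the factor \<open>1 + R\<close> absorbs the terms with and without it
    at once.\<close>
  define C where "C = 3 * K\<^sup>2 * (1 + R)"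
  have C: "0 \<le> C" using R(2) by (simp add: C_def)
  have gn: "ito_norm M T s g \<le> ennreal C * (ito_norm M T s \<delta> + total_norm s Z \<psi>)" for s
  proof -
    have "ito_norm M T s g \<le> ennreal (3 * K\<^sup>2) * (ito_norm M T s \<delta> + ito_norm M T s Z + ito_norm M T s U)"
      by (rule ito_norm_le_sum3[OF \<delta>m Zm Um less_imp_le[OF K] gle])
    also have "\<dots> \<le> ennreal (3 * K\<^sup>2) * (ennreal (1 + R) * (ito_norm M T s \<delta> + total_norm s Z \<psi>))"
    proof (rule mult_left_mono)
      have le1: "a \<le> ennreal (1 + R) * a" for a
        using mult_right_mono[of 1 "ennreal (1 + R)" a] ennreal_leI[of 1 "1 + R"] R(2) by simp
      have "ito_norm M T s U \<le> ennreal R * jump_norm M T \<nu> s \<psi>"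
        using ito_norm_mark_integral[OF \<psi>m \<rho>(1), of s] unfolding R(1) U_def .
      also have "\<dots> \<le> ennreal (1 + R) * jump_norm M T \<nu> s \<psi>"
        by (intro mult_right_mono ennreal_leI) auto
      finally show "ito_norm M T s \<delta> + ito_norm M T s Z + ito_norm M T s U \<le> ennreal (1 + R) * (ito_norm M T s \<delta> + total_norm s Z \<psi>)"
        unfolding total_norm_def distrib_left add.assoc[symmetric] by (intro add_mono le1)
    qed simp
    also have "\<dots> = ennreal C * (ito_norm M T s \<delta> + total_norm s Z \<psi>)"
      using R(2) by (simp add: C_def ennreal_mult mult.assoc)
    finally show ?thesis .
  qed
  have fin: "ito_norm M T 0 \<delta> + total_norm 0 Z \<psi> < \<infinity>"
  proof -
    have "ito_norm M T 0 Z \<le> (\<integral>\<^sup>+(r, \<omega>). ennreal ((Z r \<omega>)\<^sup>2) \<partial>(time_leb T \<Otimes>\<^sub>M M))"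
      unfolding ito_norm_def by (intro nn_integral_mono) (auto simp: indicator_def)
    then have "ito_norm M T 0 Z < \<infinity>" using Z unfolding H2_space_def by (auto intro: le_less_trans)
    moreover have "jump_norm M T \<nu> 0 \<psi> \<le> (\<integral>\<^sup>+((r, \<omega>), z). ennreal ((\<psi> r \<omega> z)\<^sup>2) \<partial>((time_leb T \<Otimes>\<^sub>M M) \<Otimes>\<^sub>M \<nu>))"
      unfolding jump_norm_def by (intro nn_integral_mono) (auto simp: indicator_def)
    then have "jump_norm M T \<nu> 0 \<psi> < \<infinity>" using \<psi> unfolding J2_space_def by (auto intro: le_less_trans)
    ultimately show ?thesis using y(2) by (simp add: total_norm_def)
  qed
  \<comment> \<open>Finiteness of the norm of \<open>g\<close> is not assumed separately: the same
    Lipschitz estimate, taken at \<open>s = 0\<close>, yields it from the spaces to which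
    \<open>Y\<close>, \<open>Z\<close> and \<open>\<psi>\<close> belong.\<close>
  have "ennreal C * (ito_norm M T 0 \<delta> + total_norm 0 Z \<psi>) < \<infinity>"
    using fin by (simp add: ennreal_mult_less_top)
  then have gfin: "ito_norm M T 0 g < \<infinity>" by (rule le_less_trans[OF gn])
  \<comment> \<open>Rewrites the equation for the difference with integrals over
    \<open>(s, T]\<close> in \<open>time_leb T\<close>, the form in which the energy estimate
    measures them; the closed and the half-open interval differ by a null set.\<close>
  have eq': "AE \<omega> in M. \<forall>s\<in>{0..T}. \<delta> s \<omega> = (\<integral>r. indicator {s<..} r * g r \<omega> \<partial>time_leb T) - (I T \<omega> - I s \<omega> + (J T \<omega> - J s \<omega>))"
    using eq X AE_time_integrable[OF gm gfin] AE_space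
  proof eventually_elim
    case (elim \<omega>)
    show ?case
    proof
      fix s assume s: "s \<in> {0..T}"
      have sub: "{s..T} \<subseteq> {0..T}" using s by auto
      have i1: "set_integrable lborel {s..T} (\<lambda>r. g r \<omega>)"
        by (rule set_integrable_time_leb_Icc[OF _ elim(3)]) (use s in simp)
      have i2: "set_integrable lborel {s..T} (\<lambda>r. f r (x0 r) (y0 r) 0 0)"
        by (rule borel_integrable_atLeastAtMost')
           (intro fc continuous_intros continuous_on_subset[OF x0 sub] continuous_on_subset[OF y0(1) sub]; use sub in auto)
      have gs: "(\<lambda>r. g r \<omega>) \<in> borel_measurable (time_leb T)" using elim(3) by simp
      have XT: "X T \<omega> = x0 T" using elim(2) T_nonneg by simp
      have "(LBINT r:{s..T}. f r (X r \<omega>) (Y r \<omega>) (Z r \<omega>) (LINT z|\<nu>. \<rho> z * \<psi> r \<omega> z)) =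
        (LBINT r:{s..T}. g r \<omega> + f r (x0 r) (y0 r) 0 0)"
        unfolding U_def[symmetric] set_lebesgue_integral_def using elim(2) s
        by (intro Bochner_Integration.integral_cong) (auto simp: g_def indicator_def)
      also have "\<dots> = (LBINT r:{s..T}. g r \<omega>) + (LBINT r:{s..T}. f r (x0 r) (y0 r) 0 0)"
        by (rule set_integral_add(2)[OF i1 i2])
      also have "(LBINT r:{s..T}. g r \<omega>) = (\<integral>r. indicator {s<..} r * g r \<omega> \<partial>time_leb T)"
        by (rule set_integral_time_leb_Icc[OF _ _ gs]) (use s in auto)
      finally show "\<delta> s \<omega> = (\<integral>r. indicator {s<..} r * g r \<omega> \<partial>time_leb T) - (I T \<omega> - I s \<omega> + (J T \<omega> - J s \<omega>))"
        using elim(1)[rule_format, OF s] y0(2)[OF s] XT by (simp add: \<delta>_def)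
    qed
  qed
  have ca: "cadlag_adapted M F T Y" using Y by (simp add: S2_space_def)
  have \<delta>F: "\<delta> t \<in> borel_measurable (F t)" if "t \<in> {0..T}" for t
    using ca that unfolding \<delta>_def cadlag_adapted_def adapted_def by (intro borel_measurable_diff) auto
  note energy = backward_energy[OF \<delta>F y(1) \<delta>m gm I J eq' C gn fin]
  show ?thesis
  proof (rule that[OF y0])
    have "AE \<omega> in M. \<forall>s\<in>{0..T}. \<delta> s \<omega> = 0"
    proof (rule AE_cadlag_zero[OF _ energy(2)])
      show "cadlag_on T (\<lambda>t. \<delta> t \<omega>)" if "\<omega> \<in> space M" for \<omega>
        using ca that cadlag_on_continuous[OF y0(1)] unfolding \<delta>_def by (intro cadlag_on_diff) (simp_all add: cadlag_adapted_def)
    qed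
    then show "AE \<omega> in M. \<forall>s\<in>{0..T}. Y s \<omega> = y0 s" by eventually_elim (simp add: \<delta>_def)
    \<comment> \<open>The norms at \<open>s = 0\<close> see times in \<open>(0, T]\<close> only.
      Time 0 is a null set, so they still determine \<open>Z\<close> and \<open>\<psi>\<close>
      almost everywhere.\<close>
    have z: "ito_norm M T 0 Z = 0" "jump_norm M T \<nu> 0 \<psi> = 0" using energy(1) by (simp_all add: total_norm_def)
    have "AE x in time_leb T \<Otimes>\<^sub>M M. Z (fst x) (snd x) = 0"
      by (rule AE_of_square_norm_zero[OF Zm AE_pos_time _ _ z(1)[unfolded ito_norm_def]])
         (use Zm in \<open>auto intro!: borel_measurable_times_ennreal after_measurable\<close>)
    then show "AE (r, \<omega>) in time_leb T \<Otimes>\<^sub>M M. Z r \<omega> = 0" by (simp add: case_prod_beta')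
    have "AE x in (time_leb T \<Otimes>\<^sub>M M) \<Otimes>\<^sub>M \<nu>. \<psi> (fst (fst x)) (snd (fst x)) (snd x) = 0"
      by (rule AE_of_square_norm_zero[OF \<psi>m AE_pos_time_mark _ _ z(2)[unfolded jump_norm_def]])
         (use \<psi>m in \<open>auto intro!: borel_measurable_times_ennreal after_measurable\<close>)
    then show "AE ((r, \<omega>), z) in (time_leb T \<Otimes>\<^sub>M M) \<Otimes>\<^sub>M \<nu>. \<psi> r \<omega> z = 0" by (simp add: case_prod_beta')
  qed
qed

end

subsection \<open>The zero-th order solution\<close>

text \<open>Together with the analogous congruence for jump integrals, this replaces the random
  intensity by its deterministic version once \<open>X\<close> is known outside a null set.\<close>

lemma has_compensator_cong:
  assumes eq: "AE \<omega> in M. \<forall>r\<in>{0..T}. \<Lambda> r \<omega> = \<Lambda>' r \<omega>" and c: "has_compensator M F T \<nu> \<mu> \<Lambda>"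
  shows "has_compensator M F T \<nu> \<mu> \<Lambda>'"
  unfolding has_compensator_def
proof (intro allI impI)
  fix H :: "(real \<times> 'a) \<times> real \<Rightarrow> ennreal"
  assume H: "H \<in> borel_measurable (predictable_algebra M F T \<Otimes>\<^sub>M R0)"
  have "(\<integral>\<^sup>+\<omega>. (\<integral>\<^sup>+(r, z). H ((r, \<omega>), z) \<partial>\<mu> \<omega>) \<partial>M) =
      (\<integral>\<^sup>+\<omega>. (\<integral>\<^sup>+(r, z). H ((r, \<omega>), z) * ennreal (\<Lambda> r \<omega>) \<partial>(time_leb T \<Otimes>\<^sub>M \<nu>)) \<partial>M)"
    using c H unfolding has_compensator_def by blast
  also have "\<dots> = (\<integral>\<^sup>+\<omega>. (\<integral>\<^sup>+(r, z). H ((r, \<omega>), z) * ennreal (\<Lambda>' r \<omega>) \<partial>(time_leb T \<Otimes>\<^sub>M \<nu>)) \<partial>M)"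
  proof (rule nn_integral_cong_AE)
    show "AE \<omega> in M. (\<integral>\<^sup>+(r, z). H ((r, \<omega>), z) * ennreal (\<Lambda> r \<omega>) \<partial>(time_leb T \<Otimes>\<^sub>M \<nu>)) =
        (\<integral>\<^sup>+(r, z). H ((r, \<omega>), z) * ennreal (\<Lambda>' r \<omega>) \<partial>(time_leb T \<Otimes>\<^sub>M \<nu>))"
      using eq by eventually_elim (intro nn_integral_cong, auto simp: space_pair_measure)
  qed
  finally show "(\<integral>\<^sup>+\<omega>. (\<integral>\<^sup>+(r, z). H ((r, \<omega>), z) \<partial>\<mu> \<omega>) \<partial>M) = \<dots>" .
qed

lemma has_jump_integral_cong:
  assumes eq: "AE \<omega> in M. \<forall>r\<in>{0..T}. \<Lambda> r \<omega> = \<Lambda>' r \<omega>" and J: "has_jump_integral M F T \<nu> \<mu> \<Lambda> \<psi> J"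
  shows "has_jump_integral M F T \<nu> \<mu> \<Lambda>' \<psi> J"
proof -
  have e: "(\<integral>\<^sup>+\<omega>. ennreal ((simple_jump_integral \<nu> \<mu> \<Lambda> H s \<omega> - J s \<omega>)\<^sup>2) \<partial>M) =
      (\<integral>\<^sup>+\<omega>. ennreal ((simple_jump_integral \<nu> \<mu> \<Lambda>' H s \<omega> - J s \<omega>)\<^sup>2) \<partial>M)"
    if H: "simple_field M F T \<nu> H" and s: "s \<in> {0..T}" for H s
  proof (rule nn_integral_cong_AE)
    show "AE \<omega> in M. ennreal ((simple_jump_integral \<nu> \<mu> \<Lambda> H s \<omega> - J s \<omega>)\<^sup>2) =
        ennreal ((simple_jump_integral \<nu> \<mu> \<Lambda>' H s \<omega> - J s \<omega>)\<^sup>2)"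
      using eq
    proof eventually_elim
      case (elim \<omega>)
      have "compensated \<nu> \<mu> \<Lambda> (min a s) (min b s) A \<omega> = compensated \<nu> \<mu> \<Lambda>' (min a s) (min b s) A \<omega>"
        if "(a, b, A, h) \<in> set H" for a b A h
      proof -
        have "0 \<le> a" using H that by (auto simp: simple_field_def)
        then have "(LBINT r:{min a s<..min b s}. \<Lambda> r \<omega>) = (LBINT r:{min a s<..min b s}. \<Lambda>' r \<omega>)"
          unfolding set_lebesgue_integral_def using s elim
          by (intro Bochner_Integration.integral_cong) (auto simp: indicator_def)
        then show ?thesis by (simp add: compensated_def)
      qed
      then have "simple_jump_integral \<nu> \<mu> \<Lambda> H s \<omega> = simple_jump_integral \<nu> \<mu> \<Lambda>' H s \<omega>"
        unfolding simple_jump_integral_def by (intro arg_cong[where f = sum_list] map_cong refl) auto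
      then show ?case by simp
    qed
  qed
  show ?thesis
    using J unfolding has_jump_integral_def by (elim conjE exE, intro conjI exI) (auto simp: e)
qed

text \<open>A Brownian motion alone is treated as a driver with the null measure as its jump measure.\<close>

lemma (in brownian) ito_integral_zero:
  assumes I: "has_ito_integral M F T W (\<lambda>_ _. 0) I"
  shows "AE \<omega> in M. \<forall>s\<in>{0..T}. I s \<omega> = 0"
proof -
  have F: "filtered_prob_space M F T" by unfold_locales
  interpret jump_moments M F T "null_measure R0" "\<lambda>_. null_measure (mark_space T)" "\<lambda>_. 1"
    by (rule null_jump_moments[OF F])
  interpret jump_brownian_bounded M F T W "null_measure R0" "\<lambda>_. null_measure (mark_space T)" "\<lambda>_. 1" 1 1
  proof (intro jump_brownian_bounded.intro jump_brownian_bounded_axioms.intro)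
    show "jump_brownian M F T W (null_measure R0) (\<lambda>_. null_measure (mark_space T)) (\<lambda>_. 1)" by unfold_locales
    show "sigma_finite_measure (null_measure R0)"
      by (rule finite_measure.axioms(1)) (rule finite_measureI, simp)
  qed auto
  show ?thesis using zero_integrands[OF I has_jump_integral_zero] by simp
qed

text \<open>At \<epsilon> = 0 both integrands are literally the zero function. That the jump
  integral of zero vanishes is a hypothesis here, because the two cases establish it differently: by
  the isometry for a constant intensity, and by the L^1 bound for a random one.\<close>

lemma (in brownian) forward_zero_order:
  assumes S: "forward_sde M F T W \<nu> \<mu> \<Lambda> b \<sigma> \<gamma> x 0 X"
    and AX: "AX T n \<eta> b \<sigma> \<gamma> K" and n: "1 \<le> n" and K: "0 < K"
    and J0: "\<forall>J. has_jump_integral M F T \<nu> \<mu> \<Lambda> (\<lambda>_ _ _. 0) J \<longrightarrow> (\<forall>s\<in>{0..T}. AE \<omega> in M. J s \<omega> = 0)"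
  obtains x0 where "continuous_on {0..T} x0" "\<forall>s\<in>{0..T}. x0 s = x + (LBINT r:{0..s}. b r (x0 r) 0)"
    "AE \<omega> in M. \<forall>s\<in>{0..T}. X s \<omega> = x0 s"
proof -
  obtain I J where I: "has_ito_integral M F T W (\<lambda>_ _. 0) I" and J: "has_jump_integral M F T \<nu> \<mu> \<Lambda> (\<lambda>_ _ _. 0) J"
    and eq: "AE \<omega> in M. \<forall>s\<in>{0..T}. X s \<omega> = x + (LBINT r:{0..s}. b r (X r \<omega>) 0) + I s \<omega> + J s \<omega>"
    and X: "S2_space M F T X"
    using S unfolding forward_sde_def by auto
  have "AE \<omega> in M. \<forall>s\<in>{0..T}. J s \<omega> = 0"
    by (rule AE_cadlag_zero[OF _ J0[rule_format, OF J]]) (use J in \<open>auto simp: has_jump_integral_def cadlag_adapted_def\<close>)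
  with eq ito_integral_zero[OF I] have "AE \<omega> in M. \<forall>s\<in>{0..T}. X s \<omega> = x + (LBINT r:{0..s}. b r (X r \<omega>) 0)"
    by eventually_elim simp
  then show ?thesis
    by (rule forward_deterministic[OF T_nonneg AX_drift(1)[OF AX n] K AX_drift(2)[OF AX n], rotated 2])
       (use X that in \<open>auto simp: S2_space_def cadlag_adapted_def\<close>)
qed

text \<open>The common end of both cases: the forward path is at hand and the intensity is the
  deterministic \<open>\<Lambda>\<close> of the locale.\<close>

lemma (in jump_brownian_bounded) zero_order_solution:
  assumes x0: "continuous_on {0..T} x0" "\<forall>s\<in>{0..T}. x0 s = x + (LBINT r:{0..s}. b r (x0 r) 0)"
      "AE \<omega> in M. \<forall>s\<in>{0..T}. X s \<omega> = x0 s"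
    and AY: "AY T n \<eta> \<rho> \<xi> f K q" and n: "1 \<le> n" and K: "0 < K"
    and \<rho>: "(\<integral>\<^sup>+z. ennreal ((\<rho> z)\<^sup>2) \<partial>\<nu>) < \<infinity>"
    and B: "backward_sde M F T W \<nu> \<mu> (\<lambda>r _. \<Lambda> r) \<xi> f \<rho> X Y Z \<psi>"
  shows "\<exists>x0 y0 :: real \<Rightarrow> real.
      continuous_on {0..T} x0 \<and> bounded (x0 ` {0..T}) \<and>
      continuous_on {0..T} y0 \<and> bounded (y0 ` {0..T}) \<and>
      (\<forall>s\<in>{0..T}. x0 s = x + (LBINT r:{0..s}. b r (x0 r) 0)) \<and>
      (\<forall>s\<in>{0..T}. y0 s = \<xi> (x0 T) + (LBINT r:{s..T}. f r (x0 r) (y0 r) 0 0)) \<and>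
      (AE \<omega> in M. \<forall>s\<in>{0..T}. X s \<omega> = x0 s \<and> Y s \<omega> = y0 s) \<and>
      (AE (r, \<omega>) in time_leb T \<Otimes>\<^sub>M M. Z r \<omega> = 0) \<and>
      (AE ((r, \<omega>), z) in (time_leb T \<Otimes>\<^sub>M M) \<Otimes>\<^sub>M \<nu>. \<psi> r \<omega> z = 0)"
proof -
  have \<rho>m: "\<rho> \<in> borel_measurable \<nu>"
    using AY_driver(3)[OF AY n] by (simp add: measurable_cong_sets[OF \<nu>_sets refl])
  obtain y0 where y0: "continuous_on {0..T} y0"
    "\<And>s. s \<in> {0..T} \<Longrightarrow> y0 s = \<xi> (x0 T) + (LBINT r:{s..T}. f r (x0 r) (y0 r) 0 0)"
    "AE \<omega> in M. \<forall>s\<in>{0..T}. Y s \<omega> = y0 s"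
    "AE (r, \<omega>) in time_leb T \<Otimes>\<^sub>M M. Z r \<omega> = 0"
    "AE ((r, \<omega>), z) in (time_leb T \<Otimes>\<^sub>M M) \<Otimes>\<^sub>M \<nu>. \<psi> r \<omega> z = 0"
    by (rule backward_deterministic[OF x0(1,3) AY_driver(1)[OF AY n] K AY_driver(2)[OF AY n] \<rho>m \<rho> B]) blast+
  have bounded: "bounded (g ` {0..T})" if "continuous_on {0..T} g" for g :: "real \<Rightarrow> real"
    using that by (intro compact_imp_bounded compact_continuous_image) auto
  have XY: "AE \<omega> in M. \<forall>s\<in>{0..T}. X s \<omega> = x0 s \<and> Y s \<omega> = y0 s"
    using x0(3) y0(3) by eventually_elim blast
  show ?thesis
    by (intro exI[of _ x0] exI[of _ y0] conjI ballI) (fact x0(1) x0(2)[rule_format] y0 XY bounded[OF x0(1)] bounded[OF y0(1)])+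
qed

theorem lemma5p1:
  fixes M :: "'w measure" and F :: "real \<Rightarrow> 'w measure" and T :: real
    and W :: "real \<Rightarrow> 'w \<Rightarrow> real"
    and \<nu> :: "real measure" and \<mu> :: "'w \<Rightarrow> (real \<times> real) measure"
    and n_max n_ae :: nat
    and b :: "real \<Rightarrow> real \<Rightarrow> real \<Rightarrow> real" and \<sigma> :: "real \<Rightarrow> real \<Rightarrow> real"
    and \<gamma> :: "real \<Rightarrow> real \<Rightarrow> real \<Rightarrow> real" and \<xi> :: "real \<Rightarrow> real"
    and f :: "real \<Rightarrow> real \<Rightarrow> real \<Rightarrow> real \<Rightarrow> real \<Rightarrow> real"
    and \<rho> :: "real \<Rightarrow> real" and lam :: "real \<Rightarrow> real \<Rightarrow> real" and x :: real
    and X Y Z :: "real \<Rightarrow> 'w \<Rightarrow> real" and \<psi> :: "real \<Rightarrow> 'w \<Rightarrow> real \<Rightarrow> real"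
  assumes T: "T > 0"
    and space: "prob_space M" "usual_filtration M F T"
    and brownian: "brownian_motion M F T W"
    and levy: "sets \<nu> = sets R0" "sigma_finite_measure \<nu>" "(\<integral>\<^sup>+z. ennreal (\<bar>z\<bar>\<^sup>2) \<partial>\<nu>) < \<infinity>"
    and n_ae: "n_ae = n_max + 2"
    and cases:
      "(poissonian_case M F T W \<nu> \<mu> n_ae b \<sigma> \<gamma> \<xi> f \<rho> \<and>
          fbsde_solution M F T W \<nu> \<mu> (\<lambda>r \<omega>. 1) b \<sigma> \<gamma> \<xi> f \<rho> x 0 X Y Z \<psi>) \<or>
       (state_dependent_case M F T W \<nu> \<mu> n_ae b \<sigma> \<gamma> \<xi> f lam X \<and>
          fbsde_solution M F T W \<nu> \<mu> (\<lambda>r \<omega>. lam r (X r \<omega>)) b \<sigma> \<gamma> \<xi> f (\<lambda>_. 1) x 0 X Y Z \<psi>)"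
  shows "\<exists>x0 y0 :: real \<Rightarrow> real.
      continuous_on {0..T} x0 \<and> bounded (x0 ` {0..T}) \<and>
      continuous_on {0..T} y0 \<and> bounded (y0 ` {0..T}) \<and>
      (\<forall>s\<in>{0..T}. x0 s = x + (LBINT r:{0..s}. b r (x0 r) 0)) \<and>
      (\<forall>s\<in>{0..T}. y0 s = \<xi> (x0 T) + (LBINT r:{s..T}. f r (x0 r) (y0 r) 0 0)) \<and>
      (AE \<omega> in M. \<forall>s\<in>{0..T}. X s \<omega> = x0 s \<and> Y s \<omega> = y0 s) \<and>
      (AE (r, \<omega>) in time_leb T \<Otimes>\<^sub>M M. Z r \<omega> = 0) \<and>
      (AE ((r, \<omega>), z) in (time_leb T \<Otimes>\<^sub>M M) \<Otimes>\<^sub>M \<nu>. \<psi> r \<omega> z = 0)"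
proof -
  have T0: "0 \<le> T" using T by simp
  have F: "filtered_prob_space M F T"
    using space unfolding usual_filtration_def
    by (intro filtered_prob_space.intro filtered_prob_space_axioms.intro) auto
  interpret brownian M F T W
    by (intro brownian.intro brownian_axioms.intro F brownian T0)
  have n: "1 \<le> n_ae" using n_ae by simp
  have space_\<nu>: "space \<nu> = - {0}"
    using sets_eq_imp_space_eq[OF levy(1)] by (simp add: R0_def space_restrict_space)
  from cases show ?thesis
  proof (elim disjE conjE)
    assume P: "poissonian_case M F T W \<nu> \<mu> n_ae b \<sigma> \<gamma> \<xi> f \<rho>"
      and S: "fbsde_solution M F T W \<nu> \<mu> (\<lambda>r \<omega>. 1) b \<sigma> \<gamma> \<xi> f \<rho> x 0 X Y Z \<psi>"
    obtain K q where K: "K > 0" and AX: "AX T n_ae (\<lambda>z. min 1 \<bar>z\<bar>) b \<sigma> \<gamma> K"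
      and AY: "AY T n_ae (\<lambda>z. min 1 \<bar>z\<bar>) \<rho> \<xi> f K q"
      using P unfolding poissonian_case_def by blast
    have fwd: "forward_sde M F T W \<nu> \<mu> (\<lambda>r \<omega>. 1) b \<sigma> \<gamma> x 0 X" and bwd: "backward_sde M F T W \<nu> \<mu> (\<lambda>r _. 1) \<xi> f \<rho> X Y Z \<psi>"
      using S by (simp_all add: fbsde_solution_def)
    have prm: "poisson_random_measure M F T \<nu> \<mu>" using P by (simp add: poissonian_case_def)
    interpret jump_moments M F T \<nu> \<mu> "\<lambda>_. 1"
      by (rule poisson_jump_moments[OF F T0 levy(1,2) prm])
    interpret jump_brownian_bounded M F T W \<nu> \<mu> "\<lambda>_. 1" 1 1
    proof (intro jump_brownian_bounded.intro jump_brownian_bounded_axioms.intro levy)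
      show "jump_brownian M F T W \<nu> \<mu> (\<lambda>_. 1)" by unfold_locales
    qed auto
    \<comment> \<open>The intensity is constant from the outset, so the isometry applies at once;
      pairing with the zero Ito integral isolates \<open>J\<close>.\<close>
    have J0: "\<forall>J. has_jump_integral M F T \<nu> \<mu> (\<lambda>r \<omega>. 1) (\<lambda>_ _ _. 0) J \<longrightarrow> (\<forall>s\<in>{0..T}. AE \<omega> in M. J s \<omega> = 0)"
    proof (intro allI impI ballI)
      fix J s assume J: "has_jump_integral M F T \<nu> \<mu> (\<lambda>r \<omega>. 1) (\<lambda>_ _ _. 0) J" and s: "s \<in> {0..T}"
      from zero_integrands[OF has_ito_integral_zero J] show "AE \<omega> in M. J s \<omega> = 0"
        by eventually_elim (use s in simp)
    qed
    obtain x0 where x0: "continuous_on {0..T} x0" "\<forall>s\<in>{0..T}. x0 s = x + (LBINT r:{0..s}. b r (x0 r) 0)"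
      "AE \<omega> in M. \<forall>s\<in>{0..T}. X s \<omega> = x0 s"
      by (rule forward_zero_order[OF fwd AX n K J0]) blast+
    \<comment> \<open>Near the origin \<open>\<nu>\<close> may have infinite mass. The bound
      \<open>K * min 1 \<bar>z\<bar> \<le> K * \<bar>z\<bar>\<close> on \<open>\<rho>\<close>
      reduces the claim to the finite second moment of \<open>\<nu>\<close>.\<close>
    have "(\<integral>\<^sup>+z. ennreal ((\<rho> z)\<^sup>2) \<partial>\<nu>) \<le> (\<integral>\<^sup>+z. ennreal (K\<^sup>2) * ennreal (\<bar>z\<bar>\<^sup>2) \<partial>\<nu>)"
    proof (rule nn_integral_mono)
      fix z assume "z \<in> space \<nu>"
      then have "\<bar>\<rho> z\<bar> \<le> K * min 1 \<bar>z\<bar>" using AY_driver(4)[OF AY n] by (simp add: space_\<nu>)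
      also have "\<dots> \<le> K * \<bar>z\<bar>" using K by (intro mult_left_mono) auto
      finally have "\<bar>\<rho> z\<bar>\<^sup>2 \<le> (K * \<bar>z\<bar>)\<^sup>2" by (rule power_mono) simp
      then show "ennreal ((\<rho> z)\<^sup>2) \<le> ennreal (K\<^sup>2) * ennreal (\<bar>z\<bar>\<^sup>2)"
        by (simp add: power_mult_distrib flip: ennreal_mult)
    qed
    also have "\<dots> = ennreal (K\<^sup>2) * (\<integral>\<^sup>+z. ennreal (\<bar>z\<bar>\<^sup>2) \<partial>\<nu>)"
    proof (rule nn_integral_cmult)
      have "(\<lambda>z. ennreal (\<bar>z\<bar>\<^sup>2)) \<in> borel_measurable R0"
        unfolding R0_def by (rule measurable_restrict_space1) simp
      then show "(\<lambda>z. ennreal (\<bar>z\<bar>\<^sup>2)) \<in> borel_measurable \<nu>" by (simp add: measurable_cong_sets[OF levy(1) refl])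
    qed
    also have "\<dots> < \<infinity>" using levy(3) by (simp add: ennreal_mult_less_top)
    finally have \<rho>: "(\<integral>\<^sup>+z. ennreal ((\<rho> z)\<^sup>2) \<partial>\<nu>) < \<infinity>" .
    from zero_order_solution[where b = b and x = x, OF x0 AY n K \<rho> bwd] show ?thesis .
  next
    let ?\<Lambda> = "\<lambda>r \<omega>. lam r (X r \<omega>)"
    assume P: "state_dependent_case M F T W \<nu> \<mu> n_ae b \<sigma> \<gamma> \<xi> f lam X"
      and S: "fbsde_solution M F T W \<nu> \<mu> ?\<Lambda> b \<sigma> \<gamma> \<xi> f (\<lambda>_. 1) x 0 X Y Z \<psi>"
    obtain K q where K: "K > 0" and AX: "AX T n_ae (\<lambda>_. 1) b \<sigma> \<gamma> K" and AY: "AY T n_ae (\<lambda>_. 1) (\<lambda>_. 1) \<xi> f K q"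
      using P unfolding state_dependent_case_def by blast
    obtain c1 c2 Dlam where c1: "c1 > 0"
      and Dlam: "has_continuous_partials n_ae ({0..T} \<times> UNIV) {(0, 1)} (\<lambda>(t, x). lam t x) Dlam"
      and bounds: "\<And>t x. t \<in> {0..T} \<Longrightarrow> c1 \<le> lam t x \<and> lam t x \<le> c2"
      using P unfolding state_dependent_case_def by blast
    have \<nu>1: "emeasure \<nu> (- {0}) = 1" and rm: "random_measure M F T \<mu>" and iv: "integer_valued M T \<mu>"
      and comp: "has_compensator M F T \<nu> \<mu> ?\<Lambda>"
      using P by (simp_all add: state_dependent_case_def)
    have "continuous_on ({0..T} \<times> UNIV) (Dlam [])"
      using Dlam by (auto simp: has_continuous_partials_def words_def)
    then have lam: "continuous_on ({0..T} \<times> UNIV) (\<lambda>(t, x). lam t x)"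
      by (rule continuous_on_eq) (use Dlam in \<open>auto simp: has_continuous_partials_def has_partials_def\<close>)
    have fwd: "forward_sde M F T W \<nu> \<mu> ?\<Lambda> b \<sigma> \<gamma> x 0 X" and bwd: "backward_sde M F T W \<nu> \<mu> ?\<Lambda> \<xi> f (\<lambda>_. 1) X Y Z \<psi>"
      using S by (simp_all add: fbsde_solution_def)
    have X: "cadlag_adapted M F T X" using fwd by (simp add: forward_sde_def S2_space_def)
    have "(\<lambda>p. X (fst p) (snd p)) \<in> borel_measurable (time_leb T \<Otimes>\<^sub>M M)"
      using cadlag_measurable_pair[of T X M, OF cadlag_adapted_measurable[OF X]] X by (simp add: cadlag_adapted_def case_prod_beta')
    then have "(\<lambda>p. (fst p, X (fst p) (snd p))) \<in> borel_measurable (time_leb T \<Otimes>\<^sub>M M)"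
      by (intro borel_measurable_Pair measurable_compose[OF measurable_fst measurable_time_id])
    from borel_measurable_continuous_compose[OF lam this]
    have \<Lambda>m: "(\<lambda>p. ?\<Lambda> (fst p) (snd p)) \<in> borel_measurable (time_leb T \<Otimes>\<^sub>M M)" by (auto simp: space_pair_measure)
    have \<Lambda>b: "0 \<le> ?\<Lambda> r \<omega> \<and> ?\<Lambda> r \<omega> \<le> c2" if "r \<in> {0..T}" for r \<omega>
      using bounds[OF that, of "X r \<omega>"] c1 by auto
    \<comment> \<open>The intensity still depends on \<open>X\<close> here, so no isometry is
      available. The L^1 argument, with \<open>\<nu>\<close> of mass 1 and the intensity at most
      \<open>c2\<close>, breaks the circle.\<close>
    have J0: "\<forall>J. has_jump_integral M F T \<nu> \<mu> ?\<Lambda> (\<lambda>_ _ _. 0) J \<longrightarrow> (\<forall>s\<in>{0..T}. AE \<omega> in M. J s \<omega> = 0)"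
      by (intro allI impI ballI jump_integral_zero[OF F T0 levy(1) \<nu>1 rm comp \<Lambda>m \<Lambda>b])
    obtain x0 where x0: "continuous_on {0..T} x0" "\<forall>s\<in>{0..T}. x0 s = x + (LBINT r:{0..s}. b r (x0 r) 0)"
      "AE \<omega> in M. \<forall>s\<in>{0..T}. X s \<omega> = x0 s"
      by (rule forward_zero_order[OF fwd AX n K J0]) blast+
    \<comment> \<open>From here on the intensity is deterministic. The compensator and the jump
      integrals are transferred to \<open>?l\<close> by congruence, after which the isometry can be
      instantiated with \<open>c1\<close> and \<open>c2\<close>.\<close>
    let ?l = "\<lambda>r. lam r (x0 r)"
    have eq: "AE \<omega> in M. \<forall>r\<in>{0..T}. ?\<Lambda> r \<omega> = ?l r" using x0(3) by eventually_elim simp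
    have "continuous_on {0..T} (\<lambda>r. (\<lambda>(t, x). lam t x) (r, x0 r))"
      by (rule continuous_on_compose2[OF lam]) (use x0(1) in \<open>auto intro!: continuous_intros\<close>)
    then have li: "set_integrable lborel {0..T} ?l" by (intro borel_integrable_atLeastAtMost') simp
    have lb: "0 \<le> ?l r" "?l r \<le> c2" if "r \<in> {0..T}" for r using bounds[OF that, of "x0 r"] c1 by auto
    interpret jump_moments M F T \<nu> \<mu> ?l
      by (rule compensator_jump_moments[OF F T0 levy(1,2) rm iv has_compensator_cong[OF eq comp] li lb])
    interpret jump_brownian_bounded M F T W \<nu> \<mu> ?l c1 c2
    proof (intro jump_brownian_bounded.intro jump_brownian_bounded_axioms.intro levy c1 bounds)
      show "jump_brownian M F T W \<nu> \<mu> ?l" by unfold_locales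
    qed
    have \<rho>: "(\<integral>\<^sup>+z. ennreal ((1 :: real)\<^sup>2) \<partial>\<nu>) < \<infinity>" using \<nu>1 by (simp add: space_\<nu>)
    have "backward_sde M F T W \<nu> \<mu> (\<lambda>r _. ?l r) \<xi> f (\<lambda>_. 1) X Y Z \<psi>"
      using bwd has_jump_integral_cong[OF eq] unfolding backward_sde_def by blast
    from zero_order_solution[where b = b and x = x, OF x0 AY n K \<rho> this] show ?thesis .
  qed
qed

end
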